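(* Let $0\leq\gamma<\infty$ and $1\leq r\leq\infty$. (A) Let $0<q<\infty$. The operator $\mathfrak R_\gamma^*:L^r(\mathbb S^1)\to L^q(\mathbb R^2)$ is bounded provided that $\gamma>\frac{2}{q}-\frac12$ and (i) $\gamma>\max\left\{\frac{3}{2q}-\frac{1}{2r'},\frac{2}{q}-\frac{1}{r'}\right\}$. If additionally $1<r\leq q$, then (still under $\gamma>\frac{2}{q}-\frac12$) the operator is also bounded if (ii) $\gamma=\max\left\{\frac{3}{2q}-\frac{1}{2r'},\frac{2}{q}-\frac{1}{r'}\right\}$ and $q\neq r'$. (B) If $q=\infty$, the operator $\mathfrak R_\gamma^*:L^r(\mathbb S^1)\to L^\infty(\mathbb R^2)$ is bounded for all $r\in[1,\infty]$ and $\gamma\in[0,\infty)$. (C) These conditions are optimal: for $0<q<\infty$, if $\mathfrak R_\gamma^*:L^r(\mathbb S^1)\to L^q(\mathbb R^2)$ is bounded, then $\gamma>\frac{2}{q}-\frac12$ and either (i) holds, or $1<r\leq q$ and (ii) holds.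
   Context: $\mathbb S^1=\{\xi\in\mathbb R^2:|\xi|=1\}$ with canonical surface measure $\sigma$. The Fourier extension operator is $(\mathcal R^*F)(x,y)=\frac{1}{2\pi}\int_{\mathbb S^1}e^{i(x,y)\cdot\omega}F(\omega)\,d\sigma(\omega)$ for $(x,y)\in\mathbb R^2$, $F\in L^1(\mathbb S^1)$. The weighted operator is $(\mathfrak R_\gamma^*F)(x,y)=(\mathcal R^*F)(x,y)(1+|x|+|y|)^{-\gamma}$. $r'$ denotes the conjugate exponent, $\frac1r+\frac1{r'}=1$, with $\frac1\infty=0$. For $0<q<1$, $L^q$ is equipped with its usual quasi-norm. Bounded means there is $C>0$ with $\|\mathfrak R_\gamma^*F\|_{L^q(\mathbb R^2)}\leq C\|F\|_{L^r(\mathbb S^1)}$ for all $F\in L^r(\mathbb S^1)$. *)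

theory Defs
  imports "HOL-Analysis.Analysis" "HOL-Probability.Essential_Supremum"
begin

text \<open>
  Lebesgue spaces with exponent \<open>0 < p \<le> \<infinity>\<close>. Functions are not identified up to
  null sets. The value \<open>Lp_norm M p f\<close> is meaningful only for \<open>f \<in> Lp_space M p\<close>; for
  \<open>0 < p < 1\<close> it is the usual quasi-norm.
\<close>

definition Lp_space :: "'a measure \<Rightarrow> ereal \<Rightarrow> ('a \<Rightarrow> complex) set" where
  "Lp_space M p = {f \<in> borel_measurable M.
     if p = \<infinity> then esssup M (\<lambda>x. ereal (norm (f x))) < \<infinity>
     else integrable M (\<lambda>x. norm (f x) powr real_of_ereal p)}"

definition Lp_norm :: "'a measure \<Rightarrow> ereal \<Rightarrow> ('a \<Rightarrow> complex) \<Rightarrow> real" where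
  "Lp_norm M p f =
     (if p = \<infinity> then real_of_ereal (esssup M (\<lambda>x. ereal (norm (f x))))
      else (\<integral>x. norm (f x) powr real_of_ereal p \<partial>M) powr (1 / real_of_ereal p))"

definition Lp_bounded ::
  "'a measure \<Rightarrow> ereal \<Rightarrow> 'b measure \<Rightarrow> ereal \<Rightarrow> (('a \<Rightarrow> complex) \<Rightarrow> 'b \<Rightarrow> complex) \<Rightarrow> bool" where
  "Lp_bounded M r N q T \<longleftrightarrow>
     (\<exists>C>0. \<forall>F \<in> Lp_space M r. T F \<in> Lp_space N q \<and> Lp_norm N q (T F) \<le> C * Lp_norm M r F)"

text \<open>
  Arc length on the unit circle of \<open>\<real>\<^sup>2\<close>, as the image of Lebesgue measure on
  \<open>[0, 2\<pi>)\<close> under the unit-speed parametrization. The type \<open>real \<times> real\<close> carries the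
  Euclidean norm and inner product.
\<close>

definition circle_measure :: "(real \<times> real) measure" where
  "circle_measure =
     distr (restrict_space lborel {0..<2 * pi}) (restrict_space borel (sphere 0 1))
       (\<lambda>t. (cos t, sin t))"

lemma circle_param_measurable:
  "(\<lambda>t. (cos t, sin t)) \<in>
     restrict_space lborel {0..<2 * pi} \<rightarrow>\<^sub>M restrict_space borel (sphere (0 :: real \<times> real) 1)"
  by (intro measurable_restrict_space1 measurable_restrict_space2)
     (auto simp: norm_Pair borel_prod[symmetric])

lemma space_circle_measure: "space circle_measure = sphere 0 1"
  by (simp add: circle_measure_def space_restrict_space)

lemma emeasure_circle_measure: "emeasure circle_measure (sphere 0 1) = ennreal (2 * pi)"
proof -
  have "emeasure circle_measure (sphere 0 1) = 
      emeasure (restrict_space lborel {0..<2 * pi}) {0..<2 * pi}"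
    unfolding circle_measure_def
    by (subst emeasure_distr[OF circle_param_measurable])
       (auto simp: sets_restrict_space space_restrict_space norm_Pair
             intro!: arg_cong2[where f = emeasure])
  then show ?thesis
    by (simp add: emeasure_restrict_space)
qed

definition extension_op :: "(real \<times> real \<Rightarrow> complex) \<Rightarrow> real \<times> real \<Rightarrow> complex" where
  "extension_op F z =
     1 / (2 * of_real pi) * (\<integral>\<omega>. exp (\<i> * of_real (z \<bullet> \<omega>)) * F \<omega> \<partial>circle_measure)"

definition weighted_extension_op ::
  "real \<Rightarrow> (real \<times> real \<Rightarrow> complex) \<Rightarrow> real \<times> real \<Rightarrow> complex" where
  "weighted_extension_op \<gamma> F =
     (\<lambda>(x, y). extension_op F (x, y) * of_real ((1 + \<bar>x\<bar> + \<bar>y\<bar>) powr (- \<gamma>)))"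

abbreviation weighted_extension_bounded :: "real \<Rightarrow> ereal \<Rightarrow> ereal \<Rightarrow> bool" where
  "weighted_extension_bounded \<gamma> r q \<equiv>
     Lp_bounded circle_measure r lborel q (weighted_extension_op \<gamma>)"

end

theory Submission
  imports Defs "HOL-Probability.Characteristic_Functions"
begin

text \<open>
  In the angular variable the extension of \<open>g\<close> is \<open>\<integral> g t cis (x \<bullet> circ t) dt\<close>, and \<open>g\<close> may be
  supported in an interval of length one. For sufficiency, \<open>g\<close> is cut along its decreasing
  rearrangement into atoms, bounded functions with supports of measure \<open>\<delta> = 2\<^sup>-\<^sup>l\<close>. Three estimates
  for atoms suffice: the trivial bound \<open>\<delta>\<close>, the bound \<open>R \<delta>\<close> for the energy in a ball of radius \<open>R\<close>,
  and \<open>\<delta>\<^sup>q\<^sup>-\<^sup>3\<close> for the \<open>q\<close>th power integral, \<open>q > 4\<close>. The last one is obtained by squaring the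
  extension, splitting the product dyadically according to the distance of the two angles, and using
  an \<open>L\<^sup>2\<close> bound for each piece. Both \<open>L\<^sup>2\<close> bounds are Schur tests for Gaussian kernels, after the
  plane has been weighted by a Gaussian. Interpolating the three estimates gains on both sides of a
  critical relation between \<open>\<delta>\<close> and \<open>R\<close>, so that the sums over atoms and dyadic shells decouple.

  For necessity, the indicator of the arc of angles in \<open>(2\<^sup>-\<^sup>k\<^sup>-\<^sup>1, 2\<^sup>-\<^sup>k]\<close> has an extension of size
  \<open>2\<^sup>-\<^sup>k\<close> on a box of dimensions \<open>4\<^sup>k\<close> and \<open>2\<^sup>k\<close>. These Knapp examples are superposed with random
  signs. The condition \<open>\<gamma> > 2/q - 1/2\<close> is forced by the constant function.
\<close>

subsection \<open>Gaussian kernels and Schur tests\<close>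

text \<open>With \<open>\<rho> = 1 / r'\<close> all conditions are linear in \<open>\<rho>\<close>
  and \<open>1 / q\<close>. The extension of an arc of length \<open>\<delta>\<close> has size
  \<open>\<delta>\<close> up to radius \<open>1 / \<delta>\<close> and then survives on a tube out
  to radius \<open>1 / \<delta>\<^sup>2\<close>. The two entries of the maximum belong to these two
  radii: the critical relation is \<open>R * \<delta> = 1\<close> for \<open>q * \<rho> < 1\<close>
  and \<open>R * \<delta>\<^sup>2 = 1\<close> for \<open>q * \<rho> > 1\<close>. At
  \<open>q * \<rho> = 1\<close> all dyadic radii in between contribute equally, and this logarithm
  excludes \<open>q = r'\<close>. The obstacle is equality in (ii): no decay is left over, so each
  estimate must win a power in both directions away from the critical relation, and the sum over
  atoms closes only because \<open>r \<le> q\<close>. Gaussian weights are used because their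
  Fourier transform is positive: the weighted energy is exactly a double integral against a positive
  kernel. This gives upper bounds by the Schur test without a change of variables, and lower bounds
  for the constant function from the same identity.\<close>

lemma gaussian_integral_shift:
  fixes c a :: real
  assumes "c > 0"
  shows "integrable lborel (\<lambda>x. exp (- c * (x - a)\<^sup>2))"
    and "(\<integral>x. exp (- c * (x - a)\<^sup>2) \<partial>lborel) = sqrt (pi / c)"
proof -
  define \<sigma> where "\<sigma> = 1 / sqrt (2 * c)"
  have \<sigma>: "\<sigma> > 0" using assms by (simp add: \<sigma>_def)
  have s2: "\<sigma>\<^sup>2 = 1 / (2 * c)" using assms by (simp add: \<sigma>_def power_divide)
  have eq: "exp (- c * (x - a)\<^sup>2) = sqrt (pi / c) * normal_density a \<sigma> x" for x
    using assms by (simp add: normal_density_def s2 field_simps real_sqrt_mult real_sqrt_divide)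
  show "integrable lborel (\<lambda>x. exp (- c * (x - a)\<^sup>2))"
    unfolding eq using integrable_normal_density[OF \<sigma>] by simp
  show "(\<integral>x. exp (- c * (x - a)\<^sup>2) \<partial>lborel) = sqrt (pi / c)"
    unfolding eq using integral_normal_density[OF \<sigma>] by simp
qed

lemma nn_gaussian_integral_shift:
  fixes c a :: real
  assumes "c > 0"
  shows "(\<integral>\<^sup>+x. ennreal (exp (- c * (x - a)\<^sup>2)) \<partial>lborel) = ennreal (sqrt (pi / c))"
  using gaussian_integral_shift[OF assms, of a]
  by (simp add: nn_integral_eq_integral)

text \<open>The characteristic function of the standard normal law, rescaled:
  \<open>k = sqrt (2 * c)\<close> turns \<open>exp (- (k * x)\<^sup>2 / 2)\<close> into
  \<open>exp (- c * x\<^sup>2)\<close>.\<close>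

lemma gaussian_fourier_real:
  fixes c s :: real
  assumes "c > 0"
  shows "(\<integral>x. cis (x * s) * of_real (exp (- c * x\<^sup>2)) \<partial>lborel)
    = of_real (sqrt (pi / c) * exp (- s\<^sup>2 / (4 * c)))"
proof -
  define k where "k = sqrt (2 * c)"
  have k: "k > 0" "k\<^sup>2 = 2 * c" using assms by (auto simp: k_def)
  have "of_real (exp (- (s / k)\<^sup>2 / 2)) = char std_normal_distribution (s / k)"
    by (simp add: char_std_normal_distribution)
  also have "\<dots> = (\<integral>x. std_normal_density x *\<^sub>R iexp (s / k * x) \<partial>lborel)"
    unfolding char_def by (subst integral_density) (auto simp: normal_density_nonneg)
  also have "\<dots> = k *\<^sub>R (\<integral>x. std_normal_density (k * x) *\<^sub>R iexp (s / k * (k * x)) \<partial>lborel)"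
    using k by (subst lborel_integral_real_affine[where c = k and t = 0]) auto
  also have "(\<lambda>x. std_normal_density (k * x) *\<^sub>R iexp (s / k * (k * x)))
      = (\<lambda>x. (1 / sqrt (2 * pi)) *\<^sub>R (cis (x * s) * of_real (exp (- c * x\<^sup>2))))"
    using k by (auto simp: std_normal_density_def power_mult_distrib cis_conv_exp scaleR_conv_of_real mult_ac
                simp del: of_real_exp)
  finally have *: "of_real (exp (- (s / k)\<^sup>2 / 2)) =
      (k / sqrt (2 * pi)) *\<^sub>R (\<integral>x. cis (x * s) * of_real (exp (- c * x\<^sup>2)) \<partial>lborel)"
    by simp
  have "sqrt (2 * pi) / k = sqrt (pi / c)"
    by (simp add: k_def real_sqrt_divide real_sqrt_mult)
  moreover have "(s / k)\<^sup>2 / 2 = s\<^sup>2 / (4 * c)" using k by (simp add: power_divide)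
  moreover have "(sqrt (2 * pi) / k) *\<^sub>R of_real (exp (- (s / k)\<^sup>2 / 2)) =
      (\<integral>x. cis (x * s) * of_real (exp (- c * x\<^sup>2)) \<partial>lborel)"
    unfolding * using k by simp
  ultimately show ?thesis
    by (simp add: scaleR_conv_of_real)
qed

lemma gaussian_fourier_plane:
  fixes c :: real and \<xi> :: "real \<times> real"
  assumes "c > 0"
  shows "integrable lborel (\<lambda>x::real \<times> real. exp (- c * (norm x)\<^sup>2))"
    and "(\<integral>x. cis (x \<bullet> \<xi>) * of_real (exp (- c * (norm x)\<^sup>2)) \<partial>lborel)
    = of_real (pi / c * exp (- (norm \<xi>)\<^sup>2 / (4 * c)))"
proof -
  have sp: "exp (- c * (norm x)\<^sup>2) = exp (- c * (fst x)\<^sup>2) * exp (- c * (snd x)\<^sup>2)" for x :: "real \<times> real"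
    by (cases x) (simp add: norm_Pair exp_add[symmetric] algebra_simps)
  have i1: "integrable lborel (\<lambda>x::real. exp (- c * x\<^sup>2))"
    using gaussian_integral_shift(1)[OF assms, of 0] by simp
  have i2: "integrable (lborel \<Otimes>\<^sub>M lborel) (\<lambda>(x::real, y::real). exp (- c * x\<^sup>2) * exp (- c * y\<^sup>2))"
    using i1 by (intro lborel_pair.Fubini_integrable) (auto intro!: integrable_mult_right integrable_mult_left)
  have i3: "integrable lborel (\<lambda>x::real \<times> real. exp (- c * (norm x)\<^sup>2))"
    unfolding sp using i2 unfolding lborel_prod by (simp add: case_prod_beta')
  show "integrable lborel (\<lambda>x::real \<times> real. exp (- c * (norm x)\<^sup>2))" by (fact i3)
  obtain u v where \<xi>: "\<xi> = (u, v)" by (cases \<xi>)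
  let ?f = "\<lambda>x y. cis (x * u) * of_real (exp (- c * x\<^sup>2)) * (cis (y * v) * of_real (exp (- c * y\<^sup>2)))"
  have f_eq: "cis ((x, y) \<bullet> \<xi>) * of_real (exp (- c * (norm (x, y))\<^sup>2)) = ?f x y" for x y
    unfolding sp \<xi> by (simp add: cis_mult[symmetric] del: of_real_exp)
  have i4: "integrable (lborel \<Otimes>\<^sub>M lborel) (\<lambda>(x, y). ?f x y)"
    by (rule Bochner_Integration.integrable_bound[OF i2])
       (auto simp: norm_mult case_prod_beta' cis_conv_exp)
  have "(\<integral>x. cis (x \<bullet> \<xi>) * of_real (exp (- c * (norm x)\<^sup>2)) \<partial>lborel) = 
    (\<integral>x. (\<lambda>(x, y). ?f x y) x \<partial>(lborel \<Otimes>\<^sub>M lborel))"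
    unfolding lborel_prod by (rule Bochner_Integration.integral_cong[OF refl]) (simp only: f_eq[symmetric] case_prod_beta' prod.collapse)
  also have "\<dots> = (\<integral>x. (\<integral>y. ?f x y \<partial>lborel) \<partial>lborel)"
    by (rule lborel_pair.integral_fst[OF i4, symmetric])
  also have "\<dots> = of_real (sqrt (pi / c) * exp (- u\<^sup>2 / (4 * c))) * of_real (sqrt (pi / c) * exp (- v\<^sup>2 / (4 * c)))"
    unfolding integral_mult_right_zero integral_mult_left_zero gaussian_fourier_real[OF assms] ..
  also have "\<dots> = of_real (pi / c * exp (- (norm \<xi>)\<^sup>2 / (4 * c)))"
  proof -
    have e: "exp (- (norm \<xi>)\<^sup>2 / (4 * c)) = exp (- u\<^sup>2 / (4 * c)) * exp (- v\<^sup>2 / (4 * c))"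
      by (simp add: \<xi> norm_Pair exp_add[symmetric] add_divide_distrib diff_divide_distrib)
    have "sqrt (pi / c) * sqrt (pi / c) = pi / c" using assms by simp
    moreover have "s * a * (s * b) = (s * s) * (a * b)" for s a b :: real by simp
    ultimately show ?thesis unfolding e of_real_mult[symmetric] by presburger
  qed
  finally show "(\<integral>x. cis (x \<bullet> \<xi>) * of_real (exp (- c * (norm x)\<^sup>2)) \<partial>lborel)
    = of_real (pi / c * exp (- (norm \<xi>)\<^sup>2 / (4 * c)))" .
qed

lemma (in pair_sigma_finite) integrable_times:
  fixes f :: "'a \<Rightarrow> 'c::{real_normed_field, banach, second_countable_topology}"
  assumes f: "integrable M1 f" and g: "integrable M2 g"
  shows "integrable (M1 \<Otimes>\<^sub>M M2) (\<lambda>(x, y). f x * g y)"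
proof (rule Fubini_integrable)
  have [measurable]: "f \<in> borel_measurable M1" "g \<in> borel_measurable M2" using f g by auto
  show "(\<lambda>(x, y). f x * g y) \<in> borel_measurable (M1 \<Otimes>\<^sub>M M2)" by measurable
  show "integrable M1 (\<lambda>x. \<integral>y. norm ((\<lambda>(x, y). f x * g y) (x, y)) \<partial>M2)"
    using integrable_norm[OF f] by (simp add: norm_mult)
  show "AE x in M1. integrable M2 (\<lambda>y. (\<lambda>(x, y). f x * g y) (x, y))"
    using g by simp
qed

lemma measurable_cis [measurable]: "cis \<in> borel_measurable borel"
  by (intro borel_measurable_continuous_onI continuous_intros)

text \<open>Expanding the square gives a double integral over pairs of points of \<open>M\<close>.
  Integrating in \<open>x\<close> first, which the Gaussian makes absolutely convergent, replaces
  the oscillation by a Gaussian in the difference of the frequencies. The identity is kept as an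
  equality since \<open>full_gaussian_lower\<close> reads it from below. \<open>M\<close> will be
  the line for single angles and the plane for pairs of angles.\<close>

lemma oscillatory_square:
  fixes a :: "'a \<Rightarrow> complex" and \<phi> :: "'a \<Rightarrow> real \<times> real" and c :: real
  assumes "sigma_finite_measure M" and a: "integrable M a"
    and \<phi>[measurable]: "\<phi> \<in> borel_measurable M" and c: "c > 0"
  defines "g \<equiv> \<lambda>x. \<integral>m. a m * cis (x \<bullet> \<phi> m) \<partial>M"
    and "K \<equiv> \<lambda>p. a (fst p) * cnj (a (snd p)) * of_real (pi / c * exp (- (norm (\<phi> (fst p) - \<phi> (snd p)))\<^sup>2 / (4 * c)))"
  shows "integrable (M \<Otimes>\<^sub>M M) K"
    and "(\<integral>\<^sup>+x. ennreal ((norm (g x))\<^sup>2 * exp (- c * (norm x)\<^sup>2)) \<partial>lborel) = ennreal (norm (\<integral>p. K p \<partial>(M \<Otimes>\<^sub>M M)))"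
proof -
  interpret M: sigma_finite_measure M by fact
  interpret MM: pair_sigma_finite M M ..
  interpret PP: sigma_finite_measure "M \<Otimes>\<^sub>M M" by (rule sigma_finite_pair_measure) fact+
  interpret LP: pair_sigma_finite "lborel :: (real \<times> real) measure" "M \<Otimes>\<^sub>M M" ..
  have am[measurable]: "a \<in> borel_measurable M" using a by auto
  define A where "A p = a (fst p) * cnj (a (snd p))" for p
  define \<Phi> where "\<Phi> p = \<phi> (fst p) - \<phi> (snd p)" for p
  have [measurable]: "cnj \<in> borel_measurable borel"
    by (intro borel_measurable_continuous_onI continuous_intros)
  have [measurable]: "A \<in> borel_measurable (M \<Otimes>\<^sub>M M)" "\<Phi> \<in> borel_measurable (M \<Otimes>\<^sub>M M)"
    unfolding A_def \<Phi>_def by measurable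
  have Aint: "integrable (M \<Otimes>\<^sub>M M) A"
    using MM.integrable_times[OF a, of "\<lambda>m. cnj (a m)"] a by (simp add: A_def[abs_def] case_prod_beta')
  define h where "h x p = A p * cis (x \<bullet> \<Phi> p) * of_real (exp (- c * (norm x)\<^sup>2))" for x p
  have [measurable]: "case_prod h \<in> borel_measurable (lborel \<Otimes>\<^sub>M (M \<Otimes>\<^sub>M M))"
    unfolding h_def by measurable
  have hint: "integrable (lborel \<Otimes>\<^sub>M (M \<Otimes>\<^sub>M M)) (case_prod h)"
  proof (rule LP.Fubini_integrable)
    have "(\<lambda>x. \<integral>p. norm (case_prod h (x, p)) \<partial>(M \<Otimes>\<^sub>M M)) = 
      (\<lambda>x. (\<integral>p. norm (A p) \<partial>(M \<Otimes>\<^sub>M M)) * exp (- c * (norm x)\<^sup>2))"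
      by (simp add: h_def norm_mult)
    then show "integrable lborel (\<lambda>x. \<integral>p. norm (case_prod h (x, p)) \<partial>(M \<Otimes>\<^sub>M M))"
      using gaussian_fourier_plane(1)[OF c] by simp
    show "AE x in lborel. integrable (M \<Otimes>\<^sub>M M) (\<lambda>p. case_prod h (x, p))"
    proof (rule AE_I2)
      fix x :: "real \<times> real"
      show "integrable (M \<Otimes>\<^sub>M M) (\<lambda>p. case_prod h (x, p))"
        using Aint by (rule Bochner_Integration.integrable_bound[OF integrable_mult_right[of "of_real (exp (- c * (norm x)\<^sup>2))"]])
           (auto simp: h_def norm_mult)
    qed
  qed simp
  have gg: "(\<integral>p. h x p \<partial>(M \<Otimes>\<^sub>M M)) = of_real ((norm (g x))\<^sup>2 * exp (- c * (norm x)\<^sup>2))" for x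
  proof -
    have i: "integrable M (\<lambda>m. a m * cis (x \<bullet> \<phi> m))"
      using a by (rule Bochner_Integration.integrable_bound) (auto simp: norm_mult)
    let ?b = "\<lambda>m. a m * cis (x \<bullet> \<phi> m)"
    have i2: "integrable (M \<Otimes>\<^sub>M M) (\<lambda>(m, m'). ?b m * cnj (?b m'))"
      using i by (intro MM.integrable_times integrable_cnj)
    have "(\<integral>p. h x p \<partial>(M \<Otimes>\<^sub>M M)) = (\<integral>p. (\<lambda>(m, m'). ?b m * cnj (?b m')) p * of_real (exp (- c * (norm x)\<^sup>2)) \<partial>(M \<Otimes>\<^sub>M M))"
    proof (rule Bochner_Integration.integral_cong[OF refl])
      fix p
      have "cis (x \<bullet> \<Phi> p) = cis (x \<bullet> \<phi> (fst p)) * cnj (cis (x \<bullet> \<phi> (snd p)))"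
        by (simp add: \<Phi>_def inner_diff_right cis_cnj cis_mult)
      then show "h x p = (\<lambda>(m, m'). ?b m * cnj (?b m')) p * of_real (exp (- c * (norm x)\<^sup>2))"
        by (simp add: h_def A_def case_prod_beta' mult_ac)
    qed
    also have "\<dots> = (\<integral>p. (\<lambda>(m, m'). ?b m * cnj (?b m')) p \<partial>(M \<Otimes>\<^sub>M M)) * of_real (exp (- c * (norm x)\<^sup>2))"
      by (rule integral_mult_left_zero)
    also have "(\<integral>p. (\<lambda>(m, m'). ?b m * cnj (?b m')) p \<partial>(M \<Otimes>\<^sub>M M)) = (\<integral>m. (\<integral>m'. ?b m * cnj (?b m') \<partial>M) \<partial>M)"
      by (rule MM.integral_fst[OF i2, symmetric])
    also have "\<dots> = g x * cnj (g x)"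
      unfolding integral_mult_right_zero integral_mult_left_zero g_def by (simp del: complex_cnj_mult)
    also have "\<dots> = of_real ((norm (g x))\<^sup>2)" by (simp only: complex_norm_square)
    finally show ?thesis by simp
  qed
  have gint: "integrable lborel (\<lambda>x. (norm (g x))\<^sup>2 * exp (- c * (norm x)\<^sup>2))"
  proof -
    have "integrable lborel (\<lambda>x. \<integral>p. h x p \<partial>(M \<Otimes>\<^sub>M M))" by (rule LP.integrable_fst[OF hint])
    then show ?thesis unfolding gg complex_of_real_integrable_eq .
  qed
  have kint: "(\<integral>x. h x p \<partial>lborel) = K p" for p
    unfolding h_def K_def A_def using gaussian_fourier_plane(2)[OF c, of "\<Phi> p"] by (simp add: mult.assoc \<Phi>_def)
  show "integrable (M \<Otimes>\<^sub>M M) K"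
    using LP.integrable_snd[OF hint] unfolding kint .
  have "(\<integral>\<^sup>+x. ennreal ((norm (g x))\<^sup>2 * exp (- c * (norm x)\<^sup>2)) \<partial>lborel) 
     = ennreal (\<integral>x. (norm (g x))\<^sup>2 * exp (- c * (norm x)\<^sup>2) \<partial>lborel)"
    using gint by (intro nn_integral_eq_integral) auto
  also have "\<dots> = ennreal (norm (\<integral>x. complex_of_real ((norm (g x))\<^sup>2 * exp (- c * (norm x)\<^sup>2)) \<partial>lborel))"
    unfolding integral_complex_of_real by (simp add: integral_nonneg_AE abs_of_nonneg del: of_real_mult)
  also have "(\<integral>x. complex_of_real ((norm (g x))\<^sup>2 * exp (- c * (norm x)\<^sup>2)) \<partial>lborel) = (\<integral>x. (\<integral>p. h x p \<partial>(M \<Otimes>\<^sub>M M)) \<partial>lborel)"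
    unfolding gg ..
  also have "\<dots> = (\<integral>p. (\<integral>x. h x p \<partial>lborel) \<partial>(M \<Otimes>\<^sub>M M))"
    by (rule LP.Fubini_integral[OF hint, symmetric])
  finally show "(\<integral>\<^sup>+x. ennreal ((norm (g x))\<^sup>2 * exp (- c * (norm x)\<^sup>2)) \<partial>lborel) = ennreal (norm (\<integral>p. K p \<partial>(M \<Otimes>\<^sub>M M)))"
    unfolding kint .
qed

lemma oscillatory_square_bound:
  fixes a :: "'a \<Rightarrow> complex" and \<phi> :: "'a \<Rightarrow> real \<times> real" and c :: real
  assumes "sigma_finite_measure M" and a: "integrable M a"
    and \<phi>: "\<phi> \<in> borel_measurable M" and c: "c > 0"
  defines "g \<equiv> \<lambda>x. \<integral>m. a m * cis (x \<bullet> \<phi> m) \<partial>M"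
  shows "(\<integral>\<^sup>+x. ennreal ((norm (g x))\<^sup>2 * exp (- c * (norm x)\<^sup>2)) \<partial>lborel) \<le>
    (\<integral>\<^sup>+p. ennreal (norm (a (fst p)) * norm (a (snd p)) *
       (pi / c * exp (- (norm (\<phi> (fst p) - \<phi> (snd p)))\<^sup>2 / (4 * c)))) \<partial>(M \<Otimes>\<^sub>M M))"
proof -
  let ?K = "\<lambda>p. a (fst p) * cnj (a (snd p)) * of_real (pi / c * exp (- (norm (\<phi> (fst p) - \<phi> (snd p)))\<^sup>2 / (4 * c)))"
  have "(\<integral>\<^sup>+x. ennreal ((norm (g x))\<^sup>2 * exp (- c * (norm x)\<^sup>2)) \<partial>lborel) = ennreal (norm (\<integral>p. ?K p \<partial>(M \<Otimes>\<^sub>M M)))"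
    unfolding g_def by (rule oscillatory_square(2)[OF assms(1-4)])
  also have "\<dots> \<le> (\<integral>\<^sup>+p. norm (?K p) \<partial>(M \<Otimes>\<^sub>M M))"
    by (rule integral_norm_bound_ennreal) (rule oscillatory_square(1)[OF assms(1-4)])
  also have "\<dots> = (\<integral>\<^sup>+p. ennreal (norm (a (fst p)) * norm (a (snd p)) *
       (pi / c * exp (- (norm (\<phi> (fst p) - \<phi> (snd p)))\<^sup>2 / (4 * c)))) \<partial>(M \<Otimes>\<^sub>M M))"
  proof -
    have "norm (complex_of_real (pi / c * exp z)) = pi / c * exp z" for z
      using c by (simp only: norm_of_real) simp
    then show ?thesis unfolding norm_mult by (simp add: norm_mult)
  qed
  finally show ?thesis .
qed

text \<open>Schur test by \<open>2 * a * b \<le> a\<^sup>2 + b\<^sup>2\<close>: each half leaves the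
  kernel to be integrated in one variable, and symmetry makes both halves equal. The kernel is
  controlled only between points of \<open>S\<close>, because chords of the circle control angles
  only when these are close.\<close>

lemma schur_bound:
  fixes a :: "'a \<Rightarrow> real" and k :: "'a \<Rightarrow> 'a \<Rightarrow> real"
  assumes "sigma_finite_measure M" and [measurable]: "a \<in> borel_measurable M" "S \<in> sets M"
    and k[measurable]: "case_prod k \<in> borel_measurable (M \<Otimes>\<^sub>M M)"
    and k0: "\<And>m m'. k m m' \<ge> 0" and sym: "\<And>m m'. k m m' = k m' m"
    and supp: "\<And>m. m \<notin> S \<Longrightarrow> a m = 0"
    and B: "\<And>m. m \<in> S \<Longrightarrow> (\<integral>\<^sup>+m'. ennreal (k m m') * indicator S m' \<partial>M) \<le> B"
  shows "(\<integral>\<^sup>+p. ennreal (\<bar>a (fst p)\<bar> * \<bar>a (snd p)\<bar> * k (fst p) (snd p)) \<partial>(M \<Otimes>\<^sub>M M))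
    \<le> B * (\<integral>\<^sup>+m. ennreal ((a m)\<^sup>2) \<partial>M)"
proof -
  interpret M: sigma_finite_measure M by fact
  interpret MM: pair_sigma_finite M M ..
  let ?u = "\<lambda>m m'. ennreal ((a m)\<^sup>2) * (ennreal (k m m') * indicator S m')"
  have [measurable]: "(\<lambda>p. k (fst p) (snd p)) \<in> borel_measurable (M \<Otimes>\<^sub>M M)"
    using k by (simp add: case_prod_beta')
  have half: "ennreal (\<bar>a (fst p)\<bar> * \<bar>a (snd p)\<bar> * k (fst p) (snd p)) 
      \<le> ennreal (1/2) * (?u (fst p) (snd p) + ?u (snd p) (fst p))" for p
  proof (cases "fst p \<in> S \<and> snd p \<in> S")
    case True
    have "2 * (\<bar>a (fst p)\<bar> * \<bar>a (snd p)\<bar>) \<le> (a (fst p))\<^sup>2 + (a (snd p))\<^sup>2"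
      using sum_squares_bound[of "\<bar>a (fst p)\<bar>" "\<bar>a (snd p)\<bar>"] by simp
    then have "\<bar>a (fst p)\<bar> * \<bar>a (snd p)\<bar> * k (fst p) (snd p) \<le> 
       (1/2 * ((a (fst p))\<^sup>2 + (a (snd p))\<^sup>2)) * k (fst p) (snd p)"
      by (intro mult_right_mono) (auto simp: k0)
    also have "\<dots> = 1/2 * ((a (fst p))\<^sup>2 * k (fst p) (snd p) + (a (snd p))\<^sup>2 * k (snd p) (fst p))"
      by (subst sym[of "snd p" "fst p"]) (simp add: algebra_simps)
    finally have "ennreal (\<bar>a (fst p)\<bar> * \<bar>a (snd p)\<bar> * k (fst p) (snd p)) \<le> 
        ennreal (1/2 * ((a (fst p))\<^sup>2 * k (fst p) (snd p) + (a (snd p))\<^sup>2 * k (snd p) (fst p)))"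
      by (rule ennreal_leI)
    also have "\<dots> = ennreal (1/2) * (ennreal ((a (fst p))\<^sup>2) * ennreal (k (fst p) (snd p)) + 
         ennreal ((a (snd p))\<^sup>2) * ennreal (k (snd p) (fst p)))"
      by (subst ennreal_mult) (auto simp: k0 ennreal_mult)
    finally show ?thesis using True by simp
  next
    case False
    then have 0: "\<bar>a (fst p)\<bar> * \<bar>a (snd p)\<bar> * k (fst p) (snd p) = 0" using supp by auto
    show ?thesis unfolding 0 by simp
  qed
  have m1: "(\<lambda>p. ?u (fst p) (snd p)) \<in> borel_measurable (M \<Otimes>\<^sub>M M)"
    by measurable
  have "(\<lambda>p. ennreal ((a (snd p))\<^sup>2) * (ennreal (k (fst p) (snd p)) * indicator S (fst p))) \<in> borel_measurable (M \<Otimes>\<^sub>M M)"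
    by measurable
  then have m2: "(\<lambda>p. ?u (snd p) (fst p)) \<in> borel_measurable (M \<Otimes>\<^sub>M M)"
    by (simp only: sym[of "snd _" "fst _"])
  have one: "(\<integral>\<^sup>+m. (\<integral>\<^sup>+m'. ?u m m' \<partial>M) \<partial>M) \<le> B * (\<integral>\<^sup>+m. ennreal ((a m)\<^sup>2) \<partial>M)"
  proof -
    have "(\<integral>\<^sup>+m. (\<integral>\<^sup>+m'. ?u m m' \<partial>M) \<partial>M) \<le> (\<integral>\<^sup>+m. ennreal ((a m)\<^sup>2) * B \<partial>M)"
    proof (rule nn_integral_mono)
      fix m assume m: "m \<in> space M"
      have [measurable]: "k m \<in> borel_measurable M"
        using measurable_compose_Pair1[OF m k] by simp
      have "(\<integral>\<^sup>+m'. ?u m m' \<partial>M) = ennreal ((a m)\<^sup>2) * (\<integral>\<^sup>+m'. ennreal (k m m') * indicator S m' \<partial>M)"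
        by (rule nn_integral_cmult) simp
      also have "\<dots> \<le> ennreal ((a m)\<^sup>2) * B"
        using B[of m] supp[of m] by (cases "m \<in> S") (auto intro: mult_left_mono)
      finally show "(\<integral>\<^sup>+m'. ?u m m' \<partial>M) \<le> ennreal ((a m)\<^sup>2) * B" .
    qed
    also have "\<dots> = B * (\<integral>\<^sup>+m. ennreal ((a m)\<^sup>2) \<partial>M)"
      by (subst nn_integral_multc) (auto simp: mult.commute)
    finally show ?thesis .
  qed
  have "(\<integral>\<^sup>+p. ennreal (\<bar>a (fst p)\<bar> * \<bar>a (snd p)\<bar> * k (fst p) (snd p)) \<partial>(M \<Otimes>\<^sub>M M)) \<le>
     (\<integral>\<^sup>+p. ennreal (1/2) * (?u (fst p) (snd p) + ?u (snd p) (fst p)) \<partial>(M \<Otimes>\<^sub>M M))"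
    by (rule nn_integral_mono) (rule half)
  also have "\<dots> = ennreal (1/2) * ((\<integral>\<^sup>+p. ?u (fst p) (snd p) \<partial>(M \<Otimes>\<^sub>M M)) + (\<integral>\<^sup>+p. ?u (snd p) (fst p) \<partial>(M \<Otimes>\<^sub>M M)))"
    using m1 m2 by (simp only: nn_integral_cmult nn_integral_add borel_measurable_add)
  also have "(\<integral>\<^sup>+p. ?u (fst p) (snd p) \<partial>(M \<Otimes>\<^sub>M M)) = (\<integral>\<^sup>+m. (\<integral>\<^sup>+m'. ?u m m' \<partial>M) \<partial>M)"
    using M.nn_integral_fst[OF m1] by simp
  also have "(\<integral>\<^sup>+p. ?u (snd p) (fst p) \<partial>(M \<Otimes>\<^sub>M M)) = (\<integral>\<^sup>+m. (\<integral>\<^sup>+m'. ?u m m' \<partial>M) \<partial>M)"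
    using MM.nn_integral_snd[OF m2] by simp
  also have "ennreal (1/2) * ((\<integral>\<^sup>+m. (\<integral>\<^sup>+m'. ?u m m' \<partial>M) \<partial>M) + (\<integral>\<^sup>+m. (\<integral>\<^sup>+m'. ?u m m' \<partial>M) \<partial>M)) \<le> 
     ennreal (1/2) * (B * (\<integral>\<^sup>+m. ennreal ((a m)\<^sup>2) \<partial>M) + B * (\<integral>\<^sup>+m. ennreal ((a m)\<^sup>2) \<partial>M))"
    by (intro mult_left_mono add_mono one) auto
  also have "\<dots> = B * (\<integral>\<^sup>+m. ennreal ((a m)\<^sup>2) \<partial>M)"
  proof -
    have "ennreal (1/2) * (x + x) = x" for x
    proof -
      have "ennreal (1/2) * (x + x) = ennreal (1/2) * 2 * x" by (simp add: mult.assoc mult_2)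
      also have "ennreal (1/2) * 2 = ennreal (1/2 * 2)" by (subst ennreal_mult) auto
      finally show ?thesis by simp
    qed
    then show ?thesis .
  qed
  finally show ?thesis .
qed

subsection \<open>Linear and bilinear energy estimates\<close>

definition circ :: "real \<Rightarrow> real \<times> real" where
  "circ t = (cos t, sin t)"

text \<open>A function of the angle, extended without the factor 1/(2 pi);
  \<open>extension_op_eq\<close> restores both the circle and the factor.\<close>

definition arc_ext :: "(real \<Rightarrow> complex) \<Rightarrow> real \<times> real \<Rightarrow> complex" where
  "arc_ext g x = (\<integral>t. g t * cis (x \<bullet> circ t) \<partial>lborel)"

lemma measurable_circ [measurable]: "circ \<in> borel_measurable borel"
  unfolding circ_def by (intro borel_measurable_continuous_onI continuous_intros)

text \<open>The derivative \<open>cos x - 1 / 2\<close> of the difference stays nonnegative up to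
  \<open>pi / 3\<close>, which exceeds 1.\<close>

lemma sin_ge_half:
  fixes v :: real
  assumes "0 \<le> v" "v \<le> 1"
  shows "v / 2 \<le> sin v"
proof -
  have "sin 0 - 0 / 2 \<le> sin v - v / 2"
  proof (rule DERIV_nonneg_imp_nondecreasing[OF assms(1)])
    fix x :: real assume x: "0 \<le> x" "x \<le> v"
    have "cos (pi / 3) \<le> cos x"
      using x assms pi_gt3 by (intro cos_monotone_0_pi_le) auto
    then show "\<exists>y. ((\<lambda>x. sin x - x / 2) has_real_derivative y) (at x) \<and> 0 \<le> y"
      by (intro exI[of _ "cos x - 1 / 2"]) (auto intro!: derivative_eq_intros simp: cos_60)
  qed
  then show ?thesis by simp
qed

lemma sin_sq_ge_quarter:
  fixes v :: real
  assumes "\<bar>v\<bar> \<le> 1"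
  shows "v\<^sup>2 / 4 \<le> (sin v)\<^sup>2"
proof -
  have "(\<bar>v\<bar> / 2)\<^sup>2 \<le> (sin \<bar>v\<bar>)\<^sup>2"
    using assms by (intro power_mono sin_ge_half) auto
  also have "(sin \<bar>v\<bar>)\<^sup>2 = (sin v)\<^sup>2" by (cases "v \<ge> 0") auto
  finally show ?thesis by (simp add: power_divide)
qed

text \<open>Law of cosines in half-angle form: for nonnegative radii the radial and the angular
  difference contribute separately, both with a nonnegative sign.\<close>

lemma norm_circ_diff:
  "(norm (r *\<^sub>R circ a - s *\<^sub>R circ b))\<^sup>2 = (r - s)\<^sup>2 + 4 * r * s * (sin ((a - b) / 2))\<^sup>2"
proof -
  have "(norm (r *\<^sub>R circ a - s *\<^sub>R circ b))\<^sup>2 = (r * cos a - s * cos b)\<^sup>2 + (r * sin a - s * sin b)\<^sup>2"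
    by (simp add: circ_def norm_Pair)
  also have "\<dots> = r\<^sup>2 * ((cos a)\<^sup>2 + (sin a)\<^sup>2) + s\<^sup>2 * ((cos b)\<^sup>2 + (sin b)\<^sup>2) - 2 * r * s * (cos a * cos b + sin a * sin b)"
    by algebra
  also have "\<dots> = r\<^sup>2 + s\<^sup>2 - 2 * r * s * cos (a - b)" by (simp add: cos_diff)
  also have "cos (a - b) = 1 - 2 * (sin ((a - b) / 2))\<^sup>2"
  proof -
    have e: "2 * ((a - b) / 2) = a - b" by simp
    show ?thesis using cos_double_sin[of "(a - b) / 2"] unfolding e .
  qed
  finally show ?thesis by (simp add: power2_eq_square algebra_simps)
qed

lemma norm_circ [simp]: "norm (circ t) = 1"
  by (simp add: circ_def norm_Pair)

text \<open>Polar coordinates of the sum: the length sees only the gap \<open>u\<close>, the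
  direction only the mid angle, so \<open>norm_circ_diff\<close> separates the two
  variables.\<close>

lemma circ_add: "circ (t + u) + circ t = (2 * cos (u / 2)) *\<^sub>R circ (t + u / 2)"
proof -
  have "(t + u + t) / 2 = t + u / 2" "(t + u - t) / 2 = u / 2" by (auto simp: field_simps)
  then show ?thesis
    unfolding circ_def by (simp only: add_Pair cos_plus_cos[of "t + u" t] sin_plus_sin[of "t + u" t]) (simp add: mult_ac)
qed

text \<open>For angles at distance at most one the chord is at least half the angle, so the kernel
  lies below a Gaussian of width about \<open>sqrt c\<close> in one variable. Its mass, of order
  \<open>1 / sqrt c\<close>, is the linear growth in the radius once
  \<open>c = 1 / R\<^sup>2\<close>.\<close>

lemma arc_ext_L2_gaussian:
  fixes g :: "real \<Rightarrow> complex"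
  assumes g: "integrable lborel g" and supp: "\<And>t. t \<notin> {\<alpha>..\<alpha>+1} \<Longrightarrow> g t = 0" and c: "c > 0"
  shows "(\<integral>\<^sup>+x. ennreal ((norm (arc_ext g x))\<^sup>2 * exp (- c * (norm x)\<^sup>2)) \<partial>lborel) \<le>
    ennreal (pi / c * sqrt (16 * pi * c)) * (\<integral>\<^sup>+t. ennreal ((norm (g t))\<^sup>2) \<partial>lborel)"
proof -
  have [measurable]: "g \<in> borel_measurable borel" using g by auto
  define k where "k s t = pi / c * exp (- (norm (circ s - circ t))\<^sup>2 / (4 * c))" for s t
  have "(\<integral>\<^sup>+x. ennreal ((norm (arc_ext g x))\<^sup>2 * exp (- c * (norm x)\<^sup>2)) \<partial>lborel) \<le>
    (\<integral>\<^sup>+p. ennreal (norm (g (fst p)) * norm (g (snd p)) * k (fst p) (snd p)) \<partial>(lborel \<Otimes>\<^sub>M lborel))"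
    unfolding arc_ext_def k_def by (rule oscillatory_square_bound[OF sigma_finite_lborel g _ c]) simp
  also have "\<dots> = (\<integral>\<^sup>+p. ennreal (\<bar>norm (g (fst p))\<bar> * \<bar>norm (g (snd p))\<bar> * k (fst p) (snd p)) \<partial>(lborel \<Otimes>\<^sub>M lborel))"
    by simp
  also have "\<dots> \<le> ennreal (pi / c * sqrt (16 * pi * c)) * (\<integral>\<^sup>+t. ennreal ((norm (g t))\<^sup>2) \<partial>lborel)"
  proof (rule schur_bound[OF sigma_finite_lborel, where S = "{\<alpha>..\<alpha>+1}"])
    show "case_prod k \<in> borel_measurable (lborel \<Otimes>\<^sub>M lborel)"
      unfolding k_def by measurable
    show "0 \<le> k m m'" for m m' using c by (simp add: k_def)
    show "k m m' = k m' m" for m m' by (simp add: k_def norm_minus_commute)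
    fix m assume m: "m \<in> {\<alpha>..\<alpha>+1}"
    have "(\<integral>\<^sup>+m'. ennreal (k m m') * indicator {\<alpha>..\<alpha>+1} m' \<partial>lborel) \<le> 
      (\<integral>\<^sup>+m'. ennreal (pi / c) * ennreal (exp (- (1 / (16 * c)) * (m' - m)\<^sup>2)) \<partial>lborel)"
    proof (rule nn_integral_mono)
      fix m'
      have "k m m' \<le> pi / c * exp (- (1 / (16 * c)) * (m' - m)\<^sup>2)" if m': "m' \<in> {\<alpha>..\<alpha>+1}"
      proof -
        have "(norm (circ m - circ m'))\<^sup>2 = 4 * (sin ((m - m') / 2))\<^sup>2"
          using norm_circ_diff[of 1 m 1 m'] by simp
        moreover have "((m - m') / 2)\<^sup>2 / 4 \<le> (sin ((m - m') / 2))\<^sup>2"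
          using m m' by (intro sin_sq_ge_quarter) (auto simp: abs_if)
        ultimately have "(m' - m)\<^sup>2 / 4 \<le> (norm (circ m - circ m'))\<^sup>2"
          by (simp add: power_divide power2_commute)
        then have "- (norm (circ m - circ m'))\<^sup>2 / (4 * c) \<le> - (1 / (16 * c)) * (m' - m)\<^sup>2"
          using c by (simp add: field_simps)
        then show ?thesis unfolding k_def using c by (intro mult_left_mono) auto
      qed
      then show "ennreal (k m m') * indicator {\<alpha>..\<alpha>+1} m' \<le> ennreal (pi / c) * ennreal (exp (- (1 / (16 * c)) * (m' - m)\<^sup>2))"
        using c by (auto simp: indicator_def ennreal_mult[symmetric] intro!: ennreal_leI)
    qed
    also have "\<dots> = ennreal (pi / c) * ennreal (sqrt (pi / (1 / (16 * c))))"
      using c by (subst nn_integral_cmult, simp, subst nn_gaussian_integral_shift) auto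
    also have "\<dots> = ennreal (pi / c * sqrt (16 * pi * c))"
      using c by (simp add: ennreal_mult[symmetric] mult_ac)
    finally show "(\<integral>\<^sup>+m'. ennreal (k m m') * indicator {\<alpha>..\<alpha>+1} m' \<partial>lborel) \<le> ennreal (pi / c * sqrt (16 * pi * c))" .
  qed (use supp in auto)
  finally show ?thesis .
qed

text \<open>The sum of two points of the circle has length \<open>2 * cos (u / 2)\<close>, which
  changes at rate about \<open>b\<close> when \<open>u\<close> is about \<open>b\<close>, while its
  direction changes at rate one with \<open>t\<close>. Hence the kernel lies below a product of
  Gaussians of widths about \<open>sqrt c / b\<close> and \<open>sqrt c\<close>. Their masses cancel
  the factor \<open>pi / c\<close>, so the bound does not depend on \<open>c\<close>; the loss
  \<open>1 / b\<close> is the reciprocal Jacobian of the sum map.\<close>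

lemma pair_ext_L2_gaussian:
  fixes a :: "real \<times> real \<Rightarrow> complex"
  assumes a: "integrable lborel a" and supp: "\<And>p. p \<notin> {\<alpha>..\<alpha>+1} \<times> {b<..2*b} \<Longrightarrow> a p = 0" 
    and c: "c > 0" and b: "b > 0" "2 * b \<le> 1"
  shows "(\<integral>\<^sup>+x. ennreal ((norm (\<integral>p. a p * cis (x \<bullet> (circ (fst p + snd p) + circ (fst p))) \<partial>lborel))\<^sup>2 * exp (- c * (norm x)\<^sup>2)) \<partial>lborel) \<le>
    ennreal (64 * pi\<^sup>2 / b) * (\<integral>\<^sup>+p. ennreal ((norm (a p))\<^sup>2) \<partial>lborel)"
proof -
  have [measurable]: "a \<in> borel_measurable borel" using a by auto
  define \<phi> where "\<phi> p = circ (fst p + snd p) + circ (fst p)" for p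
  have \<phi>m[measurable]: "\<phi> \<in> borel_measurable borel"
    unfolding \<phi>_def by (rule borel_measurable_continuous_onI) (auto simp: circ_def intro!: continuous_intros)
  define S where "S = {\<alpha>..\<alpha>+1} \<times> {b<..2*b}"
  have S[measurable]: "S \<in> sets borel" unfolding S_def by (intro borel_Times) auto
  define k where "k p q = pi / c * exp (- (norm (\<phi> p - \<phi> q))\<^sup>2 / (4 * c))" for p q
  have "(\<integral>\<^sup>+x. ennreal ((norm (\<integral>p. a p * cis (x \<bullet> \<phi> p) \<partial>lborel))\<^sup>2 * exp (- c * (norm x)\<^sup>2)) \<partial>lborel) \<le>
    (\<integral>\<^sup>+p. ennreal (norm (a (fst p)) * norm (a (snd p)) * k (fst p) (snd p)) \<partial>(lborel \<Otimes>\<^sub>M lborel))"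
    unfolding k_def by (rule oscillatory_square_bound[OF sigma_finite_lborel a _ c]) simp
  also have "\<dots> = (\<integral>\<^sup>+p. ennreal (\<bar>norm (a (fst p))\<bar> * \<bar>norm (a (snd p))\<bar> * k (fst p) (snd p)) \<partial>(lborel \<Otimes>\<^sub>M lborel))"
    by simp
  also have "\<dots> \<le> ennreal (64 * pi\<^sup>2 / b) * (\<integral>\<^sup>+t. ennreal ((norm (a t))\<^sup>2) \<partial>lborel)"
  proof (rule schur_bound[OF sigma_finite_lborel, where S = S])
    show "case_prod k \<in> borel_measurable (lborel \<Otimes>\<^sub>M lborel)"
      unfolding k_def by measurable
    show "0 \<le> k m m'" for m m' using c by (simp add: k_def)
    show "k m m' = k m' m" for m m' by (simp add: k_def norm_minus_commute)
    fix p assume p: "p \<in> S"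
    obtain t0 u0 where p_eq: "p = (t0, u0)" by (cases p)
    have t0: "t0 \<in> {\<alpha>..\<alpha>+1}" and u0: "u0 \<in> {b<..2*b}" using p by (auto simp: S_def p_eq)
    \<comment> \<open>Centred where the mid angles \<open>t + u / 2\<close> and
      \<open>t0 + u0 / 2\<close> agree. Integrating in \<open>t\<close> before \<open>u\<close>
      removes this shift.\<close>
    let ?e1 = "\<lambda>t u. exp (- (1 / (16 * c)) * (t - (t0 + u0 / 2 - u / 2))\<^sup>2)"
    let ?e2 = "\<lambda>u. exp (- (b\<^sup>2 / (256 * c)) * (u - u0)\<^sup>2)"
    have kle: "k (t0, u0) (t, u) \<le> pi / c * (?e2 u * ?e1 t u)" if t: "t \<in> {\<alpha>..\<alpha>+1}" and u: "u \<in> {b<..2*b}" for t u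
    proof -
      define \<rho> where "\<rho> u = 2 * cos (u / 2)" for u :: real
      have \<rho>1: "\<rho> v \<ge> 1" if "v \<in> {b<..2*b}" for v
      proof -
        have "cos (pi / 3) \<le> cos (v / 2)" using that b pi_gt3 by (intro cos_monotone_0_pi_le) auto
        then show ?thesis by (simp add: \<rho>_def cos_60)
      qed
      have d: "(norm (\<phi> (t0, u0) - \<phi> (t, u)))\<^sup>2 = (\<rho> u0 - \<rho> u)\<^sup>2 + 4 * \<rho> u0 * \<rho> u * (sin ((t0 + u0 / 2 - (t + u / 2)) / 2))\<^sup>2"
        unfolding \<phi>_def by (simp only: fst_conv snd_conv circ_add norm_circ_diff \<rho>_def)
      have s1: "((t0 + u0 / 2 - (t + u / 2)) / 2)\<^sup>2 / 4 \<le> (sin ((t0 + u0 / 2 - (t + u / 2)) / 2))\<^sup>2"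
        using t t0 u u0 b by (intro sin_sq_ge_quarter) (auto simp: abs_if)
      have "1 * 1 \<le> \<rho> u0 * \<rho> u" using \<rho>1[OF u] \<rho>1[OF u0] by (intro mult_mono) auto
      then have "4 * 1 * (((t0 + u0 / 2 - (t + u / 2)) / 2)\<^sup>2 / 4) \<le> 4 * (\<rho> u0 * \<rho> u) * (sin ((t0 + u0 / 2 - (t + u / 2)) / 2))\<^sup>2"
        using s1 by (intro mult_mono) auto
      then have A: "(t - (t0 + u0 / 2 - u / 2))\<^sup>2 / 4 \<le> 4 * \<rho> u0 * \<rho> u * (sin ((t0 + u0 / 2 - (t + u / 2)) / 2))\<^sup>2"
        by (simp add: power2_eq_square field_simps)
      \<comment> \<open>The separation enters here: \<open>(u0 + u) / 4\<close> exceeds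
        \<open>b / 2\<close>, so its sine is at least \<open>b / 4\<close>.\<close>
      have "\<rho> u0 - \<rho> u = 4 * sin ((u0 + u) / 4) * sin ((u - u0) / 4)"
        unfolding \<rho>_def right_diff_distrib[symmetric] cos_diff_cos by (simp add: field_simps)
      moreover have "b / 4 \<le> sin ((u0 + u) / 4)"
        using u u0 b sin_ge_half[of "(u0 + u) / 4"] by auto
      then have "(b / 4)\<^sup>2 \<le> (sin ((u0 + u) / 4))\<^sup>2" using b by (intro power_mono) auto
      moreover have "((u - u0) / 4)\<^sup>2 / 4 \<le> (sin ((u - u0) / 4))\<^sup>2"
        using u u0 b by (intro sin_sq_ge_quarter) (auto simp: abs_if)
      ultimately have B: "16 * (b / 4)\<^sup>2 * (((u - u0) / 4)\<^sup>2 / 4) \<le> (\<rho> u0 - \<rho> u)\<^sup>2"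
        unfolding power_mult_distrib by (simp only: power_mult_distrib) (intro mult_mono, auto)
      have "(b\<^sup>2 * (u - u0)\<^sup>2) / 64 + (t - (t0 + u0 / 2 - u / 2))\<^sup>2 / 4 \<le> (norm (\<phi> (t0, u0) - \<phi> (t, u)))\<^sup>2"
        using A B unfolding d by (simp add: power_divide)
      then have "- (norm (\<phi> (t0, u0) - \<phi> (t, u)))\<^sup>2 / (4 * c) \<le> 
         - ((b\<^sup>2 * (u - u0)\<^sup>2) / 64 + (t - (t0 + u0 / 2 - u / 2))\<^sup>2 / 4) / (4 * c)"
        using c by (intro divide_right_mono) auto
      also have "\<dots> = - (b\<^sup>2 / (256 * c)) * (u - u0)\<^sup>2 + - (1 / (16 * c)) * (t - (t0 + u0 / 2 - u / 2))\<^sup>2"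
        using c by (simp add: add_divide_distrib diff_divide_distrib)
      finally show ?thesis
        unfolding k_def exp_add[symmetric] using c by (intro mult_left_mono) auto
    qed
    have "(\<integral>\<^sup>+q. ennreal (k p q) * indicator S q \<partial>lborel) \<le> 
      (\<integral>\<^sup>+q. ennreal (pi / c) * (ennreal (?e2 (snd q)) * ennreal (?e1 (fst q) (snd q))) \<partial>(lborel \<Otimes>\<^sub>M lborel))"
      unfolding lborel_prod
    proof (rule nn_integral_mono)
      fix q :: "real \<times> real"
      show "ennreal (k p q) * indicator S q \<le> ennreal (pi / c) * (ennreal (?e2 (snd q)) * ennreal (?e1 (fst q) (snd q)))"
        using kle[of "fst q" "snd q"] c
        by (cases q) (auto simp: indicator_def S_def p_eq ennreal_mult[symmetric] simp del: mult_minus_left intro!: ennreal_leI)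
    qed
    also have "\<dots> = (\<integral>\<^sup>+u. (\<integral>\<^sup>+t. ennreal (pi / c) * (ennreal (?e2 u) * ennreal (?e1 t u)) \<partial>lborel) \<partial>lborel)"
      by (subst lborel_pair.nn_integral_snd[symmetric]) auto
    also have "\<dots> = (\<integral>\<^sup>+u. ennreal (pi / c) * (ennreal (?e2 u) * ennreal (sqrt (pi / (1 / (16 * c))))) \<partial>lborel)"
      using c by (subst nn_integral_cmult, simp, subst nn_integral_cmult, simp, subst nn_gaussian_integral_shift) auto
    also have "\<dots> = ennreal (pi / c) * (ennreal (sqrt (pi / (b\<^sup>2 / (256 * c)))) * ennreal (sqrt (pi / (1 / (16 * c)))))"
      using c b by (subst nn_integral_cmult, simp, subst nn_integral_multc, simp, subst nn_gaussian_integral_shift) auto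
    also have "\<dots> = ennreal (pi / c * (sqrt (pi / (b\<^sup>2 / (256 * c))) * sqrt (pi / (1 / (16 * c)))))"
      using c by (simp add: ennreal_mult[symmetric])
    also have "sqrt (pi / (b\<^sup>2 / (256 * c))) * sqrt (pi / (1 / (16 * c))) = sqrt ((64 * pi * c / b)\<^sup>2)"
      using c b unfolding real_sqrt_mult[symmetric] by (simp add: power2_eq_square field_simps)
    also have "sqrt ((64 * pi * c / b)\<^sup>2) = 64 * pi * c / b"
      using c b by (intro real_sqrt_unique) auto
    also have "pi / c * (64 * pi * c / b) = 64 * pi\<^sup>2 / b" using c by (simp add: power2_eq_square)
    finally show "(\<integral>\<^sup>+q. ennreal (k p q) * indicator S q \<partial>lborel) \<le> ennreal (64 * pi\<^sup>2 / b)" .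
  qed (use supp S in \<open>auto simp: S_def[symmetric]\<close>)
  finally show ?thesis unfolding \<phi>_def .
qed

text \<open>The Gaussian bound is uniform in \<open>c\<close>; Fatou along
  \<open>c = 1 / (n + 1)\<close> removes the weight.\<close>

lemma pair_ext_L2:
  fixes a :: "real \<times> real \<Rightarrow> complex"
  assumes a: "integrable lborel a" and supp: "\<And>p. p \<notin> {\<alpha>..\<alpha>+1} \<times> {b<..2*b} \<Longrightarrow> a p = 0" 
    and b: "b > 0" "2 * b \<le> 1"
  shows "(\<integral>\<^sup>+x. ennreal ((norm (\<integral>p. a p * cis (x \<bullet> (circ (fst p + snd p) + circ (fst p))) \<partial>lborel))\<^sup>2) \<partial>lborel) \<le>
    ennreal (64 * pi\<^sup>2 / b) * (\<integral>\<^sup>+p. ennreal ((norm (a p))\<^sup>2) \<partial>lborel)"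
proof -
  have [measurable]: "a \<in> borel_measurable borel" using a by auto
  define G where "G x = (\<integral>p. a p * cis (x \<bullet> (circ (fst p + snd p) + circ (fst p))) \<partial>lborel)" for x
  have [measurable]: "(\<lambda>p::real \<times> real. circ (fst p + snd p) + circ (fst p)) \<in> borel_measurable borel"
    by (rule borel_measurable_continuous_onI) (auto simp: circ_def intro!: continuous_intros)
  have [measurable]: "G \<in> borel_measurable borel"
    unfolding G_def by measurable
  let ?u = "\<lambda>n x. ennreal ((norm (G x))\<^sup>2 * exp (- (1 / real (Suc n)) * (norm x)\<^sup>2))"
  have lim: "(\<lambda>n. ?u n x) \<longlonglongrightarrow> ennreal ((norm (G x))\<^sup>2)" for x
  proof -
    have "(\<lambda>n. (norm (G x))\<^sup>2 * exp (- (1 / real (Suc n)) * (norm x)\<^sup>2)) \<longlonglongrightarrow> (norm (G x))\<^sup>2 * exp (- 0 * (norm x)\<^sup>2)"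
      by (intro tendsto_intros LIMSEQ_Suc lim_1_over_n)
    then show ?thesis by (intro tendsto_ennrealI) simp
  qed
  have "(\<integral>\<^sup>+x. ennreal ((norm (G x))\<^sup>2) \<partial>lborel) = (\<integral>\<^sup>+x. liminf (\<lambda>n. ?u n x) \<partial>lborel)"
    using lim_imp_Liminf[OF _ lim] by simp
  also have "\<dots> \<le> liminf (\<lambda>n. \<integral>\<^sup>+x. ?u n x \<partial>lborel)"
    by (rule nn_integral_liminf) simp
  also have "\<dots> \<le> liminf (\<lambda>n. ennreal (64 * pi\<^sup>2 / b) * (\<integral>\<^sup>+p. ennreal ((norm (a p))\<^sup>2) \<partial>lborel))"
    unfolding G_def by (intro Liminf_mono always_eventually allI pair_ext_L2_gaussian[OF a supp] b) auto
  finally show ?thesis unfolding G_def by (simp add: Liminf_const)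
qed

subsection \<open>Atoms\<close>

text \<open>For \<open>z > 0\<close> this is \<open>min (z powr e) (z powr - e)\<close>.\<close>

definition kap :: "real \<Rightarrow> real \<Rightarrow> real" where
  "kap e z = exp (- e * \<bar>ln z\<bar>)"

lemma kap_pos [simp]: "0 < kap e z" "0 \<le> kap e z" by (auto simp: kap_def)

lemma kap_powr: "kap e z powr c = kap (e * c) z"
  by (simp add: kap_def powr_def)

lemma kap_mult: "kap e z * kap c z = kap (e + c) z"
  by (simp add: kap_def exp_add[symmetric] algebra_simps)

lemma kap_inverse: "z > 0 \<Longrightarrow> kap e (1 / z) = kap e z"
  by (simp add: kap_def ln_div)

lemma powr_le_kap_small:
  assumes "0 < z" "z \<le> 1" "e \<le> a" shows "z powr a \<le> kap e z"
proof -
  have "ln z \<le> 0" using assms by simp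
  then have "a * ln z \<le> e * ln z" using assms(3) by (intro mult_right_mono_neg)
  then show ?thesis using assms \<open>ln z \<le> 0\<close> by (simp add: kap_def powr_def)
qed

lemma powr_le_kap_large:
  assumes "1 \<le> z" "a \<le> - e" shows "z powr a \<le> kap e z"
proof -
  have "ln z \<ge> 0" using assms by simp
  then have "a * ln z \<le> - e * ln z" using assms by (intro mult_right_mono)
  then show ?thesis using assms \<open>ln z \<ge> 0\<close> by (simp add: kap_def powr_def)
qed

text \<open>After absorbing \<open>e\<close> into the ratio \<open>D = B powr e\<close>, each term
  is the minimum of \<open>Z\<close> and \<open>1 / Z\<close>. It is at most \<open>K\<close> times
  the increment of the bounded function \<open>Z / (1 + Z)\<close> from \<open>Z\<close> to
  \<open>D * Z\<close>, so the sum telescopes to at most \<open>K\<close>. This is uniform in the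
  offset \<open>Y\<close> and does not need the index at which the sequence crosses 1.\<close>

lemma kap_geometric_sum:
  fixes B e :: real
  assumes B: "B > 1" and e: "e > 0"
  shows "\<exists>K>0. \<forall>Y>0. \<forall>n. (\<Sum>l<n. kap e (B ^ l * Y)) \<le> K"
proof -
  define D where "D = B powr e"
  have D: "D > 1" unfolding D_def using assms by (simp add: gr_one_powr)
  define \<psi> where "\<psi> Z = Z / (1 + Z)" for Z :: real
  define K where "K = 2 * (D + 1) / (D - 1)"
  have K: "K > 0" using D by (simp add: K_def)
  have key: "exp (- \<bar>ln Z\<bar>) \<le> K * (\<psi> (D * Z) - \<psi> Z)" if Z: "Z > 0" for Z
  proof -
    have DZ: "1 + D * Z > 0" using D Z by (simp add: add_pos_pos)
    have "\<psi> (D * Z) - \<psi> Z = (D - 1) * Z / ((1 + D * Z) * (1 + Z))"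
      unfolding \<psi>_def using Z DZ by (simp add: field_simps)
    then have eq: "K * (\<psi> (D * Z) - \<psi> Z) = 2 * (D + 1) * Z / ((1 + D * Z) * (1 + Z))"
      using D by (simp add: K_def)
    have Den: "0 < (1 + D * Z) * (1 + Z)" using Z DZ by simp
    show ?thesis
    proof (cases "Z \<le> 1")
      case True
      have "(1 + D * Z) * (1 + Z) \<le> (1 + D) * 2"
        using True Z D by (intro mult_mono) auto
      then have "Z * ((1 + D * Z) * (1 + Z)) \<le> 2 * (D + 1) * Z" using Z by (simp add: mult.commute)
      moreover have "exp (- \<bar>ln Z\<bar>) = Z" using True Z by simp
      ultimately show ?thesis unfolding eq pos_le_divide_eq[OF Den] by simp
    next
      case False
      have "D * Z \<le> D * Z" "1 \<le> Z" using False by auto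
      then have "(1 + D * Z) * (1 + Z) \<le> ((1 + D) * Z) * (2 * Z)"
        using Z D by (intro mult_mono) (auto simp: algebra_simps)
      then have "(1 + D * Z) * (1 + Z) \<le> 2 * (D + 1) * Z * Z" by (simp add: algebra_simps)
      moreover have "exp (- \<bar>ln Z\<bar>) = 1 / Z" using False Z by (simp add: exp_minus inverse_eq_divide)
      ultimately show ?thesis unfolding eq pos_le_divide_eq[OF Den] using Z by (simp add: pos_divide_le_eq)
    qed
  qed
  have "(\<Sum>l<n. kap e (B ^ l * Y)) \<le> K" if Y: "Y > 0" for Y n
  proof -
    define Z where "Z l = D ^ l * Y powr e" for l :: nat
    have Zp: "Z l > 0" for l using D Y by (simp add: Z_def)
    have Zs: "Z (Suc l) = D * Z l" for l by (simp add: Z_def)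
    have "kap e (B ^ l * Y) = exp (- \<bar>ln (Z l)\<bar>)" for l
    proof -
      have "ln (Z l) = e * ln (B ^ l * Y)"
        using B Y e by (simp add: Z_def D_def ln_mult ln_powr ln_realpow algebra_simps)
      then show ?thesis using e by (simp add: kap_def abs_mult)
    qed
    then have "(\<Sum>l<n. kap e (B ^ l * Y)) \<le> (\<Sum>l<n. K * (\<psi> (Z (Suc l)) - \<psi> (Z l)))"
      using key[OF Zp] by (intro sum_mono) (simp add: Zs)
    also have "\<dots> = K * (\<psi> (Z n) - \<psi> (Z 0))"
      unfolding sum_distrib_left[symmetric] sum_lessThan_telescope[of "\<lambda>l. \<psi> (Z l)" n] ..
    also have "\<dots> \<le> K * 1"
    proof (intro mult_left_mono)
      have "\<psi> (Z n) \<le> 1" "\<psi> (Z 0) \<ge> 0" using Zp[of n] Zp[of 0] by (auto simp: \<psi>_def)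
      then show "\<psi> (Z n) - \<psi> (Z 0) \<le> 1" by simp
    qed (use K in auto)
    finally show ?thesis by simp
  qed
  then show ?thesis using K by blast
qed

lemma kap_geometric_suminf:
  fixes B e :: real
  assumes B: "B > 1" and e: "e > 0"
  shows "\<exists>K>0. \<forall>Y>0. (\<Sum>l. ennreal (kap e (B ^ l * Y))) \<le> ennreal K"
proof -
  obtain K where K: "K > 0" "\<And>Y n. Y > 0 \<Longrightarrow> (\<Sum>l<n. kap e (B ^ l * Y)) \<le> K"
    using kap_geometric_sum[OF assms] by blast
  have "(\<Sum>l. ennreal (kap e (B ^ l * Y))) \<le> ennreal K" if "Y > 0" for Y
    unfolding suminf_eq_SUP using K that by (intro SUP_least) (simp add: ennreal_leI)
  then show ?thesis using K by blast
qed

text \<open>This pigeonhole step replaces every use of Hoelder's and Minkowski's inequalities for infinite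
  sums: one summand alone controls the sum, up to its weight.\<close>

lemma dominant_term:
  fixes a \<theta> :: "nat \<Rightarrow> real"
  assumes a: "summable a" "\<And>l. 0 \<le> a l" and s: "s \<le> (\<Sum>l. a l)"
    and \<theta>: "\<And>l. \<theta> l > 0" and A: "\<And>n. (\<Sum>l<n. \<theta> l) \<le> A"
  shows "\<exists>l. s \<le> 2 * A / \<theta> l * a l"
proof (rule ccontr)
  assume "\<nexists>l. s \<le> 2 * A / \<theta> l * a l"
  then have n: "2 * A / \<theta> l * a l < s" for l by (auto simp: not_le)
  have "A \<ge> 0" using A[of 0] by simp
  have "A > 0" using A[of 1] \<theta>[of 0] by simp
  have "0 \<le> 2 * A / \<theta> 0 * a 0" using \<open>A > 0\<close> \<theta>[of 0] a by simp
  with n[of 0] have "s > 0" by linarith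
  have le: "a l \<le> \<theta> l * (s / (2 * A))" for l
    using n[of l] \<theta>[of l] \<open>A > 0\<close> by (simp add: field_simps)
  \<comment> \<open>The factor 2 in the statement leaves a total of at most \<open>s / 2\<close>,
    strictly below \<open>s\<close> even after passing to the limit.\<close>
  have "(\<Sum>l. a l) \<le> s / 2"
  proof (rule suminf_le_const[OF a(1)])
    fix n
    have "(\<Sum>l<n. a l) \<le> (\<Sum>l<n. \<theta> l) * (s / (2 * A))"
      unfolding sum_distrib_right using le by (intro sum_mono)
    also have "\<dots> \<le> A * (s / (2 * A))" using A[of n] \<open>s > 0\<close> \<open>A > 0\<close> by (intro mult_right_mono) auto
    finally show "(\<Sum>l<n. a l) \<le> s / 2" using \<open>A > 0\<close> by simp
  qed
  then show False using s \<open>s > 0\<close> by simp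
qed

text \<open>The dominant index depends on \<open>x\<close>; replacing the chosen term by the sum
  over all indices avoids selecting it measurably.\<close>

lemma nn_integral_le_suminf:
  assumes v[measurable]: "\<And>l::nat. v l \<in> borel_measurable M"
    and ex: "\<And>x. x \<in> space M \<Longrightarrow> \<exists>l. u x \<le> v l x"
  shows "(\<integral>\<^sup>+x. u x \<partial>M) \<le> (\<Sum>l. \<integral>\<^sup>+x. v l x \<partial>M)"
proof -
  have "u x \<le> (\<Sum>l. v l x)" if "x \<in> space M" for x
  proof -
    from ex[OF that] obtain l where "u x \<le> v l x" by blast
    also have "v l x \<le> (\<Sum>l. v l x)" using sum_le_suminf[of "\<lambda>l. v l x" "{l}"] by simp
    finally show ?thesis .
  qed
  then have "(\<integral>\<^sup>+x. u x \<partial>M) \<le> (\<integral>\<^sup>+x. (\<Sum>l. v l x) \<partial>M)" by (intro nn_integral_mono)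
  also have "\<dots> = (\<Sum>l. \<integral>\<^sup>+x. v l x \<partial>M)" by (rule nn_integral_suminf) simp
  finally show ?thesis .
qed

text \<open>Supports are arbitrary measurable sets, not arcs, so that estimates may use only the
  measure \<open>\<delta>\<close>. The window of length one keeps half differences of angles in the
  range of \<open>sin_sq_ge_quarter\<close>.\<close>

definition atom :: "real \<Rightarrow> real \<Rightarrow> (real \<Rightarrow> complex) \<Rightarrow> bool" where
  "atom \<alpha> \<delta> g \<longleftrightarrow> g \<in> borel_measurable borel \<and> (\<forall>t. norm (g t) \<le> 1) \<and>
     (\<forall>t. t \<notin> {\<alpha>..\<alpha>+1} \<longrightarrow> g t = 0) \<and> emeasure lborel {t. g t \<noteq> 0} \<le> ennreal \<delta>"

lemma atomD:
  assumes "atom \<alpha> \<delta> g"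
  shows "g \<in> borel_measurable borel" "norm (g t) \<le> 1" "t \<notin> {\<alpha>..\<alpha>+1} \<Longrightarrow> g t = 0"
    "emeasure lborel {t. g t \<noteq> 0} \<le> ennreal \<delta>"
  using assms by (auto simp: atom_def)

lemma atom_nn_integral:
  assumes "atom \<alpha> \<delta> g"
  shows "(\<integral>\<^sup>+t. ennreal (norm (g t)) \<partial>lborel) \<le> ennreal \<delta>"
    and "(\<integral>\<^sup>+t. ennreal ((norm (g t))\<^sup>2) \<partial>lborel) \<le> ennreal \<delta>"
proof -
  note [measurable] = atomD(1)[OF assms]
  have E: "{t. g t \<noteq> 0} \<in> sets lborel" by measurable
  have "(\<integral>\<^sup>+t. ennreal (norm (g t)) \<partial>lborel) \<le> (\<integral>\<^sup>+t. indicator {t. g t \<noteq> 0} t \<partial>lborel)"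
    using atomD(2)[OF assms] by (intro nn_integral_mono) (auto simp: indicator_def)
  also have "\<dots> \<le> ennreal \<delta>" using atomD(4)[OF assms] nn_integral_indicator[OF E] by simp
  finally show 1: "(\<integral>\<^sup>+t. ennreal (norm (g t)) \<partial>lborel) \<le> ennreal \<delta>" .
  have "(\<integral>\<^sup>+t. ennreal ((norm (g t))\<^sup>2) \<partial>lborel) \<le> (\<integral>\<^sup>+t. ennreal (norm (g t)) \<partial>lborel)"
    using atomD(2)[OF assms] by (intro nn_integral_mono ennreal_leI) (simp add: power2_eq_square mult_left_le)
  then show "(\<integral>\<^sup>+t. ennreal ((norm (g t))\<^sup>2) \<partial>lborel) \<le> ennreal \<delta>" using 1 by simp
qed

lemma atom_integrable: "atom \<alpha> \<delta> g \<Longrightarrow> integrable lborel g"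
  using atom_nn_integral(1)[of \<alpha> \<delta> g] atomD(1)[of \<alpha> \<delta> g]
  by (intro integrableI_bounded) (auto intro: le_less_trans)

lemma measurable_arc_ext [measurable]:
  assumes [measurable]: "g \<in> borel_measurable borel"
  shows "arc_ext g \<in> borel_measurable borel"
  unfolding arc_ext_def[abs_def] by measurable

lemma norm_arc_ext_le:
  assumes "integrable lborel g"
  shows "ennreal (norm (arc_ext g x)) \<le> (\<integral>\<^sup>+t. ennreal (norm (g t)) \<partial>lborel)"
proof -
  have [measurable]: "g \<in> borel_measurable borel" using assms by auto
  have "integrable lborel (\<lambda>t. g t * cis (x \<bullet> circ t))"
    using assms by (rule Bochner_Integration.integrable_bound) (auto simp: norm_mult)
  from integral_norm_bound_ennreal[OF this] show ?thesis
    by (simp add: arc_ext_def norm_mult)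
qed

lemma atom_sup:
  assumes "atom \<alpha> \<delta> g" "\<delta> \<ge> 0"
  shows "norm (arc_ext g x) \<le> \<delta>"
  using order_trans[OF norm_arc_ext_le[OF atom_integrable[OF assms(1)]] atom_nn_integral(1)[OF assms(1)]] assms(2)
  by (simp add: ennreal_le_iff)

text \<open>With \<open>c = 1 / R\<^sup>2\<close> the Gaussian is at least \<open>exp (- 1)\<close>
  on the ball.\<close>

lemma arc_ext_L2_ball:
  fixes g :: "real \<Rightarrow> complex"
  assumes g: "integrable lborel g" and supp: "\<And>t. t \<notin> {\<alpha>..\<alpha>+1} \<Longrightarrow> g t = 0" and R: "R > 0"
  shows "(\<integral>\<^sup>+x. ennreal ((norm (arc_ext g x))\<^sup>2) * indicator (cball 0 R) x \<partial>lborel) \<le>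
    ennreal (exp 1 * (4 * pi * sqrt pi) * R) * (\<integral>\<^sup>+t. ennreal ((norm (g t))\<^sup>2) \<partial>lborel)"
proof -
  have [measurable]: "g \<in> borel_measurable borel" using g by auto
  define c where "c = 1 / R\<^sup>2"
  have c: "c > 0" using R by (simp add: c_def)
  have "(\<integral>\<^sup>+x. ennreal ((norm (arc_ext g x))\<^sup>2) * indicator (cball 0 R) x \<partial>lborel) \<le>
    (\<integral>\<^sup>+x. ennreal (exp 1) * ennreal ((norm (arc_ext g x))\<^sup>2 * exp (- c * (norm x)\<^sup>2)) \<partial>lborel)"
  proof (rule nn_integral_mono)
    fix x :: "real \<times> real"
    have "(norm (arc_ext g x))\<^sup>2 \<le> exp 1 * ((norm (arc_ext g x))\<^sup>2 * exp (- c * (norm x)\<^sup>2))" if "norm x \<le> R"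
    proof -
      have "(norm x)\<^sup>2 \<le> R\<^sup>2" using that by (intro power_mono) auto
      then have "c * (norm x)\<^sup>2 \<le> 1" using R by (simp add: c_def)
      then have "1 \<le> exp (1 + (- c * (norm x)\<^sup>2))" by simp
      then have "(norm (arc_ext g x))\<^sup>2 * 1 \<le> (norm (arc_ext g x))\<^sup>2 * (exp 1 * exp (- c * (norm x)\<^sup>2))"
        unfolding exp_add by (intro mult_left_mono) auto
      then show ?thesis by (simp add: mult_ac)
    qed
    then show "ennreal ((norm (arc_ext g x))\<^sup>2) * indicator (cball 0 R) x \<le> 
        ennreal (exp 1) * ennreal ((norm (arc_ext g x))\<^sup>2 * exp (- c * (norm x)\<^sup>2))"
      by (auto simp: indicator_def ennreal_mult[symmetric] simp del: mult_minus_left intro!: ennreal_leI)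
  qed
  also have "\<dots> = ennreal (exp 1) * (\<integral>\<^sup>+x. ennreal ((norm (arc_ext g x))\<^sup>2 * exp (- c * (norm x)\<^sup>2)) \<partial>lborel)"
    by (rule nn_integral_cmult) simp
  also have "\<dots> \<le> ennreal (exp 1) * (ennreal (pi / c * sqrt (16 * pi * c)) * (\<integral>\<^sup>+t. ennreal ((norm (g t))\<^sup>2) \<partial>lborel))"
    by (intro mult_left_mono arc_ext_L2_gaussian[OF g supp c]) auto
  also have "\<dots> = ennreal (exp 1 * (4 * pi * sqrt pi) * R) * (\<integral>\<^sup>+t. ennreal ((norm (g t))\<^sup>2) \<partial>lborel)"
  proof -
    have "sqrt (16 * pi * c) = 4 * sqrt pi / R"
      using R by (simp add: c_def real_sqrt_mult real_sqrt_divide)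
    then have "exp 1 * (pi / c * sqrt (16 * pi * c)) = exp 1 * (4 * pi * sqrt pi) * R"
      using R by (simp add: c_def power2_eq_square)
    then show ?thesis using c by (simp add: mult.assoc[symmetric] ennreal_mult[symmetric])
  qed
  finally show ?thesis .
qed

lemma atom_L2_ball:
  assumes "atom \<alpha> \<delta> g" "\<delta> \<ge> 0" "R > 0"
  shows "(\<integral>\<^sup>+x. ennreal ((norm (arc_ext g x))\<^sup>2) * indicator (cball 0 R) x \<partial>lborel) \<le>
    ennreal (exp 1 * (4 * pi * sqrt pi) * R * \<delta>)"
proof -
  have "(\<integral>\<^sup>+x. ennreal ((norm (arc_ext g x))\<^sup>2) * indicator (cball 0 R) x \<partial>lborel) \<le>
    ennreal (exp 1 * (4 * pi * sqrt pi) * R) * (\<integral>\<^sup>+t. ennreal ((norm (g t))\<^sup>2) \<partial>lborel)"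
    using arc_ext_L2_ball[OF atom_integrable[OF assms(1)] atomD(3)[OF assms(1)] assms(3)] .
  also have "\<dots> \<le> ennreal (exp 1 * (4 * pi * sqrt pi) * R) * ennreal \<delta>"
    by (intro mult_left_mono atom_nn_integral(2)[OF assms(1)]) auto
  finally show ?thesis using assms by (simp add: ennreal_mult[symmetric])
qed

section \<open>Bilinear decomposition of the squared extension\<close>

definition dyad :: "nat \<Rightarrow> real set" where
  "dyad j = {(1/2) ^ Suc j <.. (1/2) ^ j}"

lemma dyad_sets [measurable]: "dyad j \<in> sets borel"
  by (simp add: dyad_def)

lemma dyad_disjoint: "i \<noteq> j \<Longrightarrow> dyad i \<inter> dyad j = {}"
proof (induct i j rule: linorder_wlog)
  case (le i j)
  then have "(1/2 :: real) ^ j \<le> (1/2) ^ Suc i" by (intro power_decreasing) auto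
  then show ?case by (auto simp: dyad_def)
qed auto

lemma dyad_Union: "(\<Union>j. dyad j) = {0<..1}"
proof
  show "(\<Union>j. dyad j) \<subseteq> {0<..1}"
  proof
    fix u assume "u \<in> (\<Union>j. dyad j)"
    then obtain j where "(1/2) ^ Suc j < u" "u \<le> (1/2) ^ j" by (auto simp: dyad_def)
    moreover have "(0::real) < (1/2) ^ Suc j" "(1/2::real) ^ j \<le> 1" by (auto simp: power_le_one)
    ultimately show "u \<in> {0<..1}" by (metis greaterThanAtMost_iff less_trans order_trans)
  qed
  show "{0<..1} \<subseteq> (\<Union>j. dyad j)"
  proof
    fix u :: real assume u: "u \<in> {0<..1}"
    then obtain n where n: "(1/2) ^ n < u" using real_arch_pow_inv[of u "1/2"] by auto
    define j where "j = (LEAST n. (1/2) ^ n < u)"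
    have j: "(1/2) ^ j < u" unfolding j_def using n by (rule LeastI)
    have "j \<noteq> 0" using j u by (intro notI) auto
    then obtain i where i: "j = Suc i" by (cases j) auto
    have "\<not> (1/2) ^ i < u" using not_less_Least[of i "\<lambda>n. (1/2) ^ n < u"] i j_def by auto
    then show "u \<in> (\<Union>j. dyad j)" using j i by (auto simp: dyad_def)
  qed
qed

text \<open>Squaring without conjugation makes frequencies add. With the second angle written as
  \<open>t + u\<close>, exchanging the two angles reflects \<open>u\<close>, so positive
  \<open>u\<close> carries half of the square. The unit window confines \<open>u\<close> to (0, 1]
  up to a null set, and the dyadic intervals tile this range.\<close>

lemma integral_square_dyadic:
  fixes k :: "real \<Rightarrow> complex"
  assumes k: "integrable lborel k" and supp: "\<And>t. t \<notin> {\<alpha>..\<alpha>+1} \<Longrightarrow> k t = 0"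
  shows "(\<integral>t. k t \<partial>lborel)\<^sup>2 = 
    2 * (\<Sum>j. \<integral>p. indicator (dyad j) (snd p) *\<^sub>R (k (fst p + snd p) * k (fst p)) \<partial>lborel)"
proof -
  have [measurable]: "k \<in> borel_measurable borel" using k by auto
  have kt: "integrable lborel (\<lambda>u. k (t + u))" for t
    using lborel_integrable_real_affine[OF k, of 1 t] by simp
  have kI: "(\<integral>u. k (t + u) \<partial>lborel) = (\<integral>u. k u \<partial>lborel)" for t
    using lborel_integral_real_affine[of 1 k t] by simp
  have kN: "(\<integral>u. norm (k (t + u)) \<partial>lborel) = (\<integral>u. norm (k u) \<partial>lborel)" for t
    using lborel_integral_real_affine[of 1 "\<lambda>t. norm (k t)" t] by simp
  define H where "H t u = k (t + u) * k t" for t u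
  have Hm[measurable]: "case_prod H \<in> borel_measurable (lborel \<Otimes>\<^sub>M lborel)"
    unfolding H_def by measurable
  have Hint: "integrable (lborel \<Otimes>\<^sub>M lborel) (case_prod H)"
  proof (rule lborel_pair.Fubini_integrable)
    have "(\<lambda>t. \<integral>u. norm (case_prod H (t, u)) \<partial>lborel) = (\<lambda>t. (\<integral>u. norm (k u) \<partial>lborel) * norm (k t))"
      by (simp add: H_def norm_mult kN)
    then show "integrable lborel (\<lambda>t. \<integral>u. norm (case_prod H (t, u)) \<partial>lborel)"
      using k by simp
    show "AE t in lborel. integrable lborel (\<lambda>u. case_prod H (t, u))"
      using kt by (simp add: H_def)
  qed simp
  define h where "h u = (\<integral>t. H t u \<partial>lborel)" for u
  have hint: "integrable lborel h"
    unfolding h_def[abs_def] by (rule lborel_pair.integrable_snd[OF Hint])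
  have [measurable]: "h \<in> borel_measurable borel" using hint by auto
  have "(\<integral>t. k t \<partial>lborel)\<^sup>2 = (\<integral>t. (\<integral>u. H t u \<partial>lborel) \<partial>lborel)"
    by (simp add: H_def kI power2_eq_square)
  also have "\<dots> = (\<integral>u. h u \<partial>lborel)"
    unfolding h_def by (rule lborel_pair.Fubini_integral[OF Hint, symmetric])
  finally have sq: "(\<integral>t. k t \<partial>lborel)\<^sup>2 = (\<integral>u. h u \<partial>lborel)" .
  have even: "h (- u) = h u" for u
  proof -
    have "h (- u) = (\<integral>t. H (u + 1 * t) (- u) \<partial>lborel)"
      unfolding h_def by (subst lborel_integral_real_affine[of 1 _ u]) auto
    also have "\<dots> = h u" unfolding h_def by (rule Bochner_Integration.integral_cong) (auto simp: H_def add.commute)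
    finally show ?thesis .
  qed
  have zero: "h u = 0" if "u > 1" for u
  proof -
    have "H t u = 0" for t
      using supp[of t] supp[of "t + u"] that by (cases "t \<in> {\<alpha>..\<alpha>+1}") (auto simp: H_def)
    then show ?thesis by (simp add: h_def)
  qed
  have pos: "integrable lborel (\<lambda>u. indicator {0<..1} u *\<^sub>R h u)"
    using hint by (intro integrable_mult_indicator) auto
  have neg: "integrable lborel (\<lambda>u. indicator {-1..<0} u *\<^sub>R h u)"
    using hint by (intro integrable_mult_indicator) auto
  have "(\<integral>u. h u \<partial>lborel) = (\<integral>u. indicator {0<..1} u *\<^sub>R h u + indicator {-1..<0} u *\<^sub>R h u \<partial>lborel)"
  proof (rule integral_cong_AE)
    have "AE u in lborel. u \<noteq> (0::real)" by (rule AE_lborel_singleton)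
    then show "AE u in lborel. h u = indicator {0<..1} u *\<^sub>R h u + indicator {-1..<0} u *\<^sub>R h u"
    proof (rule AE_mp, intro AE_I2 impI)
      fix u :: real assume "u \<noteq> 0"
      then show "h u = indicator {0<..1} u *\<^sub>R h u + indicator {-1..<0} u *\<^sub>R h u"
        using zero[of u] zero[of "- u"] even[of u] by (auto simp: indicator_def)
    qed
  qed auto
  also have "\<dots> = (\<integral>u. indicator {0<..1} u *\<^sub>R h u \<partial>lborel) + (\<integral>u. indicator {-1..<0} u *\<^sub>R h u \<partial>lborel)"
    by (rule Bochner_Integration.integral_add[OF pos neg])
  also have "(\<integral>u. indicator {-1..<0} u *\<^sub>R h u \<partial>lborel) = (\<integral>u. indicator {0<..1} u *\<^sub>R h u \<partial>lborel)"
    by (subst lborel_integral_real_affine[of "-1" _ 0]) (auto simp: even indicator_def intro!: Bochner_Integration.integral_cong)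
  finally have two: "(\<integral>u. h u \<partial>lborel) = 2 * (\<integral>u. indicator {0<..1} u *\<^sub>R h u \<partial>lborel)" by simp
  have "(\<integral>u. indicator {0<..1} u *\<^sub>R h u \<partial>lborel) = (LINT u:(\<Union>j. dyad j)|lborel. h u)"
    by (simp add: set_lebesgue_integral_def dyad_Union)
  also have "\<dots> = (\<Sum>j. (LINT u:dyad j|lborel. h u))"
    using pos by (intro lebesgue_integral_countable_add dyad_disjoint) (auto simp: set_integrable_def dyad_Union)
  also have "(\<lambda>j. LINT u:dyad j|lborel. h u) = 
     (\<lambda>j. \<integral>p. indicator (dyad j) (snd p) *\<^sub>R (k (fst p + snd p) * k (fst p)) \<partial>lborel)"
  proof
    fix j
    have i: "integrable (lborel \<Otimes>\<^sub>M lborel) (\<lambda>(t, u). indicator (dyad j) u *\<^sub>R H t u)"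
      using Hint by (rule Bochner_Integration.integrable_bound) (auto simp: indicator_def case_prod_beta')
    have "(LINT u:dyad j|lborel. h u) = (\<integral>u. (\<integral>t. indicator (dyad j) u *\<^sub>R H t u \<partial>lborel) \<partial>lborel)"
      by (simp add: set_lebesgue_integral_def h_def)
    also have "\<dots> = (\<integral>p. (\<lambda>(t, u). indicator (dyad j) u *\<^sub>R H t u) p \<partial>(lborel \<Otimes>\<^sub>M lborel))"
      by (rule lborel_pair.integral_snd[OF i])
    also have "\<dots> = (\<integral>p. indicator (dyad j) (snd p) *\<^sub>R (k (fst p + snd p) * k (fst p)) \<partial>lborel)"
      unfolding lborel_prod by (simp add: case_prod_beta' H_def)
    finally show "(LINT u:dyad j|lborel. h u) = (\<integral>p. indicator (dyad j) (snd p) *\<^sub>R (k (fst p + snd p) * k (fst p)) \<partial>lborel)" .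
  qed
  finally show ?thesis unfolding sq two by simp
qed

definition piece :: "(real \<Rightarrow> complex) \<Rightarrow> nat \<Rightarrow> real \<times> real \<Rightarrow> complex" where
  "piece g j p = indicator (dyad j) (snd p) *\<^sub>R (g (fst p + snd p) * g (fst p))"

definition piece_ext :: "(real \<Rightarrow> complex) \<Rightarrow> nat \<Rightarrow> real \<times> real \<Rightarrow> complex" where
  "piece_ext g j x = (\<integral>p. piece g j p * cis (x \<bullet> (circ (fst p + snd p) + circ (fst p))) \<partial>lborel)"

lemma measurable_piece [measurable]:
  assumes [measurable]: "g \<in> borel_measurable borel"
  shows "piece g j \<in> borel_measurable borel"
proof -
  have "(\<lambda>p. piece g j p) \<in> borel_measurable (lborel \<Otimes>\<^sub>M lborel)"
    unfolding piece_def by measurable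
  then show ?thesis unfolding lborel_prod by simp
qed

lemma measurable_circ_pair [measurable]: "(\<lambda>p::real \<times> real. circ (fst p + snd p) + circ (fst p)) \<in> borel_measurable borel"
  by (rule borel_measurable_continuous_onI) (auto simp: circ_def intro!: continuous_intros)

lemma measurable_piece_ext [measurable]:
  assumes [measurable]: "g \<in> borel_measurable borel"
  shows "piece_ext g j \<in> borel_measurable borel"
  unfolding piece_ext_def[abs_def] by measurable

lemma arc_ext_square:
  assumes "integrable lborel g" and supp: "\<And>t. t \<notin> {\<alpha>..\<alpha>+1} \<Longrightarrow> g t = 0"
  shows "(arc_ext g x)\<^sup>2 = 2 * (\<Sum>j. piece_ext g j x)"
proof -
  have [measurable]: "g \<in> borel_measurable borel" using assms(1) by auto
  have i: "integrable lborel (\<lambda>t. g t * cis (x \<bullet> circ t))"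
    using assms(1) by (rule Bochner_Integration.integrable_bound) (auto simp: norm_mult)
  have "piece g j p * cis (x \<bullet> (circ (fst p + snd p) + circ (fst p))) = 
    indicator (dyad j) (snd p) *\<^sub>R (g (fst p + snd p) * cis (x \<bullet> circ (fst p + snd p)) * (g (fst p) * cis (x \<bullet> circ (fst p))))" for j p
    by (simp add: piece_def inner_add_right cis_mult[symmetric])
  then show ?thesis
    unfolding arc_ext_def piece_ext_def by (subst integral_square_dyadic[OF i, of \<alpha>]) (simp_all add: supp)
qed

text \<open>For fixed \<open>t\<close> the variable \<open>u\<close> is confined both to a translate
  of the support of \<open>g\<close>, of measure at most \<open>\<delta>\<close>, and to a dyadic
  interval of length below \<open>(1/2) ^ j\<close>; the integral in \<open>t\<close> gives the
  other factor \<open>\<delta>\<close>.\<close>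

lemma piece_nn_integral:
  assumes g: "atom \<alpha> \<delta> g" and \<delta>: "\<delta> \<ge> 0"
  shows "(\<integral>\<^sup>+p. ennreal (norm (piece g j p)) \<partial>lborel) \<le> ennreal (\<delta> * min \<delta> ((1/2) ^ j))"
proof -
  note [measurable] = atomD(1)[OF g]
  have E[measurable]: "{t. g t \<noteq> 0} \<in> sets borel" by measurable
  have "(\<integral>\<^sup>+p. ennreal (norm (piece g j p)) \<partial>lborel) = (\<integral>\<^sup>+p. ennreal (norm (piece g j p)) \<partial>(lborel \<Otimes>\<^sub>M lborel))"
    unfolding lborel_prod ..
  also have "\<dots> = (\<integral>\<^sup>+t. (\<integral>\<^sup>+u. ennreal (norm (piece g j (t, u))) \<partial>lborel) \<partial>lborel)"
    by (subst lborel.nn_integral_fst[symmetric]) (auto simp: lborel_prod)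
  also have "\<dots> \<le> (\<integral>\<^sup>+t. ennreal (norm (g t)) * ennreal (min \<delta> ((1/2) ^ j)) \<partial>lborel)"
  proof (rule nn_integral_mono)
    fix t
    have eq: "ennreal (norm (piece g j (t, u))) = ennreal (norm (g t)) * (indicator (dyad j) u * ennreal (norm (g (t + u))))" for u
      by (auto simp: piece_def norm_mult indicator_def ennreal_mult mult.commute)
    have "(\<integral>\<^sup>+u. indicator (dyad j) u * ennreal (norm (g (t + u))) \<partial>lborel) \<le> (\<integral>\<^sup>+u. ennreal (norm (g (t + u))) \<partial>lborel)"
      by (rule nn_integral_mono) (auto simp: indicator_def)
    also have "\<dots> = (\<integral>\<^sup>+u. ennreal (norm (g u)) \<partial>lborel)"
      using nn_integral_real_affine[of "\<lambda>u. ennreal (norm (g u))" 1 t] by simp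
    also have "\<dots> \<le> ennreal \<delta>" by (rule atom_nn_integral(1)[OF g])
    finally have 1: "(\<integral>\<^sup>+u. indicator (dyad j) u * ennreal (norm (g (t + u))) \<partial>lborel) \<le> ennreal \<delta>" .
    have "(\<integral>\<^sup>+u. indicator (dyad j) u * ennreal (norm (g (t + u))) \<partial>lborel) \<le> (\<integral>\<^sup>+u. indicator (dyad j) u \<partial>lborel)"
      using atomD(2)[OF g] by (intro nn_integral_mono) (auto simp: indicator_def)
    also have "\<dots> = ennreal ((1/2) ^ j - (1/2) ^ Suc j)"
      by (simp add: dyad_def)
    also have "\<dots> \<le> ennreal ((1/2) ^ j)" by (intro ennreal_leI) simp
    finally have 2: "(\<integral>\<^sup>+u. indicator (dyad j) u * ennreal (norm (g (t + u))) \<partial>lborel) \<le> ennreal ((1/2) ^ j)" .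
    have "(\<integral>\<^sup>+u. ennreal (norm (piece g j (t, u))) \<partial>lborel) = ennreal (norm (g t)) * (\<integral>\<^sup>+u. indicator (dyad j) u * ennreal (norm (g (t + u))) \<partial>lborel)"
      unfolding eq by (rule nn_integral_cmult) simp
    also have "\<dots> \<le> ennreal (norm (g t)) * ennreal (min \<delta> ((1/2) ^ j))"
      using 1 2 by (intro mult_left_mono) (auto simp: min_def)
    finally show "(\<integral>\<^sup>+u. ennreal (norm (piece g j (t, u))) \<partial>lborel) \<le> ennreal (norm (g t)) * ennreal (min \<delta> ((1/2) ^ j))" .
  qed
  also have "\<dots> = (\<integral>\<^sup>+t. ennreal (norm (g t)) \<partial>lborel) * ennreal (min \<delta> ((1/2) ^ j))"
    by (rule nn_integral_multc) simp
  also have "\<dots> \<le> ennreal \<delta> * ennreal (min \<delta> ((1/2) ^ j))"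
    by (intro mult_right_mono atom_nn_integral(1)[OF g]) auto
  also have "\<dots> = ennreal (\<delta> * min \<delta> ((1/2) ^ j))" using \<delta> by (simp add: ennreal_mult)
  finally show ?thesis .
qed

text \<open>The mass from \<open>piece_nn_integral\<close> bounds the extension pointwise. As the
  piece is bounded by one, the mass also bounds the square integral required by
  \<open>pair_ext_L2\<close>, which is applied with \<open>b = (1/2) ^ Suc j\<close>; hence
  \<open>128 = 2 * 64\<close>.\<close>

lemma
  assumes g: "atom \<alpha> \<delta> g" and \<delta>: "\<delta> \<ge> 0"
  shows piece_ext_sup: "norm (piece_ext g j x) \<le> \<delta> * min \<delta> ((1/2) ^ j)"
    and piece_ext_L2: "(\<integral>\<^sup>+x. ennreal ((norm (piece_ext g j x))\<^sup>2) \<partial>lborel) \<le> ennreal (128 * pi\<^sup>2 * 2 ^ j * (\<delta> * min \<delta> ((1/2) ^ j)))"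
proof -
  note [measurable] = atomD(1)[OF g]
  have i: "integrable lborel (piece g j)"
    using piece_nn_integral[OF g \<delta>, of j] by (intro integrableI_bounded) (auto intro: le_less_trans)
  have i2: "integrable lborel (\<lambda>p. piece g j p * cis (x \<bullet> (circ (fst p + snd p) + circ (fst p))))"
    using i by (rule Bochner_Integration.integrable_bound) (auto simp: norm_mult)
  have "ennreal (norm (piece_ext g j x)) \<le> (\<integral>\<^sup>+p. ennreal (norm (piece g j p)) \<partial>lborel)"
    using integral_norm_bound_ennreal[OF i2] by (simp add: piece_ext_def norm_mult)
  also note piece_nn_integral[OF g \<delta>, of j]
  finally show "norm (piece_ext g j x) \<le> \<delta> * min \<delta> ((1/2) ^ j)"
    using \<delta> by (simp add: ennreal_le_iff)
  have n1: "norm (piece g j p) \<le> 1" for p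
    using atomD(2)[OF g] by (auto simp: piece_def norm_mult indicator_def intro!: mult_le_one)
  have "(\<integral>\<^sup>+x. ennreal ((norm (piece_ext g j x))\<^sup>2) \<partial>lborel) \<le> 
     ennreal (64 * pi\<^sup>2 / ((1/2) ^ Suc j)) * (\<integral>\<^sup>+p. ennreal ((norm (piece g j p))\<^sup>2) \<partial>lborel)"
    unfolding piece_ext_def
  proof (rule pair_ext_L2[OF i])
    fix p assume "p \<notin> {\<alpha>..\<alpha> + 1} \<times> {(1 / 2) ^ Suc j<..2 * (1 / 2) ^ Suc j :: real}"
    then show "piece g j p = 0"
      using atomD(3)[OF g, of "fst p"] by (cases p) (auto simp: piece_def dyad_def indicator_def)
  qed (auto simp: power_le_one)
  also have "\<dots> \<le> ennreal (64 * pi\<^sup>2 / ((1/2) ^ Suc j)) * (\<integral>\<^sup>+p. ennreal (norm (piece g j p)) \<partial>lborel)"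
    using n1 by (intro mult_left_mono nn_integral_mono ennreal_leI) (auto simp: power2_eq_square mult_left_le)
  also have "\<dots> \<le> ennreal (64 * pi\<^sup>2 / ((1/2) ^ Suc j)) * ennreal (\<delta> * min \<delta> ((1/2) ^ j))"
    by (intro mult_left_mono piece_nn_integral[OF g \<delta>]) auto
  also have "\<dots> = ennreal (128 * pi\<^sup>2 * 2 ^ j * (\<delta> * min \<delta> ((1/2) ^ j)))"
    using \<delta> by (subst ennreal_mult[symmetric]) (auto simp: power_one_over field_simps)
  finally show "(\<integral>\<^sup>+x. ennreal ((norm (piece_ext g j x))\<^sup>2) \<partial>lborel) \<le> ennreal (128 * pi\<^sup>2 * 2 ^ j * (\<delta> * min \<delta> ((1/2) ^ j)))" .
qed

text \<open>With \<open>p = q / 2\<close> the \<open>q\<close>th power of the extension is the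
  \<open>p\<close>th power of its square, whose pieces are interpolated between their sup and
  \<open>L\<^sup>2\<close> bounds. Relative to the target \<open>\<delta> powr (q - 3)\<close>,
  piece \<open>j\<close> costs \<open>z\<close> for \<open>z \<le> 1\<close> and
  \<open>z powr (2 - p)\<close> for \<open>z \<ge> 1\<close>, where
  \<open>z = 2 ^ j * \<delta>\<close> compares the support with the separation. Both ranges are
  summable exactly because \<open>p > 2\<close>, that is \<open>q > 4\<close>.\<close>

lemma atom_Lq:
  fixes q :: real
  assumes q: "q > 4"
  shows "\<exists>C>0. \<forall>\<alpha> \<delta> g. \<delta> > 0 \<longrightarrow> atom \<alpha> \<delta> g \<longrightarrow> 
    (\<integral>\<^sup>+x. ennreal (norm (arc_ext g x) powr q) \<partial>lborel) \<le> ennreal (C * \<delta> powr (q - 3))"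
proof -
  define p where "p = q / 2"
  \<comment> \<open>The smaller of the two decay rates 1 and \<open>p - 2\<close> on either side of
    \<open>z = 1\<close>.\<close>
  define c where "c = min 1 (p - 2)"
  \<comment> \<open>Half of the decay pays for the pigeonhole weights, which reappear to the power
    \<open>p\<close>; the other half sums the integrals.\<close>
  define \<tau> where "\<tau> = c / (2 * p)"
  have p: "p > 2" using q by (simp add: p_def)
  have c: "c > 0" "c \<le> 1" "c \<le> p - 2" using p by (auto simp: c_def)
  have \<tau>: "\<tau> > 0" using p c by (simp add: \<tau>_def)
  obtain K where K: "K > 0" "\<And>Y n. Y > 0 \<Longrightarrow> (\<Sum>l<n. kap \<tau> (2 ^ l * Y)) \<le> K"
    using kap_geometric_sum[OF _ \<tau>, of 2] by fastforce
  obtain K' where K': "K' > 0" "\<And>Y. Y > 0 \<Longrightarrow> (\<Sum>l. ennreal (kap (c / 2) (2 ^ l * Y))) \<le> ennreal K'"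
    using kap_geometric_suminf[of 2 "c / 2"] c(1) by fastforce
  define C where "C = (4 * K) powr p * (128 * pi\<^sup>2) * K'"
  have "(\<integral>\<^sup>+x. ennreal (norm (arc_ext g x) powr q) \<partial>lborel) \<le> ennreal (C * \<delta> powr (q - 3))"
    if \<delta>: "\<delta> > 0" and g: "atom \<alpha> \<delta> g" for \<alpha> \<delta> g
  proof -
    note [measurable] = atomD(1)[OF g]
    define z where "z j = 2 ^ j * \<delta>" for j :: nat
    have z: "z j > 0" for j using \<delta> by (simp add: z_def)
    define M where "M j = \<delta> * min \<delta> ((1/2) ^ j)" for j :: nat
    have M: "M j > 0" for j using \<delta> by (simp add: M_def)
    define v where "v j x = ennreal ((4 * K) powr p * kap (- c / 2) (z j) * norm (piece_ext g j x) powr p)" for j x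
    have ex: "\<exists>j. ennreal (norm (arc_ext g x) powr q) \<le> v j x" for x
    proof -
      have summ: "summable (\<lambda>j. 2 * norm (piece_ext g j x))"
      proof (rule summable_comparison_test)
        show "\<exists>N. \<forall>n\<ge>N. norm (2 * norm (piece_ext g n x)) \<le> 2 * \<delta> * (1/2) ^ n"
        proof (intro exI allI impI)
          fix n
          have "\<delta> * min \<delta> ((1/2) ^ n) \<le> \<delta> * (1/2) ^ n" using \<delta> by (intro mult_left_mono) auto
          then have "norm (piece_ext g n x) \<le> \<delta> * (1/2) ^ n"
            using piece_ext_sup[OF g less_imp_le[OF \<delta>]] by (rule order_trans[rotated])
          then show "norm (2 * norm (piece_ext g n x)) \<le> 2 * \<delta> * (1/2) ^ n" by simp
        qed
      qed (auto intro!: summable_mult summable_geometric)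
      have summ': "summable (\<lambda>j. norm (piece_ext g j x))" using summ by simp
      have "(norm (arc_ext g x))\<^sup>2 = 2 * norm (\<Sum>j. piece_ext g j x)"
        using arc_ext_square[OF atom_integrable[OF g] atomD(3)[OF g], where x = x]
        by (simp add: norm_power[symmetric] norm_mult)
      also have "\<dots> \<le> 2 * (\<Sum>j. norm (piece_ext g j x))"
        using summable_norm[OF summ'] by simp
      also have "\<dots> = (\<Sum>j. 2 * norm (piece_ext g j x))" by (rule suminf_mult[OF summ', symmetric])
      finally obtain j where j: "(norm (arc_ext g x))\<^sup>2 \<le> 2 * K / kap \<tau> (z j) * (2 * norm (piece_ext g j x))"
        using dominant_term[OF summ, of _ "\<lambda>j. kap \<tau> (z j)" K] K(2)[OF \<delta>] by (auto simp: z_def)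
      have "norm (arc_ext g x) powr q = (norm (arc_ext g x))\<^sup>2 powr p"
      proof -
        have "(norm (arc_ext g x))\<^sup>2 = norm (arc_ext g x) powr 2"
          by (cases "arc_ext g x = 0") simp_all
        then show ?thesis by (simp only: powr_powr p_def) simp
      qed
      also have "\<dots> \<le> (4 * K * (norm (piece_ext g j x) / kap \<tau> (z j))) powr p"
        using j p by (intro powr_mono2) (auto simp: mult_ac)
      also have "\<dots> = (4 * K) powr p * (norm (piece_ext g j x) powr p / kap \<tau> (z j) powr p)"
        using K by (simp add: powr_mult powr_divide)
      also have "\<dots> = (4 * K) powr p * kap (- c / 2) (z j) * norm (piece_ext g j x) powr p"
      proof -
        have kp: "kap \<tau> (z j) powr p = kap (c / 2) (z j)" using p by (simp add: kap_powr \<tau>_def)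
        have "kap (- c / 2) (z j) * kap (c / 2) (z j) = 1" unfolding kap_mult by (simp add: kap_def)
        moreover have "kap (c / 2) (z j) \<noteq> 0" by (simp add: kap_def)
        ultimately have "kap (- c / 2) (z j) = 1 / kap (c / 2) (z j)" by (simp only: eq_divide_eq) simp
        then show ?thesis unfolding kp by simp
      qed
      finally show ?thesis unfolding v_def by (intro exI[of _ j] ennreal_leI)
    qed
    have vint: "(\<integral>\<^sup>+x. v j x \<partial>lborel) \<le> ennreal ((4 * K) powr p * (128 * pi\<^sup>2) * \<delta> powr (q - 3)) * ennreal (kap (c / 2) (z j))" for j
    proof -
      have pw: "norm (piece_ext g j x) powr p \<le> M j powr (p - 2) * (norm (piece_ext g j x))\<^sup>2" for x
      proof (cases "piece_ext g j x = 0")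
        case False
        have "norm (piece_ext g j x) powr p = norm (piece_ext g j x) powr (p - 2) * norm (piece_ext g j x) powr 2"
          by (simp only: powr_add[symmetric]) simp
        also have "\<dots> \<le> M j powr (p - 2) * norm (piece_ext g j x) powr 2"
          using piece_ext_sup[OF g, where j = j and x = x] \<delta> p by (intro mult_right_mono powr_mono2) (auto simp: M_def)
        also have "norm (piece_ext g j x) powr 2 = (norm (piece_ext g j x))\<^sup>2"
          using False by simp
        finally show ?thesis .
      qed simp
      have mk: "M j powr (p - 2) * (2 ^ j * M j) \<le> \<delta> powr (q - 3) * kap c (z j)"
      proof -
        \<comment> \<open>The factor by which the minimum falls short of \<open>\<delta>\<close>, so
          that \<open>M j\<close> is \<open>\<delta> powr 2 * \<mu>\<close>.\<close>
        define \<mu> where "\<mu> = min 1 (1 / z j)"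
        have \<mu>: "\<mu> > 0" using z[of j] by (simp add: \<mu>_def)
        have "(1/2) ^ j = \<delta> * (1 / z j)" using \<delta> by (simp add: z_def power_one_over)
        then have "min \<delta> ((1/2) ^ j) = \<delta> * \<mu>" unfolding \<mu>_def using \<delta> by (simp add: min_mult_distrib_left)
        then have Meq: "M j = \<delta> powr 2 * \<mu>" using \<delta> by (simp add: M_def power2_eq_square)
        have zj: "2 ^ j = z j * \<delta> powr (- 1)" using \<delta> by (simp add: z_def powr_minus field_simps)
        have "M j powr (p - 2) * (2 ^ j * M j) = 2 ^ j * M j powr (p - 1)"
          using M[of j] powr_add[of "M j" "p - 2" 1] by simp
        also have "\<dots> = z j * \<delta> powr (- 1) * (\<delta> powr (2 * (p - 1)) * \<mu> powr (p - 1))"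
          unfolding Meq zj using \<delta> \<mu> by (simp only: powr_mult powr_powr powr_ge_zero less_imp_le)
        also have "\<dots> = \<delta> powr (- 1 + 2 * (p - 1)) * (z j * \<mu> powr (p - 1))"
          unfolding powr_add by simp
        also have "- 1 + 2 * (p - 1) = q - 3" by (simp add: p_def)
        also have "z j * \<mu> powr (p - 1) \<le> kap c (z j)"
        proof (cases "z j \<le> 1")
          case True
          then have "\<mu> = 1" using z[of j] by (simp add: \<mu>_def min_def)
          then show ?thesis using powr_le_kap_small[of "z j" c 1] True z[of j] c by simp
        next
          case False
          then have "1 / z j \<le> 1" by simp
          then have mu: "\<mu> = z j powr (- 1)" using z[of j] by (simp add: \<mu>_def min_absorb2 powr_minus divide_inverse)
          have "z j * \<mu> powr (p - 1) = z j powr 1 * z j powr (- 1 * (p - 1))"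
            unfolding mu powr_powr using z[of j] by simp
          also have "\<dots> = z j powr (2 - p)" unfolding powr_add[symmetric] by simp
          also have "\<dots> \<le> kap c (z j)" using False c by (intro powr_le_kap_large) auto
          finally show ?thesis .
        qed
        finally show ?thesis by (simp add: mult_left_mono)
      qed
      have "(\<integral>\<^sup>+x. v j x \<partial>lborel) \<le> (\<integral>\<^sup>+x. ennreal ((4 * K) powr p * kap (- c / 2) (z j) * M j powr (p - 2)) * ennreal ((norm (piece_ext g j x))\<^sup>2) \<partial>lborel)"
        unfolding v_def by (intro nn_integral_mono) (simp add: ennreal_mult[symmetric] mult.assoc ennreal_leI mult_left_mono pw)
      also have "\<dots> = ennreal ((4 * K) powr p * kap (- c / 2) (z j) * M j powr (p - 2)) * (\<integral>\<^sup>+x. ennreal ((norm (piece_ext g j x))\<^sup>2) \<partial>lborel)"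
        by (rule nn_integral_cmult) simp
      also have "\<dots> \<le> ennreal ((4 * K) powr p * kap (- c / 2) (z j) * M j powr (p - 2)) * ennreal (128 * pi\<^sup>2 * 2 ^ j * M j)"
        unfolding M_def using \<delta> by (intro mult_left_mono piece_ext_L2[OF g]) auto
      also have "\<dots> = ennreal ((4 * K) powr p * (128 * pi\<^sup>2) * kap (- c / 2) (z j) * (M j powr (p - 2) * (2 ^ j * M j)))"
        using M[of j] by (simp add: ennreal_mult[symmetric] mult_ac)
      also have "\<dots> \<le> ennreal ((4 * K) powr p * (128 * pi\<^sup>2) * kap (- c / 2) (z j) * (\<delta> powr (q - 3) * kap c (z j)))"
        by (intro ennreal_leI mult_left_mono mk) auto
      also have "(4 * K) powr p * (128 * pi\<^sup>2) * kap (- c / 2) (z j) * (\<delta> powr (q - 3) * kap c (z j)) = 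
         ((4 * K) powr p * (128 * pi\<^sup>2) * \<delta> powr (q - 3)) * (kap (- c / 2) (z j) * kap c (z j))" by simp
      also have "kap (- c / 2) (z j) * kap c (z j) = kap (c / 2) (z j)" by (simp add: kap_mult)
      finally show ?thesis by (simp add: ennreal_mult)
    qed
    have "(\<integral>\<^sup>+x. ennreal (norm (arc_ext g x) powr q) \<partial>lborel) \<le> (\<Sum>j. \<integral>\<^sup>+x. v j x \<partial>lborel)"
    proof (rule nn_integral_le_suminf)
      show "v j \<in> borel_measurable lborel" for j unfolding v_def[abs_def] by measurable
    qed (rule ex)
    also have "\<dots> \<le> (\<Sum>j. ennreal ((4 * K) powr p * (128 * pi\<^sup>2) * \<delta> powr (q - 3)) * ennreal (kap (c / 2) (z j)))"
      by (intro suminf_le vint) auto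
    also have "\<dots> = ennreal ((4 * K) powr p * (128 * pi\<^sup>2) * \<delta> powr (q - 3)) * (\<Sum>j. ennreal (kap (c / 2) (z j)))"
      by simp
    also have "\<dots> \<le> ennreal ((4 * K) powr p * (128 * pi\<^sup>2) * \<delta> powr (q - 3)) * ennreal K'"
      unfolding z_def using K'(2)[OF \<delta>] by (intro mult_left_mono) auto
    also have "\<dots> = ennreal (C * \<delta> powr (q - 3))"
      using K' by (simp add: C_def ennreal_mult[symmetric] mult_ac)
    finally show ?thesis .
  qed
  moreover have "C > 0" using K K' by (simp add: C_def)
  ultimately show ?thesis by blast
qed

subsection \<open>Atomic decomposition and interpolation\<close>

text \<open>The heights are those of the decreasing rearrangement at dyadic measures, so that the atoms
  have geometrically decreasing supports.\<close>

lemma atomic_decomposition: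
  fixes g :: "real \<Rightarrow> complex" and r :: real
  assumes g[measurable]: "g \<in> borel_measurable borel" and supp: "\<And>t. t \<notin> {\<alpha>..\<alpha>+1} \<Longrightarrow> g t = 0"
    and r: "r \<ge> 1" and gr: "(\<integral>\<^sup>+t. ennreal (norm (g t) powr r) \<partial>lborel) \<le> 1"
  obtains h :: "nat \<Rightarrow> real" and G :: "nat \<Rightarrow> real \<Rightarrow> complex"
  where "\<And>l. h l \<ge> 0" "\<And>l. atom \<alpha> ((1/2) ^ l) (G l)"
    "\<And>n. (\<Sum>l<n. (1/2) ^ l * h l powr r) \<le> 4 * 2 powr r"
    "\<And>x. summable (\<lambda>l. h l * norm (arc_ext (G l) x))"
    "\<And>x. norm (arc_ext g x) \<le> (\<Sum>l. h l * norm (arc_ext (G l) x))"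
proof -
  define m where "m s = emeasure lborel {t. norm (g t) > s}" for s :: real
  have mset[measurable]: "{t. norm (g t) > s} \<in> sets borel" for s by measurable
  have m_mono: "m s' \<le> m s" if "s \<le> s'" for s s'
    unfolding m_def by (rule emeasure_mono) (use that in auto)
  define A where "A l = {s. 0 \<le> s \<and> m s \<le> ennreal ((1/2) ^ l)}" for l :: nat
  have A_ne: "A l \<noteq> {}" for l
  proof -
    \<comment> \<open>Chebyshev: since the \<open>r\<close>th power integral is at most one,
      \<open>s powr r = 2 ^ l\<close> makes the superlevel set small enough.\<close>
    define s where "s = (2 ^ l) powr (1 / r)"
    have sr: "s powr r = 2 ^ l" using r by (simp add: s_def powr_powr)
    have s0: "s > 0" by (simp add: s_def)
    have "m s = (\<integral>\<^sup>+t. indicator {t. norm (g t) > s} t \<partial>lborel)"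
      by (simp add: m_def)
    also have "\<dots> \<le> (\<integral>\<^sup>+t. ennreal ((1/2) ^ l) * ennreal (norm (g t) powr r) \<partial>lborel)"
    proof (rule nn_integral_mono)
      fix t
      have "1 \<le> (1/2) ^ l * norm (g t) powr r" if "norm (g t) > s"
      proof -
        have "s powr r \<le> norm (g t) powr r" using that s0 r by (intro powr_mono2) auto
        then show ?thesis unfolding sr by (simp add: power_one_over field_simps)
      qed
      then show "indicator {t. norm (g t) > s} t \<le> ennreal ((1/2) ^ l) * ennreal (norm (g t) powr r)"
        by (auto simp: indicator_def ennreal_mult[symmetric] simp flip: ennreal_1 intro!: ennreal_leI)
    qed
    also have "\<dots> = ennreal ((1/2) ^ l) * (\<integral>\<^sup>+t. ennreal (norm (g t) powr r) \<partial>lborel)"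
      by (rule nn_integral_cmult) simp
    also have "\<dots> \<le> ennreal ((1/2) ^ l) * 1" by (intro mult_left_mono gr) auto
    finally have "s \<in> A l" using s0 by (simp add: A_def)
    then show ?thesis by auto
  qed
  have A_bdd: "bdd_below (A l)" for l by (intro bdd_belowI[of _ 0]) (auto simp: A_def)
  define H where "H l = Inf (A l)" for l
  have H0: "H l \<ge> 0" for l unfolding H_def using A_ne by (intro cInf_greatest) (auto simp: A_def)
  have below: "m s > ennreal ((1/2) ^ l)" if "0 \<le> s" "s < H l" for s l
  proof (rule ccontr)
    assume "\<not> m s > ennreal ((1/2) ^ l)"
    then have "s \<in> A l" using that by (auto simp: A_def)
    then have "H l \<le> s" unfolding H_def using A_bdd by (rule cInf_lower)
    then show False using that by simp
  qed
  have above: "m s \<le> ennreal ((1/2) ^ l)" if lt: "H l < s" for s l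
  proof -
    obtain s' where "s' \<in> A l" "s' < s" using lt cInf_lessD[OF A_ne] unfolding H_def by blast
    then show ?thesis using m_mono[of s' s] by (auto simp: A_def intro: order_trans)
  qed
  \<comment> \<open>The infimum is attained: the superlevel set at \<open>H l\<close> is the
    increasing union of those at slightly larger heights.\<close>
  have at_H: "m (H l) \<le> ennreal ((1/2) ^ l)" for l
  proof -
    define B where "B n = {t. norm (g t) > H l + 1 / real (Suc n)}" for n
    have inc: "incseq B"
    proof (rule incseq_SucI)
      fix n
      have "1 / real (Suc (Suc n)) \<le> 1 / real (Suc n)" by (simp add: frac_le)
      then show "B n \<le> B (Suc n)" by (auto simp: B_def)
    qed
    have Bm: "range B \<subseteq> sets lborel" using mset by (auto simp: B_def)
    have "{t. norm (g t) > H l} = (\<Union>n. B n)"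
    proof
      show "{t. norm (g t) > H l} \<subseteq> (\<Union>n. B n)"
      proof
        fix t assume "t \<in> {t. norm (g t) > H l}"
        then have "0 < norm (g t) - H l" by simp
        then obtain n where "1 / real (Suc n) < norm (g t) - H l" using nat_approx_posE by blast
        then show "t \<in> (\<Union>n. B n)" by (auto simp: B_def intro!: exI[of _ n])
      qed
      show "(\<Union>n. B n) \<subseteq> {t. norm (g t) > H l}"
      proof
        fix t assume "t \<in> (\<Union>n. B n)"
        then obtain n where "norm (g t) > H l + 1 / real (Suc n)" by (auto simp: B_def)
        moreover have "1 / real (Suc n) > 0" by simp
        ultimately have "norm (g t) > H l" by linarith
        then show "t \<in> {t. norm (g t) > H l}" by simp
      qed
    qed
    then have "m (H l) = (SUP n. emeasure lborel (B n))"
      unfolding m_def by (simp only: SUP_emeasure_incseq[OF Bm inc])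
    also have "\<dots> \<le> ennreal ((1/2) ^ l)"
      using above[of l "H l + 1 / real (Suc _)"] by (intro SUP_least) (simp add: B_def m_def)
    finally show ?thesis .
  qed
  \<comment> \<open>The support lies in a window of measure one, so height zero is admissible at
    level 0 and the layers exhaust all positive values from below.\<close>
  have H00: "H 0 = 0"
  proof -
    have "m 0 \<le> emeasure lborel {\<alpha>..\<alpha>+1}"
      unfolding m_def
    proof (rule emeasure_mono)
      show "{t. 0 < norm (g t)} \<subseteq> {\<alpha>..\<alpha>+1}"
        using supp by (metis (mono_tags, lifting) mem_Collect_eq norm_zero less_irrefl subsetI)
    qed simp
    then have "0 \<in> A 0" by (simp add: A_def)
    then have "H 0 \<le> 0" unfolding H_def using A_bdd by (rule cInf_lower)
    then show ?thesis using H0[of 0] by simp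
  qed
  have H_mono: "H l \<le> H (Suc l)" for l
    unfolding H_def
  proof (rule cInf_superset_mono[OF A_ne A_bdd])
    have "ennreal ((1/2) ^ Suc l) \<le> ennreal ((1/2) ^ l)" by (intro ennreal_leI) simp
    then show "A (Suc l) \<subseteq> A l" unfolding A_def by (auto intro: order_trans)
  qed
  \<comment> \<open>Layer \<open>l\<close> holds the values in \<open>(H l, H (Suc l)]\<close>: the
    lower end controls the measure of its support, the upper end is its height.\<close>
  define h where "h l = H (Suc l)" for l
  define L where "L l = {t. H l < norm (g t) \<and> norm (g t) \<le> h l}" for l
  have Lm[measurable]: "L l \<in> sets borel" for l unfolding L_def by measurable
  \<comment> \<open>If \<open>h l = 0\<close> the layer is empty, so the division by zero is never
    seen.\<close>
  define G where "G l t = indicator (L l) t *\<^sub>R (g t / of_real (h l))" for l t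
  have h0: "h l \<ge> 0" for l using H0 by (simp add: h_def)
  have hpos: "h l > 0" if "t \<in> L l" for t l
    using that H0[of l] by (auto simp: L_def)
  have Gm[measurable]: "G l \<in> borel_measurable borel" for l unfolding G_def[abs_def] by measurable
  have atoms: "atom \<alpha> ((1/2) ^ l) (G l)" for l
    unfolding atom_def
  proof (intro conjI allI impI)
    show "norm (G l t) \<le> 1" for t
      using hpos[of t l] by (auto simp: G_def indicator_def norm_divide) (auto simp: L_def)
    show "G l t = 0" if "t \<notin> {\<alpha>..\<alpha>+1}" for t using supp[OF that] by (simp add: G_def)
    have "emeasure lborel {t. G l t \<noteq> 0} \<le> m (H l)"
      unfolding m_def by (rule emeasure_mono) (auto simp: G_def L_def indicator_def split: if_splits)
    with at_H show "emeasure lborel {t. G l t \<noteq> 0} \<le> ennreal ((1/2) ^ l)" using order_trans by blast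
  qed simp
  define P where "P l = H l powr r" for l
  have P0: "P 0 = 0" using H00 by (simp add: P_def)
  have P_mono: "P l \<le> P (Suc l)" for l
    unfolding P_def using H_mono H0 r by (intro powr_mono2) auto
  have sum_bound: "(\<Sum>l<n. (1/2) ^ l * h l powr r) \<le> 4 * 2 powr r" for n
  proof -
    \<comment> \<open>Abel summation passes from the powers of the heights to their increments,
      which can be compared with the distribution function. The boundary term has the favourable
      sign.\<close>
    have abel: "2 * (\<Sum>i<n. (1/2) ^ i * (P (Suc i) - P i)) - (\<Sum>l<n. (1/2) ^ l * P (Suc l)) = 2 * (1/2) ^ n * P n" for n
      by (induct n) (simp_all add: P0 algebra_simps)
    \<comment> \<open>The bound by \<open>P n\<close> is carried along for the induction: when the
      last increment is counted it yields \<open>P (Suc n)\<close>, and \<open>H (Suc n) < v\<close>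
      turns this into the bound by \<open>v powr r\<close>.\<close>
    have tele: "(\<Sum>i<n. (P (Suc i) - P i) * indicator {..<v} (H (Suc i))) \<le> P n \<and> 
        (\<Sum>i<n. (P (Suc i) - P i) * indicator {..<v} (H (Suc i))) \<le> v powr r" for v n
    proof (induct n)
      case (Suc n)
      show ?case
      proof (cases "H (Suc n) < v")
        case True
        then have "P (Suc n) \<le> v powr r" unfolding P_def using H0[of "Suc n"] r by (intro powr_mono2) auto
        then show ?thesis using Suc True by (auto simp: indicator_def)
      next
        case False
        then show ?thesis using Suc P_mono[of n] by (auto simp: indicator_def)
      qed
    qed (simp add: P0)
    \<comment> \<open>Half of a positive \<open>H (Suc i)\<close> lies strictly below the infimum,
      so its superlevel set has measure above \<open>(1/2) ^ Suc i\<close>; the factor 2 makes up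
      for the extra half.\<close>
    have each: "ennreal ((1/2) ^ i * (P (Suc i) - P i)) \<le> 
       (\<integral>\<^sup>+t. ennreal (2 * ((P (Suc i) - P i) * indicator {..<2 * norm (g t)} (H (Suc i)))) \<partial>lborel)" for i
    proof (cases "H (Suc i) = 0")
      case True
      then have "P (Suc i) = 0" by (simp add: P_def)
      moreover have "P i \<ge> 0" by (simp add: P_def)
      ultimately have "P (Suc i) - P i \<le> 0" by simp
      then have "(1/2) ^ i * (P (Suc i) - P i) \<le> 0" by (simp add: mult_nonneg_nonpos)
      then show ?thesis by (simp add: ennreal_neg)
    next
      case False
      then have pos: "H (Suc i) / 2 \<ge> 0" "H (Suc i) / 2 < H (Suc i)" using H0[of "Suc i"] by auto
      have eq: "ennreal (2 * ((P (Suc i) - P i) * indicator {..<2 * norm (g t)} (H (Suc i)))) = 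
         ennreal (2 * (P (Suc i) - P i)) * indicator {t. norm (g t) > H (Suc i) / 2} t" for t
        by (auto simp: indicator_def)
      have "ennreal ((1/2) ^ i * (P (Suc i) - P i)) = ennreal (2 * (P (Suc i) - P i)) * ennreal ((1/2) ^ Suc i)"
        using P_mono[of i] by (subst ennreal_mult[symmetric]) auto
      also have "\<dots> \<le> ennreal (2 * (P (Suc i) - P i)) * m (H (Suc i) / 2)"
        using below[OF pos] by (intro mult_left_mono) auto
      also have "\<dots> = (\<integral>\<^sup>+t. ennreal (2 * ((P (Suc i) - P i) * indicator {..<2 * norm (g t)} (H (Suc i)))) \<partial>lborel)"
        unfolding eq by (subst nn_integral_cmult_indicator) (auto simp: m_def)
      finally show ?thesis .
    qed
    have "ennreal (\<Sum>i<n. (1/2) ^ i * (P (Suc i) - P i)) = (\<Sum>i<n. ennreal ((1/2) ^ i * (P (Suc i) - P i)))"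
      using P_mono by (intro sum_ennreal[symmetric]) auto
    also have "\<dots> \<le> (\<Sum>i<n. \<integral>\<^sup>+t. ennreal (2 * ((P (Suc i) - P i) * indicator {..<2 * norm (g t)} (H (Suc i)))) \<partial>lborel)"
      by (intro sum_mono each)
    also have "\<dots> = (\<integral>\<^sup>+t. (\<Sum>i<n. ennreal (2 * ((P (Suc i) - P i) * indicator {..<2 * norm (g t)} (H (Suc i))))) \<partial>lborel)"
    proof (rule nn_integral_sum[symmetric])
      fix i
      have "indicator {..<2 * norm (g t)} (H (Suc i)) = (indicator {t. norm (g t) > H (Suc i) / 2} t :: real)" for t
        by (auto simp: indicator_def)
      then show "(\<lambda>t. ennreal (2 * ((P (Suc i) - P i) * indicator {..<2 * norm (g t)} (H (Suc i))))) \<in> borel_measurable lborel"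
        by simp
    qed
    also have "\<dots> \<le> (\<integral>\<^sup>+t. ennreal (2 * 2 powr r) * ennreal (norm (g t) powr r) \<partial>lborel)"
    proof (rule nn_integral_mono)
      fix t
      have "(\<Sum>i<n. ennreal (2 * ((P (Suc i) - P i) * indicator {..<2 * norm (g t)} (H (Suc i))))) =
        ennreal (\<Sum>i<n. 2 * ((P (Suc i) - P i) * indicator {..<2 * norm (g t)} (H (Suc i))))"
        using P_mono by (intro sum_ennreal) auto
      also have "\<dots> = ennreal (2 * (\<Sum>i<n. (P (Suc i) - P i) * indicator {..<2 * norm (g t)} (H (Suc i))))"
        by (simp only: sum_distrib_left)
      also have "\<dots> \<le> ennreal (2 * (2 * norm (g t)) powr r)"
        using tele by (intro ennreal_leI mult_left_mono) auto
      also have "\<dots> = ennreal (2 * 2 powr r) * ennreal (norm (g t) powr r)"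
        by (simp add: powr_mult ennreal_mult[symmetric])
      finally show "(\<Sum>i<n. ennreal (2 * ((P (Suc i) - P i) * indicator {..<2 * norm (g t)} (H (Suc i))))) \<le>
         ennreal (2 * 2 powr r) * ennreal (norm (g t) powr r)" .
    qed
    also have "\<dots> = ennreal (2 * 2 powr r) * (\<integral>\<^sup>+t. ennreal (norm (g t) powr r) \<partial>lborel)"
      by (rule nn_integral_cmult) simp
    also have "\<dots> \<le> ennreal (2 * 2 powr r) * 1" by (intro mult_left_mono gr) auto
    finally have "(\<Sum>i<n. (1/2) ^ i * (P (Suc i) - P i)) \<le> 2 * 2 powr r" by (simp add: ennreal_le_iff)
    moreover have "0 \<le> 2 * (1/2) ^ n * P n" by (simp add: P_def)
    ultimately have "(\<Sum>l<n. (1/2) ^ l * P (Suc l)) \<le> 4 * 2 powr r" using abel[of n] by linarith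
    then show ?thesis by (simp add: P_def h_def)
  qed
  \<comment> \<open>On a window of finite length, values below one are bounded by one and larger
    values by their \<open>r\<close>th power.\<close>
  have gint: "integrable lborel g"
  proof (rule integrableI_bounded)
    have "(\<integral>\<^sup>+t. ennreal (norm (g t)) \<partial>lborel) \<le> (\<integral>\<^sup>+t. indicator {\<alpha>..\<alpha>+1} t + ennreal (norm (g t) powr r) \<partial>lborel)"
    proof (rule nn_integral_mono)
      fix t
      show "ennreal (norm (g t)) \<le> indicator {\<alpha>..\<alpha>+1} t + ennreal (norm (g t) powr r)"
      proof (cases "norm (g t) \<le> 1")
        case True
        then have "ennreal (norm (g t)) \<le> indicator {\<alpha>..\<alpha>+1} t" using supp[of t] by (auto simp: indicator_def)
        then show ?thesis by (rule order_trans) simp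
      next
        case False
        then have "norm (g t) powr 1 \<le> norm (g t) powr r" using r by (intro powr_mono) auto
        then have "ennreal (norm (g t)) \<le> ennreal (norm (g t) powr r)" using False by (intro ennreal_leI) simp
        then show ?thesis by (rule order_trans) simp
      qed
    qed
    also have "\<dots> = 1 + (\<integral>\<^sup>+t. ennreal (norm (g t) powr r) \<partial>lborel)"
      by (subst nn_integral_add) auto
    also have "\<dots> \<le> 1 + 1" by (intro add_left_mono gr)
    also have "\<dots> < \<infinity>" by simp
    finally show "(\<integral>\<^sup>+t. ennreal (norm (g t)) \<partial>lborel) < \<infinity>" .
  qed simp
  have L_disj: "l = l'" if "t \<in> L l" "t \<in> L l'" for t l l'
    using that
  proof (induct l l' rule: linorder_wlog)
    case (le a b)
    show ?case
    proof (rule ccontr)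
      assume "a \<noteq> b"
      then have "Suc a \<le> b" using le by simp
      then have "H (Suc a) \<le> H b" using lift_Suc_mono_le[of H] H_mono by blast
      then show False using le by (auto simp: L_def h_def)
    qed
  qed auto
  \<comment> \<open>Values above every \<open>H l\<close> occupy a set of measure at most
    \<open>(1/2) ^ l\<close> for all \<open>l\<close>, hence a null set.\<close>
  have AE_L: "AE t in lborel. g t = 0 \<or> (\<exists>l. t \<in> L l)"
  proof -
    define N where "N = {t. \<forall>l. norm (g t) > H l}"
    have Nm: "N \<in> sets lborel" unfolding N_def by measurable
    have "emeasure lborel N \<le> ennreal ((1/2) ^ l)" for l
    proof -
      have "emeasure lborel N \<le> m (H l)" unfolding m_def by (rule emeasure_mono) (auto simp: N_def)
      with at_H show ?thesis using order_trans by blast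
    qed
    moreover have "(\<lambda>l. ennreal ((1/2) ^ l)) \<longlonglongrightarrow> ennreal 0" by (intro tendsto_ennrealI LIMSEQ_power_zero) simp
    ultimately have "emeasure lborel N \<le> ennreal 0" by (intro LIMSEQ_le_const) auto
    then have "N \<in> null_sets lborel" using Nm by auto
    moreover have "g t = 0 \<or> (\<exists>l. t \<in> L l)" if "t \<notin> N" for t
    proof (cases "g t = 0")
      case False
      from that obtain l0 where l0: "norm (g t) \<le> H l0" by (auto simp: N_def not_less)
      define k where "k = (LEAST l. norm (g t) \<le> H l)"
      have k: "norm (g t) \<le> H k" unfolding k_def using l0 by (rule LeastI)
      have "k \<noteq> 0" using k H00 False by (intro notI) auto
      then obtain i where i: "k = Suc i" by (cases k) auto
      have "\<not> norm (g t) \<le> H i" using not_less_Least[of i "\<lambda>l. norm (g t) \<le> H l"] i k_def by auto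
      then show ?thesis using k i by (auto simp: L_def h_def)
    qed simp
    ultimately show ?thesis by (auto intro: AE_I'[of N])
  qed
  define D where "D l t = of_real (h l) * G l t" for l t
  have Dm[measurable]: "D l \<in> borel_measurable borel" for l unfolding D_def[abs_def] by measurable
  have D_eq: "D l t = indicator (L l) t *\<^sub>R g t" for l t
    using hpos[of t l] by (auto simp: D_def G_def indicator_def)
  have D_sums: "(\<lambda>l. D l t) sums g t" "(\<lambda>l. norm (D l t)) sums norm (g t)" if t: "g t = 0 \<or> (\<exists>l. t \<in> L l)" for t
  proof -
    have "(\<lambda>l. D l t) sums g t \<and> (\<lambda>l. norm (D l t)) sums norm (g t)"
    proof (cases "g t = 0")
      case False
      with t obtain l where l: "t \<in> L l" by auto
      have iff: "t \<in> L k \<longleftrightarrow> k = l" for k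
        using l L_disj by blast
      have "(\<lambda>k. D k t) = (\<lambda>k. if k = l then g t else 0)" "(\<lambda>k. norm (D k t)) = (\<lambda>k. if k = l then norm (g t) else 0)"
        by (auto simp: D_eq indicator_def iff)
      then show ?thesis using sums_single[of l "\<lambda>_. g t"] sums_single[of l "\<lambda>_. norm (g t)"] by simp
    qed (simp add: D_eq)
    then show "(\<lambda>l. D l t) sums g t" "(\<lambda>l. norm (D l t)) sums norm (g t)" by auto
  qed
  have Dint: "integrable lborel (D l)" for l
    unfolding D_eq[abs_def] using gint by (intro integrable_mult_indicator) auto
  \<comment> \<open>The layers are disjoint, so the partial sums of their masses stay below the mass
    of \<open>g\<close>; this licenses the interchange of sum and integral below.\<close>
  have Dsum: "summable (\<lambda>l. \<integral>t. norm (D l t) \<partial>lborel)"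
  proof (rule bounded_imp_summable)
    fix n
    have "(\<Sum>l\<le>n. \<integral>t. norm (D l t) \<partial>lborel) = (\<integral>t. (\<Sum>l\<le>n. norm (D l t)) \<partial>lborel)"
      using Dint by (intro Bochner_Integration.integral_sum[symmetric]) auto
    also have "\<dots> \<le> (\<integral>t. norm (g t) \<partial>lborel)"
    proof (rule integral_mono_AE)
      show "AE t in lborel. (\<Sum>l\<le>n. norm (D l t)) \<le> norm (g t)"
        using AE_L
      proof eventually_elim
        case (elim t)
        show ?case using sum_le_suminf[OF sums_summable[OF D_sums(2)[OF elim]], of "{..n}"] sums_unique[OF D_sums(2)[OF elim]] by simp
      qed
    qed (use Dint gint in \<open>auto intro!: integrable_norm\<close>)
    finally show "(\<Sum>l\<le>n. \<integral>t. norm (D l t) \<partial>lborel) \<le> (\<integral>t. norm (g t) \<partial>lborel)" .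
  qed (auto intro: integral_nonneg_AE)
  have Dext: "arc_ext (D l) x = of_real (h l) * arc_ext (G l) x" for l x
    unfolding arc_ext_def D_def by (simp add: mult.assoc)
  have DextN: "h l * norm (arc_ext (G l) x) = norm (arc_ext (D l) x)" for l x
    using h0[of l] by (simp add: Dext norm_mult)
  have ci: "integrable lborel (\<lambda>t. f t * cis (x \<bullet> circ t))" if "integrable lborel f" for f x
  proof -
    have [measurable]: "f \<in> borel_measurable borel" using that by auto
    show ?thesis using that by (rule Bochner_Integration.integrable_bound) (auto simp: norm_mult)
  qed
  have DextS: "summable (\<lambda>l. norm (arc_ext (D l) x))" for x
  proof (rule summable_comparison_test'[OF Dsum])
    show "norm (norm (arc_ext (D l) x)) \<le> (\<integral>t. norm (D l t) \<partial>lborel)" for l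
      using integral_norm_bound[of lborel "\<lambda>t. D l t * cis (x \<bullet> circ t)"] by (simp add: arc_ext_def norm_mult)
  qed
  have main: "norm (arc_ext g x) \<le> (\<Sum>l. norm (arc_ext (D l) x))" for x
  proof -
    have "(\<integral>t. (\<Sum>l. D l t * cis (x \<bullet> circ t)) \<partial>lborel) = (\<Sum>l. \<integral>t. D l t * cis (x \<bullet> circ t) \<partial>lborel)"
    proof (rule integral_suminf)
      show "AE t in lborel. summable (\<lambda>l. norm (D l t * cis (x \<bullet> circ t)))"
        using AE_L by eventually_elim (use D_sums(2) in \<open>auto simp: norm_mult intro: sums_summable\<close>)
      show "summable (\<lambda>l. \<integral>t. norm (D l t * cis (x \<bullet> circ t)) \<partial>lborel)"
        using Dsum by (simp add: norm_mult)
    qed (rule ci[OF Dint])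
    moreover have "(\<integral>t. (\<Sum>l. D l t * cis (x \<bullet> circ t)) \<partial>lborel) = arc_ext g x"
      unfolding arc_ext_def
    proof (rule integral_cong_AE)
      show "AE t in lborel. (\<Sum>l. D l t * cis (x \<bullet> circ t)) = g t * cis (x \<bullet> circ t)"
        using AE_L
      proof eventually_elim
        case (elim t)
        show ?case using sums_mult2[OF D_sums(1)[OF elim], of "cis (x \<bullet> circ t)"] by (simp add: sums_iff)
      qed
    qed auto
    ultimately have "arc_ext g x = (\<Sum>l. arc_ext (D l) x)" by (simp add: arc_ext_def)
    then show ?thesis using summable_norm[OF DextS[of x]] by simp
  qed
  show thesis
  proof (rule that[of h G])
    show "summable (\<lambda>l. h l * norm (arc_ext (G l) x))" for x using DextS by (simp add: DextN)
    show "norm (arc_ext g x) \<le> (\<Sum>l. h l * norm (arc_ext (G l) x))" for x using main by (simp add: DextN)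
  qed (use h0 atoms sum_bound in auto)
qed

section \<open>The weight, dyadic shells and summation over atoms\<close>

definition wt :: "real \<times> real \<Rightarrow> real" where
  "wt x = 1 + \<bar>fst x\<bar> + \<bar>snd x\<bar>"

lemma wt_ge_1: "wt x \<ge> 1" by (simp add: wt_def)

lemma wt_pos [simp]: "wt x > 0" using wt_ge_1[of x] by linarith

lemma norm_le_wt: "norm x \<le> wt x"
proof -
  have "norm x \<le> norm (fst x) + norm (snd x)" by (cases x) (simp add: norm_Pair sqrt_sum_squares_le_sum_abs)
  then show ?thesis by (simp add: wt_def)
qed

lemma measurable_wt [measurable]: "wt \<in> borel_measurable borel"
  unfolding wt_def[abs_def] by (intro borel_measurable_continuous_onI continuous_intros)

lemma wt_dyadic: obtains k :: nat where "2 ^ k \<le> wt x" "wt x < 2 ^ Suc k"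
proof -
  obtain n where n: "wt x < 2 ^ n" using real_arch_pow[of 2 "wt x"] by auto
  define m where "m = (LEAST n. wt x < 2 ^ n)"
  have m: "wt x < 2 ^ m" unfolding m_def using n by (rule LeastI)
  have "m \<noteq> 0" using m wt_ge_1[of x] by (intro notI) auto
  then obtain k where k: "m = Suc k" by (cases m) auto
  have "\<not> wt x < 2 ^ k" using not_less_Least[of k "\<lambda>n. wt x < 2 ^ n"] k m_def by auto
  then show thesis using m k that[of k] by auto
qed

text \<open>The normalized local form: a window of length one at any position, with a constant
  uniform in the position, and \<open>q\<close>th powers instead of quasi-norms, so that
  \<open>q < 1\<close> needs no separate treatment. The exponent \<open>r\<close> is finite here;
  \<open>r = \<infinity>\<close> is reached from smaller exponents because the circle has finite
  length.\<close>

definition ext_bdd :: "real \<Rightarrow> real \<Rightarrow> real \<Rightarrow> bool" where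
  "ext_bdd \<gamma> r q \<longleftrightarrow> (\<exists>C\<ge>0. \<forall>\<alpha> g. g \<in> borel_measurable borel \<longrightarrow> (\<forall>t. t \<notin> {\<alpha>..\<alpha>+1} \<longrightarrow> g t = 0) \<longrightarrow>
     (\<integral>\<^sup>+t. ennreal (norm (g t) powr r) \<partial>lborel) \<le> 1 \<longrightarrow>
     (\<integral>\<^sup>+x. ennreal ((norm (arc_ext g x) * wt x powr - \<gamma>) powr q) \<partial>lborel) \<le> ennreal C)"

text \<open>Larger exponents give smaller sequence norms: each term of the summable sequence is at
  most \<open>N\<close>, so its power \<open>p / r\<close> is at most
  \<open>N powr (p / r - 1)\<close> times the term. This is where \<open>r \<le> q\<close> enters
  the critical case.\<close>

lemma atomic_norm_sum:
  fixes h :: "nat \<Rightarrow> real"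
  assumes r: "r \<ge> 1" and p: "p \<ge> r" and h: "\<And>l. h l \<ge> 0"
    and N: "\<And>n. (\<Sum>l<n. (1/2) ^ l * h l powr r) \<le> N"
  shows "(\<Sum>l. ennreal (h l powr p * ((1/2) ^ l) powr (p / r))) \<le> ennreal (N powr (p / r))"
proof -
  define y where "y l = (1/2) ^ l * h l powr r" for l
  have y0: "y l \<ge> 0" for l by (simp add: y_def)
  have N0: "N \<ge> 0" using N[of 0] by simp
  have yN: "y l \<le> N" for l
  proof -
    have "y l \<le> (\<Sum>i<Suc l. y i)" using y0 by (intro member_le_sum) auto
    also have "\<dots> \<le> N" using N[of "Suc l"] by (simp only: y_def)
    finally show ?thesis .
  qed
  have eq: "h l powr p * ((1/2) ^ l) powr (p / r) = y l powr (p / r)" for l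
    unfolding y_def using r h[of l] by (simp add: powr_mult powr_powr mult.commute)
  have le: "y l powr (p / r) \<le> N powr (p / r - 1) * y l" for l
  proof (cases "y l = 0")
    case False
    have "y l powr (p / r) = y l powr (p / r - 1) * y l powr 1"
      by (simp only: powr_add[symmetric]) simp
    also have "\<dots> \<le> N powr (p / r - 1) * y l powr 1"
      using yN[of l] y0[of l] r p by (intro mult_right_mono powr_mono2) auto
    finally show ?thesis using y0[of l] by simp
  qed (use r p in simp)
  have "(\<Sum>l. ennreal (h l powr p * ((1/2) ^ l) powr (p / r))) \<le> (\<Sum>l. ennreal (N powr (p / r - 1)) * ennreal (y l))"
    unfolding eq using le y0 by (intro suminf_le) (auto simp: ennreal_mult[symmetric] intro!: ennreal_leI)
  also have "\<dots> = ennreal (N powr (p / r - 1)) * (\<Sum>l. ennreal (y l))" by simp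
  also have "\<dots> \<le> ennreal (N powr (p / r - 1)) * ennreal N"
  proof (rule mult_left_mono)
    show "(\<Sum>l. ennreal (y l)) \<le> ennreal N"
      unfolding suminf_eq_SUP using N y0 by (intro SUP_least) (simp add: sum_ennreal y_def ennreal_leI)
  qed simp
  also have "ennreal (N powr (p / r - 1)) * ennreal N = ennreal (N powr (p / r))"
  proof (cases "N = 0")
    case False
    have "N powr (p / r - 1) * N powr 1 = N powr (p / r)" by (simp only: powr_add[symmetric]) simp
    then show ?thesis using N0 by (simp add: ennreal_mult[symmetric])
  qed simp
  finally show ?thesis .
qed

text \<open>The atom index is outermost because the shells are summed first, for each fixed
  atom.\<close>

lemma nn_integral_le_suminf2:
  assumes v[measurable]: "\<And>k l::nat. v k l \<in> borel_measurable M"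
    and ex: "\<And>x. x \<in> space M \<Longrightarrow> \<exists>k l. u x \<le> v k l x"
  shows "(\<integral>\<^sup>+x. u x \<partial>M) \<le> (\<Sum>l::nat. \<Sum>k::nat. \<integral>\<^sup>+x. v k l x \<partial>M)"
proof -
  have "(\<integral>\<^sup>+x. u x \<partial>M) \<le> (\<Sum>l. \<integral>\<^sup>+x. (\<Sum>k. v k l x) \<partial>M)"
  proof (rule nn_integral_le_suminf)
    fix x assume "x \<in> space M"
    then obtain k l where "u x \<le> v k l x" using ex by blast
    also have "v k l x \<le> (\<Sum>k. v k l x)" using sum_le_suminf[of "\<lambda>k. v k l x" "{k}"] by simp
    finally show "\<exists>l. u x \<le> (\<Sum>k. v k l x)" by blast
  qed simp
  also have "\<dots> = (\<Sum>l. \<Sum>k. \<integral>\<^sup>+x. v k l x \<partial>M)"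
    by (intro suminf_cong nn_integral_suminf) simp
  finally show ?thesis .
qed

text \<open>Real interpolation: the estimate for atoms gains on both sides of the critical relation
  between the size of an atom and the distance to the origin, hence dyadic shells and atoms decouple.\<close>

lemma ext_bdd_by_shells:
  fixes q r \<gamma> e C :: real and s :: nat
  assumes r: "r \<ge> 1" and q: "q \<ge> r" and e: "e > 0" and s: "s \<ge> 1" and \<gamma>: "\<gamma> \<ge> 0" and C: "C \<ge> 0"
    and est: "\<And>\<alpha> k l G. atom \<alpha> ((1/2) ^ l) G \<Longrightarrow>
      (\<integral>\<^sup>+x. ennreal (norm (arc_ext G x) powr q) * indicator (cball 0 (2 ^ Suc k)) x \<partial>lborel) \<le>
      ennreal (C * (2 ^ k) powr (\<gamma> * q) * (((1/2) ^ l) powr (q / r) * kap e (2 ^ k * ((1/2) ^ l) ^ s)))"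
  shows "ext_bdd \<gamma> r q"
proof -
  \<comment> \<open>After the \<open>q\<close>th power the pigeonhole weights cost
    \<open>e / 2\<close>, which leaves \<open>e / 2\<close> for the sum over shells.\<close>
  define \<tau> where "\<tau> = e / (2 * q)"
  have q0: "q > 0" using r q by simp
  have \<tau>: "\<tau> > 0" using q0 e by (simp add: \<tau>_def)
  have B: "(2::real) ^ s > 1" using s by simp
  obtain K where K: "K > 0" "\<And>Y n. Y > 0 \<Longrightarrow> (\<Sum>l<n. kap \<tau> ((2 ^ s) ^ l * Y)) \<le> K"
    using kap_geometric_sum[OF B \<tau>] by blast
  obtain K' where K': "K' > 0" "\<And>Y. Y > 0 \<Longrightarrow> (\<Sum>l. ennreal (kap (e / 2) (2 ^ l * Y))) \<le> ennreal K'"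
    using kap_geometric_suminf[of 2 "e / 2"] e by fastforce
  define N where "N = 4 * 2 powr r"
  define C1 where "C1 = (2 * K) powr q * C"
  have C1: "C1 \<ge> 0" using C by (simp add: C1_def)
  define Z where "Z k l = (2::real) ^ k * ((1/2) ^ l) ^ s" for k l :: nat
  have Zpos: "Z k l > 0" for k l by (simp add: Z_def)
  \<comment> \<open>For a fixed shell, \<open>Z k l\<close> is a decreasing geometric sequence in
    \<open>l\<close>. As \<open>kap\<close> is even in the logarithm, its reciprocals may be summed
    instead.\<close>
  have Zsum: "(\<Sum>l<n. kap \<tau> (Z k l)) \<le> K" for k n
  proof -
    have "kap \<tau> (Z k l) = kap \<tau> ((2 ^ s) ^ l * (1 / 2 ^ k))" for l
    proof -
      have "Z k l = 1 / ((2 ^ s) ^ l * (1 / 2 ^ k))"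
        by (simp add: Z_def power_one_over power_mult[symmetric] mult.commute)
      then show ?thesis using kap_inverse[of "(2 ^ s) ^ l * (1 / 2 ^ k)" \<tau>] by simp
    qed
    then show ?thesis using K(2)[of "1 / 2 ^ k" n] by simp
  qed
  have "(\<integral>\<^sup>+x. ennreal ((norm (arc_ext g x) * wt x powr - \<gamma>) powr q) \<partial>lborel) \<le> ennreal (C1 * K' * N powr (q / r))"
    if g[measurable]: "g \<in> borel_measurable borel" and supp: "\<And>t. t \<notin> {\<alpha>..\<alpha>+1} \<Longrightarrow> g t = 0"
      and gr: "(\<integral>\<^sup>+t. ennreal (norm (g t) powr r) \<partial>lborel) \<le> 1" for \<alpha> g
  proof -
    obtain h G where h: "\<And>l. h l \<ge> 0" and G: "\<And>l. atom \<alpha> ((1/2) ^ l) (G l)"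
      and sumN: "\<And>n. (\<Sum>l<n. (1/2) ^ l * h l powr r) \<le> N"
      and summ: "\<And>x. summable (\<lambda>l. h l * norm (arc_ext (G l) x))"
      and dom: "\<And>x. norm (arc_ext g x) \<le> (\<Sum>l. h l * norm (arc_ext (G l) x))"
      using atomic_decomposition[OF g supp r gr] unfolding N_def by blast
    have [measurable]: "arc_ext (G l) \<in> borel_measurable borel" for l
      using atomD(1)[OF G] by (rule measurable_arc_ext)
    have [measurable]: "cball (0 :: real \<times> real) R \<in> sets borel" for R by simp
    define v where "v k l x = ennreal ((2 ^ k) powr (- (\<gamma> * q)) * (2 * K) powr q * kap (- e / 2) (Z k l) * h l powr q) * 
       (ennreal (norm (arc_ext (G l) x) powr q) * indicator (cball 0 (2 ^ Suc k)) x)" for k l x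
    have ex: "\<exists>k l. ennreal ((norm (arc_ext g x) * wt x powr - \<gamma>) powr q) \<le> v k l x" for x
    proof -
      obtain k where k: "2 ^ k \<le> wt x" "wt x < 2 ^ Suc k" by (rule wt_dyadic)
      have xin: "x \<in> cball 0 (2 ^ Suc k)" using k(2) norm_le_wt[of x] by simp
      obtain l where l: "norm (arc_ext g x) \<le> 2 * K / kap \<tau> (Z k l) * (h l * norm (arc_ext (G l) x))"
        using dominant_term[OF summ _ dom, of x "\<lambda>l. kap \<tau> (Z k l)" K] h Zsum by auto
      have kp: "kap \<tau> (Z k l) powr q = kap (e / 2) (Z k l)" using q0 by (simp add: kap_powr \<tau>_def)
      have "kap (- e / 2) (Z k l) * kap (e / 2) (Z k l) = 1" unfolding kap_mult by (simp add: kap_def)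
      moreover have "kap (e / 2) (Z k l) \<noteq> 0" by (simp add: kap_def)
      ultimately have ki: "kap (- e / 2) (Z k l) = 1 / kap (e / 2) (Z k l)" by (simp only: eq_divide_eq) simp
      have "(norm (arc_ext g x) * wt x powr - \<gamma>) powr q \<le> (2 * K / kap \<tau> (Z k l) * (h l * norm (arc_ext (G l) x)) * (2 ^ k) powr - \<gamma>) powr q"
        using l k(1) \<gamma> q0 K h[of l] by (intro powr_mono2 mult_mono powr_mono2') auto
      also have "\<dots> = (2 * K) powr q / kap (e / 2) (Z k l) * (h l powr q * norm (arc_ext (G l) x) powr q) * (2 ^ k) powr (- (\<gamma> * q))"
        using K h[of l] by (simp add: powr_mult powr_divide kp powr_powr)
      also have "\<dots> = ((2 ^ k) powr (- (\<gamma> * q)) * (2 * K) powr q * kap (- e / 2) (Z k l) * h l powr q) * norm (arc_ext (G l) x) powr q"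
        unfolding ki by simp
      finally have "ennreal ((norm (arc_ext g x) * wt x powr - \<gamma>) powr q) \<le> v k l x"
        using xin by (simp add: v_def ennreal_mult[symmetric] ennreal_leI)
      then show ?thesis by blast
    qed
    have vint: "(\<integral>\<^sup>+x. v k l x \<partial>lborel) \<le> ennreal (C1 * (h l powr q * ((1/2) ^ l) powr (q / r))) * ennreal (kap (e / 2) (Z k l))" for k l
    proof -
      have "(\<integral>\<^sup>+x. v k l x \<partial>lborel) = ennreal ((2 ^ k) powr (- (\<gamma> * q)) * (2 * K) powr q * kap (- e / 2) (Z k l) * h l powr q) * 
        (\<integral>\<^sup>+x. ennreal (norm (arc_ext (G l) x) powr q) * indicator (cball 0 (2 ^ Suc k)) x \<partial>lborel)"
        unfolding v_def by (rule nn_integral_cmult) simp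
      also have "\<dots> \<le> ennreal ((2 ^ k) powr (- (\<gamma> * q)) * (2 * K) powr q * kap (- e / 2) (Z k l) * h l powr q) * 
        ennreal (C * (2 ^ k) powr (\<gamma> * q) * (((1/2) ^ l) powr (q / r) * kap e (Z k l)))"
        unfolding Z_def by (intro mult_left_mono est[OF G]) auto
      also have "\<dots> = ennreal (((2 ^ k) powr (- (\<gamma> * q)) * (2 ^ k) powr (\<gamma> * q)) * (C1 * (h l powr q * ((1/2) ^ l) powr (q / r))) * (kap (- e / 2) (Z k l) * kap e (Z k l)))"
        using C by (simp add: ennreal_mult[symmetric] C1_def mult_ac)
      also have "(2 ^ k) powr (- (\<gamma> * q)) * (2 ^ k) powr (\<gamma> * q) = (1::real)"
        by (simp only: powr_add[symmetric]) simp
      also have "kap (- e / 2) (Z k l) * kap e (Z k l) = kap (e / 2) (Z k l)" by (simp add: kap_mult)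
      finally show ?thesis using C1 by (simp add: ennreal_mult)
    qed
    have "(\<integral>\<^sup>+x. ennreal ((norm (arc_ext g x) * wt x powr - \<gamma>) powr q) \<partial>lborel) \<le> (\<Sum>l. \<Sum>k. \<integral>\<^sup>+x. v k l x \<partial>lborel)"
    proof (rule nn_integral_le_suminf2)
      show "v k l \<in> borel_measurable lborel" for k l unfolding v_def[abs_def] by measurable
    qed (rule ex)
    also have "\<dots> \<le> (\<Sum>l. \<Sum>k. ennreal (C1 * (h l powr q * ((1/2) ^ l) powr (q / r))) * ennreal (kap (e / 2) (Z k l)))"
      by (intro suminf_le vint) auto
    also have "\<dots> = (\<Sum>l. ennreal (C1 * (h l powr q * ((1/2) ^ l) powr (q / r))) * (\<Sum>k. ennreal (kap (e / 2) (Z k l))))"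
      by simp
    \<comment> \<open>For a fixed atom the shells form a geometric sequence. The remaining sum over
      atoms has no decay left and rests on \<open>q \<ge> r\<close>.\<close>
    also have "\<dots> \<le> (\<Sum>l. ennreal (C1 * (h l powr q * ((1/2) ^ l) powr (q / r))) * ennreal K')"
      unfolding Z_def by (intro suminf_le mult_left_mono K'(2)) auto
    also have "\<dots> = (\<Sum>l. ennreal (C1 * K') * ennreal (h l powr q * ((1/2) ^ l) powr (q / r)))"
      using C1 K' by (simp add: ennreal_mult[symmetric] mult_ac)
    also have "\<dots> = ennreal (C1 * K') * (\<Sum>l. ennreal (h l powr q * ((1/2) ^ l) powr (q / r)))"
      by simp
    also have "\<dots> \<le> ennreal (C1 * K') * ennreal (N powr (q / r))"
      by (intro mult_left_mono atomic_norm_sum r q h sumN) auto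
    also have "\<dots> = ennreal (C1 * K' * N powr (q / r))"
      using C1 K' by (simp add: ennreal_mult)
    finally show ?thesis .
  qed
  then show ?thesis
    unfolding ext_bdd_def using C1 K' by (intro exI[of _ "C1 * K' * N powr (q / r)"]) auto
qed

section \<open>Estimates for one atom on one ball\<close>

lemma emeasure_cball_plane: 
  assumes "R \<ge> 0"
  shows "emeasure lborel (cball (0 :: real \<times> real) R) \<le> ennreal (4 * R\<^sup>2)"
proof -
  have "cball (0 :: real \<times> real) R \<subseteq> {-R..R} \<times> {-R..R}"
  proof
    fix x :: "real \<times> real" assume "x \<in> cball 0 R"
    then have "norm x \<le> R" by simp
    then have "\<bar>fst x\<bar> \<le> R" "\<bar>snd x\<bar> \<le> R"
      using norm_fst_le[of "fst x" "snd x"] norm_snd_le[of "snd x" "fst x"] by auto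
    then show "x \<in> {-R..R} \<times> {-R..R}" by (cases x) auto
  qed
  then have "emeasure lborel (cball (0 :: real \<times> real) R) \<le> emeasure (lborel \<Otimes>\<^sub>M lborel) ({-R..R} \<times> {-R..R})"
    unfolding lborel_prod by (intro emeasure_mono) (auto intro!: borel_Times)
  also have "\<dots> = ennreal (2 * R) * ennreal (2 * R)"
    using assms by (subst lborel.emeasure_pair_measure_Times) auto
  also have "\<dots> = ennreal (4 * R\<^sup>2)" using assms by (simp add: ennreal_mult[symmetric] power2_eq_square)
  finally show ?thesis .
qed

text \<open>Factors out the critical monomial. The sign of \<open>x\<close> shows on which side of
  \<open>R * d ^ s = 1\<close> the estimate gains.\<close>

lemma powr_rebalance:
  fixes R d x :: real
  assumes "R > 0" "d > 0" "a = c + x" "b = c' + real s * x"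
  shows "R powr a * d powr b = R powr c * (d powr c' * (R * d ^ s) powr x)"
proof -
  have "(R * d ^ s) powr x = R powr x * d powr (real s * x)"
    using assms(1,2) by (simp add: powr_mult powr_powr powr_realpow[symmetric])
  then show ?thesis using assms(3,4) by (simp add: powr_add)
qed

text \<open>Interpolation by cutting at a height \<open>\<tau>\<close>: small values are compared
  with a constant, large ones with the square. \<open>powr_split_high\<close> cuts in the same way
  between the square and a larger power.\<close>

lemma powr_split_low:
  fixes v \<tau> q :: real
  assumes "v \<ge> 0" "\<tau> > 0" "0 < q" "q \<le> 2"
  shows "v powr q \<le> \<tau> powr (q - 2) * v\<^sup>2 + \<tau> powr q"
proof (cases "v \<le> \<tau>")
  case True
  then have "v powr q \<le> \<tau> powr q" using assms by (intro powr_mono2) auto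
  moreover have "0 \<le> \<tau> powr (q - 2) * v\<^sup>2" by simp
  ultimately show ?thesis by linarith
next
  case False
  then have v: "v > 0" using assms by simp
  have "v powr q = v powr (q - 2) * v powr 2" by (simp only: powr_add[symmetric]) simp
  also have "\<dots> \<le> \<tau> powr (q - 2) * v powr 2"
    using False assms by (intro mult_right_mono powr_mono2') auto
  also have "v powr 2 = v\<^sup>2" using v by simp
  finally show ?thesis using powr_ge_zero[of \<tau> q] by linarith
qed

lemma powr_split_high:
  fixes v \<tau> q q' :: real
  assumes "v \<ge> 0" "\<tau> > 0" "2 \<le> q" "q \<le> q'"
  shows "v powr q \<le> \<tau> powr (q - 2) * v\<^sup>2 + \<tau> powr (q - q') * v powr q'"
proof (cases "v = 0")
  case False
  then have v: "v > 0" using assms by simp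
  show ?thesis
  proof (cases "v \<le> \<tau>")
    case True
    have "v powr q = v powr (q - 2) * v powr 2" by (simp only: powr_add[symmetric]) simp
    also have "\<dots> \<le> \<tau> powr (q - 2) * v powr 2"
      using True assms by (intro mult_right_mono powr_mono2) auto
    also have "v powr 2 = v\<^sup>2" using v by simp
    finally show ?thesis using mult_nonneg_nonneg[OF powr_ge_zero powr_ge_zero, of \<tau> "q - q'" v q'] by linarith
  next
    case False
    have "v powr q = v powr (q - q') * v powr q'" by (simp only: powr_add[symmetric]) simp
    also have "\<dots> \<le> \<tau> powr (q - q') * v powr q'"
      using False assms by (intro mult_right_mono powr_mono2') auto
    finally show ?thesis using mult_nonneg_nonneg[OF powr_ge_zero zero_le_power2, of \<tau> "q - 2" v] by linarith
  qed
qed (use assms in simp)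

lemma two_sided_kap:
  assumes z: "z > 0" and X: "X \<le> P * z powr a" "X \<le> P * z powr (- b)" and P: "P \<ge> 0" and ab: "a \<ge> e" "b \<ge> e"
  shows "X \<le> P * kap e z"
proof (cases "z \<le> 1")
  case True
  then have "P * z powr a \<le> P * kap e z" using z ab P by (intro mult_left_mono powr_le_kap_small) auto
  then show ?thesis using X by linarith
next
  case False
  then have "P * z powr (- b) \<le> P * kap e z" using z ab P by (intro mult_left_mono powr_le_kap_large) auto
  then show ?thesis using X by linarith
qed

text \<open>The last factor 2 accounts for balls of radius \<open>2 * R\<close>, the outer edge of
  the dyadic shell at \<open>R\<close>.\<close>

definition L2c :: real where "L2c = exp 1 * (4 * pi * sqrt pi) * 2"

lemma L2c_pos [simp]: "L2c > 0" "L2c \<ge> 0" by (auto simp: L2c_def)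

lemma atom_L2_ball2:
  assumes "atom \<alpha> \<delta> G" "\<delta> \<ge> 0" "R > 0"
  shows "(\<integral>\<^sup>+x. ennreal ((norm (arc_ext G x))\<^sup>2) * indicator (cball 0 (2 * R)) x \<partial>lborel) \<le> ennreal (L2c * R * \<delta>)"
  using atom_L2_ball[OF assms(1,2), of "2 * R"] assms(3) by (simp add: L2c_def mult_ac)

lemma atom_ball_sup:
  fixes q R \<delta> :: real
  assumes G: "atom \<alpha> \<delta> G" and \<delta>: "\<delta> > 0" and R: "R > 0" and q: "q > 0"
  shows "(\<integral>\<^sup>+x. ennreal (norm (arc_ext G x) powr q) * indicator (cball 0 (2 * R)) x \<partial>lborel) \<le>
    ennreal (16 * (R powr 2 * \<delta> powr q))"
proof -
  have "(\<integral>\<^sup>+x. ennreal (norm (arc_ext G x) powr q) * indicator (cball 0 (2 * R)) x \<partial>lborel) \<le>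
    (\<integral>\<^sup>+x. ennreal (\<delta> powr q) * indicator (cball (0 :: real \<times> real) (2 * R)) x \<partial>lborel)"
    by (intro nn_integral_mono mult_right_mono ennreal_leI powr_mono2) (use atom_sup[OF G] \<delta> q in auto)
  also have "\<dots> = ennreal (\<delta> powr q) * emeasure lborel (cball (0 :: real \<times> real) (2 * R))"
    by (rule nn_integral_cmult_indicator) simp
  also have "\<dots> \<le> ennreal (\<delta> powr q) * ennreal (4 * (2 * R)\<^sup>2)"
    using R by (intro mult_left_mono emeasure_cball_plane) auto
  also have "\<dots> = ennreal (16 * (R powr 2 * \<delta> powr q))"
    using R by (simp add: ennreal_mult[symmetric] power_mult_distrib mult_ac)
  finally show ?thesis .
qed

lemma atom_ball_low:
  fixes q R \<delta> :: real
  assumes G: "atom \<alpha> \<delta> G" and \<delta>: "\<delta> > 0" and R: "R > 0" and q: "0 < q" "q \<le> 2"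
  shows "(\<integral>\<^sup>+x. ennreal (norm (arc_ext G x) powr q) * indicator (cball 0 (2 * R)) x \<partial>lborel) \<le>
    ennreal ((L2c + 16) * (R powr (2 - q / 2) * \<delta> powr (q / 2)))"
proof -
  note [measurable] = atomD(1)[OF G]
  have [measurable]: "cball (0 :: real \<times> real) (2 * R) \<in> sets borel" by simp
  \<comment> \<open>The root mean square on the ball: energy about \<open>R * \<delta>\<close> over
    an area about \<open>R\<^sup>2\<close>. At this height both parts of the cut have the same
    order.\<close>
  define \<tau> where "\<tau> = \<delta> powr (1/2) * R powr (-1/2)"
  have \<tau>: "\<tau> > 0" using \<delta> R by (simp add: \<tau>_def)
  have "(\<integral>\<^sup>+x. ennreal (norm (arc_ext G x) powr q) * indicator (cball 0 (2 * R)) x \<partial>lborel) \<le>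
    (\<integral>\<^sup>+x. ennreal (\<tau> powr (q - 2)) * (ennreal ((norm (arc_ext G x))\<^sup>2) * indicator (cball 0 (2 * R)) x) + ennreal (\<tau> powr q) * indicator (cball 0 (2 * R)) x \<partial>lborel)"
  proof (rule nn_integral_mono)
    fix x
    have "ennreal (norm (arc_ext G x) powr q) \<le> ennreal (\<tau> powr (q - 2)) * ennreal ((norm (arc_ext G x))\<^sup>2) + ennreal (\<tau> powr q)"
      using powr_split_low[of "norm (arc_ext G x)" \<tau> q] \<tau> q by (simp add: ennreal_mult[symmetric] ennreal_plus[symmetric] ennreal_leI del: ennreal_plus)
    then show "ennreal (norm (arc_ext G x) powr q) * indicator (cball 0 (2 * R)) x \<le> 
      ennreal (\<tau> powr (q - 2)) * (ennreal ((norm (arc_ext G x))\<^sup>2) * indicator (cball 0 (2 * R)) x) + ennreal (\<tau> powr q) * indicator (cball 0 (2 * R)) x"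
      by (auto simp: indicator_def)
  qed
  also have "\<dots> = ennreal (\<tau> powr (q - 2)) * (\<integral>\<^sup>+x. ennreal ((norm (arc_ext G x))\<^sup>2) * indicator (cball 0 (2 * R)) x \<partial>lborel) + 
     ennreal (\<tau> powr q) * emeasure lborel (cball (0 :: real \<times> real) (2 * R))"
    by (subst nn_integral_add) (auto simp: nn_integral_cmult nn_integral_cmult_indicator)
  also have "\<dots> \<le> ennreal (\<tau> powr (q - 2)) * ennreal (L2c * R * \<delta>) + ennreal (\<tau> powr q) * ennreal (4 * (2 * R)\<^sup>2)"
    using R \<delta> by (intro add_mono mult_left_mono emeasure_cball_plane atom_L2_ball2[OF G]) auto
  also have "\<dots> = ennreal (L2c * (\<tau> powr (q - 2) * R * \<delta>) + 16 * (\<tau> powr q * R\<^sup>2))"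
    using R \<delta> by (simp add: ennreal_mult[symmetric] ennreal_plus[symmetric] power_mult_distrib mult_ac del: ennreal_plus)
  also have "\<tau> powr (q - 2) * R * \<delta> = R powr (2 - q / 2) * \<delta> powr (q / 2)"
  proof -
    have "\<tau> powr (q - 2) * R * \<delta> = (\<delta> powr (1/2 * (q - 2)) * \<delta> powr 1) * (R powr (-1/2 * (q - 2)) * R powr 1)"
      unfolding \<tau>_def using \<delta> R by (simp add: powr_mult powr_powr)
    also have "\<dots> = \<delta> powr (q / 2) * R powr (2 - q / 2)"
      unfolding powr_add[symmetric] by (simp add: field_simps)
    finally show ?thesis by simp
  qed
  also have "\<tau> powr q * R\<^sup>2 = R powr (2 - q / 2) * \<delta> powr (q / 2)"
  proof -
    have "\<tau> powr q * R\<^sup>2 = \<delta> powr (1/2 * q) * (R powr (-1/2 * q) * R powr 2)"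
      unfolding \<tau>_def using \<delta> R by (simp add: powr_mult powr_powr)
    also have "\<dots> = \<delta> powr (q / 2) * R powr (2 - q / 2)"
      unfolding powr_add[symmetric] by (simp add: field_simps)
    finally show ?thesis by simp
  qed
  finally show ?thesis by (simp add: distrib_right)
qed

lemma atom_ball_mid:
  fixes q R \<delta> :: real
  assumes G: "atom \<alpha> \<delta> G" and \<delta>: "\<delta> > 0" and R: "R > 0" and q: "2 \<le> q"
  shows "(\<integral>\<^sup>+x. ennreal (norm (arc_ext G x) powr q) * indicator (cball 0 (2 * R)) x \<partial>lborel) \<le>
    ennreal (L2c * (R powr 1 * \<delta> powr (q - 1)))"
proof -
  note [measurable] = atomD(1)[OF G]
  have [measurable]: "cball (0 :: real \<times> real) (2 * R) \<in> sets borel" by simp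
  have pw: "norm (arc_ext G x) powr q \<le> \<delta> powr (q - 2) * (norm (arc_ext G x))\<^sup>2" for x
  proof (cases "arc_ext G x = 0")
    case False
    have "norm (arc_ext G x) powr q = norm (arc_ext G x) powr (q - 2) * norm (arc_ext G x) powr 2"
      by (simp only: powr_add[symmetric]) simp
    also have "\<dots> \<le> \<delta> powr (q - 2) * norm (arc_ext G x) powr 2"
      using atom_sup[OF G] \<delta> q by (intro mult_right_mono powr_mono2) auto
    finally show ?thesis using False by simp
  qed simp
  have "(\<integral>\<^sup>+x. ennreal (norm (arc_ext G x) powr q) * indicator (cball 0 (2 * R)) x \<partial>lborel) \<le>
    (\<integral>\<^sup>+x. ennreal (\<delta> powr (q - 2)) * (ennreal ((norm (arc_ext G x))\<^sup>2) * indicator (cball 0 (2 * R)) x) \<partial>lborel)"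
    using pw by (intro nn_integral_mono) (auto simp: indicator_def ennreal_mult[symmetric] intro!: ennreal_leI)
  also have "\<dots> = ennreal (\<delta> powr (q - 2)) * (\<integral>\<^sup>+x. ennreal ((norm (arc_ext G x))\<^sup>2) * indicator (cball 0 (2 * R)) x \<partial>lborel)"
    by (rule nn_integral_cmult) simp
  also have "\<dots> \<le> ennreal (\<delta> powr (q - 2)) * ennreal (L2c * R * \<delta>)"
    using R \<delta> by (intro mult_left_mono atom_L2_ball2[OF G]) auto
  also have "\<dots> = ennreal (L2c * R * (\<delta> powr (q - 2) * \<delta> powr 1))"
    using R \<delta> by (simp add: ennreal_mult[symmetric] mult_ac)
  also have "\<dots> = ennreal (L2c * (R powr 1 * \<delta> powr (q - 1)))"
    unfolding powr_add[symmetric] using R by (simp add: mult_ac)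
  finally show ?thesis .
qed

text \<open>The critical relation is \<open>R * \<delta> = 1\<close>. Inside, the trivial sup bound
  gains the power \<open>q * \<rho>\<close>; outside, the energy bound gains the power
  \<open>b\<close>. Positivity of \<open>b\<close> is \<open>q * \<rho> < 1\<close> for
  \<open>q \<ge> 2\<close> and \<open>\<rho> < 1 / 2\<close> for \<open>q < 2\<close>; the latter is
  the condition \<open>\<gamma> > 2 / q - 1 / 2\<close> on this line.\<close>

lemma ext_bdd_below_dual:
  fixes q r \<rho> :: real
  assumes r: "r > 1" and \<rho>: "\<rho> = 1 - 1 / r" and q: "r \<le> q" "q * \<rho> < 1" and \<rho>2: "\<rho> < 1/2" 
    and \<gamma>: "\<gamma> = 2 / q - \<rho>"
  shows "ext_bdd \<gamma> r q"
proof -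
  have q0: "q > 1" using r q by simp
  have \<rho>0: "\<rho> > 0" using r by (simp add: \<rho>)
  have \<gamma>0: "\<gamma> \<ge> 0"
  proof -
    have "\<rho> \<le> 1 / q" using q q0 by (simp add: field_simps)
    also have "\<dots> \<le> 2 / q" using q0 by (simp add: field_simps)
    finally show ?thesis by (simp add: \<gamma>)
  qed
  have \<gamma>q: "\<gamma> * q = 2 - q * \<rho>" using q0 by (simp add: \<gamma> field_simps)
  have qr: "q / r = q - q * \<rho>" using r by (simp add: \<rho> field_simps)
  \<comment> \<open>What is left of the exponent of \<open>R\<close> after comparing
    \<open>\<gamma> * q = 2 - q * \<rho>\<close> with the exponent 1 of \<open>atom_ball_mid\<close>
    or \<open>2 - q / 2\<close> of \<open>atom_ball_low\<close>.\<close>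
  define b where "b = (if q \<ge> 2 then 1 - q * \<rho> else q / 2 - q * \<rho>)"
  have b: "b > 0" using q \<rho>2 q0 by (simp add: b_def)
  define e where "e = min (q * \<rho>) b"
  have e: "e > 0" using b q0 \<rho>0 by (simp add: e_def)
  define C where "C = L2c + 16"
  have C: "C \<ge> 16" "C \<ge> L2c" by (simp_all add: C_def)
  show ?thesis
  proof (rule ext_bdd_by_shells[where s = 1 and e = e and C = C])
    fix \<alpha> k l G assume G: "atom \<alpha> ((1/2) ^ l) G"
    define R where "R = (2::real) ^ k"
    define d where "d = (1/2::real) ^ l"
    have Rd: "R > 0" "d > 0" by (auto simp: R_def d_def)
    note G' = G[folded d_def]
    let ?I = "\<integral>\<^sup>+x. ennreal (norm (arc_ext G x) powr q) * indicator (cball 0 (2 * R)) x \<partial>lborel"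
    let ?P = "C * R powr (\<gamma> * q) * d powr (q / r)"
    have 1: "?I \<le> ennreal (?P * (R * d ^ 1) powr (q * \<rho>))"
    proof -
      have le: "16 * (R powr 2 * d powr q) \<le> C * (R powr 2 * d powr q)" using C by (intro mult_right_mono) auto
      have eq: "R powr 2 * d powr q = R powr (\<gamma> * q) * (d powr (q / r) * (R * d ^ 1) powr (q * \<rho>))"
        using Rd by (rule powr_rebalance) (simp_all add: \<gamma>q qr)
      have "?I \<le> ennreal (16 * (R powr 2 * d powr q))" using q0 by (intro atom_ball_sup[OF G' Rd(2,1)]) auto
      also have "\<dots> \<le> ennreal (C * (R powr 2 * d powr q))" using le by (rule ennreal_leI)
      finally show ?thesis unfolding eq by (simp only: mult.assoc)
    qed
    have 2: "?I \<le> ennreal (?P * (R * d ^ 1) powr (- b))"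
    proof (cases "q \<ge> 2")
      case True
      have le: "L2c * (R powr 1 * d powr (q - 1)) \<le> C * (R powr 1 * d powr (q - 1))" using C by (intro mult_right_mono) auto
      have eq: "R powr 1 * d powr (q - 1) = R powr (\<gamma> * q) * (d powr (q / r) * (R * d ^ 1) powr (- b))"
        using Rd by (rule powr_rebalance) (simp_all add: \<gamma>q qr b_def True)
      have "?I \<le> ennreal (L2c * (R powr 1 * d powr (q - 1)))" by (rule atom_ball_mid[OF G' Rd(2,1) True])
      also have "\<dots> \<le> ennreal (C * (R powr 1 * d powr (q - 1)))" using le by (rule ennreal_leI)
      finally show ?thesis unfolding eq by (simp only: mult.assoc)
    next
      case False
      have "R powr (2 - q / 2) * d powr (q / 2) = R powr (\<gamma> * q) * (d powr (q / r) * (R * d ^ 1) powr (- b))"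
        using Rd by (rule powr_rebalance) (use False in \<open>simp_all add: \<gamma>q qr b_def\<close>)
      then show ?thesis using atom_ball_low[OF G' Rd(2,1), of q] False q0
        by (simp add: C_def mult.assoc)
    qed
    \<comment> \<open>\<open>two_sided_kap\<close> compares real numbers, so finiteness of the
      integral is extracted first.\<close>
    have fin: "?I < \<infinity>" using 1 by (rule le_less_trans) simp
    then have I: "?I = ennreal (enn2real ?I)" by (simp add: less_top)
    have "enn2real ?I \<le> ?P * kap e (R * d ^ 1)"
    proof (rule two_sided_kap)
      show "enn2real ?I \<le> ?P * (R * d ^ 1) powr (q * \<rho>)" "enn2real ?I \<le> ?P * (R * d ^ 1) powr (- b)"
        using 1 2 C Rd by (auto intro!: enn2real_leI mult_nonneg_nonneg)
    qed (use Rd C in \<open>auto simp: e_def\<close>)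
    then have "?I \<le> ennreal (?P * kap e (R * d ^ 1))" by (subst I) (rule ennreal_leI)
    then show "(\<integral>\<^sup>+x. ennreal (norm (arc_ext G x) powr q) * indicator (cball 0 (2 ^ Suc k)) x \<partial>lborel) \<le>
      ennreal (C * (2 ^ k) powr (\<gamma> * q) * (((1/2) ^ l) powr (q / r) * kap e (2 ^ k * ((1/2) ^ l) ^ 1)))"
      by (simp add: R_def d_def mult.assoc)
  qed (use r q e \<gamma>0 C in auto)
qed

text \<open>Cutting at a height \<open>\<tau>\<close> interpolates between the energy on the ball
  and the global bound of exponent \<open>q'\<close>; \<open>\<kappa>\<close> is the share of the
  latter.\<close>

lemma atom_ball_above:
  fixes q q' C1 :: real
  assumes q: "2 < q" "q < q'" and q'4: "q' > 4" and C1: "C1 \<ge> 0"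
    and est: "\<And>\<alpha> \<delta> G. \<delta> > 0 \<Longrightarrow> atom \<alpha> \<delta> G \<Longrightarrow> 
       (\<integral>\<^sup>+x. ennreal (norm (arc_ext G x) powr q') \<partial>lborel) \<le> ennreal (C1 * \<delta> powr (q' - 3))"
    and G: "atom \<alpha> \<delta> G" and \<delta>: "\<delta> > 0" and R: "R > 0" and \<kappa>: "\<kappa> = (q - 2) / (q' - 2)"
  shows "(\<integral>\<^sup>+x. ennreal (norm (arc_ext G x) powr q) * indicator (cball 0 (2 * R)) x \<partial>lborel) \<le>
    ennreal ((L2c + C1) * (R powr (1 - \<kappa>) * \<delta> powr (1 + \<kappa> * (q' - 4))))"
proof -
  note [measurable] = atomD(1)[OF G]
  have [measurable]: "cball (0 :: real \<times> real) (2 * R) \<in> sets borel" by simp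
  \<comment> \<open>Chosen so that \<open>\<tau> powr (q' - 2)\<close> is the quotient of the two
    bounds \<open>\<delta> powr (q' - 3)\<close> and \<open>R * \<delta>\<close>, up to constants;
    both parts of the cut then agree.\<close>
  define \<tau> where "\<tau> = \<delta> powr ((q' - 4) / (q' - 2)) * R powr (- 1 / (q' - 2))"
  have \<tau>: "\<tau> > 0" using \<delta> R by (simp add: \<tau>_def)
  have \<tau>p: "\<tau> powr a = \<delta> powr ((q' - 4) / (q' - 2) * a) * R powr (- 1 / (q' - 2) * a)" for a
    unfolding \<tau>_def using \<delta> R by (simp add: powr_mult powr_powr)
  have q'2: "q' - 2 \<noteq> 0" using q'4 by simp
  have \<kappa>': "\<kappa> * (q' - 2) = q - 2" using q'2 by (simp add: \<kappa>)
  have "(\<integral>\<^sup>+x. ennreal (norm (arc_ext G x) powr q) * indicator (cball 0 (2 * R)) x \<partial>lborel) \<le>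
    (\<integral>\<^sup>+x. ennreal (\<tau> powr (q - 2)) * (ennreal ((norm (arc_ext G x))\<^sup>2) * indicator (cball 0 (2 * R)) x) + ennreal (\<tau> powr (q - q')) * ennreal (norm (arc_ext G x) powr q') \<partial>lborel)"
  proof (rule nn_integral_mono)
    fix x
    have "ennreal (norm (arc_ext G x) powr q) \<le> ennreal (\<tau> powr (q - 2)) * ennreal ((norm (arc_ext G x))\<^sup>2) + ennreal (\<tau> powr (q - q')) * ennreal (norm (arc_ext G x) powr q')"
      using powr_split_high[of "norm (arc_ext G x)" \<tau> q q'] \<tau> q by (simp add: ennreal_mult[symmetric] ennreal_plus[symmetric] ennreal_leI del: ennreal_plus)
    then show "ennreal (norm (arc_ext G x) powr q) * indicator (cball 0 (2 * R)) x \<le> 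
      ennreal (\<tau> powr (q - 2)) * (ennreal ((norm (arc_ext G x))\<^sup>2) * indicator (cball 0 (2 * R)) x) + ennreal (\<tau> powr (q - q')) * ennreal (norm (arc_ext G x) powr q')"
      by (auto simp: indicator_def)
  qed
  also have "\<dots> = ennreal (\<tau> powr (q - 2)) * (\<integral>\<^sup>+x. ennreal ((norm (arc_ext G x))\<^sup>2) * indicator (cball 0 (2 * R)) x \<partial>lborel) + 
     ennreal (\<tau> powr (q - q')) * (\<integral>\<^sup>+x. ennreal (norm (arc_ext G x) powr q') \<partial>lborel)"
    by (subst nn_integral_add) (auto simp: nn_integral_cmult)
  also have "\<dots> \<le> ennreal (\<tau> powr (q - 2)) * ennreal (L2c * R * \<delta>) + ennreal (\<tau> powr (q - q')) * ennreal (C1 * \<delta> powr (q' - 3))"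
    using R \<delta> by (intro add_mono mult_left_mono est[OF \<delta> G] atom_L2_ball2[OF G]) auto
  also have "\<dots> = ennreal (L2c * (\<tau> powr (q - 2) * R * \<delta>) + C1 * (\<tau> powr (q - q') * \<delta> powr (q' - 3)))"
    using R \<delta> C1 by (simp add: ennreal_mult[symmetric] ennreal_plus[symmetric] mult_ac del: ennreal_plus)
  also have "\<tau> powr (q - 2) * R * \<delta> = R powr (1 - \<kappa>) * \<delta> powr (1 + \<kappa> * (q' - 4))"
  proof -
    have "\<tau> powr (q - 2) * R * \<delta> = (\<delta> powr ((q' - 4) / (q' - 2) * (q - 2)) * \<delta> powr 1) * (R powr (- 1 / (q' - 2) * (q - 2)) * R powr 1)"
      unfolding \<tau>p using \<delta> R by simp
    also have "\<dots> = \<delta> powr ((q' - 4) / (q' - 2) * (q - 2) + 1) * R powr (- 1 / (q' - 2) * (q - 2) + 1)"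
      unfolding powr_add ..
    also have "(q' - 4) / (q' - 2) * (q - 2) + 1 = 1 + \<kappa> * (q' - 4)" by (simp add: \<kappa>)
    also have "- 1 / (q' - 2) * (q - 2) + 1 = 1 - \<kappa>" by (simp add: \<kappa>)
    finally show ?thesis by simp
  qed
  also have "\<tau> powr (q - q') * \<delta> powr (q' - 3) = R powr (1 - \<kappa>) * \<delta> powr (1 + \<kappa> * (q' - 4))"
  proof -
    have "\<tau> powr (q - q') * \<delta> powr (q' - 3) = \<delta> powr ((q' - 4) / (q' - 2) * (q - q') + (q' - 3)) * R powr (- 1 / (q' - 2) * (q - q'))"
      unfolding \<tau>p powr_add by simp
    also have "(q' - 4) / (q' - 2) * (q - q') + (q' - 3) = 1 + \<kappa> * (q' - 4)"
    proof -
      have "(q' - 4) / (q' - 2) * (q - q') = (q' - 4) * ((q - 2) / (q' - 2) - 1)"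
        using q'2 by (simp add: field_simps)
      then show ?thesis unfolding \<kappa> by (simp add: algebra_simps)
    qed
    also have "- 1 / (q' - 2) * (q - q') = 1 - \<kappa>" using q'2 by (simp add: \<kappa> field_simps)
    finally show ?thesis by simp
  qed
  finally show ?thesis by (simp add: distrib_right)
qed

text \<open>The critical relation is \<open>R * \<delta>\<^sup>2 = 1\<close>, the length of the
  Knapp box. For each admissible share \<open>\<kappa>\<close> the estimate carries the power
  \<open>1 - \<kappa> - \<gamma> * q\<close> of \<open>R * \<delta>\<^sup>2\<close>. The neutral
  share \<open>u = 1 - \<gamma> * q\<close> is interior to the admissible range precisely under the
  hypotheses on \<open>\<gamma>\<close>, so one share on either side of it gives a gain in either
  direction.\<close>

lemma ext_bdd_above_dual:
  fixes q r \<gamma> :: real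
  assumes q: "q > 2" and \<gamma>: "\<gamma> > 0" "\<gamma> > 2 / q - 1 / 2" "\<gamma> < 1 / q"
    and r: "1 / r = 1 - 3 / q + 2 * \<gamma>"
  shows "ext_bdd \<gamma> r q"
proof -
  have q0: "q > 0" using q by simp
  have g1: "\<gamma> * q > 0" "\<gamma> * q > 2 - q / 2" "\<gamma> * q < 1"
    using \<gamma> q0 by (simp_all add: field_simps)
  have ri: "1 / r > 1 / q" "1 / r < 1"
  proof -
    have "1 - 3 / q + 2 * (2 / q - 1 / 2) < 1 / r" unfolding r using \<gamma> by simp
    then show "1 / r > 1 / q" by (simp add: field_simps)
    have "2 * \<gamma> < 3 / q" using \<gamma> q0 by (simp add: field_simps)
    then show "1 / r < 1" unfolding r by simp
  qed
  have r0: "r > 0" using ri q0 by (metis less_trans zero_less_divide_1_iff)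
  have r1: "r \<ge> 1" "q \<ge> r" using ri r0 q0 by (auto simp: field_simps)
  have qr: "q / r = q - 3 + 2 * (\<gamma> * q)"
  proof -
    have "q / r = q * (1 / r)" by simp
    also have "\<dots> = q - 3 + 2 * (\<gamma> * q)" unfolding r using q0 by (simp add: field_simps)
    finally show ?thesis .
  qed
  have bound: "\<exists>C\<ge>0. \<forall>\<alpha> (R::real) (d::real) G. R > 0 \<longrightarrow> d > 0 \<longrightarrow> atom \<alpha> d G \<longrightarrow>
      (\<integral>\<^sup>+x. ennreal (norm (arc_ext G x) powr q) * indicator (cball 0 (2 * R)) x \<partial>lborel) \<le> 
      ennreal (C * (R powr (\<gamma> * q) * (d powr (q / r) * (R * d ^ 2) powr (1 - \<kappa> - \<gamma> * q))))"
    if \<kappa>: "0 < \<kappa>" "\<kappa> < 1" "\<kappa> < (q - 2) / 2" for \<kappa>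
  proof -
    \<comment> \<open>Solves \<open>\<kappa> = (q - 2) / (q' - 2)\<close>; then
      \<open>\<kappa> < 1\<close> means \<open>q < q'\<close>, and
      \<open>\<kappa> < (q - 2) / 2\<close> means \<open>q' > 4\<close>.\<close>
    define q' where "q' = 2 + (q - 2) / \<kappa>"
    have q': "q < q'" "q' > 4"
    proof -
      have "\<kappa> * (q - 2) < 1 * (q - 2)" using \<kappa> q by (intro mult_strict_right_mono) auto
      then have "q - 2 < (q - 2) / \<kappa>" using \<kappa> by (simp add: less_divide_eq mult.commute)
      then show "q < q'" by (simp add: q'_def)
      have "2 < (q - 2) / \<kappa>" using \<kappa> by (simp add: less_divide_eq)
      then show "q' > 4" by (simp add: q'_def)
    qed
    have \<kappa>eq: "\<kappa> = (q - 2) / (q' - 2)" using \<kappa> q by (simp add: q'_def)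
    have "\<kappa> * (q' - 2) = q - 2" using \<kappa> by (simp add: q'_def)
    then have \<kappa>2: "\<kappa> * (q' - 4) = q - 2 - 2 * \<kappa>" by (simp add: algebra_simps)
    obtain C1 where C1: "C1 > 0" "\<And>\<alpha> \<delta> G. \<delta> > 0 \<Longrightarrow> atom \<alpha> \<delta> G \<Longrightarrow> 
       (\<integral>\<^sup>+x. ennreal (norm (arc_ext G x) powr q') \<partial>lborel) \<le> ennreal (C1 * \<delta> powr (q' - 3))"
      using atom_Lq[OF q'(2)] by blast
    show ?thesis
    proof (intro exI[of _ "L2c + C1"] conjI allI impI)
      show "0 \<le> L2c + C1" using C1 by (simp add: add_nonneg_nonneg)
      fix \<alpha> R d :: real and G assume R: "R > 0" and d: "d > 0" and G: "atom \<alpha> d G"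
      have "R powr (1 - \<kappa>) * d powr (1 + \<kappa> * (q' - 4)) = 
         R powr (\<gamma> * q) * (d powr (q / r) * (R * d ^ 2) powr (1 - \<kappa> - \<gamma> * q))"
        using R d by (rule powr_rebalance) (simp_all add: qr \<kappa>2)
      then show "(\<integral>\<^sup>+x. ennreal (norm (arc_ext G x) powr q) * indicator (cball 0 (2 * R)) x \<partial>lborel) \<le> 
        ennreal ((L2c + C1) * (R powr (\<gamma> * q) * (d powr (q / r) * (R * d ^ 2) powr (1 - \<kappa> - \<gamma> * q))))"
        using atom_ball_above[OF q q' _ C1(2) G d R \<kappa>eq] C1(1) by simp
    qed
  qed
  define u where "u = 1 - \<gamma> * q"
  have u: "0 < u" "u < 1" "u < (q - 2) / 2" using g1 by (simp_all add: u_def field_simps)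
  define \<kappa>1 where "\<kappa>1 = u / 2"
  define v where "v = min 1 ((q - 2) / 2)"
  have v: "v \<le> 1" "v \<le> (q - 2) / 2" "u < v" unfolding v_def using u by (simp, intro min.cobounded2, simp)
  define \<kappa>2 where "\<kappa>2 = (u + v) / 2"
  have \<kappa>1: "0 < \<kappa>1" "\<kappa>1 < 1" "\<kappa>1 < (q - 2) / 2" "\<kappa>1 < u" using u by (simp_all add: \<kappa>1_def)
  have \<kappa>2: "0 < \<kappa>2" "\<kappa>2 < 1" "\<kappa>2 < (q - 2) / 2" "u < \<kappa>2"
  proof -
    show "0 < \<kappa>2" "\<kappa>2 < 1" "u < \<kappa>2" using u v unfolding \<kappa>2_def by auto
    have "(u + v) / 2 < M" if "u < M" "v \<le> M" for M :: real using that by simp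
    then show "\<kappa>2 < (q - 2) / 2" using u(3) v(2) unfolding \<kappa>2_def by blast
  qed
  obtain Ca where Ca: "Ca \<ge> 0" "\<And>\<alpha> (R::real) (d::real) G. R > 0 \<Longrightarrow> d > 0 \<Longrightarrow> atom \<alpha> d G \<Longrightarrow>
      (\<integral>\<^sup>+x. ennreal (norm (arc_ext G x) powr q) * indicator (cball 0 (2 * R)) x \<partial>lborel) \<le> 
      ennreal (Ca * (R powr (\<gamma> * q) * (d powr (q / r) * (R * d ^ 2) powr (u - \<kappa>1))))"
    using bound[OF \<kappa>1(1-3)] unfolding u_def by (auto simp: algebra_simps)
  obtain Cb where Cb: "Cb \<ge> 0" "\<And>\<alpha> (R::real) (d::real) G. R > 0 \<Longrightarrow> d > 0 \<Longrightarrow> atom \<alpha> d G \<Longrightarrow>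
      (\<integral>\<^sup>+x. ennreal (norm (arc_ext G x) powr q) * indicator (cball 0 (2 * R)) x \<partial>lborel) \<le> 
      ennreal (Cb * (R powr (\<gamma> * q) * (d powr (q / r) * (R * d ^ 2) powr (u - \<kappa>2))))"
    using bound[OF \<kappa>2(1-3)] unfolding u_def by (auto simp: algebra_simps)
  define e where "e = min (u - \<kappa>1) (\<kappa>2 - u)"
  have e: "e > 0" using \<kappa>1 \<kappa>2 by (simp add: e_def)
  define C where "C = Ca + Cb"
  have C: "C \<ge> 0" "C \<ge> Ca" "C \<ge> Cb" using Ca Cb by (simp_all add: C_def)
  show ?thesis
  proof (rule ext_bdd_by_shells[where s = 2 and e = e and C = C])
    fix \<alpha> k l G assume G: "atom \<alpha> ((1/2) ^ l) G"
    define R where "R = (2::real) ^ k"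
    define d where "d = (1/2::real) ^ l"
    have Rd: "R > 0" "d > 0" by (auto simp: R_def d_def)
    note G' = G[folded d_def]
    let ?I = "\<integral>\<^sup>+x. ennreal (norm (arc_ext G x) powr q) * indicator (cball 0 (2 * R)) x \<partial>lborel"
    let ?P = "C * R powr (\<gamma> * q) * d powr (q / r)"
    have 1: "?I \<le> ennreal (?P * (R * d ^ 2) powr (u - \<kappa>1))"
    proof -
      note Ca(2)[OF Rd G']
      also have "ennreal (Ca * (R powr (\<gamma> * q) * (d powr (q / r) * (R * d ^ 2) powr (u - \<kappa>1)))) \<le>
        ennreal (C * (R powr (\<gamma> * q) * (d powr (q / r) * (R * d ^ 2) powr (u - \<kappa>1))))"
        using C by (intro ennreal_leI mult_right_mono) auto
      finally show ?thesis by (simp only: mult.assoc)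
    qed
    have 2: "?I \<le> ennreal (?P * (R * d ^ 2) powr (- (\<kappa>2 - u)))"
    proof -
      note Cb(2)[OF Rd G']
      also have "ennreal (Cb * (R powr (\<gamma> * q) * (d powr (q / r) * (R * d ^ 2) powr (u - \<kappa>2)))) \<le>
        ennreal (C * (R powr (\<gamma> * q) * (d powr (q / r) * (R * d ^ 2) powr (u - \<kappa>2))))"
        using C by (intro ennreal_leI mult_right_mono) auto
      finally show ?thesis by (simp only: mult.assoc minus_diff_eq)
    qed
    have fin: "?I < \<infinity>" using 1 by (rule le_less_trans) simp
    then have I: "?I = ennreal (enn2real ?I)" by (simp add: less_top)
    have "enn2real ?I \<le> ?P * kap e (R * d ^ 2)"
    proof (rule two_sided_kap)
      show "enn2real ?I \<le> ?P * (R * d ^ 2) powr (u - \<kappa>1)" "enn2real ?I \<le> ?P * (R * d ^ 2) powr (- (\<kappa>2 - u))"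
        using 1 2 C by (auto intro!: enn2real_leI mult_nonneg_nonneg)
    qed (use Rd C in \<open>auto simp: e_def\<close>)
    then have "?I \<le> ennreal (?P * kap e (R * d ^ 2))" by (subst I) (rule ennreal_leI)
    then show "(\<integral>\<^sup>+x. ennreal (norm (arc_ext G x) powr q) * indicator (cball 0 (2 ^ Suc k)) x \<partial>lborel) \<le>
      ennreal (C * (2 ^ k) powr (\<gamma> * q) * (((1/2) ^ l) powr (q / r) * kap e (2 ^ k * ((1/2) ^ l) ^ 2)))"
      by (simp add: R_def d_def mult.assoc)
  qed (use r1 e \<gamma> C in auto)
qed

text \<open>On the scaling line the weight gives no room, so atoms are separated instead according to the
  size of the extension: the level \<open>\<mu>\<close> at which an atom is critical is a geometric sequence.\<close>

lemma dominant_term_two_exponents: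
  fixes f a \<mu> \<tau> A q q0 q1 :: real
  assumes f: "f \<ge> 0" and a: "a \<ge> 0" and \<mu>: "\<mu> > 0" and A: "A > 0" and dom: "f \<le> A / kap \<tau> (f / \<mu>) * a"
    and q: "0 < q0" "q0 < q" "q < q1" and \<tau>: "\<tau> * q0 \<le> q - q0" "\<tau> * q1 \<le> q1 - q" "\<tau> > 0"
  shows "f powr q \<le> A powr q0 * \<mu> powr (q - q0) * a powr q0 + A powr q1 * \<mu> powr (q - q1) * a powr q1"
proof (cases "f = 0")
  case True
  then show ?thesis using q by simp
next
  case False
  define z where "z = f / \<mu>"
  have z: "z > 0" using False f \<mu> by (simp add: z_def)
  have fz: "f = \<mu> * z" using \<mu> by (simp add: z_def)
  \<comment> \<open>Holds for any exponent \<open>p\<close> for which the weight absorbs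
    \<open>z powr (q - p)\<close>: \<open>q0\<close> serves values below the level
    \<open>\<mu>\<close>, and \<open>q1\<close> values above it.\<close>
  have gen: "f powr q \<le> A powr p * \<mu> powr (q - p) * a powr p" if p: "p > 0" and zz: "z powr (q - p) \<le> kap \<tau> z powr p" for p
  proof -
    have "f powr q = f powr (q - p) * f powr p" by (simp only: powr_add[symmetric]) simp
    also have "f powr p \<le> (A / kap \<tau> z * a) powr p"
      using dom f p unfolding z_def by (intro powr_mono2) auto
    also have "(A / kap \<tau> z * a) powr p = A powr p / kap \<tau> z powr p * a powr p"
      using A a by (simp add: powr_mult powr_divide)
    also have "f powr (q - p) = \<mu> powr (q - p) * z powr (q - p)" unfolding fz using \<mu> z by (simp add: powr_mult)
    finally have "f powr q \<le> \<mu> powr (q - p) * z powr (q - p) * (A powr p / kap \<tau> z powr p * a powr p)"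
      by (simp add: mult_left_mono)
    also have "\<dots> = (z powr (q - p) / kap \<tau> z powr p) * (A powr p * \<mu> powr (q - p) * a powr p)" by simp
    also have "\<dots> \<le> 1 * (A powr p * \<mu> powr (q - p) * a powr p)"
      using zz by (intro mult_right_mono) (auto simp: divide_le_eq kap_def)
    finally show ?thesis by simp
  qed
  show ?thesis
  proof (cases "z \<le> 1")
    case True
    have "z powr (q - q0) \<le> kap (\<tau> * q0) z" using True z \<tau> by (intro powr_le_kap_small) auto
    then have "f powr q \<le> A powr q0 * \<mu> powr (q - q0) * a powr q0" using q by (intro gen) (auto simp: kap_powr)
    moreover have "0 \<le> A powr q1 * \<mu> powr (q - q1) * a powr q1" by simp
    ultimately show ?thesis by linarith
  next
    case False
    have "z powr (q - q1) \<le> kap (\<tau> * q1) z" using False \<tau> by (intro powr_le_kap_large) auto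
    then have "f powr q \<le> A powr q1 * \<mu> powr (q - q1) * a powr q1" using q by (intro gen) (auto simp: kap_powr)
    moreover have "0 \<le> A powr q0 * \<mu> powr (q - q0) * a powr q0" by simp
    ultimately show ?thesis by linarith
  qed
qed

text \<open>The bound \<open>\<delta> powr (p - 3)\<close> is global and holds for all
  \<open>p > 4\<close>, hence on both sides of \<open>q\<close>. For atoms of measure
  \<open>\<delta>\<close> the level \<open>\<delta> powr (3 / q)\<close> is critical: with it, every
  such \<open>p\<close> produces the same form \<open>\<delta> powr (p / r)\<close>. The sums over
  atoms then close because \<open>p > 4 > r\<close>.\<close>

lemma ext_bdd_scaling_line:
  fixes q r :: real
  assumes q: "q > 4" and r: "1 / r = 1 - 3 / q"
  shows "ext_bdd 0 r q"
proof -
  have "r = 1 / (1 / r)" by simp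
  also have "1 / r = (q - 3) / q" unfolding r using q by (simp add: diff_divide_distrib)
  finally have req: "r = q / (q - 3)" by simp
  have r1: "r \<ge> 1" "r < 4" using q by (auto simp: req field_simps)
  \<comment> \<open>Any exponent strictly between 4 and \<open>q\<close> would do; the pigeonhole
    weights need room on both sides of \<open>q\<close>.\<close>
  define q0 where "q0 = (4 + q) / 2"
  define q1 where "q1 = q + 1"
  have qs: "q0 > 4" "q0 < q" "q < q1" "q1 > 4" using q by (auto simp: q0_def q1_def)
  define \<tau> where "\<tau> = min ((q - q0) / q0) ((q1 - q) / q1)"
  have \<tau>: "\<tau> > 0" "\<tau> * q0 \<le> q - q0" "\<tau> * q1 \<le> q1 - q"
  proof -
    show "\<tau> > 0" using qs by (simp add: \<tau>_def)
    have "\<tau> * q0 \<le> (q - q0) / q0 * q0" using qs by (intro mult_right_mono) (auto simp: \<tau>_def)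
    then show "\<tau> * q0 \<le> q - q0" using qs by simp
    have "\<tau> * q1 \<le> (q1 - q) / q1 * q1" using qs by (intro mult_right_mono) (auto simp: \<tau>_def)
    then show "\<tau> * q1 \<le> q1 - q" using qs by simp
  qed
  define B where "B = (2::real) powr (3 / q)"
  have B: "B > 1" using q by (simp add: B_def gr_one_powr)
  obtain K where K: "K > 0" "\<And>Y n. Y > 0 \<Longrightarrow> (\<Sum>l<n. kap \<tau> (B ^ l * Y)) \<le> K"
    using kap_geometric_sum[OF B \<tau>(1)] by blast
  obtain C0 where C0: "C0 > 0" "\<And>\<alpha> \<delta> G. \<delta> > 0 \<Longrightarrow> atom \<alpha> \<delta> G \<Longrightarrow> 
       (\<integral>\<^sup>+x. ennreal (norm (arc_ext G x) powr q0) \<partial>lborel) \<le> ennreal (C0 * \<delta> powr (q0 - 3))"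
    using atom_Lq[OF qs(1)] by blast
  obtain C1 where C1: "C1 > 0" "\<And>\<alpha> \<delta> G. \<delta> > 0 \<Longrightarrow> atom \<alpha> \<delta> G \<Longrightarrow> 
       (\<integral>\<^sup>+x. ennreal (norm (arc_ext G x) powr q1) \<partial>lborel) \<le> ennreal (C1 * \<delta> powr (q1 - 3))"
    using atom_Lq[OF qs(4)] by blast
  define N where "N = 4 * 2 powr r"
  define \<mu> where "\<mu> l = ((1/2::real) ^ l) powr (3 / q)" for l :: nat
  have \<mu>: "\<mu> l > 0" for l by (simp add: \<mu>_def)
  have \<mu>B: "f / \<mu> l = B ^ l * f" for f l
  proof -
    have "\<mu> l = 1 / B ^ l"
      unfolding \<mu>_def B_def by (simp add: power_one_over powr_divide powr_realpow[symmetric] powr_powr mult.commute)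
    then show ?thesis by simp
  qed
  define D where "D = (2 * K) powr q0 * C0 * N powr (q0 / r) + (2 * K) powr q1 * C1 * N powr (q1 / r)"
  have "(\<integral>\<^sup>+x. ennreal ((norm (arc_ext g x) * wt x powr - 0) powr q) \<partial>lborel) \<le> ennreal D"
    if g[measurable]: "g \<in> borel_measurable borel" and supp: "\<And>t. t \<notin> {\<alpha>..\<alpha>+1} \<Longrightarrow> g t = 0"
      and gr: "(\<integral>\<^sup>+t. ennreal (norm (g t) powr r) \<partial>lborel) \<le> 1" for \<alpha> g
  proof -
    obtain h G where h: "\<And>l. h l \<ge> 0" and G: "\<And>l. atom \<alpha> ((1/2) ^ l) (G l)"
      and sumN: "\<And>n. (\<Sum>l<n. (1/2) ^ l * h l powr r) \<le> N"
      and summ: "\<And>x. summable (\<lambda>l. h l * norm (arc_ext (G l) x))"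
      and dom: "\<And>x. norm (arc_ext g x) \<le> (\<Sum>l. h l * norm (arc_ext (G l) x))"
      using atomic_decomposition[OF g supp r1(1) gr] unfolding N_def by blast
    have [measurable]: "arc_ext (G l) \<in> borel_measurable borel" for l
      using atomD(1)[OF G] by (rule measurable_arc_ext)
    let ?a = "\<lambda>l x. h l * norm (arc_ext (G l) x)"
    define w where "w p l x = ennreal ((2 * K) powr p * \<mu> l powr (q - p) * h l powr p) * ennreal (norm (arc_ext (G l) x) powr p)" for p l x
    have [measurable]: "w p l \<in> borel_measurable borel" for p l unfolding w_def[abs_def] by measurable
    have ex: "\<exists>l. ennreal ((norm (arc_ext g x) * wt x powr - 0) powr q) \<le> w q0 l x + w q1 l x" for x
    proof (cases "arc_ext g x = 0")
      case True
      then show ?thesis by simp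
    next
      case False
      then have f0: "norm (arc_ext g x) > 0" by simp
      have "\<exists>l. norm (arc_ext g x) \<le> 2 * K / kap \<tau> (norm (arc_ext g x) / \<mu> l) * ?a l x"
        using f0 h K(2) by (intro dominant_term[OF summ _ dom]) (auto simp: \<mu>B)
      then obtain l where l: "norm (arc_ext g x) \<le> 2 * K / kap \<tau> (norm (arc_ext g x) / \<mu> l) * ?a l x" ..
      have "norm (arc_ext g x) powr q \<le> (2 * K) powr q0 * \<mu> l powr (q - q0) * ?a l x powr q0 + (2 * K) powr q1 * \<mu> l powr (q - q1) * ?a l x powr q1"
        using K h[of l] \<mu>[of l] qs \<tau> by (intro dominant_term_two_exponents[OF _ _ _ _ l]) auto
      also have "\<dots> = (2 * K) powr q0 * \<mu> l powr (q - q0) * h l powr q0 * norm (arc_ext (G l) x) powr q0 + 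
           (2 * K) powr q1 * \<mu> l powr (q - q1) * h l powr q1 * norm (arc_ext (G l) x) powr q1"
        using h[of l] by (simp add: powr_mult)
      finally have "ennreal (norm (arc_ext g x) powr q) \<le> w q0 l x + w q1 l x"
        by (simp add: w_def ennreal_mult[symmetric] ennreal_plus[symmetric] ennreal_leI del: ennreal_plus)
      then show ?thesis by (intro exI[of _ l]) (simp add: wt_ge_1[THEN order_trans[rotated]] less_imp_neq[OF wt_pos, symmetric])
    qed
    have wint: "(\<Sum>l. \<integral>\<^sup>+x. w p l x \<partial>lborel) \<le> ennreal ((2 * K) powr p * C * N powr (p / r))"
      if p: "p > 4" and C: "C > 0" "\<And>\<alpha> \<delta> G. \<delta> > 0 \<Longrightarrow> atom \<alpha> \<delta> G \<Longrightarrow> 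
       (\<integral>\<^sup>+x. ennreal (norm (arc_ext G x) powr p) \<partial>lborel) \<le> ennreal (C * \<delta> powr (p - 3))" for p C
    proof -
      have one: "(\<integral>\<^sup>+x. w p l x \<partial>lborel) \<le> ennreal ((2 * K) powr p * C) * ennreal (h l powr p * ((1/2) ^ l) powr (p / r))" for l
      proof -
        have "(\<integral>\<^sup>+x. w p l x \<partial>lborel) = ennreal ((2 * K) powr p * \<mu> l powr (q - p) * h l powr p) * (\<integral>\<^sup>+x. ennreal (norm (arc_ext (G l) x) powr p) \<partial>lborel)"
          unfolding w_def by (rule nn_integral_cmult) simp
        also have "\<dots> \<le> ennreal ((2 * K) powr p * \<mu> l powr (q - p) * h l powr p) * ennreal (C * ((1/2) ^ l) powr (p - 3))"
          by (intro mult_left_mono C(2)[OF _ G]) auto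
        also have "\<dots> = ennreal ((2 * K) powr p * C * (h l powr p * (\<mu> l powr (q - p) * ((1/2) ^ l) powr (p - 3))))"
          using C(1) by (simp add: ennreal_mult[symmetric] mult_ac)
        also have "\<mu> l powr (q - p) * ((1/2) ^ l) powr (p - 3) = ((1/2) ^ l) powr (p / r)"
        proof -
          have "\<mu> l powr (q - p) * ((1/2) ^ l) powr (p - 3) = ((1/2) ^ l) powr (3 / q * (q - p) + (p - 3))"
            unfolding \<mu>_def powr_powr powr_add ..
          also have "3 / q * (q - p) + (p - 3) = p / r"
            using q by (simp add: req field_simps)
          finally show ?thesis .
        qed
        finally show ?thesis using C(1) by (simp add: ennreal_mult)
      qed
      have "(\<Sum>l. \<integral>\<^sup>+x. w p l x \<partial>lborel) \<le> (\<Sum>l. ennreal ((2 * K) powr p * C) * ennreal (h l powr p * ((1/2) ^ l) powr (p / r)))"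
        by (intro suminf_le one) auto
      also have "\<dots> = ennreal ((2 * K) powr p * C) * (\<Sum>l. ennreal (h l powr p * ((1/2) ^ l) powr (p / r)))"
        by simp
      also have "\<dots> \<le> ennreal ((2 * K) powr p * C) * ennreal (N powr (p / r))"
        using p r1 by (intro mult_left_mono atomic_norm_sum h sumN) auto
      finally show ?thesis using C(1) by (simp add: ennreal_mult)
    qed
    have "(\<integral>\<^sup>+x. ennreal ((norm (arc_ext g x) * wt x powr - 0) powr q) \<partial>lborel) \<le> (\<Sum>l. \<integral>\<^sup>+x. w q0 l x + w q1 l x \<partial>lborel)"
      by (rule nn_integral_le_suminf[OF _ ex]) simp
    also have "\<dots> = (\<Sum>l. (\<integral>\<^sup>+x. w q0 l x \<partial>lborel) + (\<integral>\<^sup>+x. w q1 l x \<partial>lborel))"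
      by (intro suminf_cong nn_integral_add) auto
    also have "\<dots> = (\<Sum>l. \<integral>\<^sup>+x. w q0 l x \<partial>lborel) + (\<Sum>l. \<integral>\<^sup>+x. w q1 l x \<partial>lborel)"
      by (rule suminf_add[symmetric]) auto
    also have "\<dots> \<le> ennreal ((2 * K) powr q0 * C0 * N powr (q0 / r)) + ennreal ((2 * K) powr q1 * C1 * N powr (q1 / r))"
      by (intro add_mono wint qs C0 C1)
    also have "\<dots> = ennreal D" using C0 C1 by (simp add: D_def)
    finally show ?thesis .
  qed
  moreover have "D \<ge> 0" using C0 C1 by (simp add: D_def)
  ultimately show ?thesis unfolding ext_bdd_def by blast
qed

subsection \<open>Bounds in the angular variable\<close>

lemma ext_bddI:
  assumes "C \<ge> 0" "\<And>\<alpha> g. g \<in> borel_measurable borel \<Longrightarrow> (\<And>t. t \<notin> {\<alpha>..\<alpha>+1} \<Longrightarrow> g t = 0) \<Longrightarrow>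
     (\<integral>\<^sup>+t. ennreal (norm (g t) powr r) \<partial>lborel) \<le> 1 \<Longrightarrow>
     (\<integral>\<^sup>+x. ennreal ((norm (arc_ext g x) * wt x powr - \<gamma>) powr q) \<partial>lborel) \<le> ennreal C"
  shows "ext_bdd \<gamma> r q"
  unfolding ext_bdd_def using assms by blast

text \<open>Joins the scaling line to the interior: at \<open>\<gamma> = 0\<close> the lower bound
  on \<open>\<gamma>\<close> forces \<open>q > 4\<close>.\<close>

lemma ext_bdd_core:
  fixes q r \<gamma> :: real
  assumes q: "q > 2" and \<gamma>: "\<gamma> \<ge> 0" "\<gamma> > 2 / q - 1 / 2" "\<gamma> < 1 / q"
    and r: "1 / r = 1 - 3 / q + 2 * \<gamma>"
  shows "ext_bdd \<gamma> r q"
proof (cases "\<gamma> = 0")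
  case True
  then have "2 / q < 1 / 2" using \<gamma> by simp
  then have "q > 4" using q by (simp add: field_simps)
  then show ?thesis using ext_bdd_scaling_line[of q r] r True by simp
next
  case False
  then show ?thesis using ext_bdd_above_dual[OF q _ \<gamma>(2,3) r] \<gamma>(1) by simp
qed

lemma wt_powr_mono:
  assumes "\<gamma>1 \<le> \<gamma>" shows "wt x powr - \<gamma> \<le> wt x powr - \<gamma>1"
  using assms wt_ge_1[of x] by (intro powr_mono) auto

lemma ext_bdd_mono:
  assumes "ext_bdd \<gamma>1 r q" "\<gamma>1 \<le> \<gamma>" "q \<ge> 0"
  shows "ext_bdd \<gamma> r q"
proof -
  obtain C where C: "C \<ge> 0" "\<And>\<alpha> g. g \<in> borel_measurable borel \<Longrightarrow> (\<And>t. t \<notin> {\<alpha>..\<alpha>+1} \<Longrightarrow> g t = 0) \<Longrightarrow>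
     (\<integral>\<^sup>+t. ennreal (norm (g t) powr r) \<partial>lborel) \<le> 1 \<Longrightarrow>
     (\<integral>\<^sup>+x. ennreal ((norm (arc_ext g x) * wt x powr - \<gamma>1) powr q) \<partial>lborel) \<le> ennreal C"
    using assms(1) unfolding ext_bdd_def by blast
  show ?thesis
  proof (rule ext_bddI[OF C(1)])
    fix \<alpha> :: real and g :: "real \<Rightarrow> complex"
    assume g: "g \<in> borel_measurable borel" "\<And>t. t \<notin> {\<alpha>..\<alpha>+1} \<Longrightarrow> g t = 0" "(\<integral>\<^sup>+t. ennreal (norm (g t) powr r) \<partial>lborel) \<le> 1"
    have "(\<integral>\<^sup>+x. ennreal ((norm (arc_ext g x) * wt x powr - \<gamma>) powr q) \<partial>lborel) \<le> (\<integral>\<^sup>+x. ennreal ((norm (arc_ext g x) * wt x powr - \<gamma>1) powr q) \<partial>lborel)"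
      using assms by (intro nn_integral_mono ennreal_leI powr_mono2 mult_left_mono wt_powr_mono) auto
    also note C(2)[OF g]
    finally show "(\<integral>\<^sup>+x. ennreal ((norm (arc_ext g x) * wt x powr - \<gamma>) powr q) \<partial>lborel) \<le> ennreal C" .
  qed
qed

lemma wt_integrable:
  assumes s: "s > 2"
  shows "(\<integral>\<^sup>+x. ennreal (wt x powr - s) \<partial>lborel) < \<infinity>"
proof -
  define \<theta> where "\<theta> = (2::real) powr (2 - s)"
  have \<theta>: "0 \<le> \<theta>" "\<theta> < 1" using s by (auto simp: \<theta>_def powr_less_one)
  let ?v = "\<lambda>k x. ennreal ((2 ^ k) powr - s) * indicator (cball (0 :: real \<times> real) (2 ^ Suc k)) x"
  have "(\<integral>\<^sup>+x. ennreal (wt x powr - s) \<partial>lborel) \<le> (\<Sum>k. \<integral>\<^sup>+x. ?v k x \<partial>lborel)"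
  proof (rule nn_integral_le_suminf)
    fix x
    obtain k where k: "2 ^ k \<le> wt x" "wt x < 2 ^ Suc k" by (rule wt_dyadic)
    have "x \<in> cball 0 (2 ^ Suc k)" using k(2) norm_le_wt[of x] by simp
    moreover have "wt x powr - s \<le> (2 ^ k) powr - s" using k(1) s by (intro powr_mono2') auto
    ultimately have "ennreal (wt x powr - s) \<le> ?v k x" by (simp add: ennreal_leI)
    then show "\<exists>k. ennreal (wt x powr - s) \<le> ?v k x" by blast
    show "?v k \<in> borel_measurable lborel" for k
      by (intro borel_measurable_times_ennreal borel_measurable_const borel_measurable_indicator) simp
  qed
  also have "\<dots> \<le> (\<Sum>k. ennreal (16 * \<theta> ^ k))"
  proof (intro suminf_le)
    fix k
    have "(\<integral>\<^sup>+x. ?v k x \<partial>lborel) = ennreal ((2 ^ k) powr - s) * emeasure lborel (cball (0 :: real \<times> real) (2 ^ Suc k))"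
      by (rule nn_integral_cmult_indicator) simp
    also have "\<dots> \<le> ennreal ((2 ^ k) powr - s) * ennreal (4 * (2 ^ Suc k)\<^sup>2)"
      by (intro mult_left_mono emeasure_cball_plane) auto
    also have "\<dots> = ennreal (16 * ((2 ^ k) powr - s * (2 ^ k) powr 2))"
      by (simp add: ennreal_mult[symmetric] power_mult_distrib mult_ac)
    also have "(2 ^ k) powr - s * (2 ^ k) powr 2 = \<theta> ^ k"
      unfolding powr_add[symmetric] by (simp add: \<theta>_def powr_realpow[symmetric] powr_powr mult.commute)
    finally show "(\<integral>\<^sup>+x. ?v k x \<partial>lborel) \<le> ennreal (16 * \<theta> ^ k)" .
  qed auto
  also have "\<dots> = ennreal (\<Sum>k. 16 * \<theta> ^ k)"
    using \<theta> by (intro suminf_ennreal2 summable_mult summable_geometric) auto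
  also have "\<dots> < \<infinity>" by simp
  finally show ?thesis .
qed

text \<open>Hoelder's inequality against a power of the weight, carried out pointwise so that it
  also covers \<open>q < 1\<close>: where the weighted extension exceeds
  \<open>wt x powr - \<sigma>\<close> its larger power dominates, elsewhere an integrable power of
  the weight does.\<close>

lemma ext_bdd_lower_exponent:
  fixes q q1 \<gamma> \<gamma>1 r :: real
  assumes b: "ext_bdd \<gamma>1 r q1" and q: "0 < q" "q < q1" and \<gamma>: "\<gamma> - 2 / q > \<gamma>1 - 2 / q1"
  shows "ext_bdd \<gamma> r q"
proof -
  obtain C where C: "C \<ge> 0" "\<And>\<alpha> g. g \<in> borel_measurable borel \<Longrightarrow> (\<And>t. t \<notin> {\<alpha>..\<alpha>+1} \<Longrightarrow> g t = 0) \<Longrightarrow>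
     (\<integral>\<^sup>+t. ennreal (norm (g t) powr r) \<partial>lborel) \<le> 1 \<Longrightarrow>
     (\<integral>\<^sup>+x. ennreal ((norm (arc_ext g x) * wt x powr - \<gamma>1) powr q1) \<partial>lborel) \<le> ennreal C"
    using b unfolding ext_bdd_def by blast
  define \<theta> where "\<theta> = \<gamma> - \<gamma>1"
  \<comment> \<open>Balances the two cases. The assumed gap between \<open>\<gamma> - 2 / q\<close>
    and \<open>\<gamma>1 - 2 / q1\<close> becomes \<open>\<sigma> * q1 > 2\<close>, which is
    integrability in the plane.\<close>
  define \<sigma> where "\<sigma> = \<theta> * q / (q1 - q)"
  have \<theta>: "\<theta> > 2 / q - 2 / q1" using \<gamma> by (simp add: \<theta>_def)
  have "2 / q - 2 / q1 > 0" using q by (simp add: field_simps)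
  then have \<theta>0: "\<theta> > 0" using \<theta> by linarith
  have \<sigma>0: "\<sigma> > 0" using \<theta>0 q by (simp add: \<sigma>_def)
  have \<sigma>1: "\<sigma> * (q1 - q) = \<theta> * q" using q by (simp add: \<sigma>_def)
  have \<sigma>2: "\<sigma> * q1 > 2"
  proof -
    have "(2 / q - 2 / q1) * (q * q1) < \<theta> * (q * q1)" using \<theta> q by (intro mult_strict_right_mono) auto
    moreover have "(2 / q - 2 / q1) * (q * q1) = 2 * (q1 - q)" using q by (simp add: field_simps)
    moreover have "\<theta> * (q * q1) = (\<sigma> * (q1 - q)) * q1" unfolding \<sigma>1 by simp
    ultimately have "2 * (q1 - q) < (\<sigma> * q1) * (q1 - q)" by (simp only: mult.assoc mult.commute[of "q1 - q" q1])
    then show ?thesis by (rule mult_right_less_imp_less) (use q in simp)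
  qed
  define W where "W = enn2real (\<integral>\<^sup>+x. ennreal (wt x powr - (\<sigma> * q1)) \<partial>lborel)"
  have W: "(\<integral>\<^sup>+x. ennreal (wt x powr - (\<sigma> * q1)) \<partial>lborel) = ennreal W"
    using wt_integrable[OF \<sigma>2] by (simp add: W_def less_top)
  show ?thesis
  proof (rule ext_bddI[of "C + W"])
    show "C + W \<ge> 0" using C by (simp add: W_def)
    fix \<alpha> :: real and g :: "real \<Rightarrow> complex"
    assume g: "g \<in> borel_measurable borel" "\<And>t. t \<notin> {\<alpha>..\<alpha>+1} \<Longrightarrow> g t = 0" "(\<integral>\<^sup>+t. ennreal (norm (g t) powr r) \<partial>lborel) \<le> 1"
    note [measurable] = g(1)
    have pw: "(norm (arc_ext g x) * wt x powr - \<gamma>) powr q \<le> (norm (arc_ext g x) * wt x powr - \<gamma>1) powr q1 + wt x powr - (\<sigma> * q1)" for x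
    proof -
      define f where "f = norm (arc_ext g x) * wt x powr - \<gamma>1"
      have f0: "f \<ge> 0" by (simp add: f_def)
      have "norm (arc_ext g x) * wt x powr - \<gamma> = f * wt x powr - \<theta>"
        unfolding f_def \<theta>_def mult.assoc powr_add[symmetric] by simp
      then have eq: "(norm (arc_ext g x) * wt x powr - \<gamma>) powr q = f powr q * wt x powr - (\<theta> * q)"
        using f0 by (simp add: powr_mult powr_powr)
      show ?thesis
      proof (cases "f \<ge> wt x powr - \<sigma>")
        case True
        have fpos: "f > 0" by (rule less_le_trans[OF _ True]) (simp add: less_imp_neq[OF wt_pos, symmetric])
        have "f powr (q - q1) \<le> (wt x powr - \<sigma>) powr (q - q1)" using True q by (intro powr_mono2') (auto simp: less_imp_neq[OF wt_pos, symmetric])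
        also have "\<dots> = wt x powr (\<theta> * q)" unfolding powr_powr using \<sigma>1 by (simp add: algebra_simps)
        finally have "f powr q1 * f powr (q - q1) * wt x powr - (\<theta> * q) \<le> f powr q1 * wt x powr (\<theta> * q) * wt x powr - (\<theta> * q)"
          by (intro mult_right_mono mult_left_mono) auto
        also have "\<dots> = f powr q1" 
          unfolding mult.assoc powr_add[symmetric] by (simp add: less_imp_neq[OF wt_pos, symmetric])
        also have "f powr q1 * f powr (q - q1) = f powr q" unfolding powr_add[symmetric] by simp
        finally show ?thesis unfolding eq f_def[symmetric] using powr_ge_zero[of "wt x" "- (\<sigma> * q1)"] by linarith
      next
        case False
        then have "f powr q \<le> (wt x powr - \<sigma>) powr q" using f0 q by (intro powr_mono2) auto
        then have "f powr q * wt x powr - (\<theta> * q) \<le> (wt x powr - \<sigma>) powr q * wt x powr - (\<theta> * q)"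
          by (intro mult_right_mono) auto
        also have "\<dots> = wt x powr (- \<sigma> * q + - (\<theta> * q))" unfolding powr_powr powr_add ..
        also have "- \<sigma> * q + - (\<theta> * q) = - (\<sigma> * q1)" using \<sigma>1 by (simp add: algebra_simps)
        finally show ?thesis unfolding eq f_def[symmetric] using powr_ge_zero[of f q1] by linarith
      qed
    qed
    have "(\<integral>\<^sup>+x. ennreal ((norm (arc_ext g x) * wt x powr - \<gamma>) powr q) \<partial>lborel) \<le> 
      (\<integral>\<^sup>+x. ennreal ((norm (arc_ext g x) * wt x powr - \<gamma>1) powr q1) + ennreal (wt x powr - (\<sigma> * q1)) \<partial>lborel)"
      using pw by (intro nn_integral_mono) (simp add: ennreal_plus[symmetric] ennreal_leI del: ennreal_plus)
    also have "\<dots> = (\<integral>\<^sup>+x. ennreal ((norm (arc_ext g x) * wt x powr - \<gamma>1) powr q1) \<partial>lborel) + ennreal W"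
      unfolding W[symmetric] by (rule nn_integral_add) auto
    also have "\<dots> \<le> ennreal C + ennreal W" by (intro add_right_mono C(2)[OF g])
    also have "\<dots> = ennreal (C + W)" using C by (simp add: W_def)
    finally show "(\<integral>\<^sup>+x. ennreal ((norm (arc_ext g x) * wt x powr - \<gamma>) powr q) \<partial>lborel) \<le> ennreal (C + W)" .
  qed
qed

text \<open>The extension is bounded by the mass of \<open>g\<close>, and the weight alone is
  integrable.\<close>

lemma ext_bdd_L1:
  assumes q: "q > 0" and \<gamma>: "\<gamma> > 2 / q"
  shows "ext_bdd \<gamma> 1 q"
proof -
  have gq: "\<gamma> * q > 2" using assms by (simp add: field_simps)
  define W where "W = enn2real (\<integral>\<^sup>+x. ennreal (wt x powr - (\<gamma> * q)) \<partial>lborel)"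
  have W: "(\<integral>\<^sup>+x. ennreal (wt x powr - (\<gamma> * q)) \<partial>lborel) = ennreal W"
    using wt_integrable[OF gq] by (simp add: W_def less_top)
  show ?thesis
  proof (rule ext_bddI[of W])
    show "W \<ge> 0" by (simp add: W_def)
    fix \<alpha> :: real and g :: "real \<Rightarrow> complex"
    assume g[measurable]: "g \<in> borel_measurable borel" and "(\<integral>\<^sup>+t. ennreal (norm (g t) powr 1) \<partial>lborel) \<le> 1"
    then have 1: "(\<integral>\<^sup>+t. ennreal (norm (g t)) \<partial>lborel) \<le> 1" by simp
    then have i: "integrable lborel g" by (intro integrableI_bounded) (auto intro: le_less_trans)
    have "norm (arc_ext g x) \<le> 1" for x
    proof -
      have "ennreal (norm (arc_ext g x)) \<le> ennreal 1" using order_trans[OF norm_arc_ext_le[OF i] 1] by simp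
      then show ?thesis by (simp only: ennreal_le_iff zero_le_one)
    qed
    then have "(norm (arc_ext g x) * wt x powr - \<gamma>) powr q \<le> (1 * wt x powr - \<gamma>) powr q" for x
      using q by (intro powr_mono2 mult_right_mono) auto
    then have "(\<integral>\<^sup>+x. ennreal ((norm (arc_ext g x) * wt x powr - \<gamma>) powr q) \<partial>lborel) \<le> 
      (\<integral>\<^sup>+x. ennreal (wt x powr - (\<gamma> * q)) \<partial>lborel)"
      by (intro nn_integral_mono ennreal_leI) (simp add: powr_powr)
    then show "(\<integral>\<^sup>+x. ennreal ((norm (arc_ext g x) * wt x powr - \<gamma>) powr q) \<partial>lborel) \<le> ennreal W" unfolding W .
  qed
qed

text \<open>Apart from \<open>\<rho> = 0\<close>, each point of the open region is deduced from a
  point of the critical line in \<open>ext_bdd_core\<close> by relaxing \<open>r\<close>,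
  \<open>\<gamma>\<close> or \<open>q\<close>; the strict inequalities leave the necessary room. In
  the coordinate \<open>x = 1 / q\<close> the conditions are linear. The exponent \<open>r\<close>
  obtained is finite even for \<open>\<rho> = 1\<close>.\<close>

lemma ext_bdd_open_region:
  fixes q \<gamma> \<rho> :: real
  assumes q: "q > 0" and \<gamma>0: "\<gamma> \<ge> 0" and \<rho>: "0 \<le> \<rho>" "\<rho> \<le> 1"
    and \<gamma>: "\<gamma> > 3 / (2 * q) - \<rho> / 2" "\<gamma> > 2 / q - \<rho>" "\<gamma> > 2 / q - 1 / 2"
  shows "\<exists>r\<ge>1. 1 - 1 / r \<le> \<rho> \<and> ext_bdd \<gamma> r q"
proof (cases "\<rho> = 0")
  case True
  then show ?thesis using ext_bdd_L1[OF q] \<gamma> by (intro exI[of _ 1]) auto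
next
  case False
  then have \<rho>0: "\<rho> > 0" using \<rho> by simp
  \<comment> \<open>Reads off the exponent \<open>r\<close> that puts \<open>\<gamma>1\<close> and
    \<open>q1\<close> on the critical line; the last hypothesis says that it is no larger than the
    given one.\<close>
  have core: "\<exists>r\<ge>1. 1 - 1 / r \<le> \<rho> \<and> ext_bdd \<gamma>1 r q1"
    if a: "q1 > 2" "\<gamma>1 \<ge> 0" "\<gamma>1 > 2 / q1 - 1 / 2" "\<gamma>1 < 1 / q1" "3 / q1 - 2 * \<gamma>1 \<le> \<rho>" for q1 \<gamma>1
  proof -
    define y where "y = 1 / q1"
    have y0: "y > 0" "y < 1 / 2" using a(1) by (auto simp: y_def field_simps)
    have ay: "\<gamma>1 > 2 * y - 1 / 2" "\<gamma>1 < y" "3 * y - 2 * \<gamma>1 \<le> \<rho>" using a by (auto simp: y_def)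
    define r where "r = 1 / (1 - 3 * y + 2 * \<gamma>1)"
    have r: "1 / r = 1 - 3 * y + 2 * \<gamma>1" by (simp add: r_def)
    have "1 - 3 * y + 2 * \<gamma>1 > 0" "1 - 3 * y + 2 * \<gamma>1 \<le> 1" using ay y0 by auto
    then have "r \<ge> 1" by (simp add: r_def)
    moreover have "1 - 1 / r \<le> \<rho>" using r ay by simp
    moreover have "ext_bdd \<gamma>1 r q1"
      using a r by (intro ext_bdd_core) (auto simp: y_def)
    ultimately show ?thesis by blast
  qed
  define x where "x = 1 / q"
  have x0: "x > 0" using q by (simp add: x_def)
  have xg: "\<gamma> > 3 / 2 * x - \<rho> / 2" "\<gamma> > 2 * x - \<rho>" "\<gamma> > 2 * x - 1 / 2" using \<gamma> by (auto simp: x_def)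
  have q2: "q > 2 \<longleftrightarrow> x < 1 / 2" using q by (auto simp: x_def field_simps)
  show ?thesis
  proof (cases "\<gamma> < x")
    case True
    then have "q > 2" unfolding q2 using xg by linarith
    then show ?thesis using core[of q \<gamma>] True xg \<gamma>0 \<gamma> by (simp add: x_def)
  next
    case False
    show ?thesis
    proof (cases "\<gamma> = x")
      case True
      then have x: "x < \<rho>" "x < 1 / 2" using xg by auto
      \<comment> \<open>\<open>ext_bdd_core\<close> requires \<open>\<gamma> < 1 / q\<close>, so
        \<open>\<gamma>\<close> is lowered by less than the slack of each strict inequality.\<close>
      define \<eta> where "\<eta> = min (min (x / 2) ((\<rho> - x) / 2)) ((1 / 2 - x) / 2)"
      have \<eta>: "\<eta> > 0" "\<eta> \<le> x / 2" "\<eta> \<le> (\<rho> - x) / 2" "\<eta> \<le> (1 / 2 - x) / 2"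
        using x x0 unfolding \<eta>_def by (simp, (simp only: min_le_iff_disj, simp)+)
      have "\<exists>r\<ge>1. 1 - 1 / r \<le> \<rho> \<and> ext_bdd (x - \<eta>) r q"
      proof (rule core)
        show "q > 2" using x q2 by simp
        show "x - \<eta> \<ge> 0" using \<eta> x0 by simp
        have "x - \<eta> > 2 * x - 1 / 2" using \<eta> x by argo
        then show "x - \<eta> > 2 / q - 1 / 2" by (simp add: x_def)
        show "x - \<eta> < 1 / q" using \<eta> by (simp add: x_def)
        have "3 * x - 2 * (x - \<eta>) \<le> \<rho>" using \<eta> by argo
        then show "3 / q - 2 * (x - \<eta>) \<le> \<rho>" by (simp add: x_def)
      qed
      then show ?thesis using ext_bdd_mono[of "x - \<eta>" _ q \<gamma>] True \<eta> q by auto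
    next
      case ne: False
      then have gx: "\<gamma> > x" using \<open>\<not> \<gamma> < x\<close> by simp
      \<comment> \<open>For \<open>\<gamma> > 1 / q\<close> a larger exponent
        \<open>q1 = 1 / y\<close> is used; \<open>lo\<close> and \<open>hi\<close> collect the
        constraints on \<open>y\<close>.\<close>
      define lo where "lo = max 0 (2 * x - \<gamma>)"
      define hi where "hi = min (min \<rho> (1 / 2)) x"
      have "lo < hi" using gx xg x0 \<rho>0 unfolding lo_def hi_def max_less_iff_conj min_less_iff_conj by auto
      define y where "y = (lo + hi) / 2"
      have "lo < y" "y < hi" using \<open>lo < hi\<close> by (auto simp: y_def)
      then have y: "y > 0" "y > 2 * x - \<gamma>" "y < \<rho>" "y < 1 / 2" "y < x"
        unfolding lo_def hi_def max_less_iff_conj min_less_iff_conj by auto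
      \<comment> \<open>The weight exponent will be \<open>y - \<eta>\<close>, just below
        \<open>1 / q1\<close> as \<open>core\<close> demands and within half of every slack.\<close>
      define \<eta> where "\<eta> = min (min (y / 2) ((\<rho> - y) / 2)) (min ((1 / 2 - y) / 2) ((y - (2 * x - \<gamma>)) / 2))"
      have \<eta>: "\<eta> > 0" using y by (simp add: \<eta>_def)
      have \<eta>l: "\<eta> \<le> y / 2" "\<eta> \<le> (\<rho> - y) / 2" "\<eta> \<le> (1 / 2 - y) / 2" "\<eta> \<le> (y - (2 * x - \<gamma>)) / 2"
        unfolding \<eta>_def by (simp_all only: min_le_iff_disj) simp_all
      define q1 where "q1 = 1 / y"
      have yq: "1 / q1 = y" by (simp add: q1_def)
      have y2: "2 / q1 = 2 * y" "3 / q1 = 3 * y" by (simp_all add: q1_def)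
      have qq1: "q < q1" using y q by (simp add: q1_def x_def field_simps)
      have "\<exists>r\<ge>1. 1 - 1 / r \<le> \<rho> \<and> ext_bdd (y - \<eta>) r q1"
      proof (rule core)
        show "q1 > 2" using y by (simp add: q1_def field_simps)
        show "y - \<eta> \<ge> 0" using \<eta>l y by argo
        show "y - \<eta> > 2 / q1 - 1 / 2" unfolding y2 using \<eta>l(3) y(4) by argo
        show "y - \<eta> < 1 / q1" unfolding yq using \<eta> by simp
        show "3 / q1 - 2 * (y - \<eta>) \<le> \<rho>" unfolding y2 using \<eta>l(2) y by argo
      qed
      then obtain r where r: "r \<ge> 1" "1 - 1 / r \<le> \<rho>" "ext_bdd (y - \<eta>) r q1" by blast
      have "2 / q = 2 * x" by (simp add: x_def)
      then have "\<gamma> - 2 / q > y - \<eta> - 2 / q1" unfolding y2 using \<eta> \<eta>l(4) y(2) by argo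
      then show ?thesis using ext_bdd_lower_exponent[OF r(3) q qq1] r by blast
    qed
  qed
qed

subsection \<open>Transfer to the circle\<close>

definition on_circle :: "(real \<times> real \<Rightarrow> complex) \<Rightarrow> real \<Rightarrow> complex" where
  "on_circle F t = indicator {0..<2 * pi} t *\<^sub>R F (circ t)"

lemma sets_circle_measure: "sets circle_measure = sets (restrict_space borel (sphere 0 1))"
  by (simp add: circle_measure_def)

lemma circ_measurable_circle: 
  "circ \<in> restrict_space lborel {0..<2 * pi} \<rightarrow>\<^sub>M restrict_space borel (sphere (0 :: real \<times> real) 1)"
  using circle_param_measurable by (simp add: circ_def[abs_def])

lemma circle_measure_circ: 
  "circle_measure = distr (restrict_space lborel {0..<2 * pi}) (restrict_space borel (sphere 0 1)) circ"
  by (simp add: circle_measure_def circ_def[abs_def])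

lemma measurable_circle_measure_eq: "borel_measurable circle_measure = borel_measurable (restrict_space borel (sphere 0 1))"
  by (intro measurable_cong_sets sets_circle_measure refl)

lemma circle_nn_integral:
  fixes \<phi> :: "real \<times> real \<Rightarrow> ennreal"
  assumes "\<phi> \<in> borel_measurable circle_measure"
  shows "(\<integral>\<^sup>+\<omega>. \<phi> \<omega> \<partial>circle_measure) = (\<integral>\<^sup>+t. \<phi> (circ t) * indicator {0..<2 * pi} t \<partial>lborel)"
proof -
  have "(\<integral>\<^sup>+\<omega>. \<phi> \<omega> \<partial>circle_measure) = (\<integral>\<^sup>+t. \<phi> (circ t) \<partial>restrict_space lborel {0..<2 * pi})"
    using assms unfolding circle_measure_circ by (intro nn_integral_distr[OF circ_measurable_circle]) simp
  also have "\<dots> = (\<integral>\<^sup>+t. \<phi> (circ t) * indicator {0..<2 * pi} t \<partial>lborel)"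
    by (rule nn_integral_restrict_space) simp
  finally show ?thesis .
qed

lemma circle_AE:
  assumes "AE \<omega> in circle_measure. P \<omega>" 
  shows "AE t in lborel. t \<in> {0..<2 * pi} \<longrightarrow> P (circ t)"
proof -
  have "AE t in restrict_space lborel {0..<2 * pi}. P (circ t)"
    using AE_distrD[OF circ_measurable_circle] assms unfolding circle_measure_circ by blast
  then show ?thesis by (subst (asm) AE_restrict_space_iff) auto
qed

lemma measurable_on_circle:
  assumes "F \<in> borel_measurable circle_measure"
  shows "on_circle F \<in> borel_measurable borel"
proof -
  have "(\<lambda>t. F (circ t)) \<in> borel_measurable (restrict_space lborel {0..<2 * pi})"
    using measurable_compose[OF circ_measurable_circle] assms unfolding measurable_circle_measure_eq by blast
  then show ?thesis unfolding on_circle_def[abs_def]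
    by (subst (asm) borel_measurable_restrict_space_iff) auto
qed

lemma extension_op_eq:
  assumes F: "F \<in> borel_measurable circle_measure"
  shows "extension_op F z = 1 / (2 * of_real pi) * arc_ext (on_circle F) z"
proof -
  have "(\<lambda>\<omega>. exp (\<i> * of_real (z \<bullet> \<omega>))) \<in> borel_measurable circle_measure"
    unfolding measurable_circle_measure_eq
    by (intro measurable_restrict_space1 borel_measurable_continuous_onI continuous_intros)
  then have m: "(\<lambda>\<omega>. exp (\<i> * of_real (z \<bullet> \<omega>)) * F \<omega>) \<in> borel_measurable circle_measure"
    using F by (rule borel_measurable_times)
  have "(\<integral>\<omega>. exp (\<i> * of_real (z \<bullet> \<omega>)) * F \<omega> \<partial>circle_measure) = 
     (\<integral>t. exp (\<i> * of_real (z \<bullet> circ t)) * F (circ t) \<partial>restrict_space lborel {0..<2 * pi})"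
    using m unfolding measurable_circle_measure_eq 
    unfolding circle_measure_circ by (intro integral_distr[OF circ_measurable_circle])
  also have "\<dots> = (\<integral>t. indicator {0..<2 * pi} t *\<^sub>R (exp (\<i> * of_real (z \<bullet> circ t)) * F (circ t)) \<partial>lborel)"
    by (rule integral_restrict_space) simp
  also have "\<dots> = arc_ext (on_circle F) z"
    unfolding arc_ext_def on_circle_def by (intro Bochner_Integration.integral_cong) (auto simp: cis_conv_exp mult_ac)
  finally show ?thesis by (simp add: extension_op_def)
qed

lemma norm_weighted_extension_op:
  assumes F: "F \<in> borel_measurable circle_measure"
  shows "norm (weighted_extension_op \<gamma> F z) = norm (arc_ext (on_circle F) z) * wt z powr - \<gamma> / (2 * pi)"
  by (cases z) (simp add: weighted_extension_op_def extension_op_eq[OF F] norm_mult norm_divide wt_def)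

lemma div_two_pi_le:
  fixes a :: real assumes "a \<ge> 0" shows "a / (2 * pi) \<le> a"
proof -
  have "a * 1 \<le> a * (2 * pi)" using assms pi_gt3 by (intro mult_left_mono) auto
  then show ?thesis by (simp add: pos_divide_le_eq)
qed

lemma measurable_weighted_extension_op:
  assumes F: "F \<in> borel_measurable circle_measure"
  shows "weighted_extension_op \<gamma> F \<in> borel_measurable borel"
proof -
  note [measurable] = measurable_on_circle[OF F]
  have "weighted_extension_op \<gamma> F = (\<lambda>z. 1 / (2 * of_real pi) * arc_ext (on_circle F) z * of_real (wt z powr - \<gamma>))"
    by (auto simp: weighted_extension_op_def extension_op_eq[OF F] wt_def)
  then show ?thesis by simp
qed

lemma emeasure_space_circle: "emeasure circle_measure (space circle_measure) = ennreal (2 * pi)"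
  using emeasure_circle_measure by (simp add: space_circle_measure)

lemma Lp_norm_nonneg:
  assumes F: "F \<in> Lp_space circle_measure r"
  shows "0 \<le> Lp_norm circle_measure r F"
proof (cases "r = \<infinity>")
  case True
  have "(0::ereal) = esssup circle_measure (\<lambda>_. 0)"
    by (rule esssup_const[symmetric]) (simp add: emeasure_space_circle ennreal_eq_0_iff not_le)
  also have "\<dots> \<le> esssup circle_measure (\<lambda>x. ereal (norm (F x)))" by (rule esssup_mono) auto
  finally show ?thesis using True by (simp add: Lp_norm_def real_of_ereal_pos)
qed (simp add: Lp_norm_def)

lemma pi_bounds: "2 * pi < 7"
  using pi_approx by simp

text \<open>The factor 10 leaves room for the length of the circle, so that no sharp comparison of the
  \<open>L\<^sup>r\<close> norms is needed.\<close>

lemma normalized_on_circle: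
  fixes r1 :: real
  assumes F: "F \<in> Lp_space circle_measure r" and r1: "1 \<le> r1" "ereal r1 \<le> r" and M: "M > Lp_norm circle_measure r F"
  shows "(\<integral>\<^sup>+t. ennreal (norm (on_circle F t / of_real (10 * M)) powr r1) \<partial>lborel) \<le> 1"
proof -
  \<comment> \<open>Strictly above the norm, \<open>M\<close> is positive and can be divided by even
    when the norm vanishes.\<close>
  have M0: "M > 0" using Lp_norm_nonneg[OF F] M by linarith
  have Fm: "F \<in> borel_measurable circle_measure" using F by (simp add: Lp_space_def)
  note gm[measurable] = measurable_on_circle[OF Fm]
  let ?g = "on_circle F"
  let ?I = "{0..<2 * pi}"
  \<comment> \<open>The bound 8 covers the length of the circle plus one;
    \<open>10 powr - r1\<close> brings it below one because \<open>r1 \<ge> 1\<close>.\<close>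
  have main: "(\<integral>\<^sup>+t. ennreal (norm (?g t / of_real M) powr r1) \<partial>lborel) \<le> ennreal 8"
  proof (cases "r = \<infinity>")
    case True
    have fin: "esssup circle_measure (\<lambda>x. ereal (norm (F x))) < \<infinity>" using F True by (simp add: Lp_space_def)
    have "AE \<omega> in circle_measure. norm (F \<omega>) \<le> M"
      using esssup_AE[of "\<lambda>x. ereal (norm (F x))" circle_measure]
    proof eventually_elim
      case (elim \<omega>)
      then show ?case using M True fin unfolding Lp_norm_def
        by (cases "esssup circle_measure (\<lambda>x. ereal (norm (F x)))") auto
    qed
    from circle_AE[OF this] have "AE t in lborel. ennreal (norm (?g t / of_real M) powr r1) \<le> indicator ?I t"
    proof eventually_elim
      case (elim t)
      have "(norm (F (circ t)) / M) powr r1 \<le> 1" if "norm (F (circ t)) \<le> M"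
        using that M0 r1 by (intro powr_le1) auto
      then show ?case using elim M0 r1 by (auto simp: on_circle_def indicator_def norm_divide intro!: ennreal_le_1[THEN iffD2])
    qed
    then have "(\<integral>\<^sup>+t. ennreal (norm (?g t / of_real M) powr r1) \<partial>lborel) \<le> (\<integral>\<^sup>+t. indicator ?I t \<partial>lborel)"
      by (rule nn_integral_mono_AE)
    also have "\<dots> = ennreal (2 * pi)" by simp
    also have "\<dots> \<le> ennreal 8" using pi_bounds by (intro ennreal_leI) simp
    finally show ?thesis .
  next
    case False
    then obtain r0 where r0: "r = ereal r0" using r1 by (cases r) auto
    have r01: "r1 \<le> r0" using r1 r0 by simp
    have int: "integrable circle_measure (\<lambda>x. norm (F x) powr r0)" using F r0 by (simp add: Lp_space_def)
    define J where "J = (\<integral>x. norm (F x) powr r0 \<partial>circle_measure)"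
    have J0: "J \<ge> 0" by (simp add: J_def)
    have "J powr (1 / r0) < M" using M r0 by (simp add: Lp_norm_def J_def)
    then have "(J powr (1 / r0)) powr r0 \<le> M powr r0" using r01 r1 by (intro powr_mono2) auto
    then have JM: "J \<le> M powr r0" using r01 r1 J0 by (simp add: powr_powr)
    have nJ: "(\<integral>\<^sup>+t. ennreal (norm (?g t) powr r0) \<partial>lborel) = ennreal J"
    proof -
      have "ennreal J = (\<integral>\<^sup>+x. ennreal (norm (F x) powr r0) \<partial>circle_measure)"
        unfolding J_def by (rule nn_integral_eq_integral[symmetric, OF int]) simp
      also have "\<dots> = (\<integral>\<^sup>+t. ennreal (norm (F (circ t)) powr r0) * indicator ?I t \<partial>lborel)"
        by (rule circle_nn_integral) (use Fm in measurable)
      also have "\<dots> = (\<integral>\<^sup>+t. ennreal (norm (?g t) powr r0) \<partial>lborel)"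
        by (intro nn_integral_cong) (auto simp: on_circle_def indicator_def)
      finally show ?thesis by simp
    qed
    \<comment> \<open>The quotient is cut at height one: below it the indicator of the interval
      dominates, above it the larger exponent \<open>r0\<close> does.\<close>
    have "(\<integral>\<^sup>+t. ennreal (norm (?g t / of_real M) powr r1) \<partial>lborel) \<le> 
       (\<integral>\<^sup>+t. indicator ?I t + ennreal (M powr - r0) * ennreal (norm (?g t) powr r0) \<partial>lborel)"
    proof (rule nn_integral_mono)
      fix t
      have e: "(norm (?g t) / M) powr r0 = M powr - r0 * norm (?g t) powr r0"
        using M0 by (simp add: powr_divide powr_minus_divide)
      show "ennreal (norm (?g t / of_real M) powr r1) \<le> indicator ?I t + ennreal (M powr - r0) * ennreal (norm (?g t) powr r0)"
      proof (cases "t \<in> ?I")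
        case t: True
        show ?thesis
        proof (cases "norm (?g t) / M \<le> 1")
          case True
          then have "ennreal (norm (?g t / of_real M) powr r1) \<le> indicator ?I t"
            using M0 r1 t by (simp add: norm_divide powr_le1)
          then show ?thesis by (rule order_trans) simp
        next
          case False
          then have "(norm (?g t) / M) powr r1 \<le> (norm (?g t) / M) powr r0" using r01 by (intro powr_mono) auto
          then have "ennreal (norm (?g t / of_real M) powr r1) \<le> ennreal (M powr - r0) * ennreal (norm (?g t) powr r0)"
            unfolding e using M0 by (simp add: norm_divide ennreal_mult[symmetric] ennreal_leI)
          then show ?thesis by (rule order_trans) simp
        qed
      qed (use r1 in \<open>simp add: on_circle_def\<close>)
    qed
    also have "\<dots> = ennreal (2 * pi) + ennreal (M powr - r0) * ennreal J"
      by (subst nn_integral_add) (auto simp: nn_integral_cmult nJ)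
    also have "\<dots> \<le> ennreal (2 * pi) + ennreal (M powr - r0) * ennreal (M powr r0)"
      using JM by (intro add_left_mono mult_left_mono ennreal_leI) auto
    also have "\<dots> = ennreal (2 * pi + 1)"
    proof -
      have "ennreal (M powr - r0) * ennreal (M powr r0) = ennreal 1"
        using M0 by (simp add: ennreal_mult[symmetric] powr_minus)
      then show ?thesis using ennreal_plus[of "2 * pi" 1] by simp
    qed
    also have "\<dots> \<le> ennreal 8" using pi_bounds by (intro ennreal_leI) simp
    finally show ?thesis .
  qed
  have eq: "norm (?g t / of_real (10 * M)) powr r1 = 10 powr - r1 * norm (?g t / of_real M) powr r1" for t
  proof -
    have e: "norm (?g t / of_real (10 * M)) = norm (?g t / of_real M) / 10" using M0 by (simp add: norm_divide norm_mult)
    show ?thesis unfolding e by (simp add: powr_divide powr_minus_divide)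
  qed
  have "(\<integral>\<^sup>+t. ennreal (norm (?g t / of_real (10 * M)) powr r1) \<partial>lborel) = 
     ennreal (10 powr - r1) * (\<integral>\<^sup>+t. ennreal (norm (?g t / of_real M) powr r1) \<partial>lborel)"
    unfolding eq by (subst nn_integral_cmult[symmetric]) (auto simp: ennreal_mult)
  also have "\<dots> \<le> ennreal (10 powr - 1) * ennreal 8"
    using r1 by (intro mult_mono main ennreal_leI powr_mono) auto
  also have "\<dots> = ennreal (10 powr - 1 * 8)" by (rule ennreal_mult[symmetric]) auto
  also have "\<dots> \<le> 1" by (simp add: powr_minus)
  finally show ?thesis .
qed

text \<open>Seven unit windows cover the circle since \<open>2 * pi < 7\<close>.\<close>

lemma on_circle_pieces:
  "on_circle F t = (\<Sum>n<7. indicator {real n..<real n + 1} t *\<^sub>R on_circle F t)"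
proof (cases "t \<in> {0..<2 * pi}")
  case True
  then have t: "0 \<le> t" "t < 7" using pi_bounds by auto
  define m where "m = nat \<lfloor>t\<rfloor>"
  have m: "real m \<le> t" "t < real m + 1" using t unfolding m_def by linarith+
  have m7: "m < 7" using m t by linarith
  have iff: "t \<in> {real n..<real n + 1} \<longleftrightarrow> n = m" for n
    using m by (auto simp: not_less)
  have "(\<Sum>n<7. indicator {real n..<real n + 1} t *\<^sub>R on_circle F t) = (\<Sum>n<7. if n = m then on_circle F t else 0)"
  proof (rule sum.cong[OF refl])
    fix n
    have "(indicator {real n..<real n + 1} t :: real) = (if n = m then 1 else 0)"
      using iff[of n] by (simp add: indicator_def del: atLeastLessThan_iff)
    then show "indicator {real n..<real n + 1} t *\<^sub>R on_circle F t = (if n = m then on_circle F t else 0)"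
      by simp
  qed
  also have "\<dots> = on_circle F t" using m7 by simp
  finally show ?thesis by simp
qed (simp add: on_circle_def)

text \<open>Every term is compared with the largest one, which serves all \<open>q > 0\<close>
  alike, whether the power is concave or convex.\<close>

lemma powr_sum_le:
  fixes a :: "'b \<Rightarrow> real"
  assumes I: "finite I" "card I = n" "n > 0" and a: "\<And>i. i \<in> I \<Longrightarrow> 0 \<le> a i" and q: "q > 0"
  shows "(\<Sum>i\<in>I. a i) powr q \<le> real n powr q * (\<Sum>i\<in>I. a i powr q)"
proof -
  have ne: "a ` I \<noteq> {}" "finite (a ` I)" using I by (auto simp: card_gt_0_iff)
  obtain m where m: "m \<in> I" "a m = Max (a ` I)" using Max_in[OF ne(2,1)] by auto
  have le: "a i \<le> a m" if "i \<in> I" for i using that ne by (simp add: m(2))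
  have "(\<Sum>i\<in>I. a i) \<le> real n * a m" using sum_bounded_above[of I a "a m"] le I by simp
  then have "(\<Sum>i\<in>I. a i) powr q \<le> (real n * a m) powr q"
    using q by (intro powr_mono2) (auto intro: sum_nonneg a)
  also have "\<dots> = real n powr q * a m powr q" using a[OF m(1)] by (simp add: powr_mult)
  also have "a m powr q \<le> (\<Sum>i\<in>I. a i powr q)"
    using m(1) I by (intro member_le_sum) auto
  finally show ?thesis by (simp add: mult_left_mono)
qed

text \<open>The seven windows are estimated separately after normalization;
  \<open>70 = 7 * 10\<close> collects the number of windows and the normalizing factor.\<close>

lemma weighted_extension_bounded_finite:
  fixes q r1 \<gamma> :: real
  assumes b: "ext_bdd \<gamma> r1 q" and r1: "1 \<le> r1" "ereal r1 \<le> r" and q: "q > 0"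
  shows "weighted_extension_bounded \<gamma> r (ereal q)"
proof -
  obtain C where C: "C \<ge> 0" "\<And>\<alpha> g. g \<in> borel_measurable borel \<Longrightarrow> (\<And>t. t \<notin> {\<alpha>..\<alpha>+1} \<Longrightarrow> g t = 0) \<Longrightarrow>
     (\<integral>\<^sup>+t. ennreal (norm (g t) powr r1) \<partial>lborel) \<le> 1 \<Longrightarrow>
     (\<integral>\<^sup>+x. ennreal ((norm (arc_ext g x) * wt x powr - \<gamma>) powr q) \<partial>lborel) \<le> ennreal C"
    using b unfolding ext_bdd_def by blast
  define D where "D = 70 powr q * (7 * C)"
  have D0: "D \<ge> 0" using C by (simp add: D_def)
  have key: "(\<integral>\<^sup>+z. ennreal (norm (weighted_extension_op \<gamma> F z) powr q) \<partial>lborel) \<le> ennreal (D * M powr q)"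
    if F: "F \<in> Lp_space circle_measure r" and M: "M > Lp_norm circle_measure r F" for F M
  proof -
    have M0: "M > 0" using Lp_norm_nonneg[OF F] M by linarith
    have Fm: "F \<in> borel_measurable circle_measure" using F by (simp add: Lp_space_def)
    note gm[measurable] = measurable_on_circle[OF Fm]
    define g where "g n t = indicator {real n..<real n + 1} t *\<^sub>R (on_circle F t / of_real (10 * M))" for n :: nat and t
    have gnm[measurable]: "g n \<in> borel_measurable borel" for n unfolding g_def[abs_def] by measurable
    have gsupp: "t \<notin> {real n..real n + 1} \<Longrightarrow> g n t = 0" for n t by (auto simp: g_def)
    have gn: "(\<integral>\<^sup>+t. ennreal (norm (g n t) powr r1) \<partial>lborel) \<le> 1" for n
    proof -
      have "(\<integral>\<^sup>+t. ennreal (norm (g n t) powr r1) \<partial>lborel) \<le> (\<integral>\<^sup>+t. ennreal (norm (on_circle F t / of_real (10 * M)) powr r1) \<partial>lborel)"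
        by (intro nn_integral_mono) (auto simp: g_def indicator_def)
      also note normalized_on_circle[OF F r1 M]
      finally show ?thesis .
    qed
    have gint: "integrable lborel (g n)" for n
    proof (rule integrableI_bounded)
      have "(\<integral>\<^sup>+t. ennreal (norm (g n t)) \<partial>lborel) \<le> (\<integral>\<^sup>+t. indicator {real n..real n + 1} t + ennreal (norm (g n t) powr r1) \<partial>lborel)"
      proof (rule nn_integral_mono)
        fix t
        show "ennreal (norm (g n t)) \<le> indicator {real n..real n + 1} t + ennreal (norm (g n t) powr r1)"
        proof (cases "norm (g n t) \<le> 1")
          case True
          then have "ennreal (norm (g n t)) \<le> indicator {real n..real n + 1} t" using gsupp[of t n] by (auto simp: indicator_def)
          then show ?thesis by (rule order_trans) simp
        next
          case False
          then have "norm (g n t) powr 1 \<le> norm (g n t) powr r1" using r1 by (intro powr_mono) auto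
          then have "ennreal (norm (g n t)) \<le> ennreal (norm (g n t) powr r1)" using False by (intro ennreal_leI) simp
          then show ?thesis by (rule order_trans) simp
        qed
      qed
      also have "\<dots> = 1 + (\<integral>\<^sup>+t. ennreal (norm (g n t) powr r1) \<partial>lborel)"
        by (subst nn_integral_add) auto
      also have "\<dots> \<le> 1 + 1" by (intro add_left_mono gn)
      also have "\<dots> < \<infinity>" by simp
      finally show "(\<integral>\<^sup>+t. ennreal (norm (g n t)) \<partial>lborel) < \<infinity>" .
    qed simp
    have sum_ext: "arc_ext (on_circle F) x = of_real (10 * M) * (\<Sum>n<7. arc_ext (g n) x)" for x
    proof -
      have i: "integrable lborel (\<lambda>t. g n t * cis (x \<bullet> circ t))" for n
        using gint by (rule Bochner_Integration.integrable_bound) (auto simp: norm_mult)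
      have "on_circle F t = of_real (10 * M) * (\<Sum>n<7. g n t)" for t
        using M0 by (subst on_circle_pieces) (simp add: g_def sum_distrib_left scaleR_conv_of_real)
      then have "arc_ext (on_circle F) x = (\<integral>t. of_real (10 * M) * (\<Sum>n<7. g n t * cis (x \<bullet> circ t)) \<partial>lborel)"
        unfolding arc_ext_def by (simp add: sum_distrib_right mult.assoc)
      also have "\<dots> = of_real (10 * M) * (\<Sum>n<7. arc_ext (g n) x)"
        unfolding arc_ext_def using i by (simp add: Bochner_Integration.integral_sum)
      finally show ?thesis .
    qed
    have pw: "norm (weighted_extension_op \<gamma> F z) powr q \<le> (70 * M) powr q * (\<Sum>n<7. (norm (arc_ext (g n) z) * wt z powr - \<gamma>) powr q)" for z
    proof -
      have "norm (weighted_extension_op \<gamma> F z) \<le> norm (arc_ext (on_circle F) z) * wt z powr - \<gamma>"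
        unfolding norm_weighted_extension_op[OF Fm] by (rule div_two_pi_le) simp
      also have "\<dots> = (10 * M) * (norm (\<Sum>n<7. arc_ext (g n) z) * wt z powr - \<gamma>)"
        unfolding sum_ext using M0 by (simp add: norm_mult)
      also have "\<dots> \<le> (10 * M) * ((\<Sum>n<7. norm (arc_ext (g n) z)) * wt z powr - \<gamma>)"
        using M0 by (intro mult_left_mono mult_right_mono norm_sum) auto
      also have "\<dots> = (10 * M) * (\<Sum>n<7. norm (arc_ext (g n) z) * wt z powr - \<gamma>)"
        by (simp only: sum_distrib_right)
      finally have "norm (weighted_extension_op \<gamma> F z) powr q \<le> ((10 * M) * (\<Sum>n<7. norm (arc_ext (g n) z) * wt z powr - \<gamma>)) powr q"
        using q by (intro powr_mono2) auto
      also have "\<dots> = (10 * M) powr q * (\<Sum>n<7. norm (arc_ext (g n) z) * wt z powr - \<gamma>) powr q"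
        using M0 by (intro powr_mult)
      also have "\<dots> \<le> (10 * M) powr q * (real 7 powr q * (\<Sum>n<7. (norm (arc_ext (g n) z) * wt z powr - \<gamma>) powr q))"
        using q by (intro mult_left_mono powr_sum_le) auto
      also have "\<dots> = (70 * M) powr q * (\<Sum>n<7. (norm (arc_ext (g n) z) * wt z powr - \<gamma>) powr q)"
      proof -
        have "(70 * M) powr q = (10 * M) powr q * 7 powr q" using M0 powr_mult[of "10 * M" 7 q] by (simp add: mult_ac)
        then show ?thesis by simp
      qed
      finally show ?thesis .
    qed
    have "(\<integral>\<^sup>+z. ennreal (norm (weighted_extension_op \<gamma> F z) powr q) \<partial>lborel) \<le> 
      (\<integral>\<^sup>+z. ennreal ((70 * M) powr q) * (\<Sum>n<7. ennreal ((norm (arc_ext (g n) z) * wt z powr - \<gamma>) powr q)) \<partial>lborel)"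
      using pw by (intro nn_integral_mono) (simp add: sum_ennreal ennreal_mult[symmetric] sum_nonneg ennreal_leI)
    also have "\<dots> = ennreal ((70 * M) powr q) * (\<Sum>n<7. \<integral>\<^sup>+z. ennreal ((norm (arc_ext (g n) z) * wt z powr - \<gamma>) powr q) \<partial>lborel)"
    proof -
      have m: "(\<lambda>z. ennreal ((norm (arc_ext (g n) z) * wt z powr - \<gamma>) powr q)) \<in> borel_measurable lborel" for n
        by measurable
      show ?thesis by (simp only: nn_integral_cmult[OF borel_measurable_sum[OF m]] nn_integral_sum[OF m])
    qed
    also have "\<dots> \<le> ennreal ((70 * M) powr q) * (\<Sum>n<(7::nat). ennreal C)"
      by (intro mult_left_mono sum_mono C(2)[OF gnm gsupp gn]) auto
    also have "\<dots> = ennreal (D * M powr q)"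
    proof -
      have "(\<Sum>n<(7::nat). ennreal C) = ennreal (7 * C)" using C by (simp add: ennreal_mult)
      then show ?thesis using C M0 by (simp add: D_def ennreal_mult[symmetric] powr_mult mult_ac)
    qed
    finally show ?thesis .
  qed
  show ?thesis
    unfolding Lp_bounded_def
  \<comment> \<open>Adding one keeps the constant positive when \<open>D = 0\<close>.\<close>
  proof (intro exI[of _ "D powr (1 / q) + 1"] conjI ballI)
    show "D powr (1 / q) + 1 > 0" using powr_ge_zero[of D "1 / q"] by linarith
    fix F assume F: "F \<in> Lp_space circle_measure r"
    have Fm: "F \<in> borel_measurable circle_measure" using F by (simp add: Lp_space_def)
    note Tm[measurable] = measurable_weighted_extension_op[OF Fm, of \<gamma>]
    define L where "L = Lp_norm circle_measure r F"
    have L0: "L \<ge> 0" using Lp_norm_nonneg[OF F] by (simp add: L_def)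
    let ?T = "weighted_extension_op \<gamma> F"
    \<comment> \<open>\<open>key\<close> needs \<open>M\<close> strictly above the norm, so
      \<open>M\<close> decreases to the norm along a sequence.\<close>
    have bound: "(\<integral>\<^sup>+z. ennreal (norm (?T z) powr q) \<partial>lborel) \<le> ennreal (D * L powr q)"
    proof (rule LIMSEQ_le_const)
      have "(\<lambda>n. D * (L + 1 / real (Suc n)) powr q) \<longlonglongrightarrow> D * (L + 0) powr q"
        using q L0 by (intro tendsto_intros LIMSEQ_Suc lim_1_over_n) (auto intro!: always_eventually)
      then show "(\<lambda>n. ennreal (D * (L + 1 / real (Suc n)) powr q)) \<longlonglongrightarrow> ennreal (D * L powr q)"
        by (intro tendsto_ennrealI) simp
      show "\<exists>N. \<forall>n\<ge>N. (\<integral>\<^sup>+z. ennreal (norm (?T z) powr q) \<partial>lborel) \<le> ennreal (D * (L + 1 / real (Suc n)) powr q)"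
        using key[OF F] by (auto simp: L_def)
    qed
    have int: "integrable lborel (\<lambda>z. norm (?T z) powr q)"
      by (rule integrableI_bounded) (use bound in \<open>auto intro: le_less_trans\<close>)
    show "?T \<in> Lp_space lborel (ereal q)" using int by (simp add: Lp_space_def)
    have "ennreal (\<integral>z. norm (?T z) powr q \<partial>lborel) \<le> ennreal (D * L powr q)"
      using bound int by (subst nn_integral_eq_integral[symmetric]) auto
    then have "(\<integral>z. norm (?T z) powr q \<partial>lborel) \<le> D * L powr q" using D0 by (simp add: ennreal_le_iff)
    then have "(\<integral>z. norm (?T z) powr q \<partial>lborel) powr (1 / q) \<le> (D * L powr q) powr (1 / q)"
      using q by (intro powr_mono2) auto
    also have "\<dots> = D powr (1 / q) * L" using D0 L0 q by (simp add: powr_mult powr_powr)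
    also have "\<dots> \<le> (D powr (1 / q) + 1) * L" using L0 by (intro mult_right_mono) auto
    finally show "Lp_norm lborel (ereal q) ?T \<le> (D powr (1 / q) + 1) * Lp_norm circle_measure r F"
      by (simp add: Lp_norm_def L_def)
  qed
qed

text \<open>The extension is bounded by the mass, which \<open>normalized_on_circle\<close> controls
  with exponent one, and the weight is at most one.\<close>

lemma weighted_extension_bounded_infinity:
  assumes r: "1 \<le> r" and \<gamma>: "\<gamma> \<ge> 0"
  shows "weighted_extension_bounded \<gamma> r \<infinity>"
  unfolding Lp_bounded_def
proof (intro exI[of _ 10] conjI ballI)
  fix F assume F: "F \<in> Lp_space circle_measure r"
  have Fm: "F \<in> borel_measurable circle_measure" using F by (simp add: Lp_space_def)
  note gm[measurable] = measurable_on_circle[OF Fm]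
  have Tm: "weighted_extension_op \<gamma> F \<in> borel_measurable lborel" using measurable_weighted_extension_op[OF Fm] by simp
  define L where "L = Lp_norm circle_measure r F"
  have L0: "L \<ge> 0" using Lp_norm_nonneg[OF F] by (simp add: L_def)
  have le: "norm (weighted_extension_op \<gamma> F z) \<le> 10 * L" for z
  proof (rule field_le_epsilon)
    fix e :: real assume e: "e > 0"
    define M where "M = L + e / 10"
    have M: "M > L" "M > 0" using e L0 by (auto simp: M_def)
    have 1: "(\<integral>\<^sup>+t. ennreal (norm (on_circle F t / of_real (10 * M))) \<partial>lborel) \<le> 1"
      using normalized_on_circle[OF F, of 1 M] r M by (simp add: L_def one_ereal_def)
    have i: "integrable lborel (\<lambda>t. on_circle F t / of_real (10 * M))"
      using 1 by (intro integrableI_bounded) (auto intro: le_less_trans)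
    have "ennreal (norm (arc_ext (\<lambda>t. on_circle F t / of_real (10 * M)) z)) \<le> ennreal 1"
      using order_trans[OF norm_arc_ext_le[OF i] 1] by simp
    then have "norm (arc_ext (\<lambda>t. on_circle F t / of_real (10 * M)) z) \<le> 1" by (simp only: ennreal_le_iff zero_le_one)
    moreover have "arc_ext (\<lambda>t. on_circle F t / of_real (10 * M)) z = arc_ext (on_circle F) z / of_real (10 * M)"
      unfolding arc_ext_def by simp
    ultimately have le: "norm (arc_ext (on_circle F) z) \<le> 10 * M"
      using M(2) by (simp add: norm_divide norm_mult divide_le_eq)
    have "norm (weighted_extension_op \<gamma> F z) \<le> norm (arc_ext (on_circle F) z) * wt z powr - \<gamma>"
      unfolding norm_weighted_extension_op[OF Fm] by (rule div_two_pi_le) simp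
    also have "\<dots> \<le> norm (arc_ext (on_circle F) z) * 1"
      using wt_powr_mono[of 0 \<gamma> z] \<gamma> by (intro mult_left_mono) (auto simp: less_imp_neq[OF wt_pos, symmetric])
    finally show "norm (weighted_extension_op \<gamma> F z) \<le> 10 * L + e" using le by (simp add: M_def)
  qed
  have es: "esssup lborel (\<lambda>x. ereal (norm (weighted_extension_op \<gamma> F x))) \<le> ereal (10 * L)"
    using Tm le by (intro esssup_I) auto
  show "weighted_extension_op \<gamma> F \<in> Lp_space lborel \<infinity>"
    using Tm es by (auto simp: Lp_space_def intro: le_less_trans)
  show "Lp_norm lborel \<infinity> (weighted_extension_op \<gamma> F) \<le> 10 * Lp_norm circle_measure r F"
    using es L0 unfolding Lp_norm_def L_def
    by (cases "esssup lborel (\<lambda>x. ereal (norm (weighted_extension_op \<gamma> F x)))") (auto simp: L_def)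
qed simp

text \<open>Replaces both exponents by the real number \<open>\<rho> = 1 / r'\<close>, in which all
  conditions are linear; \<open>\<rho> = 0\<close> and \<open>\<rho> = 1\<close> encode the infinite
  exponents.\<close>

lemma conjugate_exponents_real:
  fixes r r' :: ereal
  assumes "1 \<le> r" "1 \<le> r'" "1 / r + 1 / r' = 1"
  obtains \<rho> :: real where "0 \<le> \<rho>" "\<rho> \<le> 1" "1 / r = ereal (1 - \<rho>)" "1 / r' = ereal \<rho>" "1 / (2 * r') = ereal (\<rho> / 2)"
    "r = (if \<rho> = 1 then \<infinity> else ereal (1 / (1 - \<rho>)))"
    "r' = (if \<rho> = 0 then \<infinity> else ereal (1 / \<rho>))"
proof (cases r')
  case (real s)
  then have s: "s \<ge> 1" using assms by simp
  define \<rho> where "\<rho> = 1 / s"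
  have \<rho>: "0 < \<rho>" "\<rho> \<le> 1" using s by (auto simp: \<rho>_def)
  have r1: "1 / r' = ereal \<rho>" using real s by (simp add: \<rho>_def one_ereal_def)
  have r2: "1 / (2 * r') = ereal (\<rho> / 2)" using real s by (simp add: \<rho>_def one_ereal_def numeral_eq_ereal)
  have r': "r' = (if \<rho> = 0 then \<infinity> else ereal (1 / \<rho>))" using real \<rho> by (simp add: \<rho>_def)
  show ?thesis
  proof (cases r)
    case (real t)
    then have t: "t \<ge> 1" using assms by simp
    have "1 / t + \<rho> = 1" using assms(3) r1 real t by (simp add: one_ereal_def)
    then have "1 / t = 1 - \<rho>" by simp
    moreover have "\<rho> \<noteq> 1" using calculation t by auto
    moreover have "t = 1 / (1 - \<rho>)" using \<open>1 / t = 1 - \<rho>\<close> t by (metis div_by_1 divide_divide_eq_right mult_1)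
    ultimately show ?thesis
      using that[of \<rho>] \<rho> r1 r2 r' real t by (simp add: one_ereal_def)
  next
    case PInf
    then have "\<rho> = 1" using assms(3) r1 by (simp add: one_ereal_def)
    then show ?thesis using that[of \<rho>] \<rho> r1 r2 r' PInf by simp
  next
    case MInf
    then show ?thesis using assms by simp
  qed
next
  case PInf
  show ?thesis
  proof (cases r)
    case (real t)
    then have "1 / t = 1" using assms PInf by (simp add: one_ereal_def)
    then have "t = 1" using assms real by (auto simp: field_simps split: if_splits)
    then show ?thesis using that[of 0] PInf real by (simp add: one_ereal_def numeral_eq_ereal)
  next
    case PInf': PInf
    then show ?thesis using assms PInf by simp
  next
    case MInf
    then show ?thesis using assms by simp
  qed
next
  case MInf
  then show ?thesis using assms by simp
qed

text \<open>The exponent found for windows may be smaller than \<open>r\<close>; on a circle of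
  finite length this is harmless.\<close>

lemma bounded_open_region:
  fixes q \<gamma> \<rho> :: real and r :: ereal
  assumes r: "r = (if \<rho> = 1 then \<infinity> else ereal (1 / (1 - \<rho>)))" and \<rho>: "0 \<le> \<rho>" "\<rho> \<le> 1"
    and q: "q > 0" and \<gamma>: "\<gamma> \<ge> 0" "\<gamma> > 2 / q - 1 / 2" "\<gamma> > max (3 / (2 * q) - \<rho> / 2) (2 / q - \<rho>)"
  shows "weighted_extension_bounded \<gamma> r (ereal q)"
proof -
  obtain r1 where r1: "r1 \<ge> 1" "1 - 1 / r1 \<le> \<rho>" "ext_bdd \<gamma> r1 q"
    using ext_bdd_open_region[OF q \<gamma>(1) \<rho>] \<gamma> by auto
  have "ereal r1 \<le> r"
  proof (cases "\<rho> = 1")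
    case False
    then have "1 - \<rho> > 0" using \<rho> by simp
    moreover have "1 - \<rho> \<le> 1 / r1" using r1 by simp
    ultimately have "r1 \<le> 1 / (1 - \<rho>)" using r1(1) by (simp add: field_simps)
    then show ?thesis using r False by simp
  qed (use r in simp)
  then show ?thesis using weighted_extension_bounded_finite[OF r1(3,1) _ q] by simp
qed

text \<open>The two entries of the maximum cross at \<open>\<rho> = 1 / q\<close>, so
  \<open>q * \<rho>\<close> decides which one is active and hence which critical relation
  applies.\<close>

lemma bounded_critical:
  fixes q \<gamma> \<rho> :: real and r :: ereal
  assumes r: "r = (if \<rho> = 1 then \<infinity> else ereal (1 / (1 - \<rho>)))" and \<rho>: "0 < \<rho>" "\<rho> \<le> 1"
    and q: "q > 0" "r \<le> ereal q" and \<gamma>: "\<gamma> \<ge> 0" "\<gamma> > 2 / q - 1 / 2" 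
    and eq: "\<gamma> = max (3 / (2 * q) - \<rho> / 2) (2 / q - \<rho>)" and ne: "q * \<rho> \<noteq> 1"
  shows "weighted_extension_bounded \<gamma> r (ereal q)"
proof -
  have \<rho>1: "\<rho> < 1" using r q \<rho> by (cases "\<rho> = 1") auto
  define r0 where "r0 = 1 / (1 - \<rho>)"
  have rr: "r = ereal r0" using r \<rho>1 by (simp add: r0_def)
  have r01: "r0 > 1" using \<rho> \<rho>1 by (simp add: r0_def)
  have ir: "1 / r0 = 1 - \<rho>" by (simp add: r0_def)
  have r0q: "r0 \<le> q" using q rr by simp
  have "ext_bdd \<gamma> r0 q"
  proof (cases "q * \<rho> < 1")
    case True
    then have "\<rho> < 1 / q" using q by (simp add: field_simps)
    moreover have "3 / (2 * q) = 3 / 2 * (1 / q)" "2 / q = 2 * (1 / q)" by simp_all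
    ultimately have "3 / (2 * q) - \<rho> / 2 < 2 / q - \<rho>" by argo
    then have g: "\<gamma> = 2 / q - \<rho>" using eq by simp
    then have "\<rho> < 1 / 2" using \<gamma> by simp
    then show ?thesis using ext_bdd_below_dual[OF r01 _ r0q True _ g] ir by simp
  next
    case False
    then have "q * \<rho> > 1" using ne by simp
    then have a: "\<rho> > 1 / q" using q by (simp add: field_simps)
    have x: "3 / (2 * q) = 3 / 2 * (1 / q)" "2 / q = 2 * (1 / q)" "3 / q = 3 * (1 / q)" by simp_all
    have "3 / (2 * q) - \<rho> / 2 > 2 / q - \<rho>" using a unfolding x by argo
    then have g: "\<gamma> = 3 / (2 * q) - \<rho> / 2" using eq by simp
    have g1: "\<gamma> < 1 / q" using g a unfolding x by argo
    then have "1 / q < 1 / 2" using \<gamma>(2) unfolding x by argo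
    then have "q > 2" using q by (simp add: field_simps)
    moreover have "1 / r0 = 1 - 3 / q + 2 * \<gamma>" unfolding ir g x by argo
    ultimately show ?thesis using ext_bdd_core[OF _ \<gamma> g1] by blast
  qed
  then show ?thesis using weighted_extension_bounded_finite[of \<gamma> r0 q r] r01 rr q by simp
qed

subsection \<open>Knapp examples\<close>

text \<open>The angle in \<open>[0, 2 * pi)\<close>, by which test functions of the angle are
  carried to the circle; its jump does not spoil measurability.\<close>

definition ang :: "real \<times> real \<Rightarrow> real" where
  "ang \<omega> = (if snd \<omega> \<ge> 0 then arccos (fst \<omega>) else 2 * pi - arccos (fst \<omega>))"

lemma ang_circ:
  assumes "0 \<le> t" "t < 2 * pi" shows "ang (circ t) = t"
proof (cases "t \<le> pi")
  case True
  then show ?thesis using assms by (simp add: ang_def circ_def sin_ge_zero arccos_cos)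
next
  case False
  then have "sin t < 0" using assms by (intro sin_lt_zero) auto
  moreover have "cos t = cos (2 * pi - t)" by (simp add: cos_diff)
  then have "arccos (cos t) = 2 * pi - t" using arccos_cos[of "2 * pi - t"] assms False by simp
  ultimately show ?thesis by (simp add: ang_def circ_def)
qed

lemma measurable_ang: "ang \<in> borel_measurable (restrict_space borel (sphere 0 1))"
proof -
  have b: "- 1 \<le> fst \<omega>" "fst \<omega> \<le> 1" if "\<omega> \<in> sphere 0 1" for \<omega> :: "real \<times> real"
    using norm_fst_le[of "fst \<omega>" "snd \<omega>"] that by (auto simp: abs_le_iff)
  have [measurable]: "(\<lambda>\<omega>::real \<times> real. arccos (fst \<omega>)) \<in> borel_measurable (restrict_space borel (sphere 0 1))"
    using b by (intro borel_measurable_continuous_on_restrict continuous_intros) auto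
  have [measurable]: "(\<lambda>\<omega>::real \<times> real. snd \<omega>) \<in> borel_measurable (restrict_space borel (sphere 0 1))"
    by (intro borel_measurable_continuous_on_restrict continuous_intros)
  show ?thesis unfolding ang_def[abs_def] by measurable
qed

text \<open>Boundedness restated for functions of the angle. \<open>N\<close> is any upper bound for
  the norm, so test functions need not be normalized exactly, and
  \<open>K = (2 * pi * C) powr q\<close> restores the factor of the extension operator.\<close>

lemma necessity_test:
  fixes q \<gamma> \<rho> :: real and r :: ereal
  assumes bdd: "weighted_extension_bounded \<gamma> r (ereal q)" and q: "q > 0"
    and r: "r = (if \<rho> = 1 then \<infinity> else ereal (1 / (1 - \<rho>)))" and \<rho>: "0 \<le> \<rho>" "\<rho> \<le> 1"
  shows "\<exists>K>0. \<forall>g N. g \<in> borel_measurable borel \<longrightarrow> (\<forall>t. t \<notin> {0..<2 * pi} \<longrightarrow> g t = 0) \<longrightarrow> 0 \<le> N \<longrightarrow>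
    (if \<rho> = 1 then \<forall>t. norm (g t) \<le> N else (\<integral>\<^sup>+t. ennreal (norm (g t) powr (1 / (1 - \<rho>))) \<partial>lborel) \<le> ennreal (N powr (1 / (1 - \<rho>)))) \<longrightarrow>
    (\<integral>\<^sup>+x. ennreal ((norm (arc_ext g x) * wt x powr - \<gamma>) powr q) \<partial>lborel) \<le> ennreal (K * N powr q)"
proof -
  obtain C where C: "C > 0" "\<And>F. F \<in> Lp_space circle_measure r \<Longrightarrow> weighted_extension_op \<gamma> F \<in> Lp_space lborel (ereal q) \<and>
      Lp_norm lborel (ereal q) (weighted_extension_op \<gamma> F) \<le> C * Lp_norm circle_measure r F"
    using bdd unfolding Lp_bounded_def by blast
  define K where "K = (2 * pi * C) powr q"
  have "K > 0" using C(1) by (simp add: K_def)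
  moreover have "(\<integral>\<^sup>+x. ennreal ((norm (arc_ext g x) * wt x powr - \<gamma>) powr q) \<partial>lborel) \<le> ennreal (K * N powr q)"
    if g: "g \<in> borel_measurable borel" and supp: "\<And>t. t \<notin> {0..<2 * pi} \<Longrightarrow> g t = 0" and N: "0 \<le> N"
      and gN: "if \<rho> = 1 then \<forall>t. norm (g t) \<le> N else (\<integral>\<^sup>+t. ennreal (norm (g t) powr (1 / (1 - \<rho>))) \<partial>lborel) \<le> ennreal (N powr (1 / (1 - \<rho>)))" for g N
  proof -
    define F where "F \<omega> = g (ang \<omega>)" for \<omega>
    have Fm: "F \<in> borel_measurable circle_measure"
      unfolding measurable_circle_measure_eq F_def[abs_def] by (rule measurable_compose[OF measurable_ang g])
    have oc: "on_circle F = g"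
      using supp by (auto simp: on_circle_def F_def ang_circ indicator_def)
    have FN: "F \<in> Lp_space circle_measure r \<and> Lp_norm circle_measure r F \<le> N"
    proof (cases "\<rho> = 1")
      case True
      have es: "esssup circle_measure (\<lambda>x. ereal (norm (F x))) \<le> ereal N"
      proof (rule esssup_I)
        show "(\<lambda>x. ereal (norm (F x))) \<in> borel_measurable circle_measure" using Fm by measurable
        show "AE x in circle_measure. ereal (norm (F x)) \<le> ereal N" using gN True by (simp add: F_def)
      qed
      then have 1: "F \<in> Lp_space circle_measure r" using Fm True r by (auto simp: Lp_space_def intro: le_less_trans)
      have "Lp_norm circle_measure r F \<le> N"
        using es True r N unfolding Lp_norm_def 
        by (cases "esssup circle_measure (\<lambda>x. ereal (norm (F x)))") auto
      then show ?thesis using 1 by simp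
    next
      case False
      define r0 where "r0 = 1 / (1 - \<rho>)"
      have r0: "r0 > 0" using \<rho> False by (simp add: r0_def)
      have rr: "r = ereal r0" using r False by (simp add: r0_def)
      have "(\<integral>\<^sup>+\<omega>. ennreal (norm (F \<omega>) powr r0) \<partial>circle_measure) = (\<integral>\<^sup>+t. ennreal (norm (F (circ t)) powr r0) * indicator {0..<2 * pi} t \<partial>lborel)"
        by (rule circle_nn_integral) (use Fm in measurable)
      also have "\<dots> = (\<integral>\<^sup>+t. ennreal (norm (g t) powr r0) \<partial>lborel)"
        using supp r0 by (intro nn_integral_cong) (auto simp: F_def ang_circ indicator_def)
      also have "\<dots> \<le> ennreal (N powr r0)" using gN False by (simp add: r0_def)
      finally have le: "(\<integral>\<^sup>+\<omega>. ennreal (norm (F \<omega>) powr r0) \<partial>circle_measure) \<le> ennreal (N powr r0)" .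
      have int: "integrable circle_measure (\<lambda>\<omega>. norm (F \<omega>) powr r0)"
      proof (rule integrableI_bounded)
        show "(\<lambda>\<omega>. norm (F \<omega>) powr r0) \<in> borel_measurable circle_measure" using Fm by measurable
        show "(\<integral>\<^sup>+\<omega>. ennreal (norm (norm (F \<omega>) powr r0)) \<partial>circle_measure) < \<infinity>"
          using le by (auto intro: le_less_trans)
      qed
      then have "ennreal (\<integral>\<omega>. norm (F \<omega>) powr r0 \<partial>circle_measure) \<le> ennreal (N powr r0)"
        using le by (subst nn_integral_eq_integral[symmetric]) auto
      then have "(\<integral>\<omega>. norm (F \<omega>) powr r0 \<partial>circle_measure) \<le> N powr r0" by (simp add: ennreal_le_iff)
      then have "(\<integral>\<omega>. norm (F \<omega>) powr r0 \<partial>circle_measure) powr (1 / r0) \<le> (N powr r0) powr (1 / r0)"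
        using r0 by (intro powr_mono2) auto
      also have "\<dots> = N" using r0 N by (simp add: powr_powr)
      finally show ?thesis using int Fm rr by (simp add: Lp_space_def Lp_norm_def)
    qed
    let ?T = "weighted_extension_op \<gamma> F"
    have T: "?T \<in> Lp_space lborel (ereal q)" "Lp_norm lborel (ereal q) ?T \<le> C * N"
    proof -
      show "?T \<in> Lp_space lborel (ereal q)" using C(2) FN by blast
      have "Lp_norm lborel (ereal q) ?T \<le> C * Lp_norm circle_measure r F" using C(2) FN by blast
      also have "\<dots> \<le> C * N" using FN C(1) by (intro mult_left_mono) auto
      finally show "Lp_norm lborel (ereal q) ?T \<le> C * N" .
    qed
    define I where "I = (\<integral>z. norm (?T z) powr q \<partial>lborel)"
    have I0: "I \<ge> 0" by (simp add: I_def)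
    have int: "integrable lborel (\<lambda>z. norm (?T z) powr q)" using T(1) by (simp add: Lp_space_def)
    have "I powr (1 / q) \<le> C * N" using T(2) by (simp add: Lp_norm_def I_def)
    then have "(I powr (1 / q)) powr q \<le> (C * N) powr q" using q by (intro powr_mono2) auto
    then have IN: "I \<le> (C * N) powr q" using q I0 by (simp add: powr_powr)
    have eq: "(norm (arc_ext g x) * wt x powr - \<gamma>) powr q = (2 * pi) powr q * norm (?T x) powr q" for x
    proof -
      have "norm (arc_ext g x) * wt x powr - \<gamma> = (2 * pi) * norm (?T x)"
        unfolding norm_weighted_extension_op[OF Fm] oc by simp
      then show ?thesis by (simp add: powr_mult)
    qed
    have Tm: "?T \<in> borel_measurable lborel" using measurable_weighted_extension_op[OF Fm] by simp
    have "(\<integral>\<^sup>+x. ennreal ((norm (arc_ext g x) * wt x powr - \<gamma>) powr q) \<partial>lborel) = 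
        (\<integral>\<^sup>+x. ennreal ((2 * pi) powr q) * ennreal (norm (?T x) powr q) \<partial>lborel)"
      unfolding eq by (simp add: ennreal_mult)
    also have "\<dots> = ennreal ((2 * pi) powr q) * (\<integral>\<^sup>+x. ennreal (norm (?T x) powr q) \<partial>lborel)"
      by (rule nn_integral_cmult) (use Tm in measurable)
    also have "\<dots> = ennreal ((2 * pi) powr q) * ennreal I"
      unfolding I_def using int by (subst nn_integral_eq_integral) auto
    also have "\<dots> \<le> ennreal ((2 * pi) powr q) * ennreal ((C * N) powr q)"
      using IN by (intro mult_left_mono ennreal_leI) auto
    also have "\<dots> = ennreal (K * N powr q)"
      using C(1) N by (simp add: K_def powr_mult ennreal_mult[symmetric] mult_ac)
    finally show ?thesis .
  qed
  ultimately show ?thesis by blast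
qed

text \<open>Flipping the sign of the \<open>k\<close>th term pairs the sums, and in each pair one member is at least
  \<open>norm (f k)\<close>.\<close>

lemma random_signs:
  fixes f :: "'b \<Rightarrow> complex" and q :: real
  assumes J: "finite J" "k \<in> J" and q: "q > 0"
  defines "S \<equiv> \<lambda>A. \<Sum>j\<in>J. (if j \<in> A then 1 else - 1) * f j"
  shows "2 ^ card J * norm (f k) powr q \<le> 2 * (\<Sum>A\<in>Pow J. norm (S A) powr q)"
proof -
  define flip where "flip A = (if k \<in> A then A - {k} else insert k A)" for A
  have bij: "bij_betw flip (Pow J) (Pow J)"
    using J by (intro bij_betwI[where g = flip]) (auto simp: flip_def split: if_splits)
  have diff: "norm (f k) powr q \<le> norm (S A) powr q + norm (S (flip A)) powr q" for A
  proof -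
    have split: "S B = (if k \<in> B then 1 else - 1) * f k + (\<Sum>j\<in>J - {k}. (if j \<in> B then 1 else - 1) * f j)" for B
      unfolding S_def using J by (rule sum.remove)
    have "(\<Sum>j\<in>J - {k}. (if j \<in> flip A then 1 else - 1) * f j) = (\<Sum>j\<in>J - {k}. (if j \<in> A then 1 else - 1) * f j)"
      by (intro sum.cong) (auto simp: flip_def)
    moreover have "k \<in> flip A \<longleftrightarrow> k \<notin> A" by (auto simp: flip_def)
    ultimately have "S A - S (flip A) = 2 * f k \<or> S A - S (flip A) = - 2 * f k"
      unfolding split[of A] split[of "flip A"] by auto
    then have "2 * norm (f k) = norm (S A - S (flip A))" by (auto simp: norm_mult)
    also have "\<dots> \<le> norm (S A) + norm (S (flip A))" by (rule norm_triangle_ineq4)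
    finally have "norm (f k) \<le> norm (S A) \<or> norm (f k) \<le> norm (S (flip A))" by linarith
    then have "norm (f k) powr q \<le> norm (S A) powr q \<or> norm (f k) powr q \<le> norm (S (flip A)) powr q"
      using q by (auto intro: powr_mono2)
    then show ?thesis using powr_ge_zero[of "norm (S A)" q] powr_ge_zero[of "norm (S (flip A))" q] by linarith
  qed
  have "2 ^ card J * norm (f k) powr q = (\<Sum>A\<in>Pow J. norm (f k) powr q)"
    using J by (simp add: card_Pow)
  also have "\<dots> \<le> (\<Sum>A\<in>Pow J. norm (S A) powr q + norm (S (flip A)) powr q)"
    by (intro sum_mono diff)
  also have "\<dots> = (\<Sum>A\<in>Pow J. norm (S A) powr q) + (\<Sum>A\<in>Pow J. norm (S (flip A)) powr q)"
    by (rule sum.distrib)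
  also have "(\<Sum>A\<in>Pow J. norm (S (flip A)) powr q) = (\<Sum>A\<in>Pow J. norm (S A) powr q)"
    by (rule sum.reindex_bij_betw[OF bij])
  finally show ?thesis by simp
qed

section \<open>A single arc and superpositions of arcs\<close>

definition dyad_ext :: "nat \<Rightarrow> real \<times> real \<Rightarrow> complex" where
  "dyad_ext k = arc_ext (\<lambda>t. of_real (indicator (dyad k) t))"

lemma measure_dyad: "emeasure lborel (dyad k) = ennreal ((1/2) ^ Suc k)"
  by (simp add: dyad_def)

lemma dyad_subset: "dyad k \<subseteq> {0..<2 * pi}"
proof
  fix t assume "t \<in> dyad k"
  then have "t \<in> {0<..1}" using dyad_Union by blast
  then show "t \<in> {0..<2 * pi}" using pi_gt3 by auto
qed

lemma integrable_dyad: "integrable lborel (\<lambda>t. of_real (indicator (dyad k) t) :: complex)"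
  by (rule integrable_of_real) (rule integrable_real_indicator, simp_all add: measure_dyad)

text \<open>Up to the unimodular factor \<open>cis a\<close> the phase is
  \<open>a * (cos t - 1) + b * sin t\<close>. On the box both parts are at most 1/2, so the real
  part of the integrand is at least \<open>cos 1 > 1 / 2\<close> on the arc. The arc has length
  \<open>(1/2) ^ Suc k\<close>, whence the factor 1/4.\<close>

lemma dyad_ext_lower:
  assumes x: "0 \<le> fst x" "fst x \<le> 4 ^ k" "0 \<le> snd x" "snd x \<le> 2 ^ k / 2"
  shows "(1/2) ^ k / 4 \<le> norm (dyad_ext k x)"
proof -
  obtain a b where ab: "x = (a, b)" by (cases x)
  let ?f = "\<lambda>t. of_real (indicator (dyad k) t) * cis (x \<bullet> circ t - a)"
  have i: "integrable lborel ?f"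
    using integrable_dyad by (rule Bochner_Integration.integrable_bound) (auto simp: norm_mult)
  have "dyad_ext k x = (\<integral>t. cis a * ?f t \<partial>lborel)"
    unfolding dyad_ext_def arc_ext_def
    by (intro Bochner_Integration.integral_cong) (auto simp: cis_mult mult.left_commute)
  then have eq: "dyad_ext k x = cis a * (\<integral>t. ?f t \<partial>lborel)" by simp
  have lower: "indicator (dyad k) t * (1 / 2) \<le> Re (?f t)" for t
  proof (cases "t \<in> dyad k")
    case True
    then have t: "0 < t" "t \<le> (1/2) ^ k" by (auto simp: dyad_def intro: less_trans[rotated])
    have t2: "t\<^sup>2 \<le> ((1/2) ^ k)\<^sup>2" using t by (intro power_mono) auto
    have c1: "\<bar>cos t - 1\<bar> \<le> t\<^sup>2 / 2"
    proof -
      have "cos t = 1 - 2 * (sin (t / 2))\<^sup>2" using cos_double_sin[of "t / 2"] by simp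
      moreover have "\<bar>sin (t / 2)\<bar> \<le> \<bar>t / 2\<bar>" by (rule abs_sin_x_le_abs_x)
      then have "(sin (t / 2))\<^sup>2 \<le> (t / 2)\<^sup>2" by (metis abs_le_square_iff)
      ultimately show ?thesis by (simp add: power_divide)
    qed
    have s1: "\<bar>sin t\<bar> \<le> t" using abs_sin_x_le_abs_x[of t] t by simp
    have "\<bar>a * (cos t - 1)\<bar> \<le> 4 ^ k * (((1/2) ^ k)\<^sup>2 / 2)"
      unfolding abs_mult using c1 t2 x by (intro mult_mono) (auto simp: ab)
    also have "\<dots> = 1 / 2"
    proof -
      have "(4::real) ^ k * ((1/2) ^ k)\<^sup>2 = (4 * (1/2)\<^sup>2) ^ k"
        unfolding power_mult_distrib power_mult[symmetric] by (simp add: mult.commute)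
      then show ?thesis by (simp add: power2_eq_square)
    qed
    finally have 1: "\<bar>a * (cos t - 1)\<bar> \<le> 1 / 2" .
    have "\<bar>b * sin t\<bar> \<le> (2 ^ k / 2) * (1/2) ^ k"
      unfolding abs_mult using s1 t x by (intro mult_mono) (auto simp: ab)
    also have "\<dots> = 1 / 2" by (simp add: power_one_over)
    finally have 2: "\<bar>b * sin t\<bar> \<le> 1 / 2" .
    have ph: "x \<bullet> circ t - a = a * (cos t - 1) + b * sin t" by (simp add: ab circ_def algebra_simps)
    have "\<bar>x \<bullet> circ t - a\<bar> \<le> 1" unfolding ph using 1 2 by linarith
    then have "cos (pi / 3) \<le> cos \<bar>x \<bullet> circ t - a\<bar>" using pi_gt3 by (intro cos_monotone_0_pi_le) auto
    then show ?thesis using True by (simp add: cos_60)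
  qed simp
  have "(1/2) ^ k / 4 = (\<integral>t. indicator (dyad k) t * (1 / 2 :: real) \<partial>lborel)"
    using measure_dyad[of k] by (simp add: measure_def)
  also have "\<dots> \<le> (\<integral>t. Re (?f t) \<partial>lborel)"
  proof (rule integral_mono)
    show "integrable lborel (\<lambda>t. indicator (dyad k) t * (1 / 2 :: real))"
      by (intro integrable_mult_left integrable_real_indicator) (auto simp: measure_dyad)
    show "integrable lborel (\<lambda>t. Re (?f t))" using i by (rule integrable_Re)
  qed (rule lower)
  also have "\<dots> = Re (\<integral>t. ?f t \<partial>lborel)" using i by (rule integral_Re)
  also have "\<dots> \<le> norm (\<integral>t. ?f t \<partial>lborel)" by (rule complex_Re_le_cmod)
  also have "\<dots> = norm (dyad_ext k x)" unfolding eq by (simp add: norm_mult)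
  finally show ?thesis .
qed

text \<open>As \<open>1 - \<rho> = 1 / r\<close>, the coefficients
  \<open>(2 ^ j) powr (1 - \<rho>)\<close> give each arc norm at most one, and disjointness bounds
  the norm of the superposition by \<open>card J powr (1 - \<rho>)\<close>. Summing over all choices
  of signs lets the region \<open>E i\<close> see the arc \<open>\<kappa> i\<close> alone. Several
  regions may share one arc, which is how the radii between \<open>2 ^ k\<close> and
  \<open>4 ^ k\<close> are exploited.\<close>

lemma dyadic_test:
  fixes q \<gamma> \<rho> :: real and r :: ereal
  assumes bdd: "weighted_extension_bounded \<gamma> r (ereal q)" and q: "q > 0"
    and r: "r = (if \<rho> = 1 then \<infinity> else ereal (1 / (1 - \<rho>)))" and \<rho>: "0 \<le> \<rho>" "\<rho> \<le> 1"
  shows "\<exists>K>0. \<forall>(J :: nat set) (I :: nat set) \<kappa> E. finite J \<longrightarrow> finite I \<longrightarrow> \<kappa> ` I \<subseteq> J \<longrightarrow> 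
     disjoint_family_on E I \<longrightarrow> (\<forall>i\<in>I. E i \<in> sets borel) \<longrightarrow>
     (\<Sum>i\<in>I. \<integral>\<^sup>+x. ennreal (((2 ^ \<kappa> i) powr (1 - \<rho>) * norm (dyad_ext (\<kappa> i) x) * wt x powr - \<gamma>) powr q) * indicator (E i) x \<partial>lborel)
     \<le> ennreal (K * real (card J) powr (q * (1 - \<rho>)))"
proof -
  obtain K where K: "K > 0" "\<And>g N. g \<in> borel_measurable borel \<Longrightarrow> (\<And>t. t \<notin> {0..<2 * pi} \<Longrightarrow> g t = 0) \<Longrightarrow> 0 \<le> N \<Longrightarrow>
    (if \<rho> = 1 then \<forall>t. norm (g t) \<le> N else (\<integral>\<^sup>+t. ennreal (norm (g t) powr (1 / (1 - \<rho>))) \<partial>lborel) \<le> ennreal (N powr (1 / (1 - \<rho>)))) \<Longrightarrow>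
    (\<integral>\<^sup>+x. ennreal ((norm (arc_ext g x) * wt x powr - \<gamma>) powr q) \<partial>lborel) \<le> ennreal (K * N powr q)"
    using necessity_test[OF bdd q r \<rho>] by blast
  have "(\<Sum>i\<in>I. \<integral>\<^sup>+x. ennreal (((2 ^ \<kappa> i) powr (1 - \<rho>) * norm (dyad_ext (\<kappa> i) x) * wt x powr - \<gamma>) powr q) * indicator (E i) x \<partial>lborel)
     \<le> ennreal ((2 * K) * real (card J) powr (q * (1 - \<rho>)))"
    if J: "finite J" and I: "finite I" and \<kappa>: "\<kappa> ` I \<subseteq> J" and disj: "disjoint_family_on E I" and E: "\<And>i. i \<in> I \<Longrightarrow> E i \<in> sets borel"
    for J I :: "nat set" and \<kappa> E
  proof -
    \<comment> \<open>The subset \<open>A\<close> encodes a choice of signs.\<close>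
    define c where "c A j = (if j \<in> A then 1 else - 1 :: complex) * of_real ((2 ^ j) powr (1 - \<rho>))" for A and j :: nat
    have cn: "norm (c A j) = (2 ^ j) powr (1 - \<rho>)" for A j by (simp add: c_def norm_mult)
    define g where "g A t = (\<Sum>j\<in>J. c A j * of_real (indicator (dyad j) t))" for A t
    define N where "N = real (card J) powr (1 - \<rho>)"
    have gm: "g A \<in> borel_measurable borel" for A unfolding g_def[abs_def] by measurable
    have gs: "g A t = 0" if "t \<notin> {0..<2 * pi}" for A t
    proof -
      have "t \<notin> dyad j" for j using dyad_subset that by blast
      then show ?thesis by (simp add: g_def)
    qed
    have single: "g A t = c A m" if "m \<in> J" "t \<in> dyad m" for A t m
    proof -
      have "t \<in> dyad j \<longleftrightarrow> j = m" for j using that dyad_disjoint[of j m] by blast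
      then have "g A t = (\<Sum>j\<in>J. if j = m then c A j else 0)"
        unfolding g_def by (intro sum.cong) (auto simp: indicator_def)
      then show ?thesis using that J by simp
    qed
    have none: "g A t = 0" if "\<And>m. m \<in> J \<Longrightarrow> t \<notin> dyad m" for A t
      using that by (simp add: g_def)
    have gN: "if \<rho> = 1 then \<forall>t. norm (g A t) \<le> N else (\<integral>\<^sup>+t. ennreal (norm (g A t) powr (1 / (1 - \<rho>))) \<partial>lborel) \<le> ennreal (N powr (1 / (1 - \<rho>)))" for A
    proof (cases "\<rho> = 1")
      case True
      have "norm (g A t) \<le> N" for t
      proof (cases "\<exists>m\<in>J. t \<in> dyad m")
        case t: True
        then have "card J > 0" using J by (auto simp: card_gt_0_iff)
        then show ?thesis using t single cn True by (auto simp: N_def)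
      next
        case False
        then show ?thesis using none by (simp add: N_def)
      qed
      then show ?thesis using True by simp
    next
      case False
      define r0 where "r0 = 1 / (1 - \<rho>)"
      have r0: "r0 > 0" "(1 - \<rho>) * r0 = 1" using \<rho> False by (auto simp: r0_def)
      have pw: "ennreal (norm (g A t) powr r0) \<le> (\<Sum>j\<in>J. ennreal (2 ^ j) * indicator (dyad j) t)" for t
      proof (cases "\<exists>m\<in>J. t \<in> dyad m")
        case True
        then obtain m where m: "m \<in> J" "t \<in> dyad m" by blast
        have "norm (g A t) powr r0 = 2 ^ m" unfolding single[OF m] cn powr_powr r0 by simp
        then have "ennreal (norm (g A t) powr r0) = ennreal (2 ^ m) * indicator (dyad m) t" using m by simp
        also have "\<dots> \<le> (\<Sum>j\<in>J. ennreal (2 ^ j) * indicator (dyad j) t)"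
          using m J by (intro member_le_sum) auto
        finally show ?thesis .
      next
        case False
        then show ?thesis using none[of t A] r0 by simp
      qed
      have "(\<integral>\<^sup>+t. ennreal (norm (g A t) powr r0) \<partial>lborel) \<le> (\<integral>\<^sup>+t. (\<Sum>j\<in>J. ennreal (2 ^ j) * indicator (dyad j) t) \<partial>lborel)"
        by (intro nn_integral_mono pw)
      also have "\<dots> = (\<Sum>j\<in>J. \<integral>\<^sup>+t. ennreal (2 ^ j) * indicator (dyad j) t \<partial>lborel)"
        by (rule nn_integral_sum) simp
      also have "\<dots> = (\<Sum>j\<in>J. ennreal (2 ^ j) * ennreal ((1/2) ^ Suc j))"
        by (intro sum.cong refl) (simp add: nn_integral_cmult_indicator measure_dyad)
      also have "\<dots> \<le> (\<Sum>j\<in>J. ennreal 1)"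
      proof (rule sum_mono)
        fix j
        have "ennreal (2 ^ j) * ennreal ((1/2) ^ Suc j) = ennreal (2 ^ j * (1/2) ^ Suc j)" by (rule ennreal_mult[symmetric]) auto
        also have "\<dots> \<le> ennreal 1" by (intro ennreal_leI) (simp add: power_one_over)
        finally show "ennreal (2 ^ j) * ennreal ((1/2) ^ Suc j) \<le> ennreal 1" .
      qed
      also have "\<dots> = ennreal (real (card J))" by (simp add: ennreal_of_nat_eq_real_of_nat)
      also have "real (card J) = N powr r0" unfolding N_def powr_powr r0 by (cases "card J = 0") auto
      finally show ?thesis using False by (simp add: r0_def)
    qed
    have gext: "arc_ext (g A) x = (\<Sum>j\<in>J. (if j \<in> A then 1 else - 1) * (of_real ((2 ^ j) powr (1 - \<rho>)) * dyad_ext j x))" for A x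
    proof -
      have i: "integrable lborel (\<lambda>t. of_real (indicator (dyad j) t) * cis (x \<bullet> circ t))" for j
        using integrable_dyad by (rule Bochner_Integration.integrable_bound) (auto simp: norm_mult)
      have "arc_ext (g A) x = (\<integral>t. (\<Sum>j\<in>J. c A j * (of_real (indicator (dyad j) t) * cis (x \<bullet> circ t))) \<partial>lborel)"
        unfolding arc_ext_def g_def by (simp add: sum_distrib_right mult.assoc)
      also have "\<dots> = (\<Sum>j\<in>J. c A j * dyad_ext j x)"
        unfolding dyad_ext_def arc_ext_def using i by (simp add: Bochner_Integration.integral_sum)
      finally show ?thesis by (simp add: c_def mult.assoc)
    qed
    define W where "W i x = ennreal (((2 ^ \<kappa> i) powr (1 - \<rho>) * norm (dyad_ext (\<kappa> i) x) * wt x powr - \<gamma>) powr q) * indicator (E i) x" for i x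
    define V where "V A x = ennreal ((norm (arc_ext (g A) x) * wt x powr - \<gamma>) powr q)" for A x
    \<comment> \<open>At most one region contains \<open>x\<close>, so the sum over regions reduces
      to a single term, to which \<open>random_signs\<close> applies; \<open>2 ^ card J\<close>
      counts the choices of signs.\<close>
    have pw: "ennreal (2 ^ card J) * (\<Sum>i\<in>I. W i x) \<le> 2 * (\<Sum>A\<in>Pow J. V A x)" for x
    proof (cases "\<exists>i\<in>I. x \<in> E i")
      case True
      then obtain i where i: "i \<in> I" "x \<in> E i" by blast
      have other: "W i' x = 0" if "i' \<in> I" "i' \<noteq> i" for i'
        using disj i that by (auto simp: W_def disjoint_family_on_def indicator_def)
      have "(\<Sum>i\<in>I. W i x) = W i x" using other i I by (subst sum.remove[OF I i(1)]) simp
      also have "\<dots> = ennreal (((2 ^ \<kappa> i) powr (1 - \<rho>) * norm (dyad_ext (\<kappa> i) x) * wt x powr - \<gamma>) powr q)"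
        using i by (simp add: W_def)
      finally have sW: "(\<Sum>i\<in>I. W i x) = ennreal (((2 ^ \<kappa> i) powr (1 - \<rho>) * norm (dyad_ext (\<kappa> i) x) * wt x powr - \<gamma>) powr q)" .
      have "2 ^ card J * norm (of_real ((2 ^ \<kappa> i) powr (1 - \<rho>)) * dyad_ext (\<kappa> i) x) powr q \<le> 2 * (\<Sum>A\<in>Pow J. norm (arc_ext (g A) x) powr q)"
        unfolding gext using \<kappa> i by (intro random_signs J q) auto
      then have "(2 ^ card J * norm (of_real ((2 ^ \<kappa> i) powr (1 - \<rho>)) * dyad_ext (\<kappa> i) x) powr q) * (wt x powr - \<gamma>) powr q
         \<le> (2 * (\<Sum>A\<in>Pow J. norm (arc_ext (g A) x) powr q)) * (wt x powr - \<gamma>) powr q"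
        by (rule mult_right_mono) simp
      then have "2 ^ card J * ((2 ^ \<kappa> i) powr (1 - \<rho>) * norm (dyad_ext (\<kappa> i) x) * wt x powr - \<gamma>) powr q
         \<le> 2 * (\<Sum>A\<in>Pow J. (norm (arc_ext (g A) x) * wt x powr - \<gamma>) powr q)"
        by (simp add: powr_mult norm_mult sum_distrib_right mult.assoc)
      then have "ennreal (2 ^ card J * ((2 ^ \<kappa> i) powr (1 - \<rho>) * norm (dyad_ext (\<kappa> i) x) * wt x powr - \<gamma>) powr q)
         \<le> ennreal (2 * (\<Sum>A\<in>Pow J. (norm (arc_ext (g A) x) * wt x powr - \<gamma>) powr q))" by (rule ennreal_leI)
      then show ?thesis unfolding sW V_def by (simp add: ennreal_mult sum_ennreal sum_nonneg)
    next
      case False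
      then have "(\<Sum>i\<in>I. W i x) = 0" by (auto simp: W_def intro!: sum.neutral)
      then show ?thesis by simp
    qed
    have de[measurable]: "dyad_ext k \<in> borel_measurable borel" for k
      unfolding dyad_ext_def by (rule measurable_arc_ext) simp
    have Wm: "W i \<in> borel_measurable lborel" if "i \<in> I" for i
      using E[OF that] unfolding W_def[abs_def] by measurable
    have Vm[measurable]: "V A \<in> borel_measurable lborel" for A
    proof -
      have [measurable]: "arc_ext (g A) \<in> borel_measurable borel" using gm by (rule measurable_arc_ext)
      show ?thesis unfolding V_def[abs_def] by measurable
    qed
    have "ennreal (2 ^ card J) * (\<Sum>i\<in>I. \<integral>\<^sup>+x. W i x \<partial>lborel) = (\<integral>\<^sup>+x. ennreal (2 ^ card J) * (\<Sum>i\<in>I. W i x) \<partial>lborel)"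
      using Wm by (subst nn_integral_cmult) (auto simp: nn_integral_sum intro!: borel_measurable_sum)
    also have "\<dots> \<le> (\<integral>\<^sup>+x. 2 * (\<Sum>A\<in>Pow J. V A x) \<partial>lborel)" by (intro nn_integral_mono pw)
    also have "\<dots> = 2 * (\<Sum>A\<in>Pow J. \<integral>\<^sup>+x. V A x \<partial>lborel)"
      by (subst nn_integral_cmult) (auto simp: nn_integral_sum)
    also have "\<dots> \<le> 2 * (\<Sum>A\<in>Pow J. ennreal (K * N powr q))"
      unfolding V_def by (intro mult_left_mono sum_mono K(2) gm gs gN) (auto simp: N_def)
    also have "\<dots> = ennreal (2 ^ card J) * ennreal ((2 * K) * N powr q)"
      using J K(1) by (simp add: card_Pow ennreal_mult ennreal_of_nat_eq_real_of_nat mult_ac numeral_power_eq_of_nat_cancel_iff ennreal_power[symmetric])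
    finally have "(\<Sum>i\<in>I. \<integral>\<^sup>+x. W i x \<partial>lborel) \<le> ennreal ((2 * K) * N powr q)"
      by (subst (asm) ennreal_mult_le_mult_iff) auto
    then show ?thesis unfolding W_def N_def powr_powr by (simp add: mult.commute)
  qed
  then show ?thesis using K(1) by (intro exI[of _ "2 * K"]) auto
qed

section \<open>Tests on disjoint slabs inside Knapp boxes\<close>

definition slab :: "real \<Rightarrow> real \<Rightarrow> (real \<times> real) set" where
  "slab X Y = {X / 2 <.. X} \<times> {0 <.. Y}"

lemma slab_sets [measurable]: "slab X Y \<in> sets borel"
  unfolding slab_def by (intro borel_Times) auto

text \<open>On the slab \<open>wt\<close> is at most \<open>3 * X\<close> and the extension of the
  arc is at least \<open>(1/2) ^ k / 4\<close>; the area \<open>X / 2 * Y\<close> supplies the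
  remaining factor.\<close>

lemma slab_lower:
  fixes q \<gamma> \<rho> X Y :: real
  assumes q: "q > 0" and \<gamma>: "\<gamma> \<ge> 0" and X: "1 \<le> X" "X \<le> 4 ^ k" and Y: "0 < Y" "Y \<le> X" "Y \<le> 2 ^ k / 2"
  shows "ennreal (4 powr - q * 3 powr (- (\<gamma> * q)) / 2 * ((2 ^ k) powr (- (q * \<rho>)) * (X powr (1 - \<gamma> * q) * Y))) \<le>
    (\<integral>\<^sup>+x. ennreal (((2 ^ k) powr (1 - \<rho>) * norm (dyad_ext k x) * wt x powr - \<gamma>) powr q) * indicator (slab X Y) x \<partial>lborel)"
proof -
  define m where "m = (2 ^ k) powr (- \<rho>) / 4 * (3 * X) powr - \<gamma>"
  have m0: "m > 0" using X by (simp add: m_def)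
  have low: "m \<le> (2 ^ k) powr (1 - \<rho>) * norm (dyad_ext k x) * wt x powr - \<gamma>" if x: "x \<in> slab X Y" for x
  proof -
    have xb: "0 \<le> fst x" "fst x \<le> 4 ^ k" "0 \<le> snd x" "snd x \<le> 2 ^ k / 2" "fst x \<le> X" "snd x \<le> Y"
      using x X Y by (auto simp: slab_def)
    have "wt x \<le> 3 * X" using xb X Y by (simp add: wt_def)
    then have w: "(3 * X) powr - \<gamma> \<le> wt x powr - \<gamma>" using \<gamma> by (intro powr_mono2') auto
    have "(2 ^ k) powr (- \<rho>) / 4 = (2 ^ k) powr (1 - \<rho>) * ((1/2) ^ k / 4)"
    proof -
      have "(2 ^ k) powr (1 - \<rho>) = (2 ^ k) powr 1 * (2 ^ k :: real) powr (- \<rho>)" unfolding powr_add[symmetric] by simp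
      then show ?thesis by (simp add: power_one_over)
    qed
    also have "\<dots> \<le> (2 ^ k) powr (1 - \<rho>) * norm (dyad_ext k x)"
      using dyad_ext_lower[OF xb(1-4)] by (intro mult_left_mono) auto
    finally show ?thesis unfolding m_def using w by (intro mult_mono) auto
  qed
  have mq: "m powr q * (X / 2 * Y) = 4 powr - q * 3 powr (- (\<gamma> * q)) / 2 * ((2 ^ k) powr (- (q * \<rho>)) * (X powr (1 - \<gamma> * q) * Y))"
  proof -
    have "m powr q = (2 ^ k) powr (- (q * \<rho>)) / 4 powr q * (3 powr (- (\<gamma> * q)) * X powr (- (\<gamma> * q)))"
      unfolding m_def using X by (simp add: powr_mult powr_divide powr_powr mult.commute)
    moreover have "X powr (1 - \<gamma> * q) = X * X powr (- (\<gamma> * q))" using powr_add[of X 1 "- (\<gamma> * q)"] X by simp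
    moreover have "(4::real) powr - q = 1 / 4 powr q" by (simp add: powr_minus_divide)
    moreover have "a / b * (c * d) * (X / 2 * Y) = 1 / b * c / 2 * (a * (X * d * Y))" for a b c d by simp
    ultimately show ?thesis by presburger
  qed
  have em: "emeasure lborel (slab X Y) = ennreal (X / 2 * Y)"
  proof -
    have "emeasure lborel (slab X Y) = emeasure (lborel \<Otimes>\<^sub>M lborel) ({X / 2 <.. X} \<times> {0 <.. Y})"
      unfolding lborel_prod slab_def ..
    also have "\<dots> = ennreal (X / 2) * ennreal Y"
      using X Y by (subst lborel.emeasure_pair_measure_Times) auto
    also have "\<dots> = ennreal (X / 2 * Y)" using X Y by (intro ennreal_mult[symmetric]) auto
    finally show ?thesis .
  qed
  have "ennreal (m powr q * (X / 2 * Y)) = (\<integral>\<^sup>+x. ennreal (m powr q) * indicator (slab X Y) x \<partial>lborel)"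
    using ennreal_mult[of "m powr q" "X / 2 * Y"] X Y by (subst nn_integral_cmult_indicator) (simp_all add: em)
  also have "\<dots> \<le> (\<integral>\<^sup>+x. ennreal (((2 ^ k) powr (1 - \<rho>) * norm (dyad_ext k x) * wt x powr - \<gamma>) powr q) * indicator (slab X Y) x \<partial>lborel)"
    using low m0 q by (intro nn_integral_mono) (auto simp: indicator_def intro!: ennreal_leI powr_mono2)
  finally show ?thesis unfolding mq .
qed

lemma powr_bounded_imp_nonpos:
  fixes e K :: real
  assumes "\<And>k::nat. (2 ^ k) powr e \<le> K"
  shows "e \<le> 0"
proof (rule ccontr)
  assume "\<not> e \<le> 0"
  then have "(1::real) < 2 powr e" by (simp add: gr_one_powr)
  then obtain k where k: "K < (2 powr e) ^ k" using real_arch_pow by blast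
  have "(2 powr e) ^ k = (2 ^ k) powr e" by (simp add: powr_realpow[symmetric] powr_powr mult.commute)
  then show False using assms[of k] k by simp
qed

lemma not_linear_le_powr:
  fixes e K :: real
  assumes e: "e < 1" and le: "\<And>n::nat. real n / 2 \<le> K * real n powr e"
  shows False
proof -
  have "(2 ^ k) powr (1 - e) \<le> 2 * K" for k
  proof -
    have "(2 ^ k) powr (1 - e) * (2 ^ k) powr e \<le> 2 * K * (2 ^ k :: real) powr e"
      using le[of "2 ^ k"] unfolding powr_add[symmetric] by simp
    then show ?thesis by (rule mult_right_le_imp_le) simp
  qed
  then have "1 - e \<le> 0" by (rule powr_bounded_imp_nonpos)
  then show False using e by simp
qed

text \<open>The contribution of a slab at either end of the box of arc \<open>k\<close> is a power
  of \<open>2 ^ k\<close>, whose exponent must not be positive. In the case of equality the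
  contribution is constant, and many slabs with equal contributions contradict the bound by the
  norm.\<close>

lemma necessary_exponents:
  fixes q \<gamma> \<rho> :: real and r :: ereal
  assumes bdd: "weighted_extension_bounded \<gamma> r (ereal q)" and q: "q > 0" and \<gamma>: "\<gamma> \<ge> 0"
    and r: "r = (if \<rho> = 1 then \<infinity> else ereal (1 / (1 - \<rho>)))" and \<rho>: "0 \<le> \<rho>" "\<rho> \<le> 1"
  shows "\<gamma> > max (3 / (2 * q) - \<rho> / 2) (2 / q - \<rho>) \<or> 
    (0 < \<rho> \<and> r \<le> ereal q \<and> \<gamma> = max (3 / (2 * q) - \<rho> / 2) (2 / q - \<rho>) \<and> q * \<rho> \<noteq> 1)"
proof -
  obtain K where K: "K > 0" "\<And>(J :: nat set) (I :: nat set) \<kappa> E. finite J \<Longrightarrow> finite I \<Longrightarrow> \<kappa> ` I \<subseteq> J \<Longrightarrow> 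
     disjoint_family_on E I \<Longrightarrow> (\<forall>i\<in>I. E i \<in> sets borel) \<Longrightarrow>
     (\<Sum>i\<in>I. \<integral>\<^sup>+x. ennreal (((2 ^ \<kappa> i) powr (1 - \<rho>) * norm (dyad_ext (\<kappa> i) x) * wt x powr - \<gamma>) powr q) * indicator (E i) x \<partial>lborel)
     \<le> ennreal (K * real (card J) powr (q * (1 - \<rho>)))"
    using dyadic_test[OF bdd q r \<rho>] by blast
  define c where "c = 4 powr - q * 3 powr (- (\<gamma> * q)) / (2::real)"
  have c: "c > 0" by (simp add: c_def)
  define K' where "K' = K / c"
  have test: "(\<Sum>i<n. (2 ^ \<kappa> i) powr (- (q * \<rho>)) * (X i powr (1 - \<gamma> * q) * Y i)) \<le> K' * real (card J) powr (q * (1 - \<rho>))"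
    if J: "finite J" "\<kappa> ` {..<n} \<subseteq> J"
      and X: "\<And>i. i < n \<Longrightarrow> 1 \<le> X i" "\<And>i. i < n \<Longrightarrow> X i \<le> 4 ^ \<kappa> i"
      and Y: "\<And>i. i < n \<Longrightarrow> 0 < Y i" "\<And>i. i < n \<Longrightarrow> Y i \<le> X i" "\<And>i. i < n \<Longrightarrow> Y i \<le> 2 ^ \<kappa> i / 2"
      and sep: "\<And>i j. i < j \<Longrightarrow> 2 * X i \<le> X j" for n :: nat and J \<kappa> and X Y :: "nat \<Rightarrow> real"
  proof -
    have "disjoint_family_on (\<lambda>i. slab (X i) (Y i)) {..<n}"
      unfolding disjoint_family_on_def
    proof (intro ballI impI)
      fix i j :: nat assume "i \<noteq> j"
      then show "slab (X i) (Y i) \<inter> slab (X j) (Y j) = {}"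
      proof (induct i j rule: linorder_wlog)
        case (le i j)
        then have "2 * X i \<le> X j" by (intro sep) simp
        then show ?case by (auto simp: slab_def)
      qed auto
    qed
    then have *: "(\<Sum>i<n. \<integral>\<^sup>+x. ennreal (((2 ^ \<kappa> i) powr (1 - \<rho>) * norm (dyad_ext (\<kappa> i) x) * wt x powr - \<gamma>) powr q) * indicator (slab (X i) (Y i)) x \<partial>lborel)
      \<le> ennreal (K * real (card J) powr (q * (1 - \<rho>)))"
      by (intro K(2) J) auto
    let ?t = "\<lambda>i. (2 ^ \<kappa> i) powr (- (q * \<rho>)) * (X i powr (1 - \<gamma> * q) * Y i)"
    have t0: "0 \<le> c * ?t i" if "i \<in> {..<n}" for i using Y(1)[of i] c that by simp
    have "ennreal (\<Sum>i<n. c * ?t i) = (\<Sum>i<n. ennreal (c * ?t i))"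
      by (rule sum_ennreal[symmetric, OF t0])
    also have "\<dots> \<le> (\<Sum>i<n. \<integral>\<^sup>+x. ennreal (((2 ^ \<kappa> i) powr (1 - \<rho>) * norm (dyad_ext (\<kappa> i) x) * wt x powr - \<gamma>) powr q) * indicator (slab (X i) (Y i)) x \<partial>lborel)"
      unfolding c_def using X Y by (intro sum_mono slab_lower q \<gamma>) auto
    also note *
    finally have "(\<Sum>i<n. c * ?t i) \<le> K * real (card J) powr (q * (1 - \<rho>))"
      using K(1) by (simp add: ennreal_le_iff)
    then have "c * (\<Sum>i<n. ?t i) \<le> K * real (card J) powr (q * (1 - \<rho>))" by (simp only: sum_distrib_left)
    then show ?thesis unfolding K'_def using c by (simp add: field_simps)
  qed
  have pw: "(2 ^ k) powr a * ((2 ^ k) powr b * (2 ^ k / 2)) = (2 ^ k) powr (a + b + 1) / 2" for k :: nat and a b :: real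
    by (simp add: powr_add)
  have four: "(4 ^ k) powr b = (2 ^ k) powr (2 * b)" for k :: nat and b :: real
  proof -
    have "(4::real) ^ k = (2 ^ k) powr 2" by (simp add: power_mult[symmetric] power2_eq_square power_mult_distrib[symmetric])
    then show ?thesis by (simp add: powr_powr del: powr_numeral)
  qed
  have half: "(2::real) ^ k / 2 \<le> 2 ^ k" "(2::real) ^ k / 2 \<le> 4 ^ k" "(2::real) ^ k \<le> 4 ^ k" for k :: nat
  proof -
    show 1: "(2::real) ^ k \<le> 4 ^ k" by (rule power_mono) auto
    show "(2::real) ^ k / 2 \<le> 2 ^ k" by simp
    then show "(2::real) ^ k / 2 \<le> 4 ^ k" using 1 by linarith
  qed
  have sum1: "sum f {..<1::nat} = f 0" for f :: "nat \<Rightarrow> real" by simp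
  have card1: "K' * real (card {k :: nat}) powr (q * (1 - \<rho>)) = K'" for k by simp
  \<comment> \<open>The far end of the box, \<open>X = 4 ^ k\<close> and
    \<open>Y = 2 ^ k / 2\<close>.\<close>
  have n1: "3 - 2 * (\<gamma> * q) - q * \<rho> \<le> 0"
  proof (rule powr_bounded_imp_nonpos[of _ "2 * K'"])
    fix k :: nat
    \<comment> \<open>A single slab; the shift in \<open>4 ^ (k + i)\<close> only serves the
      separation hypothesis of \<open>test\<close>, which is required for all indices.\<close>
    have "(\<Sum>i<(1::nat). (2 ^ k) powr (- (q * \<rho>)) * ((4 ^ (k + i)) powr (1 - \<gamma> * q) * (2 ^ k / 2))) \<le> K' * real (card {k}) powr (q * (1 - \<rho>))"
    proof (rule test)
      fix i j :: nat assume ij: "i < j"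
      have "2 * (4::real) ^ (k + i) \<le> 4 ^ (k + i + 1)" by simp
      also have "\<dots> \<le> 4 ^ (k + j)" using ij by (intro power_increasing) auto
      finally show "2 * (4::real) ^ (k + i) \<le> 4 ^ (k + j)" .
    qed (use half in auto)
    then have "(2 ^ k) powr (- (q * \<rho>) + 2 * (1 - \<gamma> * q) + 1) / 2 \<le> K'"
      unfolding sum1 card1 add_0_right four pw .
    moreover have e: "- (q * \<rho>) + 2 * (1 - \<gamma> * q) + 1 = 3 - 2 * (\<gamma> * q) - q * \<rho>" by simp
    ultimately show "(2 ^ k) powr (3 - 2 * (\<gamma> * q) - q * \<rho>) \<le> 2 * K'" unfolding e by linarith
  qed
  \<comment> \<open>The near end of the box, a slab whose sides are both about
    \<open>2 ^ k\<close>.\<close>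
  have n2: "2 - \<gamma> * q - q * \<rho> \<le> 0"
  proof (rule powr_bounded_imp_nonpos[of _ "2 * K'"])
    fix k :: nat
    have "(\<Sum>i<(1::nat). (2 ^ k) powr (- (q * \<rho>)) * ((2 ^ (k + i)) powr (1 - \<gamma> * q) * (2 ^ k / 2))) \<le> K' * real (card {k}) powr (q * (1 - \<rho>))"
    proof (rule test)
      fix i j :: nat assume ij: "i < j"
      have "2 * (2::real) ^ (k + i) \<le> 2 ^ (k + i + 1)" by simp
      also have "\<dots> \<le> 2 ^ (k + j)" using ij by (intro power_increasing) auto
      finally show "2 * (2::real) ^ (k + i) \<le> 2 ^ (k + j)" .
    qed (use half in auto)
    then have "(2 ^ k) powr (- (q * \<rho>) + (1 - \<gamma> * q) + 1) / 2 \<le> K'"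
      unfolding sum1 card1 add_0_right pw .
    moreover have e: "- (q * \<rho>) + (1 - \<gamma> * q) + 1 = 2 - \<gamma> * q - q * \<rho>" by simp
    ultimately show "(2 ^ k) powr (2 - \<gamma> * q - q * \<rho>) \<le> 2 * K'" unfolding e by linarith
  qed
  define x where "x = 1 / q"
  have x: "3 / (2 * q) = 3 / 2 * x" "2 / q = 2 * x" and qx: "q * x = 1" using q by (simp_all add: x_def)
  have div: "a \<le> 0 \<longleftrightarrow> a / q \<le> 0" for a using q by (simp add: divide_le_0_iff)
  have ge1: "\<gamma> \<ge> 3 / (2 * q) - \<rho> / 2"
  proof -
    have "(3 - 2 * (\<gamma> * q) - q * \<rho>) / q \<le> 0" using n1 q by (simp add: divide_le_0_iff)
    moreover have "(3 - 2 * (\<gamma> * q) - q * \<rho>) / q = 3 * x - 2 * \<gamma> - \<rho>" using q by (simp add: x_def field_simps)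
    ultimately show ?thesis unfolding x by linarith
  qed
  have ge2: "\<gamma> \<ge> 2 / q - \<rho>"
  proof -
    have "(2 - \<gamma> * q - q * \<rho>) / q \<le> 0" using n2 q by (simp add: divide_le_0_iff)
    moreover have "(2 - \<gamma> * q - q * \<rho>) / q = 2 * x - \<gamma> - \<rho>" using q by (simp add: x_def field_simps)
    ultimately show ?thesis unfolding x by linarith
  qed
  have critical: "0 < \<rho> \<and> r \<le> ereal q \<and> q * \<rho> \<noteq> 1" if eq: "\<gamma> = max (3 / (2 * q) - \<rho> / 2) (2 / q - \<rho>)"
  proof -
    have sep2: "2 * (2::real) ^ (k + i) \<le> 2 ^ (k + j)" if "i < j" for i j k :: nat
    proof -
      have "2 * (2::real) ^ (k + i) \<le> 2 ^ (k + i + 1)" by simp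
      also have "\<dots> \<le> 2 ^ (k + j)" using that by (intro power_increasing) auto
      finally show ?thesis .
    qed
    have sep4: "2 * (4::real) ^ i \<le> 4 ^ j" if "i < j" for i j :: nat
    proof -
      have "2 * (4::real) ^ i \<le> 4 ^ (i + 1)" by simp
      also have "\<dots> \<le> 4 ^ j" using that by (intro power_increasing) auto
      finally show ?thesis .
    qed
    \<comment> \<open>Equality in the maximum makes one of the exponents in \<open>n1\<close> and
      \<open>n2\<close> vanish, according to the side of \<open>q * \<rho> = 1\<close>.\<close>
    have case_small: "2 - \<gamma> * q - q * \<rho> = 0" if "q * \<rho> \<le> 1"
    proof -
      have "\<rho> \<le> x" using that q by (simp add: x_def field_simps)
      then have "\<gamma> = 2 * x - \<rho>" using eq unfolding x by argo
      then have "q * \<gamma> = q * (2 * x - \<rho>)" by simp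
      also have "\<dots> = 2 * (q * x) - q * \<rho>" by (simp only: right_diff_distrib mult.left_commute)
      finally have "q * \<gamma> = 2 * (q * x) - q * \<rho>" .
      then show ?thesis unfolding qx by (simp add: mult.commute)
    qed
    have case_large: "3 - 2 * (\<gamma> * q) - q * \<rho> = 0" if "q * \<rho> \<ge> 1"
    proof -
      have "\<rho> \<ge> x" using that q by (simp add: x_def field_simps)
      then have "2 * \<gamma> = 3 * x - \<rho>" using eq unfolding x by argo
      then have "q * (2 * \<gamma>) = q * (3 * x - \<rho>)" by simp
      then have "2 * (q * \<gamma>) = 3 * (q * x) - q * \<rho>" by (simp only: right_diff_distrib mult.left_commute)
      then show ?thesis unfolding qx by (simp add: mult.commute)
    qed
    \<comment> \<open>Both exponents vanish, so one arc receives equal contributions from all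
      \<open>n\<close> slabs at radii between \<open>2 ^ n\<close> and \<open>4 ^ n\<close>: a
      logarithmic divergence.\<close>
    have ne: "q * \<rho> \<noteq> 1"
    proof
      assume one: "q * \<rho> = 1"
      then have g1: "\<gamma> * q = 1" using case_small by simp
      have "real n / 2 \<le> K' * real n powr 0" for n
      proof (cases "n = 0")
        case False
        have "(\<Sum>i<n. (2 ^ n) powr (- (q * \<rho>)) * ((2 ^ (n + i)) powr (1 - \<gamma> * q) * (2 ^ n / 2))) \<le> K' * real (card {n}) powr (q * (1 - \<rho>))"
        proof (rule test)
          fix i assume "i < n"
          then have "(2::real) ^ (n + i) \<le> 2 ^ (n + n)" by (intro power_increasing) auto
          also have "\<dots> = 4 ^ n" by (simp add: power_add power_mult_distrib[symmetric])
          finally show "(2::real) ^ (n + i) \<le> 4 ^ n" .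
          have "(2::real) ^ n \<le> 2 ^ (n + i)" by (intro power_increasing) auto
          then show "(2::real) ^ n / 2 \<le> 2 ^ (n + i)" using half(1)[of n] by linarith
        qed (use sep2 in auto)
        moreover have "(2 ^ n) powr (- (q * \<rho>)) * ((2 ^ (n + i)) powr (1 - \<gamma> * q) * (2 ^ n / 2)) = (1 / 2 :: real)" for i
          unfolding one g1 by (simp add: powr_minus)
        ultimately show ?thesis using False by simp
      qed simp
      then show False using not_linear_le_powr[of 0 K'] by simp
    qed
    \<comment> \<open>At \<open>r = 1\<close> one normalized short arc acts like a point mass: its
      extension has constant size out to radius about \<open>2 ^ n\<close>. The slabs of sides about
      \<open>2 ^ i\<close> contribute equally because \<open>\<gamma> * q = 2\<close>.\<close>
    have pos: "0 < \<rho>"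
    proof (rule ccontr)
      assume "\<not> 0 < \<rho>"
      then have 0: "\<rho> = 0" using \<rho> by simp
      then have g2: "\<gamma> * q = 2" using case_small by simp
      have "real n / 2 \<le> K' * real n powr 0" for n
      proof (cases "n = 0")
        case False
        have "(\<Sum>i<n. (2 ^ n) powr (- (q * \<rho>)) * ((2 ^ (0 + i)) powr (1 - \<gamma> * q) * (2 ^ i / 2))) \<le> K' * real (card {n}) powr (q * (1 - \<rho>))"
        proof (rule test)
          fix i assume "i < n"
          then have i: "(2::real) ^ i \<le> 2 ^ n" by (intro power_increasing) auto
          then show "(2::real) ^ (0 + i) \<le> 4 ^ n" unfolding add_0 using half(3)[of n] by (rule order_trans)
          show "(2::real) ^ i / 2 \<le> 2 ^ n / 2" using i by (rule divide_right_mono) simp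
        qed (use sep2[where k = 0] in auto)
        moreover have "(2 ^ n) powr (- (q * \<rho>)) * ((2 ^ (0 + i)) powr (1 - \<gamma> * q) * (2 ^ i / 2)) = (1 / 2 :: real)" for i
          unfolding 0 g2 by (simp add: powr_minus)
        ultimately show ?thesis using False by simp
      qed simp
      then show False using not_linear_le_powr[of 0 K'] by simp
    qed
    \<comment> \<open>Here \<open>n\<close> different arcs contribute equally, each on its own
      critical slab, whereas the norm allows only \<open>n powr (q * (1 - \<rho>))\<close>, an
      exponent below one when \<open>q < r\<close>.\<close>
    have "r \<le> ereal q"
    proof (rule ccontr)
      assume nr: "\<not> r \<le> ereal q"
      have u: "q * (1 - \<rho>) < 1"
      proof (cases "\<rho> = 1")
        case False
        then have "1 / (1 - \<rho>) > q" using nr r by simp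
        then show ?thesis using False \<rho> by (simp add: field_simps)
      qed simp
      have "real n / 2 \<le> K' * real n powr (q * (1 - \<rho>))" for n
      proof (cases "q * \<rho> < 1")
        case True
        have e: "- (q * \<rho>) + (1 - \<gamma> * q) + 1 = 0" using case_small True by simp
        have "(\<Sum>i<n. (2 ^ i) powr (- (q * \<rho>)) * ((2 ^ (0 + i)) powr (1 - \<gamma> * q) * (2 ^ i / 2))) \<le> K' * real (card {..<n}) powr (q * (1 - \<rho>))"
          by (rule test) (use sep2[where k = 0] half in auto)
        then show ?thesis unfolding add_0 pw e by simp
      next
        case False
        then have e: "- (q * \<rho>) + 2 * (1 - \<gamma> * q) + 1 = 0" using case_large by simp
        have "(\<Sum>i<n. (2 ^ i) powr (- (q * \<rho>)) * ((4 ^ i) powr (1 - \<gamma> * q) * (2 ^ i / 2))) \<le> K' * real (card {..<n}) powr (q * (1 - \<rho>))"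
          by (rule test) (use sep4 half in auto)
        then show ?thesis unfolding four pw e by simp
      qed
      then show False using not_linear_le_powr[OF u] by blast
    qed
    then show ?thesis using pos ne by simp
  qed
  show ?thesis
  proof (cases "\<gamma> = max (3 / (2 * q) - \<rho> / 2) (2 / q - \<rho>)")
    case True
    then show ?thesis using critical by blast
  next
    case False
    then show ?thesis using ge1 ge2 by auto
  qed
qed

subsection \<open>Extension of the constant function\<close>

text \<open>Van der Corput: away from the stationary point the phase derivative is monotone, and the
  second mean value theorem replaces integration by parts.\<close>

lemma cos_phase_quarter:
  fixes \<rho> :: real
  assumes \<rho>: "\<rho> \<ge> 1"
  shows "\<bar>integral {0..pi / 2} (\<lambda>t. cos (\<rho> * cos t))\<bar> \<le> 9 / sqrt \<rho>"
proof -
  \<comment> \<open>The stationary point at zero is cut out on the scale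
    \<open>1 / sqrt \<rho>\<close> at a cost of \<open>\<delta>\<close>. Beyond it
    \<open>1 / (\<rho> * sin t)\<close> is at most \<open>2 * \<delta>\<close>, which yields
    \<open>8 * \<delta>\<close>; together this is 9.\<close>
  define \<delta> where "\<delta> = 1 / sqrt \<rho>"
  have \<delta>: "\<delta> > 0" "\<delta> \<le> 1" using \<rho> by (auto simp: \<delta>_def)
  have \<rho>\<delta>: "1 / (\<rho> * \<delta>) = \<delta>"
    using \<rho> by (simp add: \<delta>_def real_div_sqrt)
  have \<delta>pi: "\<delta> \<le> pi / 2" using \<delta> pi_gt3 by simp
  \<comment> \<open>The derivative of \<open>sin (\<rho> * cos t)\<close>, so that its integrals are
    at most 2; \<open>g\<close> is the monotone factor for which \<open>g * f\<close> is the
    cosine.\<close>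
  define f where "f t = - (\<rho> * sin t) * cos (\<rho> * cos t)" for t
  define g where "g t = - 1 / (\<rho> * sin t)" for t
  have FTC: "integral {a..b} f = sin (\<rho> * cos b) - sin (\<rho> * cos a)" if "a \<le> b" for a b
  proof (rule integral_unique, rule fundamental_theorem_of_calculus[OF that])
    fix x assume "x \<in> {a..b}"
    have "((\<lambda>t. sin (\<rho> * cos t)) has_real_derivative f x) (at x within {a..b})"
      unfolding f_def by (auto intro!: derivative_eq_intros)
    then show "((\<lambda>t. sin (\<rho> * cos t)) has_vector_derivative f x) (at x within {a..b})"
      by (simp add: has_real_derivative_iff_has_vector_derivative)
  qed
  have f2: "\<bar>integral {a..b} f\<bar> \<le> 2" if "a \<le> b" for a b
    unfolding FTC[OF that] using abs_sin_le_one[of "\<rho> * cos b"] abs_sin_le_one[of "\<rho> * cos a"] by linarith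
  have fi: "f integrable_on {\<delta>..pi / 2}"
    unfolding f_def[abs_def] by (intro integrable_continuous_real continuous_intros)
  have sinpos: "sin \<delta> > 0" using \<delta> pi_gt3 by (intro sin_gt_zero) auto
  have sin_mono: "sin x \<le> sin y" if "\<delta> \<le> x" "x \<le> y" "y \<le> pi / 2" for x y
    using that \<delta> by (intro sin_monotone_2pi_le) auto
  have g_mono: "g x \<le> g y" if "\<delta> \<le> x" "x \<le> y" "y \<le> pi / 2" for x y
  proof -
    have "0 < sin x" "sin x \<le> sin y" using sin_mono[of \<delta> x] sin_mono[of x y] that sinpos by auto
    then have "1 / (\<rho> * sin y) \<le> 1 / (\<rho> * sin x)" using \<rho> by (intro divide_left_mono mult_left_mono) auto
    then show ?thesis by (simp add: g_def)
  qed
  have g_bound: "\<bar>g x\<bar> \<le> 2 * \<delta>" if "\<delta> \<le> x" "x \<le> pi / 2" for x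
  proof -
    have "\<delta> / 2 \<le> sin \<delta>" using \<delta> by (intro sin_ge_half) auto
    also have "\<dots> \<le> sin x" using that by (intro sin_mono) auto
    finally have s: "\<delta> / 2 \<le> sin x" .
    have "1 / (\<rho> * sin x) \<le> 1 / (\<rho> * (\<delta> / 2))" using s \<rho> \<delta> by (intro divide_left_mono mult_left_mono mult_pos_pos) auto
    also have "\<dots> = 2 * (1 / (\<rho> * \<delta>))" by simp
    also have "\<dots> = 2 * \<delta>" unfolding \<rho>\<delta> ..
    finally show ?thesis using s \<delta> \<rho> by (simp add: g_def abs_mult)
  qed
  obtain c where c: "c \<in> {\<delta>..pi / 2}" "integral {\<delta>..pi / 2} (\<lambda>x. g x * f x) = g \<delta> * integral {\<delta>..c} f + g (pi / 2) * integral {c..pi / 2} f"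
    using second_mean_value_theorem[where g = g, OF fi \<delta>pi] g_mono by blast
  have "integral {\<delta>..pi / 2} (\<lambda>t. cos (\<rho> * cos t)) = integral {\<delta>..pi / 2} (\<lambda>x. g x * f x)"
  proof (rule integral_cong)
    fix x assume "x \<in> {\<delta>..pi / 2}"
    then have "0 < sin x" using sin_mono[of \<delta> x] sinpos by auto
    then show "cos (\<rho> * cos x) = g x * f x" using \<rho> by (simp add: g_def f_def)
  qed
  also note c(2)
  also have "\<bar>g \<delta> * integral {\<delta>..c} f + g (pi / 2) * integral {c..pi / 2} f\<bar> \<le> 2 * \<delta> * 2 + 2 * \<delta> * 2"
  proof -
    have "\<bar>g \<delta> * integral {\<delta>..c} f\<bar> \<le> 2 * \<delta> * 2" "\<bar>g (pi / 2) * integral {c..pi / 2} f\<bar> \<le> 2 * \<delta> * 2"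
      unfolding abs_mult using c(1) \<delta> \<delta>pi by (intro mult_mono g_bound f2; simp)+
    then show ?thesis by linarith
  qed
  finally have outer: "\<bar>integral {\<delta>..pi / 2} (\<lambda>t. cos (\<rho> * cos t))\<bar> \<le> 8 * \<delta>" by simp
  have ci: "(\<lambda>t. cos (\<rho> * cos t)) integrable_on {a..b}" for a b
    by (intro integrable_continuous_real continuous_intros)
  have inner: "\<bar>integral {0..\<delta>} (\<lambda>t. cos (\<rho> * cos t))\<bar> \<le> \<delta>"
  proof -
    have "continuous_on {0..\<delta>} (\<lambda>t. cos (\<rho> * cos t))" by (intro continuous_intros)
    then show ?thesis using integral_bound[of 0 \<delta> "\<lambda>t. cos (\<rho> * cos t)" 1] \<delta> by simp
  qed
  have "integral {0..pi / 2} (\<lambda>t. cos (\<rho> * cos t)) = integral {0..\<delta>} (\<lambda>t. cos (\<rho> * cos t)) + integral {\<delta>..pi / 2} (\<lambda>t. cos (\<rho> * cos t))"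
    using \<delta> \<delta>pi by (intro Henstock_Kurzweil_Integration.integral_combine[symmetric] ci) auto
  then have "\<bar>integral {0..pi / 2} (\<lambda>t. cos (\<rho> * cos t))\<bar> \<le> 9 * \<delta>" using inner outer by linarith
  then show ?thesis by (simp add: \<delta>_def)
qed

definition full :: "real \<Rightarrow> complex" where
  "full t = of_real (indicator {0..<2 * pi} t)"

lemma integrable_full: "integrable lborel full"
  unfolding full_def by (rule integrable_of_real) (rule integrable_real_indicator, simp_all)

text \<open>\<open>arc_ext full x\<close> is \<open>2 * pi\<close> times the Bessel function of
  order zero at \<open>norm x\<close>. A rotation makes \<open>x\<close> horizontal, and the
  symmetries of the cosine fold the circle onto a quarter, which occurs twice as \<open>Q\<close>
  and twice as its conjugate; \<open>36 = 4 * 9\<close>.\<close>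

lemma arc_ext_full_decay:
  assumes x: "norm x \<ge> 1"
  shows "norm (arc_ext full x) \<le> 36 / sqrt (norm x)"
proof -
  define \<rho> where "\<rho> = norm x"
  have \<rho>: "\<rho> \<ge> 1" using x by (simp add: \<rho>_def)
  obtain \<phi> where \<phi>: "0 \<le> \<phi>" "\<phi> < 2 * pi" "x = \<rho> *\<^sub>R circ \<phi>"
  proof -
    have "(fst x)\<^sup>2 + (snd x)\<^sup>2 = \<rho>\<^sup>2" by (simp add: \<rho>_def norm_prod_def)
    then have "(fst x / \<rho>)\<^sup>2 + (snd x / \<rho>)\<^sup>2 = 1" using \<rho> by (simp add: power_divide add_divide_distrib[symmetric])
    then obtain t where t: "0 \<le> t" "t < 2 * pi" "fst x / \<rho> = cos t" "snd x / \<rho> = sin t" by (rule sincos_total_2pi)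
    then have "x = \<rho> *\<^sub>R circ t" using \<rho> by (cases x) (auto simp: circ_def field_simps)
    then show thesis using that t by blast
  qed
  define h where "h s = cis (\<rho> * cos s)" for s
  have hc: "continuous_on UNIV h" unfolding h_def by (intro continuous_intros)
  have [measurable]: "h \<in> borel_measurable borel" using hc by (rule borel_measurable_continuous_onI)
  define L where "L S = (\<integral>s. indicator S s *\<^sub>R h s \<partial>lborel)" for S
  have int: "integrable lborel (\<lambda>s. indicator S s *\<^sub>R h s)" if "S \<in> sets borel" "emeasure lborel S < \<infinity>" for S
  proof -
    have "integrable lborel (\<lambda>s. indicator S s :: real)" using that by (intro integrable_real_indicator) auto
    then show ?thesis by (rule Bochner_Integration.integrable_bound) (use that(1) in \<open>auto simp: h_def indicator_def\<close>)
  qed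
  have add: "L {a..<c} = L {a..<b} + L {b..<c}" if "a \<le> b" "b \<le> c" for a b c
  proof -
    have "L {a..<c} = (\<integral>s. indicator {a..<b} s *\<^sub>R h s + indicator {b..<c} s *\<^sub>R h s \<partial>lborel)"
      unfolding L_def using that by (intro Bochner_Integration.integral_cong) (auto simp: indicator_def)
    then show ?thesis unfolding L_def using int that by (simp add: Bochner_Integration.integral_add)
  qed
  have rot: "arc_ext full x = L {- \<phi>..<2 * pi - \<phi>}"
  proof -
    have "arc_ext full x = (\<integral>s. full (\<phi> + 1 * s) * cis (x \<bullet> circ (\<phi> + 1 * s)) \<partial>lborel)"
      unfolding arc_ext_def by (subst lborel_integral_real_affine[of 1 _ \<phi>]) auto
    also have "\<dots> = L {- \<phi>..<2 * pi - \<phi>}"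
      unfolding L_def
    proof (rule Bochner_Integration.integral_cong[OF refl])
      fix s
      have "x \<bullet> circ (\<phi> + s) = \<rho> * (cos \<phi> * cos (\<phi> + s) + sin \<phi> * sin (\<phi> + s))"
        by (simp add: \<phi>(3) circ_def algebra_simps)
      also have "\<dots> = \<rho> * cos (\<phi> - (\<phi> + s))" by (simp only: cos_diff)
      also have "\<dots> = \<rho> * cos s" by simp
      finally have "x \<bullet> circ (\<phi> + s) = \<rho> * cos s" .
      then show "full (\<phi> + 1 * s) * cis (x \<bullet> circ (\<phi> + 1 * s)) = indicator {- \<phi>..<2 * pi - \<phi>} s *\<^sub>R h s"
        by (auto simp: full_def h_def indicator_def)
    qed
    finally show ?thesis .
  qed
  \<comment> \<open>By periodicity the part of the rotated interval below zero moves to the end of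
    \<open>[0, 2 * pi)\<close>.\<close>
  have "L {- \<phi>..<0} = (\<integral>s. indicator {- \<phi>..<0} (- 2 * pi + 1 * s) *\<^sub>R h (- 2 * pi + 1 * s) \<partial>lborel)"
    unfolding L_def by (subst lborel_integral_real_affine[of 1 _ "- 2 * pi"]) auto
  also have "\<dots> = L {2 * pi - \<phi>..<2 * pi}"
    unfolding L_def
  proof (rule Bochner_Integration.integral_cong[OF refl])
    fix s :: real
    have "cos (- 2 * pi + s) = cos s" by (simp add: cos_diff)
    then have "h (- 2 * pi + 1 * s) = h s" by (simp add: h_def)
    then show "indicator {- \<phi>..<0} (- 2 * pi + 1 * s) *\<^sub>R h (- 2 * pi + 1 * s) = indicator {2 * pi - \<phi>..<2 * pi} s *\<^sub>R h s"
      by (auto simp: indicator_def)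
  qed
  finally have shift: "L {- \<phi>..<0} = L {2 * pi - \<phi>..<2 * pi}" .
  have "arc_ext full x = L {- \<phi>..<0} + L {0..<2 * pi - \<phi>}"
    unfolding rot using \<phi> by (intro add) auto
  also have "\<dots> = L {0..<2 * pi}"
    unfolding shift using add[of 0 "2 * pi - \<phi>" "2 * pi"] \<phi> by simp
  also have "\<dots> = L {0..<pi / 2} + (L {pi / 2..<pi} + (L {pi..<3 * pi / 2} + L {3 * pi / 2..<2 * pi}))"
    using add[of 0 "pi / 2" "2 * pi"] add[of "pi / 2" pi "2 * pi"] add[of pi "3 * pi / 2" "2 * pi"] by simp
  finally have four: "arc_ext full x = L {0..<pi / 2} + (L {pi / 2..<pi} + (L {pi..<3 * pi / 2} + L {3 * pi / 2..<2 * pi}))" .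
  define Q where "Q = L {0..pi / 2}"
  have endp: "L {a..<b} = L {a..b}" for a b
    unfolding L_def
  proof (rule integral_cong_AE)
    have "AE s in lborel. s \<noteq> b" by (rule AE_lborel_singleton)
    then show "AE s in lborel. indicator {a..<b} s *\<^sub>R h s = indicator {a..b} s *\<^sub>R h s"
      by eventually_elim (auto simp: indicator_def)
  qed measurable
  have q1: "L {0..<pi / 2} = Q" unfolding Q_def by (rule endp)
  have cnjQ: "(\<integral>s. indicator {0..pi / 2} s *\<^sub>R cnj (h s) \<partial>lborel) = cnj Q"
    unfolding Q_def L_def Bochner_Integration.integral_cnj[symmetric] by simp
  have q2: "L {pi / 2..<pi} = cnj Q"
  proof -
    have "L {pi / 2..<pi} = L {pi / 2..pi}" by (rule endp)
    also have "\<dots> = (\<integral>s. indicator {pi / 2..pi} (pi + (- 1) * s) *\<^sub>R h (pi + (- 1) * s) \<partial>lborel)"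
      unfolding L_def by (subst lborel_integral_real_affine[of "- 1" _ pi]) auto
    also have "\<dots> = (\<integral>s. indicator {0..pi / 2} s *\<^sub>R cnj (h s) \<partial>lborel)"
      by (intro Bochner_Integration.integral_cong) (auto simp: indicator_def h_def cis_cnj)
    finally show ?thesis unfolding cnjQ .
  qed
  have q3: "L {pi..<3 * pi / 2} = cnj Q"
  proof -
    have "L {pi..<3 * pi / 2} = L {pi..3 * pi / 2}" by (rule endp)
    also have "\<dots> = (\<integral>s. indicator {pi..3 * pi / 2} (pi + 1 * s) *\<^sub>R h (pi + 1 * s) \<partial>lborel)"
      unfolding L_def by (subst lborel_integral_real_affine[of 1 _ pi]) auto
    also have "\<dots> = (\<integral>s. indicator {0..pi / 2} s *\<^sub>R cnj (h s) \<partial>lborel)"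
      by (intro Bochner_Integration.integral_cong) (auto simp: indicator_def h_def cis_cnj)
    finally show ?thesis unfolding cnjQ .
  qed
  have q4: "L {3 * pi / 2..<2 * pi} = Q"
  proof -
    have "L {3 * pi / 2..<2 * pi} = L {3 * pi / 2..2 * pi}" by (rule endp)
    also have "\<dots> = (\<integral>s. indicator {3 * pi / 2..2 * pi} (2 * pi + (- 1) * s) *\<^sub>R h (2 * pi + (- 1) * s) \<partial>lborel)"
      unfolding L_def by (subst lborel_integral_real_affine[of "- 1" _ "2 * pi"]) auto
    also have "\<dots> = (\<integral>s. indicator {0..pi / 2} s *\<^sub>R h s \<partial>lborel)"
      by (intro Bochner_Integration.integral_cong) (auto simp: indicator_def h_def cos_diff)
    finally show ?thesis unfolding Q_def L_def .
  qed
  have "arc_ext full x = of_real (4 * Re Q)"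
    unfolding four q1 q2 q3 q4 by (simp add: complex_eq_iff)
  then have "norm (arc_ext full x) = 4 * \<bar>Re Q\<bar>" by simp
  also have "Re Q = integral {0..pi / 2} (\<lambda>t. cos (\<rho> * cos t))"
  proof -
    have i: "integrable lborel (\<lambda>s. indicator {0..pi / 2} s *\<^sub>R h s)" by (rule int) auto
    have "Re Q = (\<integral>s. Re (indicator {0..pi / 2} s *\<^sub>R h s) \<partial>lborel)"
      unfolding Q_def L_def using i by (rule integral_Re[symmetric])
    also have "\<dots> = (LINT s:{0..pi / 2}|lborel. cos (\<rho> * cos s))"
      unfolding set_lebesgue_integral_def by (simp add: h_def)
    also have "\<dots> = integral {0..pi / 2} (\<lambda>t. cos (\<rho> * cos t))"
    proof (rule set_borel_integral_eq_integral(2))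
      show "set_integrable lborel {0..pi / 2} (\<lambda>t. cos (\<rho> * cos t))"
        using integrable_Re[OF i] by (simp add: set_integrable_def h_def)
    qed
    finally show ?thesis .
  qed
  finally show ?thesis using cos_phase_quarter[OF \<rho>] by (simp add: \<rho>_def)
qed

lemma sqrt_divide_self: "c > 0 \<Longrightarrow> sqrt c / c = 1 / sqrt c"
  by (simp add: eq_divide_eq)

text \<open>The constant function and the kernel are nonnegative, so the exact identity of
  \<open>oscillatory_square\<close> may be restricted to pairs of angles at distance below
  \<open>sqrt c\<close>. There the exponent is at least \<open>- 1 / 4\<close>, and the strip of
  such pairs has area \<open>sqrt c\<close>.\<close>

lemma full_gaussian_lower:
  fixes c :: real
  assumes c: "0 < c" "c \<le> 1"
  shows "ennreal (pi * exp (- 1 / 4) / sqrt c) \<le> (\<integral>\<^sup>+x. ennreal ((norm (arc_ext full x))\<^sup>2 * exp (- c * (norm x)\<^sup>2)) \<partial>lborel)"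
proof -
  define k where "k p = indicator {0..<2 * pi} (fst p) * indicator {0..<2 * pi} (snd p) * (pi / c * exp (- (norm (circ (fst p) - circ (snd p)))\<^sup>2 / (4 * c)))" for p
  let ?K = "\<lambda>p. full (fst p) * cnj (full (snd p)) * of_real (pi / c * exp (- (norm (circ (fst p) - circ (snd p)))\<^sup>2 / (4 * c)))"
  have Kk: "?K p = of_real (k p)" for p by (simp add: full_def k_def)
  have k0: "k p \<ge> 0" for p using c by (simp add: k_def)
  note os = oscillatory_square[OF sigma_finite_lborel integrable_full _ c(1), of circ, unfolded Kk]
  have kint: "integrable (lborel \<Otimes>\<^sub>M lborel) k"
    using os(1) by (simp add: complex_of_real_integrable_eq)
  \<comment> \<open>The first angle stays below 1 and the second below 2, so the strip does not meet
    the cut at \<open>2 * pi\<close>.\<close>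
  define T where "T = {p. 0 \<le> fst p \<and> fst p < 1 \<and> fst p \<le> snd p \<and> snd p < fst p + sqrt c}"
  have "{p \<in> space (lborel \<Otimes>\<^sub>M lborel). 0 \<le> fst p \<and> fst p < 1 \<and> fst p \<le> snd p \<and> snd p < fst p + sqrt c} \<in> sets (lborel \<Otimes>\<^sub>M lborel)"
    by measurable
  then have Tm: "T \<in> sets (lborel \<Otimes>\<^sub>M lborel)"
    by (simp add: T_def space_pair_measure)
  have kT: "pi / c * exp (- 1 / 4) * indicator T p \<le> k p" for p
  proof (cases "p \<in> T")
    case True
    then have p: "0 \<le> fst p" "fst p < 1" "fst p \<le> snd p" "snd p < fst p + sqrt c" by (auto simp: T_def)
    have "sqrt c \<le> 1" using c by simp
    then have "snd p < 2" using p by linarith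
    then have in_range: "fst p \<in> {0..<2 * pi}" "snd p \<in> {0..<2 * pi}" using p pi_gt3 by auto
    have "(norm (circ (fst p) - circ (snd p)))\<^sup>2 = 4 * (sin ((fst p - snd p) / 2))\<^sup>2"
      using norm_circ_diff[of 1 "fst p" 1 "snd p"] by simp
    also have "\<dots> \<le> 4 * ((fst p - snd p) / 2)\<^sup>2"
      using abs_sin_x_le_abs_x[of "(fst p - snd p) / 2"] by (intro mult_left_mono) (metis abs_le_square_iff, simp)
    also have "\<dots> = (snd p - fst p)\<^sup>2" by (simp add: power_divide power2_commute)
    also have "\<dots> \<le> (sqrt c)\<^sup>2" using p by (intro power_mono) auto
    also have "\<dots> = c" using c by simp
    finally have "- 1 / 4 \<le> - (norm (circ (fst p) - circ (snd p)))\<^sup>2 / (4 * c)" using c by (simp add: field_simps)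
    then have "pi / c * exp (- 1 / 4) \<le> pi / c * exp (- (norm (circ (fst p) - circ (snd p)))\<^sup>2 / (4 * c))"
      using c by (intro mult_left_mono) auto
    then show ?thesis using True in_range by (simp add: k_def)
  next
    case False
    then show ?thesis using k0 by simp
  qed
  have eT: "emeasure (lborel \<Otimes>\<^sub>M lborel) T = ennreal (sqrt c)"
  proof -
    have "emeasure (lborel \<Otimes>\<^sub>M lborel) T = (\<integral>\<^sup>+s. emeasure lborel (Pair s -` T) \<partial>lborel)"
      by (rule lborel.emeasure_pair_measure_alt[OF Tm])
    also have "\<dots> = (\<integral>\<^sup>+s. ennreal (sqrt c) * indicator {0..<1::real} s \<partial>lborel)"
    proof (rule nn_integral_cong)
      fix s :: real
      have "Pair s -` T = (if 0 \<le> s \<and> s < 1 then {s..<s + sqrt c} else {})" by (auto simp: T_def)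
      then show "emeasure lborel (Pair s -` T) = ennreal (sqrt c) * indicator {0..<1} s" using c by (simp add: indicator_def)
    qed
    also have "\<dots> = ennreal (sqrt c)" by (subst nn_integral_cmult_indicator) auto
    finally show ?thesis .
  qed
  have cs: "pi * exp (- 1 / 4) / sqrt c = pi / c * exp (- 1 / 4) * sqrt c"
  proof -
    have "pi / c * E * sqrt c = pi * E * (sqrt c / c)" for E by simp
    then show ?thesis unfolding sqrt_divide_self[OF c(1)] by simp
  qed
  have "ennreal (pi * exp (- 1 / 4) / sqrt c) = ennreal (pi / c * exp (- 1 / 4)) * ennreal (sqrt c)"
    unfolding cs using c by (intro ennreal_mult) auto
  also have "\<dots> = (\<integral>\<^sup>+p. ennreal (pi / c * exp (- 1 / 4)) * indicator T p \<partial>(lborel \<Otimes>\<^sub>M lborel))"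
    unfolding eT[symmetric] by (rule nn_integral_cmult_indicator[OF Tm, symmetric])
  also have "\<dots> \<le> (\<integral>\<^sup>+p. ennreal (k p) \<partial>(lborel \<Otimes>\<^sub>M lborel))"
  proof (rule nn_integral_mono)
    fix p
    show "ennreal (pi / c * exp (- 1 / 4)) * indicator T p \<le> ennreal (k p)"
      using kT[of p] by (cases "p \<in> T") (auto intro: ennreal_leI)
  qed
  also have "\<dots> = ennreal (\<integral>p. k p \<partial>(lborel \<Otimes>\<^sub>M lborel))"
    using kint k0 by (intro nn_integral_eq_integral) auto
  also have "\<dots> = ennreal (norm (\<integral>p. complex_of_real (k p) \<partial>(lborel \<Otimes>\<^sub>M lborel)))"
    unfolding integral_complex_of_real using k0 by (simp add: integral_nonneg_AE)
  also have "\<dots> = (\<integral>\<^sup>+x. ennreal ((norm (arc_ext full x))\<^sup>2 * exp (- c * (norm x)\<^sup>2)) \<partial>lborel)"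
    unfolding arc_ext_def by (rule os(2)[symmetric]) simp
  finally show ?thesis .
qed

text \<open>Each of the seven unit windows obeys \<open>arc_ext_L2_gaussian\<close>;
  \<open>49 = 7\<^sup>2\<close> comes from squaring a sum of seven terms.\<close>

lemma full_gaussian_upper:
  "\<exists>C>0. \<forall>c>0. (\<integral>\<^sup>+x. ennreal ((norm (arc_ext full x))\<^sup>2 * exp (- c * (norm x)\<^sup>2)) \<partial>lborel) \<le> ennreal (C / sqrt c)"
proof -
  define g where "g n t = indicator {real n..<real n + 1} t *\<^sub>R full t" for n :: nat and t
  have gm[measurable]: "g n \<in> borel_measurable borel" for n unfolding g_def full_def by measurable
  have gi: "integrable lborel (g n)" for n
    unfolding g_def by (rule integrable_mult_indicator[OF _ integrable_full]) simp
  have gsum: "full t = (\<Sum>n<7. g n t)" for t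
  proof -
    have "full = on_circle (\<lambda>_. 1)" by (auto simp: full_def on_circle_def indicator_def)
    then show ?thesis using on_circle_pieces[of "\<lambda>_. 1" t] by (simp add: g_def)
  qed
  have g2: "(\<integral>\<^sup>+t. ennreal ((norm (g n t))\<^sup>2) \<partial>lborel) \<le> 1" for n
  proof -
    have "(\<integral>\<^sup>+t. ennreal ((norm (g n t))\<^sup>2) \<partial>lborel) \<le> (\<integral>\<^sup>+t. indicator {real n..<real n + 1} t \<partial>lborel)"
      by (intro nn_integral_mono) (auto simp: g_def full_def indicator_def)
    then show ?thesis by simp
  qed
  define C where "C = 49 * (7 * (4 * pi * sqrt pi))"
  have ext: "arc_ext full x = (\<Sum>n<7. arc_ext (g n) x)" for x
  proof -
    have i: "integrable lborel (\<lambda>t. g n t * cis (x \<bullet> circ t))" for n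
      using gi by (rule Bochner_Integration.integrable_bound) (auto simp: norm_mult)
    show ?thesis unfolding arc_ext_def gsum sum_distrib_right using i by (rule Bochner_Integration.integral_sum)
  qed
  have "(\<integral>\<^sup>+x. ennreal ((norm (arc_ext full x))\<^sup>2 * exp (- c * (norm x)\<^sup>2)) \<partial>lborel) \<le> ennreal (C / sqrt c)" if c: "c > 0" for c
  proof -
    let ?G = "\<lambda>n x. ennreal ((norm (arc_ext (g n) x))\<^sup>2 * exp (- c * (norm x)\<^sup>2))"
    have Gm: "?G n \<in> borel_measurable lborel" for n by measurable
    have "ennreal ((norm (arc_ext full x))\<^sup>2 * exp (- c * (norm x)\<^sup>2)) \<le> ennreal 49 * (\<Sum>n<7. ?G n x)" for x
    proof -
      have "norm (arc_ext full x) \<le> (\<Sum>n<7. norm (arc_ext (g n) x))" unfolding ext by (rule norm_sum)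
      then have "(norm (arc_ext full x))\<^sup>2 \<le> (\<Sum>n<7. norm (arc_ext (g n) x))\<^sup>2" by (intro power_mono) auto
      also have "\<dots> = (\<Sum>n<7. norm (arc_ext (g n) x)) powr 2" by (simp add: sum_nonneg)
      also have "\<dots> \<le> real 7 powr 2 * (\<Sum>n<7. norm (arc_ext (g n) x) powr 2)" by (rule powr_sum_le) auto
      also have "\<dots> = 49 * (\<Sum>n<7. (norm (arc_ext (g n) x))\<^sup>2)" by simp
      finally have "(norm (arc_ext full x))\<^sup>2 * exp (- c * (norm x)\<^sup>2) \<le> (49 * (\<Sum>n<7. (norm (arc_ext (g n) x))\<^sup>2)) * exp (- c * (norm x)\<^sup>2)"
        by (rule mult_right_mono) simp
      also have "\<dots> = 49 * (\<Sum>n<7. (norm (arc_ext (g n) x))\<^sup>2 * exp (- c * (norm x)\<^sup>2))"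
        unfolding mult.assoc sum_distrib_right ..
      finally have "ennreal ((norm (arc_ext full x))\<^sup>2 * exp (- c * (norm x)\<^sup>2)) \<le> ennreal (49 * (\<Sum>n<7. (norm (arc_ext (g n) x))\<^sup>2 * exp (- c * (norm x)\<^sup>2)))"
        by (rule ennreal_leI)
      also have "\<dots> = ennreal 49 * ennreal (\<Sum>n<7. (norm (arc_ext (g n) x))\<^sup>2 * exp (- c * (norm x)\<^sup>2))"
        by (rule ennreal_mult) (auto intro!: sum_nonneg)
      also have "ennreal (\<Sum>n<7. (norm (arc_ext (g n) x))\<^sup>2 * exp (- c * (norm x)\<^sup>2)) = (\<Sum>n<7. ?G n x)"
        by (rule sum_ennreal[symmetric]) auto
      finally show ?thesis .
    qed
    then have "(\<integral>\<^sup>+x. ennreal ((norm (arc_ext full x))\<^sup>2 * exp (- c * (norm x)\<^sup>2)) \<partial>lborel) \<le> (\<integral>\<^sup>+x. ennreal 49 * (\<Sum>n<7. ?G n x) \<partial>lborel)"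
      by (intro nn_integral_mono)
    also have "\<dots> = ennreal 49 * (\<Sum>n<7. \<integral>\<^sup>+x. ?G n x \<partial>lborel)"
      by (simp only: nn_integral_cmult[OF borel_measurable_sum[OF Gm]] nn_integral_sum[OF Gm])
    also have "\<dots> \<le> ennreal 49 * (\<Sum>n<(7::nat). ennreal (pi / c * sqrt (16 * pi * c)) * 1)"
    proof (intro mult_left_mono sum_mono)
      fix n
      have "(\<integral>\<^sup>+x. ?G n x \<partial>lborel) \<le> ennreal (pi / c * sqrt (16 * pi * c)) * (\<integral>\<^sup>+t. ennreal ((norm (g n t))\<^sup>2) \<partial>lborel)"
        by (rule arc_ext_L2_gaussian[OF gi _ c, of "real n"]) (auto simp: g_def indicator_def)
      also have "\<dots> \<le> ennreal (pi / c * sqrt (16 * pi * c)) * 1" by (intro mult_left_mono g2) auto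
      finally show "(\<integral>\<^sup>+x. ?G n x \<partial>lborel) \<le> ennreal (pi / c * sqrt (16 * pi * c)) * 1" .
    qed auto
    also have "\<dots> = ennreal (49 * (7 * (pi / c * sqrt (16 * pi * c))))"
    proof -
      have "(\<Sum>n<(7::nat). ennreal (pi / c * sqrt (16 * pi * c)) * 1) = ennreal (\<Sum>n<(7::nat). pi / c * sqrt (16 * pi * c))"
        unfolding mult_1_right by (rule sum_ennreal) (use c in simp)
      also have "(\<Sum>n<(7::nat). pi / c * sqrt (16 * pi * c)) = 7 * (pi / c * sqrt (16 * pi * c))" by simp
      finally show ?thesis using c by (simp only:) (rule ennreal_mult[symmetric], auto)
    qed
    also have "49 * (7 * (pi / c * sqrt (16 * pi * c))) = C / sqrt c"
    proof -
      have "sqrt c / c = 1 / sqrt c" using c by (rule sqrt_divide_self)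
      moreover have "49 * (7 * (pi / c * sqrt (16 * pi * c))) = C * (sqrt c / c)" by (simp add: C_def real_sqrt_mult)
      ultimately show ?thesis by simp
    qed
    finally show ?thesis .
  qed
  moreover have "C > 0" by (simp add: C_def)
  ultimately show ?thesis by blast
qed

section \<open>The constant function in shells\<close>

definition shell :: "real \<Rightarrow> real \<Rightarrow> real \<Rightarrow> (real \<times> real) set" where
  "shell \<epsilon> A R = {x. \<epsilon> * R \<le> norm x \<and> norm x \<le> A * R}"

lemma shell_sets [measurable]: "shell \<epsilon> A R \<in> sets borel"
  unfolding shell_def by measurable

text \<open>Agmon--Hoermander: the energy of the extension of the constant function grows exactly linearly,
  so a fixed proportion of it sits in a shell.\<close>

lemma full_shell_L2:
  obtains \<epsilon> A c1 :: real where "0 < \<epsilon>" "\<epsilon> \<le> 1" "1 \<le> A" "c1 > 0"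
    "\<And>R. R \<ge> 1 \<Longrightarrow> ennreal (c1 * R) \<le> (\<integral>\<^sup>+x. ennreal ((norm (arc_ext full x))\<^sup>2) * indicator (shell \<epsilon> A R) x \<partial>lborel)"
proof -
  obtain C where C: "C > 0" "\<And>c. c > 0 \<Longrightarrow> (\<integral>\<^sup>+x. ennreal ((norm (arc_ext full x))\<^sup>2 * exp (- c * (norm x)\<^sup>2)) \<partial>lborel) \<le> ennreal (C / sqrt c)"
    using full_gaussian_upper by blast
  have fm[measurable]: "arc_ext full \<in> borel_measurable borel"
    by (rule measurable_arc_ext) (use integrable_full in auto)
  define c0 where "c0 = pi * exp (- 1 / 4)"
  have c0: "c0 > 0" by (simp add: c0_def)
  \<comment> \<open>Small enough that the ball of radius \<open>\<epsilon> * R\<close> accounts for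
    at most \<open>c0 / 4 * R\<close>.\<close>
  define \<epsilon> where "\<epsilon> = min 1 (c0 / (4 * exp 1 * C))"
  have \<epsilon>: "0 < \<epsilon>" "\<epsilon> \<le> 1" "\<epsilon> \<le> c0 / (4 * exp 1 * C)"
  proof -
    have "0 < c0 / (4 * exp 1 * C)" using c0 C(1) by simp
    then show "0 < \<epsilon>" unfolding \<epsilon>_def by (simp only: min_less_iff_conj) simp
    show "\<epsilon> \<le> 1" unfolding \<epsilon>_def by (rule min.cobounded1)
    show "\<epsilon> \<le> c0 / (4 * exp 1 * C)" unfolding \<epsilon>_def by (rule min.cobounded2)
  qed
  \<comment> \<open>Large enough that the Gaussian tail beyond \<open>A * R\<close> accounts for at
    most as much, by \<open>exp (- y) \<le> 1 / y\<close> with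
    \<open>y = A\<^sup>2 / 2\<close>.\<close>
  define A where "A = max 1 (sqrt (16 * C / c0))"
  have A: "A \<ge> 1" "A \<ge> sqrt (16 * C / c0)" by (simp_all add: A_def)
  have A2: "A\<^sup>2 \<ge> 16 * C / c0"
  proof -
    have "(sqrt (16 * C / c0))\<^sup>2 \<le> A\<^sup>2" using A C c0 by (intro power_mono) auto
    then show ?thesis using C c0 by simp
  qed
  let ?J = "\<lambda>x. (norm (arc_ext full x))\<^sup>2"
  have main: "ennreal (c0 / 2 * R) \<le> (\<integral>\<^sup>+x. ennreal (?J x) * indicator (shell \<epsilon> A R) x \<partial>lborel)" if R: "R \<ge> 1" for R
  proof -
    let ?I = "\<integral>\<^sup>+x. ennreal (?J x) * indicator (shell \<epsilon> A R) x \<partial>lborel"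
    \<comment> \<open>Gaussians at the scales \<open>R\<close>, \<open>\<epsilon> * R\<close> and
      \<open>sqrt 2 * R\<close>; the last one has half the exponent of the first.\<close>
    define c where "c = 1 / R\<^sup>2"
    define ci where "ci = 1 / (\<epsilon> * R)\<^sup>2"
    define co where "co = 1 / (2 * R\<^sup>2)"
    have cp: "c > 0" "c \<le> 1" "ci > 0" "co > 0" using R \<epsilon> by (auto simp: c_def ci_def co_def one_le_power)
    have sc: "sqrt c = 1 / R" "sqrt ci = 1 / (\<epsilon> * R)" "1 / sqrt co = sqrt 2 * R"
      using R \<epsilon> by (auto simp: c_def ci_def co_def real_sqrt_divide real_sqrt_mult)
    \<comment> \<open>Inside the shell the indicator dominates. Below it, the narrow Gaussian is at
      least \<open>exp (- 1)\<close>; above it, half of the exponent is spent on the constant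
      \<open>exp (- (A\<^sup>2 / 2))\<close>.\<close>
    have pw: "?J x * exp (- c * (norm x)\<^sup>2) \<le> ?J x * indicator (shell \<epsilon> A R) x + 
        (exp 1 * (?J x * exp (- ci * (norm x)\<^sup>2)) + exp (- (A\<^sup>2 / 2)) * (?J x * exp (- co * (norm x)\<^sup>2)))" for x
    proof -
      have J0: "?J x \<ge> 0" by simp
      consider "x \<in> shell \<epsilon> A R" | "norm x < \<epsilon> * R" | "norm x > A * R" by (cases "\<epsilon> * R \<le> norm x"; cases "norm x \<le> A * R") (auto simp: shell_def not_le)
      then have "exp (- c * (norm x)\<^sup>2) \<le> indicator (shell \<epsilon> A R) x + (exp 1 * exp (- ci * (norm x)\<^sup>2) + exp (- (A\<^sup>2 / 2)) * exp (- co * (norm x)\<^sup>2))"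
      proof cases
        case 1
        have "exp (- c * (norm x)\<^sup>2) \<le> 1" using cp by simp
        moreover have "0 \<le> exp 1 * exp (- ci * (norm x)\<^sup>2) + exp (- (A\<^sup>2 / 2)) * exp (- co * (norm x)\<^sup>2)" by (intro add_nonneg_nonneg) auto
        moreover have "indicator (shell \<epsilon> A R) x = (1 :: real)" using 1 by simp
        ultimately show ?thesis by linarith
      next
        case 2
        have "(norm x)\<^sup>2 \<le> (\<epsilon> * R)\<^sup>2" using 2 by (intro power_mono) auto
        then have "ci * (norm x)\<^sup>2 \<le> 1" using R \<epsilon> by (simp add: ci_def)
        then have "1 \<le> exp (1 + (- ci * (norm x)\<^sup>2))" by simp
        then have "1 \<le> exp 1 * exp (- ci * (norm x)\<^sup>2)" unfolding exp_add .
        moreover have "exp (- c * (norm x)\<^sup>2) \<le> 1" using cp by simp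
        moreover have "0 \<le> indicator (shell \<epsilon> A R) x + exp (- (A\<^sup>2 / 2)) * exp (- co * (norm x)\<^sup>2)" by (intro add_nonneg_nonneg) auto
        ultimately show ?thesis by linarith
      next
        case 3
        have "(A * R)\<^sup>2 \<le> (norm x)\<^sup>2" using 3 A R by (intro power_mono) auto
        then have X: "A\<^sup>2 / 2 \<le> co * (norm x)\<^sup>2" using R by (simp add: co_def field_simps power_mult_distrib)
        have "c = co + co" by (simp add: c_def co_def)
        then have Y: "c * (norm x)\<^sup>2 = co * (norm x)\<^sup>2 + co * (norm x)\<^sup>2" by (simp only: distrib_right)
        have "- c * (norm x)\<^sup>2 \<le> - (A\<^sup>2 / 2) + - co * (norm x)\<^sup>2" using X Y unfolding mult_minus_left by linarith
        then have "exp (- c * (norm x)\<^sup>2) \<le> exp (- (A\<^sup>2 / 2) + - co * (norm x)\<^sup>2)" by (simp only: exp_le_cancel_iff)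
        then have "exp (- c * (norm x)\<^sup>2) \<le> exp (- (A\<^sup>2 / 2)) * exp (- co * (norm x)\<^sup>2)" unfolding exp_add .
        moreover have "0 \<le> indicator (shell \<epsilon> A R) x + exp 1 * exp (- ci * (norm x)\<^sup>2)" by (intro add_nonneg_nonneg) auto
        ultimately show ?thesis by linarith
      qed
      then have "?J x * exp (- c * (norm x)\<^sup>2) \<le> ?J x * (indicator (shell \<epsilon> A R) x + (exp 1 * exp (- ci * (norm x)\<^sup>2) + exp (- (A\<^sup>2 / 2)) * exp (- co * (norm x)\<^sup>2)))"
        using J0 by (rule mult_left_mono)
      then show ?thesis by (simp add: distrib_left mult_ac)
    qed
    have "ennreal (c0 * R) \<le> (\<integral>\<^sup>+x. ennreal (?J x * exp (- c * (norm x)\<^sup>2)) \<partial>lborel)"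
      using full_gaussian_lower[OF cp(1,2)] R by (simp add: sc c0_def)
    also have "\<dots> \<le> (\<integral>\<^sup>+x. ennreal (?J x) * indicator (shell \<epsilon> A R) x + 
        (ennreal (exp 1) * ennreal (?J x * exp (- ci * (norm x)\<^sup>2)) + ennreal (exp (- (A\<^sup>2 / 2))) * ennreal (?J x * exp (- co * (norm x)\<^sup>2))) \<partial>lborel)"
    proof (rule nn_integral_mono)
      fix x
      have "ennreal (?J x * exp (- c * (norm x)\<^sup>2)) \<le> ennreal (?J x * indicator (shell \<epsilon> A R) x + 
        (exp 1 * (?J x * exp (- ci * (norm x)\<^sup>2)) + exp (- (A\<^sup>2 / 2)) * (?J x * exp (- co * (norm x)\<^sup>2))))"
        using pw by (rule ennreal_leI)
      also have "\<dots> = ennreal (?J x * indicator (shell \<epsilon> A R) x) + 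
        (ennreal (exp 1 * (?J x * exp (- ci * (norm x)\<^sup>2))) + ennreal (exp (- (A\<^sup>2 / 2)) * (?J x * exp (- co * (norm x)\<^sup>2))))"
        by (subst ennreal_plus; (subst ennreal_plus)?) (auto intro!: add_nonneg_nonneg mult_nonneg_nonneg)
      also have "\<dots> = ennreal (?J x) * indicator (shell \<epsilon> A R) x + 
        (ennreal (exp 1) * ennreal (?J x * exp (- ci * (norm x)\<^sup>2)) + ennreal (exp (- (A\<^sup>2 / 2))) * ennreal (?J x * exp (- co * (norm x)\<^sup>2)))"
        by (subst ennreal_mult[of "exp 1"], simp, simp, subst ennreal_mult[of "exp (- (A\<^sup>2 / 2))"], simp, simp) (auto simp: indicator_def)
      finally show "ennreal (?J x * exp (- c * (norm x)\<^sup>2)) \<le> ennreal (?J x) * indicator (shell \<epsilon> A R) x + 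
        (ennreal (exp 1) * ennreal (?J x * exp (- ci * (norm x)\<^sup>2)) + ennreal (exp (- (A\<^sup>2 / 2))) * ennreal (?J x * exp (- co * (norm x)\<^sup>2)))" .
    qed
    also have "\<dots> = ?I + (ennreal (exp 1) * (\<integral>\<^sup>+x. ennreal (?J x * exp (- ci * (norm x)\<^sup>2)) \<partial>lborel) + 
        ennreal (exp (- (A\<^sup>2 / 2))) * (\<integral>\<^sup>+x. ennreal (?J x * exp (- co * (norm x)\<^sup>2)) \<partial>lborel))"
    proof -
      have m1: "(\<lambda>x. ennreal (?J x) * indicator (shell \<epsilon> A R) x) \<in> borel_measurable lborel" by measurable
      have m2: "(\<lambda>x. ennreal (?J x * exp (- d * (norm x)\<^sup>2))) \<in> borel_measurable lborel" for d by measurable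
      have "(\<integral>\<^sup>+x. f x + (a * u x + b * v x) \<partial>lborel) = (\<integral>\<^sup>+x. f x \<partial>lborel) + (a * (\<integral>\<^sup>+x. u x \<partial>lborel) + b * (\<integral>\<^sup>+x. v x \<partial>lborel))"
        if "f \<in> borel_measurable lborel" "u \<in> borel_measurable lborel" "v \<in> borel_measurable lborel" for f u v :: "real \<times> real \<Rightarrow> ennreal" and a b
        using that by (simp add: nn_integral_add nn_integral_cmult)
      then show ?thesis using m1 m2 by blast
    qed
    also have "\<dots> \<le> ?I + (ennreal (exp 1) * ennreal (C / sqrt ci) + ennreal (exp (- (A\<^sup>2 / 2))) * ennreal (C / sqrt co))"
      by (intro add_left_mono add_mono mult_left_mono C(2) cp) auto
    also have "ennreal (exp 1) * ennreal (C / sqrt ci) + ennreal (exp (- (A\<^sup>2 / 2))) * ennreal (C / sqrt co) 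
       = ennreal (exp 1 * (C / sqrt ci) + exp (- (A\<^sup>2 / 2)) * (C / sqrt co))"
    proof -
      have "ennreal a * ennreal b + ennreal u * ennreal v = ennreal (a * b + u * v)"
        if "a \<ge> 0" "b \<ge> 0" "u \<ge> 0" "v \<ge> 0" for a b u v
        using that by (simp add: ennreal_mult)
      then show ?thesis using C(1) cp by simp
    qed
    finally have tot: "ennreal (c0 * R) \<le> ?I + ennreal (exp 1 * (C / sqrt ci) + exp (- (A\<^sup>2 / 2)) * (C / sqrt co))" .
    have inner: "exp 1 * (C / sqrt ci) \<le> c0 / 4 * R"
    proof -
      have "exp 1 * (C / sqrt ci) = exp 1 * C * \<epsilon> * R" unfolding sc by simp
      also have "\<dots> \<le> exp 1 * C * (c0 / (4 * exp 1 * C)) * R"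
        using \<epsilon> C R by (intro mult_right_mono mult_left_mono) auto
      also have "\<dots> = c0 / 4 * R" using C by simp
      finally show ?thesis .
    qed
    have outer: "exp (- (A\<^sup>2 / 2)) * (C / sqrt co) \<le> c0 / 4 * R"
    proof -
      have A0: "A\<^sup>2 > 0" using A by simp
      have "exp (- (A\<^sup>2 / 2)) = 1 / exp (A\<^sup>2 / 2)" by (simp add: exp_minus inverse_eq_divide)
      also have "\<dots> \<le> 1 / (A\<^sup>2 / 2)" 
      proof (rule divide_left_mono)
        show "A\<^sup>2 / 2 \<le> exp (A\<^sup>2 / 2)" using exp_ge_add_one_self[of "A\<^sup>2 / 2"] by linarith
      qed (use A0 in auto)
      also have "\<dots> = 2 / A\<^sup>2" by simp
      also have "\<dots> \<le> 2 / (16 * C / c0)" using A2 C c0 A0 by (intro divide_left_mono) auto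
      also have "\<dots> = c0 / (8 * C)" by simp
      finally have e: "exp (- (A\<^sup>2 / 2)) \<le> c0 / (8 * C)" .
      have "C / sqrt co = C * (sqrt 2 * R)" using sc(3) by (metis times_divide_eq_right mult.right_neutral)
      moreover have "sqrt 2 \<le> 2" using real_sqrt_le_mono[of 2 4] by simp
      then have "C * (sqrt 2 * R) \<le> C * (2 * R)" using C R by (intro mult_left_mono mult_right_mono) auto
      ultimately have "exp (- (A\<^sup>2 / 2)) * (C / sqrt co) \<le> c0 / (8 * C) * (C * (2 * R))"
        using e C R c0 cp by (intro mult_mono) auto
      also have "\<dots> = c0 / 4 * R" using C by simp
      finally show ?thesis .
    qed
    \<comment> \<open>Both tails together amount to at most half of \<open>c0 * R\<close>, so the
      shell keeps the other half.\<close>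
    show ?thesis
    proof (rule ccontr)
      assume "\<not> ennreal (c0 / 2 * R) \<le> ?I"
      then have I: "?I < ennreal (c0 / 2 * R)" by (simp add: not_le)
      then obtain i where i: "?I = ennreal i" "i \<ge> 0" by (cases ?I) (auto simp: top_unique)
      have "i < c0 / 2 * R" using I i by (simp add: ennreal_less_iff)
      define t where "t = exp 1 * (C / sqrt ci) + exp (- (A\<^sup>2 / 2)) * (C / sqrt co)"
      have "t \<ge> 0" unfolding t_def using C cp by (intro add_nonneg_nonneg mult_nonneg_nonneg divide_nonneg_nonneg) auto
      then have "ennreal (c0 * R) \<le> ennreal (i + t)" using tot i by (simp add: t_def)
      moreover have "i + t \<ge> 0" using i \<open>t \<ge> 0\<close> by simp
      ultimately have "c0 * R \<le> i + t" by (simp only: ennreal_le_iff)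
      moreover have "t \<le> c0 / 2 * R" unfolding t_def using inner outer by argo
      ultimately show False using \<open>i < c0 / 2 * R\<close> by argo
    qed
  qed
  show thesis using that[of \<epsilon> A "c0 / 2"] \<epsilon> A c0 main by simp
qed

text \<open>On the shell the extension has typical size \<open>R powr (- 1 / 2)\<close>. For
  \<open>q < 2\<close> the decay bound caps it from above; for \<open>q \<ge> 2\<close> values below
  a small multiple of this size carry at most half of the guaranteed energy. Either way a multiple
  of \<open>R\<close> is at most \<open>(\<kappa> * R powr (- 1 / 2)) powr (2 - q)\<close> times the
  integral. The condition \<open>R \<ge> 1 / \<epsilon>\<close> places the shell at
  \<open>norm x \<ge> 1\<close>, where the decay bound holds.\<close>

lemma full_shell_Lq:
  fixes q :: real
  assumes q: "q > 0"
  obtains \<epsilon> A c2 :: real where "0 < \<epsilon>" "\<epsilon> \<le> 1" "1 \<le> A" "c2 > 0"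
    "\<And>R. R \<ge> 1 / \<epsilon> \<Longrightarrow> ennreal (c2 * R powr (2 - q / 2)) \<le> (\<integral>\<^sup>+x. ennreal (norm (arc_ext full x) powr q) * indicator (shell \<epsilon> A R) x \<partial>lborel)"
proof -
  obtain \<epsilon> A c1 where eA: "0 < \<epsilon>" "\<epsilon> \<le> 1" "1 \<le> A" "c1 > 0"
    and L2: "\<And>R. R \<ge> 1 \<Longrightarrow> ennreal (c1 * R) \<le> (\<integral>\<^sup>+x. ennreal ((norm (arc_ext full x))\<^sup>2) * indicator (shell \<epsilon> A R) x \<partial>lborel)"
    using full_shell_L2 by blast
  have fm[measurable]: "arc_ext full \<in> borel_measurable borel"
    by (rule measurable_arc_ext) (use integrable_full in auto)
  have fin: "\<exists>\<kappa>>0. \<exists>c>0. \<forall>R\<ge>1 / \<epsilon>. ennreal (c * R) \<le> ennreal ((\<kappa> * R powr (- 1 / 2)) powr (2 - q)) * (\<integral>\<^sup>+x. ennreal (norm (arc_ext full x) powr q) * indicator (shell \<epsilon> A R) x \<partial>lborel)"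
  proof (cases "q < 2")
    case True
    define \<kappa> where "\<kappa> = 36 / sqrt \<epsilon>"
    have \<kappa>: "\<kappa> > 0" using eA by (simp add: \<kappa>_def)
    have "ennreal (c1 * R) \<le> ennreal ((\<kappa> * R powr (- 1 / 2)) powr (2 - q)) * (\<integral>\<^sup>+x. ennreal (norm (arc_ext full x) powr q) * indicator (shell \<epsilon> A R) x \<partial>lborel)"
      if R: "R \<ge> 1 / \<epsilon>" for R
    proof -
      have "1 \<le> 1 / \<epsilon>" using eA by simp
      then have R1: "R \<ge> 1" using R by linarith
      have \<epsilon>R: "\<epsilon> * R \<ge> 1" using R eA by (simp add: field_simps)
      define m where "m = \<kappa> * R powr (- 1 / 2)"
      have m_eq: "m = 36 / sqrt (\<epsilon> * R)"
        using R1 by (simp add: m_def \<kappa>_def real_sqrt_mult powr_minus_divide powr_half_sqrt)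
      have "(norm (arc_ext full x))\<^sup>2 \<le> m powr (2 - q) * norm (arc_ext full x) powr q" if x: "x \<in> shell \<epsilon> A R" for x
      proof (cases "arc_ext full x = 0")
        case False
        have xn: "\<epsilon> * R \<le> norm x" using x by (simp add: shell_def)
        have "norm (arc_ext full x) \<le> 36 / sqrt (norm x)" using xn \<epsilon>R by (intro arc_ext_full_decay) simp
        also have "\<dots> \<le> m"
        proof -
          have "0 < sqrt (\<epsilon> * R)" "sqrt (\<epsilon> * R) \<le> sqrt (norm x)" using xn \<epsilon>R by auto
          then show ?thesis unfolding m_eq by (intro frac_le) auto
        qed
        finally have le: "norm (arc_ext full x) \<le> m" .
        have "(norm (arc_ext full x))\<^sup>2 = norm (arc_ext full x) powr (2 - q) * norm (arc_ext full x) powr q"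
          unfolding powr_add[symmetric] using False by simp
        also have "\<dots> \<le> m powr (2 - q) * norm (arc_ext full x) powr q"
          using le True by (intro mult_right_mono powr_mono2) auto
        finally show ?thesis .
      qed simp
      then have "ennreal ((norm (arc_ext full x))\<^sup>2) * indicator (shell \<epsilon> A R) x \<le> ennreal (m powr (2 - q)) * (ennreal (norm (arc_ext full x) powr q) * indicator (shell \<epsilon> A R) x)" for x
        by (cases "x \<in> shell \<epsilon> A R") (auto simp: ennreal_mult[symmetric] intro: ennreal_leI)
      then have "(\<integral>\<^sup>+x. ennreal ((norm (arc_ext full x))\<^sup>2) * indicator (shell \<epsilon> A R) x \<partial>lborel) \<le> 
         (\<integral>\<^sup>+x. ennreal (m powr (2 - q)) * (ennreal (norm (arc_ext full x) powr q) * indicator (shell \<epsilon> A R) x) \<partial>lborel)"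
        by (intro nn_integral_mono)
      also have "\<dots> = ennreal (m powr (2 - q)) * (\<integral>\<^sup>+x. ennreal (norm (arc_ext full x) powr q) * indicator (shell \<epsilon> A R) x \<partial>lborel)"
        by (rule nn_integral_cmult) measurable
      finally show ?thesis using L2[OF R1] unfolding m_def by (rule order_trans[rotated])
    qed
    then show ?thesis using \<kappa> eA(4) by blast
  next
    case False
    \<comment> \<open>Makes \<open>\<tau>\<^sup>2\<close> times the area bound
      \<open>4 * (A * R)\<^sup>2\<close> equal to \<open>c1 / 2 * R\<close>, half of the energy of
      the shell.\<close>
    define \<kappa> where "\<kappa> = sqrt (c1 / (8 * A\<^sup>2))"
    have \<kappa>: "\<kappa> > 0" "\<kappa>\<^sup>2 = c1 / (8 * A\<^sup>2)" using eA by (auto simp: \<kappa>_def)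
    have "ennreal (c1 / 2 * R) \<le> ennreal ((\<kappa> * R powr (- 1 / 2)) powr (2 - q)) * (\<integral>\<^sup>+x. ennreal (norm (arc_ext full x) powr q) * indicator (shell \<epsilon> A R) x \<partial>lborel)"
      if R: "R \<ge> 1 / \<epsilon>" for R
    proof -
      have "1 \<le> 1 / \<epsilon>" using eA by simp
      then have R1: "R \<ge> 1" using R by linarith
      define \<tau> where "\<tau> = \<kappa> * R powr (- 1 / 2)"
      have \<tau>: "\<tau> > 0" using \<kappa> R1 by (simp add: \<tau>_def)
      have \<tau>2: "\<tau>\<^sup>2 = c1 / (8 * A\<^sup>2) / R"
        using R1 by (simp add: \<tau>_def power_mult_distrib \<kappa>(2) powr_minus_divide powr_half_sqrt power_divide)
      let ?I = "\<integral>\<^sup>+x. ennreal (norm (arc_ext full x) powr q) * indicator (shell \<epsilon> A R) x \<partial>lborel"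
      have pw: "v\<^sup>2 \<le> \<tau>\<^sup>2 + \<tau> powr (2 - q) * v powr q" if v: "v \<ge> 0" for v
      proof (cases "v \<le> \<tau>")
        case True
        then have "v\<^sup>2 \<le> \<tau>\<^sup>2" using v by (intro power_mono) auto
        moreover have "0 \<le> \<tau> powr (2 - q) * v powr q" by simp
        ultimately show ?thesis by linarith
      next
        case False': False
        then have v0: "v > 0" using \<tau> by linarith
        have "v\<^sup>2 = v powr (2 - q) * v powr q" unfolding powr_add[symmetric] using v0 by simp
        also have "\<dots> \<le> \<tau> powr (2 - q) * v powr q" using False False' \<tau> by (intro mult_right_mono powr_mono2') auto
        finally show ?thesis using zero_le_power2[of \<tau>] by linarith
      qed
      have "ennreal ((norm (arc_ext full x))\<^sup>2) * indicator (shell \<epsilon> A R) x \<le> ennreal (\<tau>\<^sup>2) * indicator (shell \<epsilon> A R) x + 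
           ennreal (\<tau> powr (2 - q)) * (ennreal (norm (arc_ext full x) powr q) * indicator (shell \<epsilon> A R) x)" for x
      proof -
        have "ennreal ((norm (arc_ext full x))\<^sup>2) \<le> ennreal (\<tau>\<^sup>2 + \<tau> powr (2 - q) * norm (arc_ext full x) powr q)"
          by (intro ennreal_leI pw) simp
        also have "\<dots> = ennreal (\<tau>\<^sup>2) + ennreal (\<tau> powr (2 - q)) * ennreal (norm (arc_ext full x) powr q)"
          by (subst ennreal_plus) (auto simp: ennreal_mult)
        finally show ?thesis by (cases "x \<in> shell \<epsilon> A R") auto
      qed
      then have "(\<integral>\<^sup>+x. ennreal ((norm (arc_ext full x))\<^sup>2) * indicator (shell \<epsilon> A R) x \<partial>lborel) \<le> 
         (\<integral>\<^sup>+x. ennreal (\<tau>\<^sup>2) * indicator (shell \<epsilon> A R) x + ennreal (\<tau> powr (2 - q)) * (ennreal (norm (arc_ext full x) powr q) * indicator (shell \<epsilon> A R) x) \<partial>lborel)"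
        by (intro nn_integral_mono)
      also have "\<dots> = ennreal (\<tau>\<^sup>2) * emeasure lborel (shell \<epsilon> A R) + ennreal (\<tau> powr (2 - q)) * ?I"
        by (subst nn_integral_add) (auto simp: nn_integral_cmult nn_integral_cmult_indicator)
      also have "\<dots> \<le> ennreal (\<tau>\<^sup>2) * ennreal (4 * (A * R)\<^sup>2) + ennreal (\<tau> powr (2 - q)) * ?I"
      proof (intro add_right_mono mult_left_mono)
        have "emeasure lborel (shell \<epsilon> A R) \<le> emeasure lborel (cball (0 :: real \<times> real) (A * R))"
          by (rule emeasure_mono) (auto simp: shell_def)
        also have "\<dots> \<le> ennreal (4 * (A * R)\<^sup>2)" using eA R1 by (intro emeasure_cball_plane) auto
        finally show "emeasure lborel (shell \<epsilon> A R) \<le> ennreal (4 * (A * R)\<^sup>2)" .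
      qed auto
      also have "ennreal (\<tau>\<^sup>2) * ennreal (4 * (A * R)\<^sup>2) = ennreal (c1 / 2 * R)"
      proof -
        have e: "\<tau>\<^sup>2 * (4 * (A * R)\<^sup>2) = c1 / 2 * R"
          unfolding \<tau>2 using R1 eA by (simp add: power_mult_distrib power2_eq_square field_simps)
        show ?thesis unfolding e[symmetric] by (rule ennreal_mult[symmetric]) auto
      qed
      finally have le: "ennreal (c1 * R) \<le> ennreal (c1 / 2 * R) + ennreal (\<tau> powr (2 - q)) * ?I"
        using L2[OF R1] by (rule order_trans[rotated])
      have "ennreal (c1 * R) = ennreal (c1 / 2 * R) + ennreal (c1 / 2 * R)"
        using eA R1 by (subst ennreal_plus[symmetric]) auto
      then have "ennreal (c1 / 2 * R) \<le> ennreal (\<tau> powr (2 - q)) * ?I"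
        using le by (simp only: ennreal_add_left_cancel_le) auto
      then show ?thesis unfolding \<tau>_def .
    qed
    then show ?thesis using \<kappa>(1) eA(4) by (intro exI[of _ \<kappa>] conjI exI[of _ "c1 / 2"]) auto
  qed
  then obtain \<kappa> c where kc: "\<kappa> > 0" "c > 0" and
    le: "\<And>R. R \<ge> 1 / \<epsilon> \<Longrightarrow> ennreal (c * R) \<le> ennreal ((\<kappa> * R powr (- 1 / 2)) powr (2 - q)) * (\<integral>\<^sup>+x. ennreal (norm (arc_ext full x) powr q) * indicator (shell \<epsilon> A R) x \<partial>lborel)"
    by blast
  define c2 where "c2 = c * \<kappa> powr (q - 2)"
  have "ennreal (c2 * R powr (2 - q / 2)) \<le> (\<integral>\<^sup>+x. ennreal (norm (arc_ext full x) powr q) * indicator (shell \<epsilon> A R) x \<partial>lborel)"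
    if R: "R \<ge> 1 / \<epsilon>" for R
  proof -
    let ?I = "\<integral>\<^sup>+x. ennreal (norm (arc_ext full x) powr q) * indicator (shell \<epsilon> A R) x \<partial>lborel"
    have R0: "R > 0" using R eA by (meson less_le_trans zero_less_divide_1_iff)
    define \<tau> where "\<tau> = \<kappa> * R powr (- 1 / 2)"
    have \<tau>: "\<tau> > 0" using kc R0 by (simp add: \<tau>_def)
    have "ennreal (\<tau> powr (q - 2)) * ennreal (c * R) \<le> ennreal (\<tau> powr (q - 2)) * (ennreal (\<tau> powr (2 - q)) * ?I)"
      using le[OF R] unfolding \<tau>_def by (rule mult_left_mono) simp
    also have "\<dots> = (ennreal (\<tau> powr (q - 2)) * ennreal (\<tau> powr (2 - q))) * ?I" by (rule mult.assoc[symmetric])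
    also have "ennreal (\<tau> powr (q - 2)) * ennreal (\<tau> powr (2 - q)) = 1"
    proof -
      have "\<tau> powr (q - 2) * \<tau> powr (2 - q) = 1" unfolding powr_add[symmetric] using \<tau> by simp
      then show ?thesis by (simp add: ennreal_mult[symmetric])
    qed
    also have "ennreal (\<tau> powr (q - 2)) * ennreal (c * R) = ennreal (c2 * R powr (2 - q / 2))"
    proof -
      have \<tau>e: "\<tau> powr (q - 2) = \<kappa> powr (q - 2) * R powr (- 1 / 2 * (q - 2))"
        unfolding \<tau>_def using kc R0 by (simp only: powr_mult powr_powr powr_ge_zero less_imp_le)
      have Re: "R powr (- 1 / 2 * (q - 2)) * R powr 1 = R powr (2 - q / 2)"
        unfolding powr_add[symmetric] by (simp add: field_simps)
      have "\<tau> powr (q - 2) * (c * R) = c2 * (R powr (- 1 / 2 * (q - 2)) * R powr 1)"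
        unfolding c2_def \<tau>e using R0 by simp
      then have "\<tau> powr (q - 2) * (c * R) = c2 * R powr (2 - q / 2)" unfolding Re .
      then show ?thesis using kc R0 by (simp add: ennreal_mult[symmetric])
    qed
    finally show ?thesis by simp
  qed
  moreover have "c2 > 0" using kc by (simp add: c2_def)
  ultimately show thesis using that[of \<epsilon> A c2] eA by blast
qed

text \<open>If the inequality fails, even by equality, each shell contributes at least a fixed
  amount; arbitrarily many disjoint shells then contradict boundedness.\<close>

lemma necessary_decay:
  fixes q \<gamma> \<rho> :: real and r :: ereal
  assumes bdd: "weighted_extension_bounded \<gamma> r (ereal q)" and q: "q > 0" and \<gamma>: "\<gamma> \<ge> 0"
    and r: "r = (if \<rho> = 1 then \<infinity> else ereal (1 / (1 - \<rho>)))" and \<rho>: "0 \<le> \<rho>" "\<rho> \<le> 1"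
  shows "\<gamma> > 2 / q - 1 / 2"
proof (rule ccontr)
  assume "\<not> \<gamma> > 2 / q - 1 / 2"
  then have "\<gamma> * q \<le> (2 / q - 1 / 2) * q" using q by (intro mult_right_mono) auto
  then have gq: "2 - q / 2 - \<gamma> * q \<ge> 0" using q by (simp add: algebra_simps)
  obtain K where K: "K > 0" "\<And>g N. g \<in> borel_measurable borel \<Longrightarrow> (\<And>t. t \<notin> {0..<2 * pi} \<Longrightarrow> g t = 0) \<Longrightarrow> 0 \<le> N \<Longrightarrow>
    (if \<rho> = 1 then \<forall>t. norm (g t) \<le> N else (\<integral>\<^sup>+t. ennreal (norm (g t) powr (1 / (1 - \<rho>))) \<partial>lborel) \<le> ennreal (N powr (1 / (1 - \<rho>)))) \<Longrightarrow>
    (\<integral>\<^sup>+x. ennreal ((norm (arc_ext g x) * wt x powr - \<gamma>) powr q) \<partial>lborel) \<le> ennreal (K * N powr q)"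
    using necessity_test[OF bdd q r \<rho>] by blast
  have fullm[measurable]: "full \<in> borel_measurable borel" using integrable_full by auto
  have fm[measurable]: "arc_ext full \<in> borel_measurable borel" by (rule measurable_arc_ext) simp
  let ?W = "\<lambda>x. ennreal ((norm (arc_ext full x) * wt x powr - \<gamma>) powr q)"
  \<comment> \<open>As 7 exceeds \<open>2 * pi\<close>, it bounds the norm of \<open>full\<close>
    for every exponent \<open>r \<ge> 1\<close>.\<close>
  have up: "(\<integral>\<^sup>+x. ?W x \<partial>lborel) \<le> ennreal (K * 7 powr q)"
  proof (rule K(2))
    show "if \<rho> = 1 then \<forall>t. norm (full t) \<le> 7 else (\<integral>\<^sup>+t. ennreal (norm (full t) powr (1 / (1 - \<rho>))) \<partial>lborel) \<le> ennreal (7 powr (1 / (1 - \<rho>)))"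
    proof (cases "\<rho> = 1")
      case False
      define r0 where "r0 = 1 / (1 - \<rho>)"
      have r0: "r0 \<ge> 1" using \<rho> False by (simp add: r0_def)
      have "(\<integral>\<^sup>+t. ennreal (norm (full t) powr r0) \<partial>lborel) = (\<integral>\<^sup>+t. indicator {0..<2 * pi} t \<partial>lborel)"
        using r0 by (intro nn_integral_cong) (auto simp: full_def indicator_def)
      also have "\<dots> = ennreal (2 * pi)" by simp
      also have "\<dots> \<le> ennreal (7 powr r0)"
        using pi_bounds powr_mono[OF r0, of 7] by (intro ennreal_leI) simp
      finally show ?thesis using False by (simp add: r0_def)
    qed (simp add: full_def indicator_def)
  qed (auto simp: full_def)
  obtain \<epsilon> A c2 where eA: "0 < \<epsilon>" "\<epsilon> \<le> 1" "1 \<le> A" "c2 > 0"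
    and Lq: "\<And>R. R \<ge> 1 / \<epsilon> \<Longrightarrow> ennreal (c2 * R powr (2 - q / 2)) \<le> (\<integral>\<^sup>+x. ennreal (norm (arc_ext full x) powr q) * indicator (shell \<epsilon> A R) x \<partial>lborel)"
    using full_shell_Lq[OF q] by blast
  define c3 where "c3 = (3 * A) powr (- (\<gamma> * q)) * c2"
  have c3: "c3 > 0" using eA by (simp add: c3_def)
  have one: "ennreal c3 \<le> (\<integral>\<^sup>+x. ?W x * indicator (shell \<epsilon> A R) x \<partial>lborel)" if R: "R \<ge> 1 / \<epsilon>" for R
  proof -
    have "1 \<le> 1 / \<epsilon>" using eA by simp
    then have R1: "R \<ge> 1" using R by linarith
    have "c3 \<le> c3 * R powr (2 - q / 2 - \<gamma> * q)" using c3 R1 gq by (simp add: ge_one_powr_ge_zero)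
    also have "\<dots> = (3 * A * R) powr (- (\<gamma> * q)) * (c2 * R powr (2 - q / 2))"
    proof -
      have "R powr (2 - q / 2 - \<gamma> * q) = R powr (2 - q / 2) * R powr (- (\<gamma> * q))" unfolding powr_add[symmetric] by simp
      moreover have "(3 * A * R) powr (- (\<gamma> * q)) = (3 * A) powr (- (\<gamma> * q)) * R powr (- (\<gamma> * q))"
        using eA R1 by (intro powr_mult)
      ultimately show ?thesis unfolding c3_def by (simp only: mult_ac)
    qed
    finally have "ennreal c3 \<le> ennreal ((3 * A * R) powr (- (\<gamma> * q)) * (c2 * R powr (2 - q / 2)))" by (rule ennreal_leI)
    also have "\<dots> = ennreal ((3 * A * R) powr (- (\<gamma> * q))) * ennreal (c2 * R powr (2 - q / 2))"
      using eA by (intro ennreal_mult) auto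
    also have "\<dots> \<le> ennreal ((3 * A * R) powr (- (\<gamma> * q))) * (\<integral>\<^sup>+x. ennreal (norm (arc_ext full x) powr q) * indicator (shell \<epsilon> A R) x \<partial>lborel)"
      by (intro mult_left_mono Lq R) auto
    also have "\<dots> = (\<integral>\<^sup>+x. ennreal ((3 * A * R) powr (- (\<gamma> * q))) * (ennreal (norm (arc_ext full x) powr q) * indicator (shell \<epsilon> A R) x) \<partial>lborel)"
      by (rule nn_integral_cmult[symmetric]) measurable
    also have "\<dots> \<le> (\<integral>\<^sup>+x. ?W x * indicator (shell \<epsilon> A R) x \<partial>lborel)"
    proof (rule nn_integral_mono)
      fix x
      have "(3 * A * R) powr (- (\<gamma> * q)) * norm (arc_ext full x) powr q \<le> (norm (arc_ext full x) * wt x powr - \<gamma>) powr q" if x: "x \<in> shell \<epsilon> A R"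
      proof -
        have "\<bar>fst x\<bar> \<le> norm x" "\<bar>snd x\<bar> \<le> norm x"
          using norm_fst_le[of "fst x" "snd x"] norm_snd_le[of "snd x" "fst x"] by auto
        then have "wt x \<le> 1 + 2 * (A * R)" using x by (simp add: wt_def shell_def)
        moreover have "1 * 1 \<le> A * R" using eA R1 by (intro mult_mono) auto
        ultimately have "wt x \<le> 3 * A * R" by simp
        then have "(3 * A * R) powr (- (\<gamma> * q)) \<le> wt x powr (- (\<gamma> * q))" using \<gamma> q by (intro powr_mono2') auto
        then have "(3 * A * R) powr (- (\<gamma> * q)) * norm (arc_ext full x) powr q \<le> wt x powr (- (\<gamma> * q)) * norm (arc_ext full x) powr q"
          by (rule mult_right_mono) simp
        also have "\<dots> = (norm (arc_ext full x) * wt x powr - \<gamma>) powr q" by (simp add: powr_mult powr_powr mult.commute)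
        finally show ?thesis .
      qed
      then show "ennreal ((3 * A * R) powr (- (\<gamma> * q))) * (ennreal (norm (arc_ext full x) powr q) * indicator (shell \<epsilon> A R) x) \<le> ?W x * indicator (shell \<epsilon> A R) x"
        by (cases "x \<in> shell \<epsilon> A R") (auto simp: ennreal_mult[symmetric] intro: ennreal_leI)
    qed
    finally show ?thesis .
  qed
  \<comment> \<open>This ratio of consecutive radii puts the outer edge \<open>A * Rad i\<close>
    below the inner edge \<open>\<epsilon> * Rad (Suc i)\<close>, with a factor 2 to spare.\<close>
  define b where "b = 2 * A / \<epsilon>"
  have b: "b \<ge> 1" using eA by (simp add: b_def le_divide_eq)
  define Rad where "Rad i = 1 / \<epsilon> * b ^ i" for i :: nat
  have Rad1: "Rad i \<ge> 1 / \<epsilon>" for i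
  proof -
    have "1 / \<epsilon> * 1 \<le> 1 / \<epsilon> * b ^ i" using b eA by (intro mult_left_mono one_le_power) auto
    then show ?thesis by (simp add: Rad_def)
  qed
  have Rad0: "Rad i > 0" for i using less_le_trans[OF _ Rad1[of i], of 0] eA by simp
  have sep: "A * Rad i < \<epsilon> * Rad j" if "i < j" for i j
  proof -
    have "A * Rad i < 2 * (A * Rad i)" using eA Rad0[of i] by simp
    also have "\<dots> = \<epsilon> * Rad (Suc i)" using eA by (simp add: Rad_def b_def)
    also have "\<dots> \<le> \<epsilon> * Rad j"
      unfolding Rad_def using that b eA by (intro mult_left_mono power_increasing) auto
    finally show ?thesis .
  qed
  have "real n * c3 \<le> K * 7 powr q" for n
  proof -
    have disj: "(\<Sum>i<n. indicator (shell \<epsilon> A (Rad i)) x) \<le> (1 :: ennreal)" for x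
    proof (cases "\<exists>m<n. x \<in> shell \<epsilon> A (Rad m)")
      case True
      then obtain m where m: "m < n" "x \<in> shell \<epsilon> A (Rad m)" by blast
      have "x \<notin> shell \<epsilon> A (Rad i)" if "i \<noteq> m" for i
        using sep[of i m] sep[of m i] m(2) that by (auto simp: shell_def neq_iff)
      then have "(\<Sum>i<n. indicator (shell \<epsilon> A (Rad i)) x) = (\<Sum>i<n. if i = m then 1 else 0 :: ennreal)"
        using m by (intro sum.cong) auto
      then show ?thesis using m by simp
    next
      case False
      then have "(\<Sum>i<n. indicator (shell \<epsilon> A (Rad i)) x) = (0 :: ennreal)" by (intro sum.neutral) auto
      then show ?thesis by simp
    qed
    have Wm: "(\<lambda>x. ?W x * indicator (shell \<epsilon> A (Rad i)) x) \<in> borel_measurable lborel" for i by measurable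
    have "ennreal (real n * c3) = (\<Sum>i<n. ennreal c3)" using c3 by (simp add: ennreal_mult ennreal_of_nat_eq_real_of_nat)
    also have "\<dots> \<le> (\<Sum>i<n. \<integral>\<^sup>+x. ?W x * indicator (shell \<epsilon> A (Rad i)) x \<partial>lborel)"
      by (intro sum_mono one Rad1)
    also have "\<dots> = (\<integral>\<^sup>+x. (\<Sum>i<n. ?W x * indicator (shell \<epsilon> A (Rad i)) x) \<partial>lborel)"
      by (rule nn_integral_sum[symmetric, OF Wm])
    also have "\<dots> \<le> (\<integral>\<^sup>+x. ?W x \<partial>lborel)"
    proof (rule nn_integral_mono)
      fix x
      have "(\<Sum>i<n. ?W x * indicator (shell \<epsilon> A (Rad i)) x) = ?W x * (\<Sum>i<n. indicator (shell \<epsilon> A (Rad i)) x)"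
        by (rule sum_distrib_left[symmetric])
      also have "\<dots> \<le> ?W x * 1" by (intro mult_left_mono disj) auto
      finally show "(\<Sum>i<n. ?W x * indicator (shell \<epsilon> A (Rad i)) x) \<le> ?W x" by simp
    qed
    also note up
    finally show ?thesis using K(1) by (simp add: ennreal_le_iff)
  qed
  moreover obtain n where "K * 7 powr q / c3 < real n" using reals_Archimedean2 by blast
  then have "K * 7 powr q < real n * c3" using c3 by (simp add: field_simps)
  ultimately show False by (meson not_le)
qed

subsection \<open>Optimal range\<close>

theorem theorem6:
  fixes \<gamma> :: real and r r' :: ereal
  assumes "0 \<le> \<gamma>"
    and "1 \<le> r" and "1 \<le> r'" and "1 / r + 1 / r' = 1"
  shows
    "(\<forall>q::ereal. 0 < q \<and> q < \<infinity> \<longrightarrow> ereal \<gamma> > 2 / q - 1 / 2 \<longrightarrow>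
        (ereal \<gamma> > max (3 / (2 * q) - 1 / (2 * r')) (2 / q - 1 / r')
           \<longrightarrow> weighted_extension_bounded \<gamma> r q) \<and>
        (1 < r \<and> r \<le> q \<and>
         ereal \<gamma> = max (3 / (2 * q) - 1 / (2 * r')) (2 / q - 1 / r') \<and> q \<noteq> r'
           \<longrightarrow> weighted_extension_bounded \<gamma> r q))
     \<and> weighted_extension_bounded \<gamma> r \<infinity>
     \<and> (\<forall>q::ereal. 0 < q \<and> q < \<infinity> \<longrightarrow> weighted_extension_bounded \<gamma> r q \<longrightarrow>
          ereal \<gamma> > 2 / q - 1 / 2 \<and>
          (ereal \<gamma> > max (3 / (2 * q) - 1 / (2 * r')) (2 / q - 1 / r') \<or>
           (1 < r \<and> r \<le> q \<and>
            ereal \<gamma> = max (3 / (2 * q) - 1 / (2 * r')) (2 / q - 1 / r') \<and> q \<noteq> r')))"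
proof -
  obtain \<rho> where \<rho>: "0 \<le> \<rho>" "\<rho> \<le> 1" and ir': "1 / r' = ereal \<rho>" "1 / (2 * r') = ereal (\<rho> / 2)"
    and r: "r = (if \<rho> = 1 then \<infinity> else ereal (1 / (1 - \<rho>)))" and r': "r' = (if \<rho> = 0 then \<infinity> else ereal (1 / \<rho>))"
    using conjugate_exponents_real[OF assms(2-4)] by metis
  have r1: "1 < r \<longleftrightarrow> 0 < \<rho>"
    unfolding r using \<rho> by (auto simp: one_ereal_def less_divide_eq)
  have main: "(ereal \<gamma> > 2 / q - 1 / 2 \<longrightarrow>
        (ereal \<gamma> > max (3 / (2 * q) - 1 / (2 * r')) (2 / q - 1 / r')
           \<longrightarrow> weighted_extension_bounded \<gamma> r q) \<and>
        (1 < r \<and> r \<le> q \<and>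
         ereal \<gamma> = max (3 / (2 * q) - 1 / (2 * r')) (2 / q - 1 / r') \<and> q \<noteq> r'
           \<longrightarrow> weighted_extension_bounded \<gamma> r q)) \<and>
      (weighted_extension_bounded \<gamma> r q \<longrightarrow>
          ereal \<gamma> > 2 / q - 1 / 2 \<and>
          (ereal \<gamma> > max (3 / (2 * q) - 1 / (2 * r')) (2 / q - 1 / r') \<or>
           (1 < r \<and> r \<le> q \<and>
            ereal \<gamma> = max (3 / (2 * q) - 1 / (2 * r')) (2 / q - 1 / r') \<and> q \<noteq> r')))"
    if "0 < q \<and> q < \<infinity>" for q :: ereal
  proof -
    obtain s where s: "q = ereal s" "s > 0" using \<open>0 < q \<and> q < \<infinity>\<close> by (cases q) auto
    have e1: "2 / ereal s - 1 / 2 = ereal (2 / s - 1 / 2)"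
      using s by (simp add: numeral_eq_ereal one_ereal_def)
    have e2: "max (3 / (2 * ereal s) - 1 / (2 * r')) (2 / ereal s - 1 / r') = ereal (max (3 / (2 * s) - \<rho> / 2) (2 / s - \<rho>))"
      unfolding ir' using s by (simp add: numeral_eq_ereal max_def)
    \<comment> \<open>The product form also covers \<open>r' = \<infinity>\<close>, where
      \<open>\<rho> = 0\<close>.\<close>
    have e3: "ereal s \<noteq> r' \<longleftrightarrow> s * \<rho> \<noteq> 1"
      unfolding r' using s by (auto simp: field_simps)
    show ?thesis
      unfolding s(1) e1 e2 e3 r1 ereal.inject less_ereal.simps
      using bounded_open_region[OF r \<rho> s(2) assms(1)] bounded_critical[OF r _ \<rho>(2) s(2) _ assms(1)]
        necessary_decay[OF _ s(2) assms(1) r \<rho>] necessary_exponents[OF _ s(2) assms(1) r \<rho>] by blast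
  qed
  then show ?thesis using weighted_extension_bounded_infinity[OF assms(2,1)] by blast
qed

end
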